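(* The interval oKLRW algebra $A_{\mathrm{int}}=\bigoplus_{\nu,\nu'\in\Omega}e(\nu')\,\mathcal O_{\mathbf 0}^{\underline\lambda}\,e(\nu)$ is the subalgebra of the oKLRW algebra $\mathcal O_{\mathbf 0}^{\underline\lambda}$ generated by the idempotents $e(\nu)$ ($\nu\in\Omega$), the long reflections $\rho_{a,l}^{b,l'}(\nu,i)$, the long crossings $C_{a,l}^{b,l'}(\nu,i)$, the admissible crossings $\sigma_j(\nu,k)$ and the dots $Y_j(\nu,k)$, for all $\nu\in\Omega$ and all admissible values of the indices.
   Context: **Quiver and data.** $Q=(Q_0,Q_1,s,t)$ is a loop-free quiver with at most one arrow (both directions counted) between two distinct vertices; $\tau$ is an involution of $Q_0$ and $Q_1$ with $s(\tau h)=\tau(t(h))$, $t(\tau h)=\tau(s(h))$, with $\tau(s(h))=t(h)$ iff $\tau(h)=h$, and without fixed vertices. $i\to j$ means there is an arrow from $i$ to $j$. Fix a partition $Q_0=Q_0^{(+)}\sqcup Q_0^{(-)}$ with $\tau(Q_0^{(\pm)})=Q_0^{(\mp)}$, all arrows going from $Q_0^{(+)}$ to $Q_0^{(-)}$, a total order on $Q_0^{(+)}$, and order $Q_0^{(-)}$ by $i<j\iff\tau i>\tau j$. $\lambda=\sum\lambda_i\varpi_i$ is a dominant weight, $\mu$ a $\tau$-invariant weight with $\lambda+\tau\lambda-\mu=\sum v_i\alpha_i$, $v_i=v_{\tau i}\ge0$. $\mathbf R=(\mathbf R_i)_{i\in Q_0}$, $\mathbf R_i$ a multiset of $\lambda_i$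 complex numbers, with $\mathbf R_i\subset\frac14+\mathbb Z$ and $\mathbf R_{\tau i}\subset\frac34+\mathbb Z$ for $i\in Q_0^{(+)}$. **oKLRW category with zero framing** (over $\mathbb C$). $X_{ij}(u,v)=u-v$ if $j\to i$ and $1$ otherwise; $f_{ij}(u,v)=X_{ij}(u,v)X_{ji}(v,u)$. The KLRW category $\mathcal K$ is the strict linear monoidal category with generating objects $i\in Q_0$ (black strands) and dominant weights $\theta=\sum\theta_i\varpi_i$ (red strands), generating morphisms $x_i:i\to i$ (dot), $\sigma_{ij}:i\otimes j\to j\otimes i$, $\sigma_{i\theta}:i\otimes\theta\to\theta\otimes i$, $\sigma_{\theta i}:\theta\otimes i\to i\otimes\theta$ (crossings), and relations ($y_r$ = dot on the $r$-th black strand): $(x_j\otimes1)\sigma_{ij}=\sigma_{ij}(1\otimes x_j)+\delta_{ij}$, $\sigma_{ij}(x_i\otimes1)=(1\otimes x_i)\sigma_{ij}+\delta_{ij}$; $\sigma_{ii}^2=0$, $\sigma_{ji}\sigma_{ij}=f_{ij}(y_1,y_2)$ for $i\ne j$; $(\sigma_{jk}\otimes1)(1\otimes\sigma_{ik})(\sigma_{ij}\otimes1)-(1\otimes\sigma_{ij})(\sigma_{ik}\otimes1)(1\otimes\sigma_{jk})=\delta_{i=k\neq j}\frac{f_{ij}(y_3,y_2)-f_{ij}(y_1,y_2)}{y_3-y_1}$; $(\sigma_{\theta j}\otimes1)(1\otimes\sigma_{ij})(\sigma_{i\theta}\otimes1)-(1\otimes\sigma_{i\theta})(\sigma_{ij}\otimes1)(1\otimes\sigma_{\theta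 j})=\delta_{ij}\sum_{a+b+1=\theta_i}x_i^a\otimes1\otimes x_j^b$; $(\sigma_{j\theta}\otimes1)(1\otimes\sigma_{i\theta})(\sigma_{ij}\otimes1)=(1\otimes\sigma_{ij})(\sigma_{i\theta}\otimes1)(1\otimes\sigma_{j\theta})$, $(\sigma_{ji}\otimes1)(1\otimes\sigma_{\theta i})(\sigma_{\theta j}\otimes1)=(1\otimes\sigma_{\theta j})(\sigma_{\theta i}\otimes1)(1\otimes\sigma_{ji})$; $(x_i\otimes1)\sigma_{\theta i}=\sigma_{\theta i}(1\otimes x_i)$, $\sigma_{i\theta}(x_i\otimes1)=(1\otimes x_i)\sigma_{i\theta}$; $\sigma_{i\theta}\sigma_{\theta i}=1\otimes x_i^{\theta_i}$, $\sigma_{\theta i}\sigma_{i\theta}=x_i^{\theta_i}\otimes1$. The oKLRW category $\mathcal O_{\mathbf 0}$ has the same objects; morphisms are linear combinations of composites of morphisms of $\mathcal K$ and morphisms $\rho_i\otimes\mathrm{id}_Z$, $\rho_i:i\to\tau i$ (reflection of the leftmost strand in a mirror at the left edge), modulo the consequences (closed under composition and $-\otimes\mathrm{id}_Z$) of the relations of $\mathcal K$ and $\rho_{\tau i}\rho_i=\mathrm{id}$, $\rho_ix_i=-x_{\tau i}\rho_i$, $\sigma_{\tau j,\tau i}(\rho_j\otimes1)\sigma_{\tau i,j}(\rho_i\otimes1)=(\rho_i\otimes1)\sigma_{\tau j,i}(\rho_j\otimes1)\sigma_{ij}$. **Red sequence and $\Omega$.** For $i\in Q_0^{(+)}$, $n\in\mathbb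 Z$ let $z_{i,n}$ be the multiplicity of $\frac34-n$ in $\mathbf R_{\tau i}$ and $z_{\tau i,n}$ that of $\frac14-n$ in $\mathbf R_i$. Put (sums over $i\in Q_0^{(+)}$) $\lambda^{(2n)}=\sum(z_{i,n}\varpi_i+z_{\tau i,n}\varpi_{\tau i})$ ($n\ge0$), $\lambda^{(1)}=\sum z_{\tau i,-1}\varpi_i$, $\lambda^{(2n+1)}=\sum(z_{\tau i,-n-1}\varpi_i+z_{i,-n}\varpi_{\tau i})$ ($n\ge1$); $\underline\lambda=(\lambda^{(0)},\lambda^{(1)},\dots)$, almost all terms being $0$. $\mathcal O_{\mathbf 0}^{\underline\lambda}=\varinjlim_N\mathcal O_{\mathbf 0}^{(\lambda^{(0)},\dots,\lambda^{(N)})}$, where $\mathcal O_{\mathbf 0}^{(\dots)}$ is the direct sum of Hom spaces of $\mathcal O_{\mathbf 0}$ between words with the given red letters (left to right) and, for $N$ large, the transition maps add a vertical red strand labelled $\lambda^{(N+1)}=0$ at the far right. $\Omega$ is the set of sequences $\nu=(\mathbf i^{(1)},\mathbf i^{(2)},\dots)$ of finite words in $Q_0$, almost all empty, such that $\mathbf i^{(2n+1)}$ is a weakly increasing word in $Q_0^{(+)}$, $\mathbf i^{(2n+2)}$ a weakly increasing word in $Q_0^{(-)}$ ($n\ge0$), and for each $i\in Q_0^{(+)}$ the letters $i,\tau i$ occur $v_i$ times in total. $e(\nu)$ is the identity of the object $\lambda^{(0)}\mathbf i^{(1)}\lambda^{(1)}\mathbf i^{(2)}\lambda^{(2)}\cdots$;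 $\mathbf i^{(r)}$ is "the $r$-th interval". **Generators.** In each diagram below the bottom is $\nu\in\Omega$, the top some $\nu'\in\Omega$, and strands not mentioned are vertical. - *Long crossing* $C_{a,l}^{b,l'}(\nu,i)$ ($a\equiv b$ mod 2, $i$ the $l$-th letter of interval $a$ of $\nu$ and the $l'$-th letter of interval $b$ of $\nu'$): $\nu'$ is obtained from $\nu$ by moving this letter; the strand moves directly, crossing each strand in between exactly once, without meeting the mirror. - *Long reflection* $\rho_{a,l}^{b,l'}(\nu,i)$ ($a-b$ odd, $i$ the $l$-th letter of interval $a$ of $\nu$, $\tau i$ the $l'$-th letter of interval $b$ of $\nu'$): $\nu'$ is obtained by removing the letter $i$ and inserting $\tau i$; the strand goes left crossing once each strand to its left, meets the mirror once, then goes right crossing once each strand to the left of its final position. - *Admissible crossing* $\sigma_j(\nu,k)$: the crossing of the $k$-th and $(k+1)$-st strands of interval $j$ when these have equal labels ($\nu'=\nu$). - *Dot* $Y_j(\nu,k)$: a dot on the $k$-th strand of interval $j$. *)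

theory Defs
  imports Complex_Main "HOL-Library.Multiset" "HOL-Library.Poly_Mapping"
    "HOL-Computational_Algebra.Polynomial" "Graph_Theory.Digraph"
begin

section \<open>Quivers with involution\<close>

text \<open>A quiver is a digraph in the sense of \<^theory>\<open>Graph_Theory.Digraph\<close>, with
  \<open>s = tail Q\<close> and \<open>t = head Q\<close>; the set of vertices is not required to be finite.\<close>

locale involutive_quiver = loopfree_digraph Q
  for Q :: "('q, 'e) pre_digraph" +
  fixes \<tau> :: "'q \<Rightarrow> 'q" and \<tau>\<^sub>1 :: "'e \<Rightarrow> 'e"
  assumes at_most_one_arrow:
    "\<lbrakk>h \<in> arcs Q; h' \<in> arcs Q; {tail Q h, head Q h} = {tail Q h', head Q h'}\<rbrakk> \<Longrightarrow> h = h'"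
  assumes tau_verts: "i \<in> verts Q \<Longrightarrow> \<tau> i \<in> verts Q"
    and tau_involution: "i \<in> verts Q \<Longrightarrow> \<tau> (\<tau> i) = i"
    and tau_no_fixpoint: "i \<in> verts Q \<Longrightarrow> \<tau> i \<noteq> i"
  assumes tau_arcs: "h \<in> arcs Q \<Longrightarrow> \<tau>\<^sub>1 h \<in> arcs Q"
    and tau_arcs_involution: "h \<in> arcs Q \<Longrightarrow> \<tau>\<^sub>1 (\<tau>\<^sub>1 h) = h"
    and tail_tau: "h \<in> arcs Q \<Longrightarrow> tail Q (\<tau>\<^sub>1 h) = \<tau> (head Q h)"
    and head_tau: "h \<in> arcs Q \<Longrightarrow> head Q (\<tau>\<^sub>1 h) = \<tau> (tail Q h)"
    and tau_fixed_arc: "h \<in> arcs Q \<Longrightarrow> \<tau> (tail Q h) = head Q h \<longleftrightarrow> \<tau>\<^sub>1 h = h"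

definition polarization :: "('q, 'e) pre_digraph \<Rightarrow> ('q \<Rightarrow> 'q) \<Rightarrow> 'q set \<Rightarrow> bool" where
  "polarization Q \<tau> P \<longleftrightarrow> P \<subseteq> verts Q \<and> \<tau> ` P = verts Q - P \<and> \<tau> ` (verts Q - P) = P \<and>
     (\<forall>h \<in> arcs Q. tail Q h \<in> P \<and> head Q h \<in> verts Q - P)"

text \<open>The coefficient of the fundamental weight of \<open>i\<close> in the simple root of \<open>j\<close>.\<close>

definition cartan :: "('q, 'e) pre_digraph \<Rightarrow> 'q \<Rightarrow> 'q \<Rightarrow> int" where
  "cartan Q i j = (if i = j then 2
     else - int (card {h \<in> arcs Q. {tail Q h, head Q h} = {i, j}}))"


section \<open>Diagrams\<close>

datatype 'q letter = Black 'q | Red "'q \<Rightarrow> nat"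

type_synonym 'q word = "'q letter list"

fun reds :: "'q word \<Rightarrow> ('q \<Rightarrow> nat) list" where
  "reds [] = []"
| "reds (Black i # w) = reds w"
| "reds (Red \<theta> # w) = \<theta> # reds w"

text \<open>Formal composites of the generating morphisms. \<open>Strands w\<close> is the identity of the word \<open>w\<close>,
  \<open>Cross a b\<close> is the crossing from \<open>[a, b]\<close> to \<open>[b, a]\<close> (black-black, black-red or red-black),
  \<open>Mirror i\<close> is the reflection \<open>\<rho>\<^sub>i\<close>, and \<open>Comp d e\<close> is \<open>d\<close> after \<open>e\<close>.\<close>

datatype 'q diagram =
    Strands "'q word"
  | Dot 'q
  | Cross "'q letter" "'q letter"
  | Mirror 'q
  | Comp "'q diagram" "'q diagram"
  | Tensor "'q diagram" "'q diagram"

text \<open>\<open>KLRW\<close> refers to the monoidal category, \<open>OKLRW\<close> to its right module category.\<close>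

datatype layer = KLRW | OKLRW

text \<open>Linear combinations of diagrams. Diagrams with different sources and targets may occur in one
  linear combination, so that this is the direct sum of all spaces of formal morphisms; the bilinear
  composition \<open>x \<odot> y\<close> puts the composite of non-composable diagrams to be zero.\<close>

type_synonym 'q lincomb = "'q diagram \<Rightarrow>\<^sub>0 complex"

definition dg :: "'q diagram \<Rightarrow> 'q lincomb" where
  "dg d = Poly_Mapping.single d 1"

definition smul :: "complex \<Rightarrow> 'q lincomb \<Rightarrow> 'q lincomb" where
  "smul a x = Poly_Mapping.map ((*) a) x"

definition tensor :: "'q lincomb \<Rightarrow> 'q lincomb \<Rightarrow> 'q lincomb" (infixr \<open>\<boxtimes>\<close> 75) where
  "x \<boxtimes> y = (\<Sum>d \<in> Poly_Mapping.keys x. \<Sum>e \<in> Poly_Mapping.keys y.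
     Poly_Mapping.single (Tensor d e) (Poly_Mapping.lookup x d * Poly_Mapping.lookup y e))"

abbreviation idm :: "'q word \<Rightarrow> 'q lincomb" where
  "idm w \<equiv> dg (Strands w)"

abbreviation dot :: "'q \<Rightarrow> 'q lincomb" where
  "dot i \<equiv> dg (Dot i)"

abbreviation cross :: "'q letter \<Rightarrow> 'q letter \<Rightarrow> 'q lincomb" where
  "cross a b \<equiv> dg (Cross a b)"

abbreviation mirror :: "'q \<Rightarrow> 'q lincomb" where
  "mirror i \<equiv> dg (Mirror i)"

context
  fixes Q :: "('q, 'e) pre_digraph" and \<tau> :: "'q \<Rightarrow> 'q"
begin

fun letter_ok :: "'q letter \<Rightarrow> bool" where
  "letter_ok (Black i) \<longleftrightarrow> i \<in> verts Q"
| "letter_ok (Red \<theta>) \<longleftrightarrow> finite {i. \<theta> i \<noteq> 0} \<and> {i. \<theta> i \<noteq> 0} \<subseteq> verts Q"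

primrec src :: "'q diagram \<Rightarrow> 'q word" where
  "src (Strands w) = w"
| "src (Dot i) = [Black i]"
| "src (Cross a b) = [a, b]"
| "src (Mirror i) = [Black i]"
| "src (Comp d e) = src e"
| "src (Tensor d e) = src d @ src e"

primrec tgt :: "'q diagram \<Rightarrow> 'q word" where
  "tgt (Strands w) = w"
| "tgt (Dot i) = [Black i]"
| "tgt (Cross a b) = [b, a]"
| "tgt (Mirror i) = [Black (\<tau> i)]"
| "tgt (Comp d e) = tgt d"
| "tgt (Tensor d e) = tgt d @ tgt e"

text \<open>Well-formed diagrams. In a tensor product only the left factor may involve mirrors.\<close>

primrec valid :: "layer \<Rightarrow> 'q diagram \<Rightarrow> bool" where
  "valid L (Strands w) \<longleftrightarrow> (\<forall>a \<in> set w. letter_ok a)"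
| "valid L (Dot i) \<longleftrightarrow> i \<in> verts Q"
| "valid L (Cross a b) \<longleftrightarrow> letter_ok a \<and> letter_ok b \<and> \<not> ((\<exists>\<theta>. a = Red \<theta>) \<and> (\<exists>\<theta>. b = Red \<theta>))"
| "valid L (Mirror i) \<longleftrightarrow> L = OKLRW \<and> i \<in> verts Q"
| "valid L (Comp d e) \<longleftrightarrow> valid L d \<and> valid L e \<and> src d = tgt e"
| "valid L (Tensor d e) \<longleftrightarrow> valid L d \<and> valid KLRW e"

definition comp :: "'q lincomb \<Rightarrow> 'q lincomb \<Rightarrow> 'q lincomb" (infixr \<open>\<odot>\<close> 70) where
  "x \<odot> y = (\<Sum>d \<in> Poly_Mapping.keys x. \<Sum>e \<in> Poly_Mapping.keys y.
     if src d = tgt e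
     then Poly_Mapping.single (Comp d e) (Poly_Mapping.lookup x d * Poly_Mapping.lookup y e)
     else 0)"


section \<open>The defining relations\<close>

definition X_fac :: "'q \<Rightarrow> 'q \<Rightarrow> 'a::comm_ring_1 \<Rightarrow> 'a \<Rightarrow> 'a" where
  "X_fac i j u v = (if j \<rightarrow>\<^bsub>Q\<^esub> i then u - v else 1)"

definition f_fac :: "'q \<Rightarrow> 'q \<Rightarrow> 'a::comm_ring_1 \<Rightarrow> 'a \<Rightarrow> 'a" where
  "f_fac i j u v = X_fac i j u v * X_fac j i v u"

text \<open>Polynomials in \<open>y\<^sub>1, y\<^sub>2\<close> and in \<open>y\<^sub>1, y\<^sub>2, y\<^sub>3\<close> are iterated univariate polynomials, the last
  variable being the outermost one. The division in \<open>f_quotient\<close> is exact.\<close>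

definition f_poly :: "'q \<Rightarrow> 'q \<Rightarrow> complex poly poly" where
  "f_poly i j = f_fac i j [:[:0, 1:]:] [:0, 1:]"

definition f_quotient :: "'q \<Rightarrow> 'q \<Rightarrow> complex poly poly poly" where
  "f_quotient i j =
     (let Y1 = [:[:[:0, 1:]:]:]; Y2 = [:[:0, 1:]:]; Y3 = [:0, 1:]
      in (f_fac i j Y3 Y2 - f_fac i j Y1 Y2) div (Y3 - Y1))"

primrec pow :: "'q word \<Rightarrow> 'q lincomb \<Rightarrow> nat \<Rightarrow> 'q lincomb" where
  "pow w x 0 = idm w"
| "pow w x (Suc n) = x \<odot> pow w x n"

text \<open>Evaluation of polynomials at endomorphisms of the word \<open>w\<close>; \<open>c\<close> evaluates the coefficients.\<close>

definition eval_poly :: "'q word \<Rightarrow> ('a::zero \<Rightarrow> 'q lincomb) \<Rightarrow> 'q lincomb \<Rightarrow> 'a poly \<Rightarrow> 'q lincomb" where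
  "eval_poly w c x p = (\<Sum>n \<le> degree p. c (coeff p n) \<odot> pow w x n)"

definition eval_poly1 :: "'q word \<Rightarrow> 'q lincomb \<Rightarrow> complex poly \<Rightarrow> 'q lincomb" where
  "eval_poly1 w y1 = eval_poly w (\<lambda>a. smul a (idm w)) y1"

definition eval_poly2 :: "'q word \<Rightarrow> 'q lincomb \<Rightarrow> 'q lincomb \<Rightarrow> complex poly poly \<Rightarrow> 'q lincomb" where
  "eval_poly2 w y1 y2 = eval_poly w (eval_poly1 w y1) y2"

definition eval_poly3 ::
  "'q word \<Rightarrow> 'q lincomb \<Rightarrow> 'q lincomb \<Rightarrow> 'q lincomb \<Rightarrow> complex poly poly poly \<Rightarrow> 'q lincomb" where
  "eval_poly3 w y1 y2 y3 = eval_poly w (eval_poly2 w y1 y2) y3"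

text \<open>Each relation \<open>x = y\<close> is recorded as the element \<open>x - y\<close>.\<close>

inductive klrw_relation :: "'q lincomb \<Rightarrow> bool" where
  dot_slide_left:
    "\<lbrakk>i \<in> verts Q; j \<in> verts Q\<rbrakk> \<Longrightarrow> klrw_relation
      ((dot j \<boxtimes> idm [Black i]) \<odot> cross (Black i) (Black j)
       - (cross (Black i) (Black j) \<odot> (idm [Black i] \<boxtimes> dot j)
          + (if i = j then idm [Black i, Black j] else 0)))"
| dot_slide_right:
    "\<lbrakk>i \<in> verts Q; j \<in> verts Q\<rbrakk> \<Longrightarrow> klrw_relation
      (cross (Black i) (Black j) \<odot> (dot i \<boxtimes> idm [Black j])
       - ((idm [Black j] \<boxtimes> dot i) \<odot> cross (Black i) (Black j)
          + (if i = j then idm [Black i, Black j] else 0)))"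
| bigon_same:
    "i \<in> verts Q \<Longrightarrow> klrw_relation
      (cross (Black i) (Black i) \<odot> cross (Black i) (Black i))"
| bigon:
    "\<lbrakk>i \<in> verts Q; j \<in> verts Q; i \<noteq> j\<rbrakk> \<Longrightarrow> klrw_relation
      (cross (Black j) (Black i) \<odot> cross (Black i) (Black j)
       - eval_poly2 [Black i, Black j] (dot i \<boxtimes> idm [Black j]) (idm [Black i] \<boxtimes> dot j) (f_poly i j))"
| triple:
    "\<lbrakk>i \<in> verts Q; j \<in> verts Q; k \<in> verts Q\<rbrakk> \<Longrightarrow> klrw_relation
      ((cross (Black j) (Black k) \<boxtimes> idm [Black i]) \<odot> (idm [Black j] \<boxtimes> cross (Black i) (Black k))
         \<odot> (cross (Black i) (Black j) \<boxtimes> idm [Black k])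
       - (idm [Black k] \<boxtimes> cross (Black i) (Black j)) \<odot> (cross (Black i) (Black k) \<boxtimes> idm [Black j])
         \<odot> (idm [Black i] \<boxtimes> cross (Black j) (Black k))
       - (if i = k \<and> k \<noteq> j
          then eval_poly3 [Black i, Black j, Black k]
                 (dot i \<boxtimes> idm [Black j, Black k])
                 (idm [Black i] \<boxtimes> dot j \<boxtimes> idm [Black k])
                 (idm [Black i, Black j] \<boxtimes> dot k) (f_quotient i j)
          else 0))"
| triple_black_red_black:
    "\<lbrakk>i \<in> verts Q; j \<in> verts Q; letter_ok (Red \<theta>)\<rbrakk> \<Longrightarrow> klrw_relation
      ((cross (Red \<theta>) (Black j) \<boxtimes> idm [Black i]) \<odot> (idm [Red \<theta>] \<boxtimes> cross (Black i) (Black j))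
         \<odot> (cross (Black i) (Red \<theta>) \<boxtimes> idm [Black j])
       - (idm [Black j] \<boxtimes> cross (Black i) (Red \<theta>)) \<odot> (cross (Black i) (Black j) \<boxtimes> idm [Red \<theta>])
         \<odot> (idm [Black i] \<boxtimes> cross (Red \<theta>) (Black j))
       - (if i = j
          then (\<Sum>(a, b) \<in> {(a, b). a + b + 1 = \<theta> i}.
                  pow [Black i] (dot i) a \<boxtimes> idm [Red \<theta>] \<boxtimes> pow [Black j] (dot j) b)
          else 0))"
| triple_black_black_red:
    "\<lbrakk>i \<in> verts Q; j \<in> verts Q; letter_ok (Red \<theta>)\<rbrakk> \<Longrightarrow> klrw_relation
      ((cross (Black j) (Red \<theta>) \<boxtimes> idm [Black i]) \<odot> (idm [Black j] \<boxtimes> cross (Black i) (Red \<theta>))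
         \<odot> (cross (Black i) (Black j) \<boxtimes> idm [Red \<theta>])
       - (idm [Red \<theta>] \<boxtimes> cross (Black i) (Black j)) \<odot> (cross (Black i) (Red \<theta>) \<boxtimes> idm [Black j])
         \<odot> (idm [Black i] \<boxtimes> cross (Black j) (Red \<theta>)))"
| triple_red_black_black:
    "\<lbrakk>i \<in> verts Q; j \<in> verts Q; letter_ok (Red \<theta>)\<rbrakk> \<Longrightarrow> klrw_relation
      ((cross (Black j) (Black i) \<boxtimes> idm [Red \<theta>]) \<odot> (idm [Black j] \<boxtimes> cross (Red \<theta>) (Black i))
         \<odot> (cross (Red \<theta>) (Black j) \<boxtimes> idm [Black i])
       - (idm [Black i] \<boxtimes> cross (Red \<theta>) (Black j)) \<odot> (cross (Red \<theta>) (Black i) \<boxtimes> idm [Black j])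
         \<odot> (idm [Red \<theta>] \<boxtimes> cross (Black j) (Black i)))"
| dot_slide_red_black:
    "\<lbrakk>i \<in> verts Q; letter_ok (Red \<theta>)\<rbrakk> \<Longrightarrow> klrw_relation
      ((dot i \<boxtimes> idm [Red \<theta>]) \<odot> cross (Red \<theta>) (Black i)
       - cross (Red \<theta>) (Black i) \<odot> (idm [Red \<theta>] \<boxtimes> dot i))"
| dot_slide_black_red:
    "\<lbrakk>i \<in> verts Q; letter_ok (Red \<theta>)\<rbrakk> \<Longrightarrow> klrw_relation
      (cross (Black i) (Red \<theta>) \<odot> (dot i \<boxtimes> idm [Red \<theta>])
       - (idm [Red \<theta>] \<boxtimes> dot i) \<odot> cross (Black i) (Red \<theta>))"
| bigon_red_black:
    "\<lbrakk>i \<in> verts Q; letter_ok (Red \<theta>)\<rbrakk> \<Longrightarrow> klrw_relation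
      (cross (Black i) (Red \<theta>) \<odot> cross (Red \<theta>) (Black i)
       - idm [Red \<theta>] \<boxtimes> pow [Black i] (dot i) (\<theta> i))"
| bigon_black_red:
    "\<lbrakk>i \<in> verts Q; letter_ok (Red \<theta>)\<rbrakk> \<Longrightarrow> klrw_relation
      (cross (Red \<theta>) (Black i) \<odot> cross (Black i) (Red \<theta>)
       - pow [Black i] (dot i) (\<theta> i) \<boxtimes> idm [Red \<theta>])"

inductive mirror_relation :: "'q lincomb \<Rightarrow> bool" where
  mirror_twice:
    "i \<in> verts Q \<Longrightarrow> mirror_relation (mirror (\<tau> i) \<odot> mirror i - idm [Black i])"
| mirror_dot:
    "i \<in> verts Q \<Longrightarrow> mirror_relation (mirror i \<odot> dot i + dot (\<tau> i) \<odot> mirror i)"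
| mirror_braid:
    "\<lbrakk>i \<in> verts Q; j \<in> verts Q\<rbrakk> \<Longrightarrow> mirror_relation
      (cross (Black (\<tau> j)) (Black (\<tau> i)) \<odot> (mirror j \<boxtimes> idm [Black (\<tau> i)])
         \<odot> cross (Black (\<tau> i)) (Black j) \<odot> (mirror i \<boxtimes> idm [Black j])
       - (mirror i \<boxtimes> idm [Black (\<tau> j)]) \<odot> cross (Black (\<tau> j)) (Black i)
         \<odot> (mirror j \<boxtimes> idm [Black i]) \<odot> cross (Black i) (Black j))"

text \<open>The axioms of a strict monoidal category (\<open>KLRW\<close>) and of a strict right module category over
  it (\<open>OKLRW\<close>). In particular, \<open>interchange\<close> says that mirrors commute with all morphisms
  that take place to their right.\<close>

inductive strictness :: "layer \<Rightarrow> 'q lincomb \<Rightarrow> bool" where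
  comp_assoc: "valid L (Comp d (Comp e f)) \<Longrightarrow>
    strictness L (dg (Comp (Comp d e) f) - dg (Comp d (Comp e f)))"
| comp_unit_left: "valid L d \<Longrightarrow> strictness L (dg (Comp (Strands (tgt d)) d) - dg d)"
| comp_unit_right: "valid L d \<Longrightarrow> strictness L (dg (Comp d (Strands (src d))) - dg d)"
| tensor_assoc: "valid L (Tensor (Tensor d e) f) \<Longrightarrow>
    strictness L (dg (Tensor (Tensor d e) f) - dg (Tensor d (Tensor e f)))"
| tensor_unit_left: "valid KLRW d \<Longrightarrow> strictness L (dg (Tensor (Strands []) d) - dg d)"
| tensor_unit_right: "valid L d \<Longrightarrow> strictness L (dg (Tensor d (Strands [])) - dg d)"
| tensor_strands: "valid L (Strands (u @ w)) \<Longrightarrow>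
    strictness L (dg (Tensor (Strands u) (Strands w)) - dg (Strands (u @ w)))"
| interchange: "valid L (Tensor (Comp d e) (Comp f g)) \<Longrightarrow>
    strictness L (dg (Tensor (Comp d e) (Comp f g)) - dg (Comp (Tensor d f) (Tensor e g)))"

text \<open>The linear combinations of diagrams that vanish in \<open>\<K>\<close> and in \<open>\<O>\<^sub>0\<close>, respectively. As all
  relations are homogeneous with respect to source and target, the space of all linear
  combinations of diagrams from \<open>u\<close> to \<open>w\<close> modulo the vanishing ones is the Hom space from \<open>u\<close>
  to \<open>w\<close>, and without a restriction on \<open>u\<close> and \<open>w\<close> it is the direct sum of the Hom spaces.\<close>

inductive null :: "layer \<Rightarrow> 'q lincomb \<Rightarrow> bool" where
  null_strictness: "strictness L x \<Longrightarrow> null L x"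
| null_klrw: "klrw_relation x \<Longrightarrow> null L x"
| null_mirror: "mirror_relation x \<Longrightarrow> null OKLRW x"
| null_zero: "null L 0"
| null_add: "\<lbrakk>null L x; null L y\<rbrakk> \<Longrightarrow> null L (x + y)"
| null_smul: "null L x \<Longrightarrow> null L (smul a x)"
| null_comp_left: "\<lbrakk>null L x; valid L d\<rbrakk> \<Longrightarrow> null L (dg d \<odot> x)"
| null_comp_right: "\<lbrakk>null L x; valid L d\<rbrakk> \<Longrightarrow> null L (x \<odot> dg d)"
| null_tensor_right: "\<lbrakk>null L x; valid KLRW d\<rbrakk> \<Longrightarrow> null L (x \<boxtimes> dg d)"
| null_tensor_left: "\<lbrakk>null KLRW x; valid L d\<rbrakk> \<Longrightarrow> null L (dg d \<boxtimes> x)"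


section \<open>The oKLRW algebra of a sequence of red strands\<close>

context
  fixes \<Lambda> :: "nat \<Rightarrow> 'q \<Rightarrow> nat"
begin

definition reds_upto :: "nat \<Rightarrow> ('q \<Rightarrow> nat) list" where
  "reds_upto N = map \<Lambda> [0..<Suc N]"

definition stage :: "nat \<Rightarrow> bool" where
  "stage N \<longleftrightarrow> (\<forall>n > N. \<Lambda> n = (\<lambda>_. 0))"

definition stage_space :: "nat \<Rightarrow> 'q lincomb set" where
  "stage_space N = {x. \<forall>d \<in> Poly_Mapping.keys x.
     valid OKLRW d \<and> reds (src d) = reds_upto N \<and> reds (tgt d) = reds_upto N}"

definition transition :: "nat \<Rightarrow> nat \<Rightarrow> 'q lincomb \<Rightarrow> 'q lincomb" where
  "transition N M x = x \<boxtimes> idm (map (\<lambda>n. Red (\<Lambda> n)) [Suc N..<Suc M])"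

text \<open>An element of the direct limit is an equivalence class of pairs \<open>(N, x)\<close>, where \<open>x\<close>
  represents an element of the algebra with red strands \<open>\<Lambda> 0, \<dots>, \<Lambda> N\<close>, and \<open>N\<close> is so large that
  all further red strands are labelled by zero.\<close>

definition lim_class :: "nat \<Rightarrow> 'q lincomb \<Rightarrow> (nat \<times> 'q lincomb) set" where
  "lim_class N x = {(M, y). stage M \<and> y \<in> stage_space M \<and>
     (\<exists>K. N \<le> K \<and> M \<le> K \<and> null OKLRW (transition N K x - transition M K y))}"

definition oklrw_algebra :: "(nat \<times> 'q lincomb) set set" where
  "oklrw_algebra = {lim_class N x | N x. stage N \<and> x \<in> stage_space N}"

definition lim_zero :: "(nat \<times> 'q lincomb) set" where
  "lim_zero = \<Union>{lim_class N 0 | N. stage N}"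

definition lim_add ::
  "(nat \<times> 'q lincomb) set \<Rightarrow> (nat \<times> 'q lincomb) set \<Rightarrow> (nat \<times> 'q lincomb) set" where
  "lim_add A B = \<Union>{lim_class N (x + y) | N x y. (N, x) \<in> A \<and> (N, y) \<in> B}"

definition lim_smul :: "complex \<Rightarrow> (nat \<times> 'q lincomb) set \<Rightarrow> (nat \<times> 'q lincomb) set" where
  "lim_smul a A = \<Union>{lim_class N (smul a x) | N x. (N, x) \<in> A}"

definition lim_mult ::
  "(nat \<times> 'q lincomb) set \<Rightarrow> (nat \<times> 'q lincomb) set \<Rightarrow> (nat \<times> 'q lincomb) set" where
  "lim_mult A B = \<Union>{lim_class N (x \<odot> y) | N x y. (N, x) \<in> A \<and> (N, y) \<in> B}"

inductive_set lin_span :: "(nat \<times> 'q lincomb) set set \<Rightarrow> (nat \<times> 'q lincomb) set set"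
  for S :: "(nat \<times> 'q lincomb) set set" where
  "lim_zero \<in> lin_span S"
| "A \<in> S \<Longrightarrow> A \<in> lin_span S"
| "\<lbrakk>A \<in> lin_span S; B \<in> lin_span S\<rbrakk> \<Longrightarrow> lim_add A B \<in> lin_span S"
| "A \<in> lin_span S \<Longrightarrow> lim_smul a A \<in> lin_span S"

text \<open>The algebra is in general not unital, so neither are its subalgebras.\<close>

inductive_set subalgebra_generated :: "(nat \<times> 'q lincomb) set set \<Rightarrow> (nat \<times> 'q lincomb) set set"
  for S :: "(nat \<times> 'q lincomb) set set" where
  "lim_zero \<in> subalgebra_generated S"
| "A \<in> S \<Longrightarrow> A \<in> subalgebra_generated S"
| "\<lbrakk>A \<in> subalgebra_generated S; B \<in> subalgebra_generated S\<rbrakk> \<Longrightarrow> lim_add A B \<in> subalgebra_generated S"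
| "A \<in> subalgebra_generated S \<Longrightarrow> lim_smul a A \<in> subalgebra_generated S"
| "\<lbrakk>A \<in> subalgebra_generated S; B \<in> subalgebra_generated S\<rbrakk> \<Longrightarrow> lim_mult A B \<in> subalgebra_generated S"


section \<open>Interval sequences\<close>

text \<open>A sequence of intervals is \<open>\<nu> :: nat \<Rightarrow> 'q list\<close>, where \<open>\<nu> r\<close> is the \<open>r\<close>-th interval for
  \<open>r \<ge> 1\<close>, and \<open>\<nu> 0 = []\<close> is a dummy. Positions in an interval are counted from 0.\<close>

definition fits :: "nat \<Rightarrow> (nat \<Rightarrow> 'q list) \<Rightarrow> bool" where
  "fits N \<nu> \<longleftrightarrow> stage N \<and> (\<forall>r > N. \<nu> r = [])"

definition seq_word :: "nat \<Rightarrow> (nat \<Rightarrow> 'q list) \<Rightarrow> 'q word" where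
  "seq_word N \<nu> = Red (\<Lambda> 0) # concat (map (\<lambda>r. map Black (\<nu> r) @ [Red (\<Lambda> r)]) [1..<Suc N])"

text \<open>The part of the word of \<open>\<nu>\<close> to the left of position \<open>l\<close> of interval \<open>a\<close>.\<close>

definition before :: "(nat \<Rightarrow> 'q list) \<Rightarrow> nat \<Rightarrow> nat \<Rightarrow> 'q word" where
  "before \<nu> a l = seq_word (a - 1) \<nu> @ map Black (take l (\<nu> a))"

definition idem :: "(nat \<Rightarrow> 'q list) \<Rightarrow> (nat \<times> 'q lincomb) set" where
  "idem \<nu> = (let N = (LEAST N. fits N \<nu>) in lim_class N (idm (seq_word N \<nu>)))"

end


section \<open>Long crossings and long reflections\<close>

text \<open>\<open>strand_right x B\<close> goes from \<open>x # B\<close> to \<open>B @ [x]\<close>, and \<open>strand_left B x\<close> goes from \<open>B @ [x]\<close>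
  to \<open>x # B\<close>; the strand \<open>x\<close> crosses each strand of \<open>B\<close> once.\<close>

primrec strand_right :: "'q letter \<Rightarrow> 'q word \<Rightarrow> 'q diagram" where
  "strand_right x [] = Strands [x]"
| "strand_right x (b # B) =
     Comp (Tensor (Strands [b]) (strand_right x B)) (Tensor (Cross x b) (Strands B))"

primrec strand_left :: "'q word \<Rightarrow> 'q letter \<Rightarrow> 'q diagram" where
  "strand_left [] x = Strands [x]"
| "strand_left (b # B) x =
     Comp (Tensor (Cross b x) (Strands B)) (Tensor (Strands [b]) (strand_left B x))"

definition padded :: "'q word \<Rightarrow> 'q diagram \<Rightarrow> 'q word \<Rightarrow> 'q diagram" where
  "padded u d w = Tensor (Tensor (Strands u) d) (Strands w)"

text \<open>The letter at position \<open>p\<close> of \<open>w\<close> is moved to position \<open>q\<close> of the resulting word; for the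
  reflection, this letter is the black letter \<open>i\<close>.\<close>

definition long_crossing :: "'q word \<Rightarrow> nat \<Rightarrow> nat \<Rightarrow> 'q diagram" where
  "long_crossing w p q =
     (if p \<le> q
      then padded (take p w) (strand_right (w ! p) (take (q - p) (drop (Suc p) w))) (drop (Suc q) w)
      else padded (take q w) (strand_left (take (p - q) (drop q w)) (w ! p)) (drop (Suc p) w))"

definition long_reflection :: "'q word \<Rightarrow> nat \<Rightarrow> 'q \<Rightarrow> nat \<Rightarrow> 'q diagram" where
  "long_reflection w p i q =
     (let u = take p w; u' = drop (Suc p) w
      in Comp (padded [] (strand_right (Black (\<tau> i)) (take q (u @ u'))) (drop q (u @ u')))
           (Comp (Tensor (Mirror i) (Strands (u @ u')))
             (padded [] (strand_left u (Black i)) u')))"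


section \<open>The interval algebra and its generators\<close>

context
  fixes P :: "'q set" and le :: "'q rel" and v :: "'q \<Rightarrow> nat" and \<Lambda> :: "nat \<Rightarrow> 'q \<Rightarrow> nat"
begin

definition interval_seqs :: "(nat \<Rightarrow> 'q list) set" where
  "interval_seqs = {\<nu>. \<nu> 0 = [] \<and> finite {r. \<nu> r \<noteq> []} \<and>
     (\<forall>n. set (\<nu> (2 * n + 1)) \<subseteq> P \<and> sorted_wrt (\<lambda>i j. (i, j) \<in> le) (\<nu> (2 * n + 1))) \<and>
     (\<forall>n. set (\<nu> (2 * n + 2)) \<subseteq> verts Q - P \<and>
          sorted_wrt (\<lambda>i j. (\<tau> j, \<tau> i) \<in> le) (\<nu> (2 * n + 2))) \<and>
     (\<forall>i \<in> P. (\<Sum>r \<in> {r. \<nu> r \<noteq> []}. count_list (\<nu> r) i + count_list (\<nu> r) (\<tau> i)) = v i)}"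

definition interval_algebra :: "(nat \<times> 'q lincomb) set set" where
  "interval_algebra = lin_span \<Lambda>
     {lim_mult \<Lambda> (idem \<Lambda> \<nu>') (lim_mult \<Lambda> A (idem \<Lambda> \<nu>)) | \<nu> \<nu>' A.
        \<nu> \<in> interval_seqs \<and> \<nu>' \<in> interval_seqs \<and> A \<in> oklrw_algebra \<Lambda>}"

definition remove_at :: "(nat \<Rightarrow> 'q list) \<Rightarrow> nat \<Rightarrow> nat \<Rightarrow> nat \<Rightarrow> 'q list" where
  "remove_at \<nu> a l = \<nu>(a := take l (\<nu> a) @ drop (Suc l) (\<nu> a))"

text \<open>\<open>\<nu>'\<close> arises from \<open>\<nu>\<close> by removing the letter \<open>i\<close> at position \<open>l\<close> of interval \<open>a\<close>
  and inserting the letter \<open>i'\<close> so that it is at position \<open>l'\<close> of interval \<open>b\<close>.\<close>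

definition moved ::
  "(nat \<Rightarrow> 'q list) \<Rightarrow> nat \<Rightarrow> nat \<Rightarrow> 'q \<Rightarrow> (nat \<Rightarrow> 'q list) \<Rightarrow> nat \<Rightarrow> nat \<Rightarrow> 'q \<Rightarrow> bool" where
  "moved \<nu> a l i \<nu>' b l' i' \<longleftrightarrow>
     1 \<le> a \<and> l < length (\<nu> a) \<and> \<nu> a ! l = i \<and>
     1 \<le> b \<and> l' < length (\<nu>' b) \<and> \<nu>' b ! l' = i' \<and>
     remove_at \<nu> a l = remove_at \<nu>' b l'"

definition idempotents :: "(nat \<times> 'q lincomb) set set" where
  "idempotents = {idem \<Lambda> \<nu> | \<nu>. \<nu> \<in> interval_seqs}"

definition long_crossings :: "(nat \<times> 'q lincomb) set set" where
  "long_crossings =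
     {lim_class \<Lambda> N (dg (long_crossing (seq_word \<Lambda> N \<nu>)
        (length (before \<Lambda> \<nu> a l)) (length (before \<Lambda> \<nu>' b l')))) | N \<nu> \<nu>' a l b l' i.
      \<nu> \<in> interval_seqs \<and> \<nu>' \<in> interval_seqs \<and> fits \<Lambda> N \<nu> \<and> fits \<Lambda> N \<nu>' \<and>
      a mod 2 = b mod 2 \<and> moved \<nu> a l i \<nu>' b l' i}"

definition long_reflections :: "(nat \<times> 'q lincomb) set set" where
  "long_reflections =
     {lim_class \<Lambda> N (dg (long_reflection (seq_word \<Lambda> N \<nu>)
        (length (before \<Lambda> \<nu> a l)) i (length (before \<Lambda> \<nu>' b l')))) | N \<nu> \<nu>' a l b l' i.
      \<nu> \<in> interval_seqs \<and> \<nu>' \<in> interval_seqs \<and> fits \<Lambda> N \<nu> \<and> fits \<Lambda> N \<nu>' \<and>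
      a mod 2 \<noteq> b mod 2 \<and> moved \<nu> a l i \<nu>' b l' (\<tau> i)}"

definition admissible_crossings :: "(nat \<times> 'q lincomb) set set" where
  "admissible_crossings =
     {lim_class \<Lambda> N (dg (padded (take p w) (Cross (w ! p) (w ! Suc p)) (drop (Suc (Suc p)) w))) |
        N \<nu> j k p w.
      \<nu> \<in> interval_seqs \<and> fits \<Lambda> N \<nu> \<and> w = seq_word \<Lambda> N \<nu> \<and> p = length (before \<Lambda> \<nu> j k) \<and>
      1 \<le> j \<and> Suc k < length (\<nu> j) \<and> \<nu> j ! k = \<nu> j ! Suc k}"

definition interval_dots :: "(nat \<times> 'q lincomb) set set" where
  "interval_dots =
     {lim_class \<Lambda> N (dg (padded (take p w) (Dot (\<nu> j ! k)) (drop (Suc p) w))) | N \<nu> j k p w.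
      \<nu> \<in> interval_seqs \<and> fits \<Lambda> N \<nu> \<and> w = seq_word \<Lambda> N \<nu> \<and> p = length (before \<Lambda> \<nu> j k) \<and>
      1 \<le> j \<and> k < length (\<nu> j)}"

end

end


section \<open>The red sequence\<close>

text \<open>\<open>z_mult \<tau> P R i n\<close> is \<open>z\<^bsub>i,n\<^esub>\<close>, where for a vertex \<open>i = \<tau> j\<close> outside \<open>P\<close>
  the multiset \<open>R j\<close> is written as \<open>R (\<tau> i)\<close>.\<close>

definition z_mult :: "('q \<Rightarrow> 'q) \<Rightarrow> 'q set \<Rightarrow> ('q \<Rightarrow> complex multiset) \<Rightarrow> 'q \<Rightarrow> int \<Rightarrow> nat" where
  "z_mult \<tau> P R i n = count (R (\<tau> i)) ((if i \<in> P then 3/4 else 1/4) - of_int n)"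

text \<open>The value at \<open>i\<close> is the coefficient of the fundamental weight of \<open>i\<close>.\<close>

definition red_sequence ::
  "('q, 'e) pre_digraph \<Rightarrow> ('q \<Rightarrow> 'q) \<Rightarrow> 'q set \<Rightarrow> ('q \<Rightarrow> complex multiset) \<Rightarrow> nat \<Rightarrow> 'q \<Rightarrow> nat" where
  "red_sequence Q \<tau> P R r i =
     (if i \<notin> verts Q then 0
      else if even r then z_mult \<tau> P R i (int (r div 2))
      else if i \<in> P then z_mult \<tau> P R (\<tau> i) (- int (r div 2) - 1)
      else if r = 1 then 0
      else z_mult \<tau> P R (\<tau> i) (- int (r div 2)))"

end

theory Submission
  imports Defs
begin

text \<open>Unfold every diagram along the mirror: a strand labelled \<open>i\<close> at position \<open>p\<close> becomes a pair
  of strands, labelled \<open>i\<close> at \<open>p\<close> and \<open>\<tau> i\<close> at \<open>- p\<close>, and a diagram without dots becomes a word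
  in the generators of the Weyl group of type B. Modulo diagrams with fewer crossings, dots slide
  through everything, squares of crossings and of reflections vanish, and braid relations hold,
  so that each Hom space is spanned by diagrams in which one reduced diagram per signed
  permutation is preceded by dots. It remains to choose the reduced diagrams as products of the
  given generators. Let \<open>L\<close> be the signed permutation of a diagram between two interval
  sequences. Among the unfolded strands whose lower interval lies to the right of their upper
  interval take the one whose upper end is rightmost. Everything this strand meets on its way
  right, to a suitable place in its lower interval, ends to the left of it at the bottom, so each
  step of the move decreases the number of inversions; hence the reduced diagram is a long
  crossing or a long reflection on top of a shorter reduced diagram. If every strand stays in its
  interval, then an inversion is an admissible crossing, because the intervals are sorted.\<close>

section \<open>Linear combinations of diagrams\<close>

text \<open>A mirror counts as a crossing. Hence the square of a reflection, which is the identity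
  and not zero, also vanishes modulo fewer crossings, and the number of inversions is the length in
  type B. The obstacle is that a reduced diagram usually passes through words that do not belong to
  interval sequences: a swap of different letters inside an interval breaks the sorting, and
  crossing one red strand changes the parity of the interval. So whole pieces have to be cut off,
  each lowering the length and starting from the word of an interval sequence. The rightmost upper
  end in the unfolded picture means the following. If some strand has its lower interval to the
  right of its upper one, take the last such strand; otherwise take the first strand whose lower
  interval is to the left of its upper one, since its mirror image is then rightmost. The suitable
  place in the lower interval is the near side of the letters equal to the moving one: inside that
  interval the strand then passes only different letters, and their order decides which strand ends
  further left at the bottom.\<close>

lemma lookup_smul [simp]: "Poly_Mapping.lookup (smul a x) d = a * Poly_Mapping.lookup x d"
  by (simp add: smul_def Poly_Mapping.map.rep_eq when_def)

lemma smul_add: "smul a (x + y) = smul a x + smul a y"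
  by (rule poly_mapping_eqI) (simp add: lookup_add algebra_simps)

lemma smul_diff: "smul a (x - y) = smul a x - smul a y"
  by (rule poly_mapping_eqI) (simp add: lookup_minus algebra_simps)

lemma smul_smul [simp]: "smul a (smul b x) = smul (a * b) x"
  by (rule poly_mapping_eqI) simp

lemma smul_zero [simp]: "smul a 0 = 0"
  by (rule poly_mapping_eqI) simp

lemma smul_one [simp]: "smul 1 x = x"
  by (rule poly_mapping_eqI) simp

lemma smul_minus_one: "smul (- 1) x = - x"
  by (rule poly_mapping_eqI) simp

lemma smul_sum: "smul a (\<Sum>i\<in>I. f i) = (\<Sum>i\<in>I. smul a (f i))"
  by (induction I rule: infinite_finite_induct) (simp_all add: smul_add)

lemma smul_single [simp]: "smul a (Poly_Mapping.single d b) = Poly_Mapping.single d (a * b)"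
  by (rule poly_mapping_eqI) (simp add: lookup_single when_def)

lemma keys_dg [simp]: "Poly_Mapping.keys (dg d) = {d}"
  by (simp add: dg_def)

lemma keys_smul: "Poly_Mapping.keys (smul a x) \<subseteq> Poly_Mapping.keys x"
  by (auto simp: in_keys_iff)

lemma lincomb_expand:
  "x = (\<Sum>d\<in>Poly_Mapping.keys x. smul (Poly_Mapping.lookup x d) (dg d))"
proof (rule poly_mapping_eqI)
  fix e
  have "(\<Sum>d\<in>Poly_Mapping.keys x. Poly_Mapping.lookup x d * Poly_Mapping.lookup (dg d) e) =
      (\<Sum>d\<in>Poly_Mapping.keys x. if d = e then Poly_Mapping.lookup x d else 0)"
    by (intro sum.cong) (auto simp: dg_def lookup_single)
  then show "Poly_Mapping.lookup x e =
      Poly_Mapping.lookup (\<Sum>d\<in>Poly_Mapping.keys x. smul (Poly_Mapping.lookup x d) (dg d)) e"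
    by (simp add: lookup_sum in_keys_iff)
qed

text \<open>The summands run over the support of \<open>x\<close> itself, so facts about the keys of
  \<open>x\<close>, such as validity and endpoints, are available for every diagram that is
  added.\<close>

lemma lincomb_induct [case_names zero add]:
  assumes "P 0"
    and "\<And>d a y. \<lbrakk>d \<in> Poly_Mapping.keys x; P y\<rbrakk> \<Longrightarrow> P (smul a (dg d) + y)"
  shows "P x"
proof -
  have "P (\<Sum>d\<in>K. smul (Poly_Mapping.lookup x d) (dg d))" if "K \<subseteq> Poly_Mapping.keys x" for K
    using finite_subset[OF that finite_keys] that
    by (induction K rule: finite_induct) (auto intro: assms)
  from this[OF subset_refl] show ?thesis by (simp flip: lincomb_expand)
qed

text \<open>Common form of \<open>tensor\<close> and \<open>comp\<close>. The coefficient is an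
  argument of \<open>F\<close> and not a factor outside, so that for \<open>comp\<close> the value
  can be zero when the two diagrams do not match.\<close>

definition bilinear_ext ::
  "('a \<Rightarrow> 'a \<Rightarrow> complex \<Rightarrow> 'a \<Rightarrow>\<^sub>0 complex) \<Rightarrow> ('a \<Rightarrow>\<^sub>0 complex) \<Rightarrow> ('a \<Rightarrow>\<^sub>0 complex) \<Rightarrow> 'a \<Rightarrow>\<^sub>0 complex"
  where "bilinear_ext F x y = (\<Sum>d \<in> Poly_Mapping.keys x. \<Sum>e \<in> Poly_Mapping.keys y.
     F d e (Poly_Mapping.lookup x d * Poly_Mapping.lookup y e))"

text \<open>Supports may shrink under addition or scaling, so bilinearity is checked over one finite
  index set that contains all supports involved. The additional summands have the form
  \<open>F d e 0\<close>.\<close>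

lemma bilinear_ext_superset:
  assumes "\<And>d e. F d e 0 = 0" "finite A" "finite B"
    "Poly_Mapping.keys x \<subseteq> A" "Poly_Mapping.keys y \<subseteq> B"
  shows "bilinear_ext F x y =
    (\<Sum>d\<in>A. \<Sum>e\<in>B. F d e (Poly_Mapping.lookup x d * Poly_Mapping.lookup y e))"
proof -
  have "bilinear_ext F x y =
    (\<Sum>d\<in>Poly_Mapping.keys x. \<Sum>e\<in>B. F d e (Poly_Mapping.lookup x d * Poly_Mapping.lookup y e))"
    unfolding bilinear_ext_def
    by (intro sum.cong refl sum.mono_neutral_left) (use assms in \<open>auto simp: in_keys_iff\<close>)
  also have "\<dots> = (\<Sum>d\<in>A. \<Sum>e\<in>B. F d e (Poly_Mapping.lookup x d * Poly_Mapping.lookup y e))"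
    by (intro sum.mono_neutral_left) (use assms in \<open>auto simp: in_keys_iff\<close>)
  finally show ?thesis .
qed

lemma bilinear_ext_add_left:
  assumes F: "\<And>d e. F d e 0 = 0" "\<And>d e a b. F d e (a + b) = F d e a + F d e b"
  shows "bilinear_ext F (x + x') y = bilinear_ext F x y + bilinear_ext F x' y"
proof -
  let ?A = "Poly_Mapping.keys x \<union> Poly_Mapping.keys x'"
  have "bilinear_ext F z y = (\<Sum>d\<in>?A. \<Sum>e\<in>Poly_Mapping.keys y.
      F d e (Poly_Mapping.lookup z d * Poly_Mapping.lookup y e))"
    if "z \<in> {x, x', x + x'}" for z
    using that keys_add[of x x'] by (intro bilinear_ext_superset F) auto
  then show ?thesis
    by (simp add: lookup_add algebra_simps F flip: sum.distrib)
qed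

lemma bilinear_ext_add_right:
  assumes F: "\<And>d e. F d e 0 = 0" "\<And>d e a b. F d e (a + b) = F d e a + F d e b"
  shows "bilinear_ext F x (y + y') = bilinear_ext F x y + bilinear_ext F x y'"
proof -
  let ?A = "Poly_Mapping.keys y \<union> Poly_Mapping.keys y'"
  have "bilinear_ext F x z = (\<Sum>d\<in>Poly_Mapping.keys x. \<Sum>e\<in>?A.
      F d e (Poly_Mapping.lookup x d * Poly_Mapping.lookup z e))"
    if "z \<in> {y, y', y + y'}" for z
    using that keys_add[of y y'] by (intro bilinear_ext_superset F) auto
  then show ?thesis
    by (simp add: lookup_add algebra_simps F flip: sum.distrib)
qed

lemma bilinear_ext_smul_left:
  assumes F: "\<And>d e. F d e 0 = 0" "\<And>d e a b. F d e (a * b) = smul a (F d e b)"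
  shows "bilinear_ext F (smul a x) y = smul a (bilinear_ext F x y)"
  by (subst bilinear_ext_superset[of F "Poly_Mapping.keys x" "Poly_Mapping.keys y"])
     (simp_all add: F(1) keys_smul, simp add: bilinear_ext_def smul_sum mult.assoc flip: F(2))

lemma bilinear_ext_smul_right:
  assumes F: "\<And>d e. F d e 0 = 0" "\<And>d e a b. F d e (a * b) = smul a (F d e b)"
  shows "bilinear_ext F x (smul a y) = smul a (bilinear_ext F x y)"
  by (subst bilinear_ext_superset[of F "Poly_Mapping.keys x" "Poly_Mapping.keys y"])
     (simp_all add: F(1) keys_smul, simp add: bilinear_ext_def smul_sum mult.left_commute flip:
       F(2))

lemma tensor_bilinear_ext: "tensor = bilinear_ext (\<lambda>d e. Poly_Mapping.single (Tensor d e))"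
  by (simp add: tensor_def bilinear_ext_def fun_eq_iff)

lemma comp_bilinear_ext: "Defs.comp \<tau> =
    bilinear_ext (\<lambda>d e a. if src d = tgt \<tau> e then Poly_Mapping.single (Comp d e) a else 0)"
  by (simp add: Defs.comp_def bilinear_ext_def fun_eq_iff)

lemma tensor_add_left: "(x + x') \<boxtimes> y = x \<boxtimes> y + x' \<boxtimes> y"
  and tensor_add_right: "x \<boxtimes> (y + y') = x \<boxtimes> y + x \<boxtimes> y'"
  and tensor_smul_left: "smul a x \<boxtimes> y = smul a (x \<boxtimes> y)"
  and tensor_smul_right: "x \<boxtimes> smul a y = smul a (x \<boxtimes> y)"
  unfolding tensor_bilinear_ext
  by (rule bilinear_ext_add_left bilinear_ext_add_right
      bilinear_ext_smul_left bilinear_ext_smul_right; simp add: single_add)+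

lemma comp_add_left: "Defs.comp \<tau> (x + x') y = Defs.comp \<tau> x y + Defs.comp \<tau> x' y"
  and comp_add_right: "Defs.comp \<tau> x (y + y') = Defs.comp \<tau> x y + Defs.comp \<tau> x y'"
  and comp_smul_left: "Defs.comp \<tau> (smul a x) y = smul a (Defs.comp \<tau> x y)"
  and comp_smul_right: "Defs.comp \<tau> x (smul a y) = smul a (Defs.comp \<tau> x y)"
  unfolding comp_bilinear_ext
  by (rule bilinear_ext_add_left bilinear_ext_add_right
      bilinear_ext_smul_left bilinear_ext_smul_right; simp add: single_add)+

lemma tensor_zero_left [simp]: "0 \<boxtimes> y = 0"
  and tensor_zero_right [simp]: "x \<boxtimes> 0 = 0"
  and comp_zero_left [simp]: "Defs.comp \<tau> 0 y = 0"
  and comp_zero_right [simp]: "Defs.comp \<tau> x 0 = 0"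
  by (simp_all add: tensor_def Defs.comp_def)

lemma tensor_dg [simp]: "dg d \<boxtimes> dg e = dg (Tensor d e)"
  by (simp add: tensor_def dg_def)

lemma comp_dg: "Defs.comp \<tau> (dg d) (dg e) = (if src d = tgt \<tau> e then dg (Comp d e) else 0)"
  by (simp add: Defs.comp_def dg_def)

lemma diff_eq_smul: "x - y = x + smul (- 1) (y :: 'q lincomb)"
  by (simp add: smul_minus_one)

lemma tensor_diff_left: "(x - x') \<boxtimes> y = x \<boxtimes> y - x' \<boxtimes> y"
  and tensor_diff_right: "x \<boxtimes> (y - y') = x \<boxtimes> y - x \<boxtimes> y'"
  and comp_diff_left: "Defs.comp \<tau> (x - x') y = Defs.comp \<tau> x y - Defs.comp \<tau> x' y"
  and comp_diff_right: "Defs.comp \<tau> x (y - y') = Defs.comp \<tau> x y - Defs.comp \<tau> x y'"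
  by (simp_all add: diff_eq_smul tensor_add_left tensor_add_right tensor_smul_left tensor_smul_right
      comp_add_left comp_add_right comp_smul_left comp_smul_right)

lemma keys_tensor:
  "Poly_Mapping.keys (x \<boxtimes> y) \<subseteq>
     {Tensor d e | d e. d \<in> Poly_Mapping.keys x \<and> e \<in> Poly_Mapping.keys y}"
  unfolding tensor_def
  by (rule order_trans[OF Poly_Mapping.keys_sum] UN_least)+ auto

lemma keys_comp:
  "Poly_Mapping.keys (Defs.comp \<tau> x y) \<subseteq>
     {Comp d e | d e. d \<in> Poly_Mapping.keys x \<and> e \<in> Poly_Mapping.keys y \<and> src d = tgt \<tau> e}"
  unfolding Defs.comp_def
  by (rule order_trans[OF Poly_Mapping.keys_sum] UN_least)+ auto


section \<open>Congruence of diagrams\<close>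

locale mirror_quiver =
  fixes Q :: "('q, 'e) pre_digraph" and \<tau> :: "'q \<Rightarrow> 'q"
  assumes tau_closed [simp]: "i \<in> verts Q \<Longrightarrow> \<tau> i \<in> verts Q"
    and tau_tau: "i \<in> verts Q \<Longrightarrow> \<tau> (\<tau> i) = i"
begin

abbreviation comp_infix (infixr \<open>\<odot>\<close> 70) where "x \<odot> y \<equiv> Defs.comp \<tau> x y"
abbreviation "is_valid \<equiv> valid Q \<tau>"
abbreviation "is_null \<equiv> null Q \<tau>"
abbreviation "target \<equiv> tgt \<tau>"
abbreviation word_ok :: "'q word \<Rightarrow> bool" where "word_ok w \<equiv> \<forall>a\<in>set w. letter_ok Q a"

lemma valid_KLRW: "is_valid KLRW d \<Longrightarrow> is_valid L d"
  by (induction d) (cases L; simp)+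

lemma word_ok_src_target: "is_valid L d \<Longrightarrow> word_ok (src d) \<and> word_ok (target d)"
proof (induction d arbitrary: L)
  case (Cross a b)
  then show ?case by simp
next
  case (Comp d e)
  then show ?case by (metis src.simps(5) tgt.simps(5) valid.simps(5))
next
  case (Tensor d e)
  then have "is_valid L d" "is_valid KLRW e" by simp_all
  with Tensor.IH show ?case by (metis UnE set_append src.simps(6) tgt.simps(6))
qed auto

lemma null_uminus: "is_null L x \<Longrightarrow> is_null L (- x)"
  using null_smul[of Q \<tau> L x "- 1"] by (simp add: smul_minus_one)

lemma null_diff_trans: "\<lbrakk>is_null L (x - y); is_null L (y - z)\<rbrakk> \<Longrightarrow> is_null L (x - z)"
  using null_add[of Q \<tau> L "x - y" "y - z"] by simp

lemma null_diff_sym: "is_null L (x - y) \<Longrightarrow> is_null L (y - x)"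
  using null_uminus[of L "x - y"] by simp

lemma null_comp_left_lin:
  assumes "is_null L y" "\<forall>d\<in>Poly_Mapping.keys x. is_valid L d"
  shows "is_null L (x \<odot> y)"
  by (rule lincomb_induct[of _ x])
     (use assms in \<open>auto simp: comp_add_left comp_smul_left intro: null_zero null_add null_smul
       null_comp_left\<close>)

lemma null_comp_right_lin:
  assumes "is_null L x" "\<forall>d\<in>Poly_Mapping.keys y. is_valid L d"
  shows "is_null L (x \<odot> y)"
  by (rule lincomb_induct[of _ y])
     (use assms in \<open>auto simp: comp_add_right comp_smul_right intro: null_zero null_add null_smul
       null_comp_right\<close>)

text \<open>Equality of two single diagrams as morphisms. The endpoints belong to the relation
  because \<open>comp\<close> yields zero when they disagree, so a factor of a composite may only be
  replaced by one with the same ends.\<close>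

definition deq :: "layer \<Rightarrow> 'q diagram \<Rightarrow> 'q diagram \<Rightarrow> bool" where
  "deq L d e \<longleftrightarrow> is_valid L d \<and> is_valid L e \<and> src d = src e \<and> target d = target e \<and>
     is_null L (dg d - dg e)"

lemma deq_refl: "is_valid L d \<Longrightarrow> deq L d d"
  by (simp add: deq_def null_zero)

lemma deq_sym: "deq L d e \<Longrightarrow> deq L e d"
  by (simp add: deq_def null_diff_sym)

lemma deq_trans [trans]: "\<lbrakk>deq L d e; deq L e f\<rbrakk> \<Longrightarrow> deq L d f"
  by (auto simp: deq_def intro: null_diff_trans)

lemma deq_comp:
  assumes "deq L d d'" "deq L e e'" "src d = target e"
  shows "deq L (Comp d e) (Comp d' e')"
proof -
  have "is_null L ((dg d - dg d') \<odot> dg e)" "is_null L (dg d' \<odot> (dg e - dg e'))"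
    using assms by (auto simp: deq_def intro: null_comp_left null_comp_right)
  from null_add[OF this] assms show ?thesis
    by (simp add: deq_def comp_diff_left comp_diff_right comp_dg)
qed

lemma deq_tensor:
  assumes "deq L d d'" "deq KLRW e e'"
  shows "deq L (Tensor d e) (Tensor d' e')"
proof -
  have "is_null L ((dg d - dg d') \<boxtimes> dg e)" "is_null L (dg d' \<boxtimes> (dg e - dg e'))"
    using assms by (auto simp: deq_def intro: null_tensor_left null_tensor_right)
  from null_add[OF this] assms show ?thesis
    by (simp add: deq_def tensor_diff_left tensor_diff_right)
qed

lemma deq_strictness:
  "\<lbrakk>strictness Q \<tau> L (dg d - dg e); is_valid L d; is_valid L e; src d = src e; target d = target e\<rbrakk>
     \<Longrightarrow> deq L d e"
  by (simp add: deq_def null_strictness)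

lemma deq_comp_assoc: "\<lbrakk>is_valid L d; is_valid L e; is_valid L f; src d = target e; src e = target
  f\<rbrakk>
    \<Longrightarrow> deq L (Comp (Comp d e) f) (Comp d (Comp e f))"
  by (rule deq_strictness) (auto intro: comp_assoc)

lemma deq_unit_left: "\<lbrakk>is_valid L d; u = target d\<rbrakk> \<Longrightarrow> deq L (Comp (Strands u) d) d"
  using word_ok_src_target[of L d] by (intro deq_strictness) (auto intro: comp_unit_left)

lemma deq_unit_right: "\<lbrakk>is_valid L d; u = src d\<rbrakk> \<Longrightarrow> deq L (Comp d (Strands u)) d"
  using word_ok_src_target[of L d] by (intro deq_strictness) (auto intro: comp_unit_right)

lemma deq_tensor_assoc: "\<lbrakk>is_valid L d; is_valid KLRW e; is_valid KLRW f\<rbrakk>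
    \<Longrightarrow> deq L (Tensor (Tensor d e) f) (Tensor d (Tensor e f))"
  by (rule deq_strictness) (auto intro: tensor_assoc)

lemma deq_tensor_unit_left: "is_valid KLRW d \<Longrightarrow> deq L (Tensor (Strands []) d) d"
  by (rule deq_strictness) (auto intro: tensor_unit_left valid_KLRW)

lemma deq_tensor_unit_right: "is_valid L d \<Longrightarrow> deq L (Tensor d (Strands [])) d"
  by (rule deq_strictness) (auto intro: tensor_unit_right)

lemma deq_tensor_strands: "\<lbrakk>word_ok u; word_ok w\<rbrakk> \<Longrightarrow> deq L (Tensor (Strands u) (Strands w)) (Strands
  (u @ w))"
  by (rule deq_strictness, rule strictness.tensor_strands) auto

lemma deq_interchange:
  "\<lbrakk>is_valid L d; is_valid L e; is_valid KLRW f; is_valid KLRW g; src d = target e; src f = target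
    g\<rbrakk>
    \<Longrightarrow> deq L (Tensor (Comp d e) (Comp f g)) (Comp (Tensor d f) (Tensor e g))"
  by (rule deq_strictness) (auto intro: interchange)

text \<open>Insert identities in both factors and apply the interchange law. Together with
  \<open>deq_split_lower_left\<close>, which puts the right factor on top instead, this is the
  exchange of heights of two distant pieces.\<close>

lemma deq_split_lower_right:
  assumes "is_valid L d" "is_valid KLRW f"
  shows "deq L (Tensor d f) (Comp (Tensor d (Strands (target f))) (Tensor (Strands (src d)) f))"
proof -
  have "deq L (Tensor (Comp d (Strands (src d))) (Comp (Strands (target f)) f)) (Tensor d f)"
    using assms by (intro deq_tensor deq_unit_left deq_unit_right) auto
  moreover have "deq L (Tensor (Comp d (Strands (src d))) (Comp (Strands (target f)) f))
      (Comp (Tensor d (Strands (target f))) (Tensor (Strands (src d)) f))"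
    using assms word_ok_src_target[of L d] word_ok_src_target[of KLRW f]
    by (intro deq_interchange) auto
  ultimately show ?thesis by (meson deq_sym deq_trans)
qed

lemma deq_split_lower_left:
  assumes "is_valid L d" "is_valid KLRW f"
  shows "deq L (Tensor d f) (Comp (Tensor (Strands (target d)) f) (Tensor d (Strands (src f))))"
proof -
  have "deq L (Tensor (Comp (Strands (target d)) d) (Comp f (Strands (src f)))) (Tensor d f)"
    using assms by (intro deq_tensor deq_unit_left deq_unit_right) auto
  moreover have "deq L (Tensor (Comp (Strands (target d)) d) (Comp f (Strands (src f))))
      (Comp (Tensor (Strands (target d)) f) (Tensor d (Strands (src f))))"
    using assms word_ok_src_target[of L d] word_ok_src_target[of KLRW f]
    by (intro deq_interchange) auto
  ultimately show ?thesis by (meson deq_sym deq_trans)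
qed

lemma deq_comp_tensor_strands:
  assumes "is_valid L d" "is_valid L e" "src d = target e" "word_ok z"
  shows "deq L (Tensor (Comp d e) (Strands z)) (Comp (Tensor d (Strands z)) (Tensor e (Strands z)))"
proof -
  have "deq L (Tensor (Comp d e) (Strands z)) (Tensor (Comp d e) (Comp (Strands z) (Strands z)))"
    using assms by (intro deq_tensor deq_refl deq_sym[OF deq_unit_left]) auto
  also have "deq L \<dots> (Comp (Tensor d (Strands z)) (Tensor e (Strands z)))"
    using assms by (intro deq_interchange) auto
  finally show ?thesis .
qed

lemma deq_strands_tensor_comp:
  assumes "is_valid KLRW d" "is_valid KLRW e" "src d = target e" "word_ok u"
  shows "deq L (Tensor (Strands u) (Comp d e)) (Comp (Tensor (Strands u) d) (Tensor (Strands u) e))"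
proof -
  have "deq L (Tensor (Strands u) (Comp d e)) (Tensor (Comp (Strands u) (Strands u)) (Comp d e))"
    using assms by (intro deq_tensor deq_refl deq_sym[OF deq_unit_left]) auto
  also have "deq L \<dots> (Comp (Tensor (Strands u) d) (Tensor (Strands u) e))"
    using assms by (intro deq_interchange) auto
  finally show ?thesis .
qed

section \<open>Diagrams surrounded by vertical strands\<close>

lemma src_padded [simp]: "src (padded u d z) = u @ src d @ z"
  and target_padded [simp]: "target (padded u d z) = u @ target d @ z"
  by (simp_all add: padded_def)

lemma valid_padded [simp]: "is_valid L (padded u d z) \<longleftrightarrow> word_ok u \<and> is_valid KLRW d \<and> word_ok z"
  by (simp add: padded_def)

lemma deq_padded_cong: "\<lbrakk>deq KLRW d e; word_ok u; word_ok z\<rbrakk> \<Longrightarrow> deq L (padded u d z) (padded u e z)"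
  unfolding padded_def by (intro deq_tensor deq_refl) auto

lemma deq_padded_comp:
  assumes "is_valid KLRW d" "is_valid KLRW e" "src d = target e" "word_ok u" "word_ok z"
  shows "deq L (padded u (Comp d e) z) (Comp (padded u d z) (padded u e z))"
proof -
  have "deq L (padded u (Comp d e) z)
      (Tensor (Comp (Tensor (Strands u) d) (Tensor (Strands u) e)) (Strands z))"
    unfolding padded_def using assms by (intro deq_tensor deq_refl deq_strands_tensor_comp) auto
  also have "deq L \<dots> (Comp (padded u d z) (padded u e z))"
    unfolding padded_def using assms by (intro deq_comp_tensor_strands) auto
  finally show ?thesis .
qed

lemma deq_padded_strands:
  assumes "word_ok u" "word_ok v" "word_ok z"
  shows "deq L (padded u (Strands v) z) (Strands (u @ v @ z))"
proof -
  have "deq L (padded u (Strands v) z) (Tensor (Strands (u @ v)) (Strands z))"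
    unfolding padded_def using assms by (intro deq_tensor deq_refl deq_tensor_strands) auto
  also have "deq L \<dots> (Strands ((u @ v) @ z))" using assms by (intro deq_tensor_strands) auto
  finally show ?thesis by simp
qed

lemma deq_padded_left:
  assumes "is_valid KLRW d" "word_ok u" "word_ok v" "word_ok z"
  shows "deq L (padded u (Tensor (Strands v) d) z) (padded (u @ v) d z)"
proof -
  have "deq L (padded u (Tensor (Strands v) d) z)
      (Tensor (Tensor (Tensor (Strands u) (Strands v)) d) (Strands z))"
    unfolding padded_def using assms by (intro deq_tensor deq_refl deq_sym[OF deq_tensor_assoc])
      auto
  also have "deq L \<dots> (padded (u @ v) d z)"
    unfolding padded_def using assms by (intro deq_tensor deq_refl deq_tensor_strands) auto
  finally show ?thesis .
qed

lemma deq_padded_right: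
  assumes "is_valid KLRW d" "word_ok u" "word_ok v" "word_ok z"
  shows "deq L (padded u (Tensor d (Strands v)) z) (padded u d (v @ z))"
proof -
  have "deq L (padded u (Tensor d (Strands v)) z)
      (Tensor (Tensor (Tensor (Strands u) d) (Strands v)) (Strands z))"
    unfolding padded_def using assms by (intro deq_tensor deq_refl deq_sym[OF deq_tensor_assoc])
      auto
  also have "deq L \<dots> (Tensor (Tensor (Strands u) d) (Tensor (Strands v) (Strands z)))"
    using assms by (intro deq_tensor_assoc) auto
  also have "deq L \<dots> (padded u d (v @ z))"
    unfolding padded_def using assms by (intro deq_tensor deq_refl deq_tensor_strands) auto
  finally show ?thesis .
qed

lemma deq_padded_tensor_strands:
  assumes "is_valid KLRW d" "word_ok u" "word_ok v" "word_ok z"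
  shows "deq L (Tensor (padded u d v) (Strands z)) (padded u d (v @ z))"
proof -
  have "deq L (Tensor (padded u d v) (Strands z)) (Tensor (Tensor (Strands u) d) (Tensor (Strands v)
    (Strands z)))"
    unfolding padded_def using assms by (intro deq_tensor_assoc) auto
  also have "deq L \<dots> (padded u d (v @ z))"
    unfolding padded_def using assms by (intro deq_tensor deq_refl deq_tensor_strands) auto
  finally show ?thesis .
qed

lemma deq_padded_padded:
  assumes "is_valid KLRW d" "word_ok u" "word_ok v" "word_ok z" "word_ok y"
  shows "deq L (padded u (padded v d z) y) (padded (u @ v) d (z @ y))"
proof -
  have "deq L (padded u (padded v d z) y) (padded u (Tensor (Strands v) d) (z @ y))"
    unfolding padded_def[of v] using assms by (intro deq_padded_right) auto
  also have "deq L \<dots> (padded (u @ v) d (z @ y))"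
    using assms by (intro deq_padded_left) auto
  finally show ?thesis .
qed

lemma deq_strands_tensor_padded:
  assumes "is_valid KLRW d" "word_ok u" "word_ok v" "word_ok z"
  shows "deq L (Tensor (Strands u) (padded v d z)) (padded (u @ v) d z)"
proof -
  have "deq L (Tensor (Strands u) (padded v d z)) (padded u (padded v d z) [])"
    using assms unfolding padded_def[of u] by (intro deq_sym[OF deq_tensor_unit_right]) auto
  also have "deq L \<dots> (padded (u @ v) d (z @ []))" using assms by (intro deq_padded_padded) auto
  finally show ?thesis by simp
qed

section \<open>Exchange of heights of distant pieces\<close>

lemma deq_commute_tensor:
  assumes "is_valid L d" "is_valid KLRW f"
  shows "deq L (Comp (Tensor d (Strands (target f))) (Tensor (Strands (src d)) f))
    (Comp (Tensor (Strands (target d)) f) (Tensor d (Strands (src f))))"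
  using deq_split_lower_right[OF assms] deq_split_lower_left[OF assms] by (meson deq_sym deq_trans)

lemma deq_commute:
  assumes "is_valid KLRW d" "is_valid KLRW e" "word_ok u" "word_ok z" "word_ok y"
  shows "deq L (Comp (padded u d (z @ target e @ y)) (padded (u @ src d @ z) e y))
    (Comp (padded (u @ target d @ z) e y) (padded u d (z @ src e @ y)))"
proof -
  have ok: "word_ok (src d)" "word_ok (target d)" "word_ok (src e)" "word_ok (target e)"
    using assms word_ok_src_target by blast+
  let ?d = "padded u d []" and ?f = "padded z e y"
  have "deq L (Comp (Tensor ?d (Strands (target ?f))) (Tensor (Strands (src ?d)) ?f))
    (Comp (Tensor (Strands (target ?d)) ?f) (Tensor ?d (Strands (src ?f))))"
    using assms by (intro deq_commute_tensor) auto
  moreover have "deq L (Comp (Tensor ?d (Strands (target ?f))) (Tensor (Strands (src ?d)) ?f))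
      (Comp (padded u d ([] @ z @ target e @ y)) (padded ((u @ src d) @ z) e y))"
    using assms ok deq_padded_tensor_strands[of d u "[]" "z @ target e @ y"]
      deq_strands_tensor_padded[of e "u @ src d" z y]
    by (intro deq_comp) (auto simp: ball_Un)
  moreover have "deq L (Comp (Tensor (Strands (target ?d)) ?f) (Tensor ?d (Strands (src ?f))))
      (Comp (padded ((u @ target d) @ z) e y) (padded u d ([] @ z @ src e @ y)))"
    using assms ok deq_padded_tensor_strands[of d u "[]" "z @ src e @ y"]
      deq_strands_tensor_padded[of e "u @ target d" z y]
    by (intro deq_comp) (auto simp: ball_Un)
  ultimately show ?thesis by (simp, meson deq_sym deq_trans)
qed

text \<open>The version of \<open>deq_commute\<close> for a piece \<open>d\<close> at the left edge.
  It may contain mirrors, hence cannot be padded on the left, and appears as the left factor of a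
  tensor product.\<close>

lemma deq_commute_first:
  assumes "is_valid L d" "is_valid KLRW e" "word_ok z" "word_ok y"
  shows "deq L (Comp (Tensor d (Strands (z @ target e @ y))) (padded (src d @ z) e y))
    (Comp (padded (target d @ z) e y) (Tensor d (Strands (z @ src e @ y))))"
proof -
  have ok: "word_ok (src d)" "word_ok (target d)" "word_ok (src e)" "word_ok (target e)"
    using assms word_ok_src_target by blast+
  let ?f = "padded z e y"
  have "deq L (Comp (Tensor d (Strands (target ?f))) (Tensor (Strands (src d)) ?f))
    (Comp (Tensor (Strands (target d)) ?f) (Tensor d (Strands (src ?f))))"
    using assms by (intro deq_commute_tensor) auto
  moreover have "deq L (Comp (Tensor d (Strands (target ?f))) (Tensor (Strands (src d)) ?f))
      (Comp (Tensor d (Strands (z @ target e @ y))) (padded (src d @ z) e y))"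
    using assms ok by (intro deq_comp deq_strands_tensor_padded) (auto intro!: deq_refl)
  moreover have "deq L (Comp (Tensor (Strands (target d)) ?f) (Tensor d (Strands (src ?f))))
      (Comp (padded (target d @ z) e y) (Tensor d (Strands (z @ src e @ y))))"
    using assms ok by (intro deq_comp deq_strands_tensor_padded) (auto intro!: deq_refl)
  ultimately show ?thesis by (meson deq_sym deq_trans)
qed

end


section \<open>The filtration by the number of crossings\<close>

text \<open>In the unfolded picture a mirror is the crossing of a strand with its own image, so it
  counts 1. Dots count 0: sliding a dot is then an identity between diagrams with equally many
  crossings, up to fewer.\<close>

primrec crossings :: "'q diagram \<Rightarrow> nat" where
  "crossings (Strands w) = 0"
| "crossings (Dot i) = 0"
| "crossings (Cross a b) = 1"
| "crossings (Mirror i) = 1"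
| "crossings (Comp d e) = crossings d + crossings e"
| "crossings (Tensor d e) = crossings d + crossings e"

lemma crossings_padded [simp]: "crossings (padded u d z) = crossings d"
  by (simp add: padded_def)

primrec is_red :: "'q letter \<Rightarrow> bool" where
  "is_red (Black i) \<longleftrightarrow> False"
| "is_red (Red \<theta>) \<longleftrightarrow> True"

primrec vertex :: "'q letter \<Rightarrow> 'q" where
  "vertex (Black i) = i"
| "vertex (Red \<theta>) = undefined"

lemma not_is_red: "\<not> is_red a \<longleftrightarrow> (\<exists>i. a = Black i)"
  by (cases a) auto

lemma is_red_iff: "is_red a \<longleftrightarrow> (\<exists>\<theta>. a = Red \<theta>)"
  by (cases a) auto

context mirror_quiver
begin

definition few :: "layer \<Rightarrow> nat \<Rightarrow> 'q word \<Rightarrow> 'q word \<Rightarrow> 'q lincomb \<Rightarrow> bool" where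
  "few L k u w x \<longleftrightarrow>
     (\<forall>d\<in>Poly_Mapping.keys x. is_valid L d \<and> src d = u \<and> target d = w \<and> crossings d < k)"

text \<open>A step of the filtration of the Hom space from \<open>u\<close> to \<open>w\<close>. The
  bound is strict: \<open>lower 0\<close> contains only elements that vanish in the Hom space, and
  \<open>lower 1\<close> is spanned by diagrams consisting of dots and vertical strands.\<close>

definition lower :: "nat \<Rightarrow> 'q word \<Rightarrow> 'q word \<Rightarrow> 'q lincomb \<Rightarrow> bool" where
  "lower k u w x \<longleftrightarrow> (\<exists>y. few OKLRW k u w y \<and> is_null OKLRW (x - y))"

definition deq_mod :: "nat \<Rightarrow> 'q diagram \<Rightarrow> 'q diagram \<Rightarrow> bool" where
  "deq_mod k d e \<longleftrightarrow> is_valid OKLRW d \<and> is_valid OKLRW e \<and> src d = src e \<and> target d = target e \<and>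
     lower k (src d) (target d) (dg d - dg e)"

lemma few_zero [simp]: "few L k u w 0"
  by (simp add: few_def)

lemma few_add: "\<lbrakk>few L k u w x; few L k u w y\<rbrakk> \<Longrightarrow> few L k u w (x + y)"
  using keys_add[of x y] unfolding few_def by blast

lemma few_smul: "few L k u w x \<Longrightarrow> few L k u w (smul a x)"
  using keys_smul[of a x] unfolding few_def by blast

lemma few_sum: "(\<And>i. i \<in> I \<Longrightarrow> few L k u w (f i)) \<Longrightarrow> few L k u w (sum f I)"
  by (induction I rule: infinite_finite_induct) (auto intro: few_add)

lemma few_mono: "\<lbrakk>few L k u w x; k \<le> l\<rbrakk> \<Longrightarrow> few L l u w x"
  unfolding few_def by fastforce

lemma few_dg: "few L k u w (dg d) \<longleftrightarrow> is_valid L d \<and> src d = u \<and> target d = w \<and> crossings d < k"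
  by (simp add: few_def)

text \<open>Both bounds are strict, so the maximal numbers of crossings \<open>k - 1\<close> and
  \<open>l - 1\<close> add up to \<open>k + l - 2\<close>. In particular the case
  \<open>k = l = 1\<close> is stable under composition.\<close>

lemma few_comp: "\<lbrakk>few L k v w x; few L l u v y\<rbrakk> \<Longrightarrow> few L (k + l - 1) u w (x \<odot> y)"
  using keys_comp[of \<tau> x y] unfolding few_def by fastforce

lemma few_tensor: "\<lbrakk>few L k u w x; few KLRW l u' w' y\<rbrakk> \<Longrightarrow> few L (k + l - 1) (u @ u') (w @ w') (x \<boxtimes>
  y)"
  using keys_tensor[of x y] unfolding few_def by fastforce

lemma few_pow: "\<lbrakk>few L 1 w w x; word_ok w\<rbrakk> \<Longrightarrow> few L 1 w w (pow \<tau> w x n)"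
proof (induction n)
  case (Suc n)
  then show ?case using few_comp[of L 1 w w x 1 w "pow \<tau> w x n"] by simp
qed (simp add: few_dg)

text \<open>The correction terms of the bigon and triple relations are polynomials in dots. This and
  the following lemmas show that such terms have no crossings at all.\<close>

lemma few_eval_poly:
  assumes "\<And>a. few L 1 w w (c a)" "few L 1 w w x" "word_ok w"
  shows "few L 1 w w (eval_poly \<tau> w c x p)"
  unfolding eval_poly_def
  using few_comp[OF assms(1) few_pow[OF assms(2,3)]] by (intro few_sum) simp

lemma few_eval_poly1:
  "\<lbrakk>few L 1 w w y1; word_ok w\<rbrakk> \<Longrightarrow> few L 1 w w (eval_poly1 \<tau> w y1 p)"
  unfolding eval_poly1_def by (intro few_eval_poly few_smul) (auto simp: few_dg)

lemma few_eval_poly2: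
  "\<lbrakk>few L 1 w w y1; few L 1 w w y2; word_ok w\<rbrakk> \<Longrightarrow> few L 1 w w (eval_poly2 \<tau> w y1 y2 p)"
  unfolding eval_poly2_def by (intro few_eval_poly few_eval_poly1)

lemma few_eval_poly3:
  "\<lbrakk>few L 1 w w y1; few L 1 w w y2; few L 1 w w y3; word_ok w\<rbrakk>
     \<Longrightarrow> few L 1 w w (eval_poly3 \<tau> w y1 y2 y3 p)"
  unfolding eval_poly3_def by (intro few_eval_poly few_eval_poly2)

lemma lower_null: "is_null OKLRW x \<Longrightarrow> lower k u w x"
  unfolding lower_def by (rule exI[of _ 0]) simp

lemma lower_few: "few OKLRW k u w x \<Longrightarrow> lower k u w x"
  unfolding lower_def by (rule exI[of _ x]) (simp add: null_zero)

lemma lower_zero [simp]: "lower k u w 0"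
  by (simp add: lower_null null_zero)

lemma lower_add:
  assumes "lower k u w x" "lower k u w y"
  shows "lower k u w (x + y)"
proof -
  obtain x' y' where "few OKLRW k u w x'" "is_null OKLRW (x - x')"
    "few OKLRW k u w y'" "is_null OKLRW (y - y')"
    using assms unfolding lower_def by blast
  then have "few OKLRW k u w (x' + y')" "is_null OKLRW ((x - x') + (y - y'))"
    by (auto intro: few_add null_add)
  then show ?thesis unfolding lower_def by (metis add_diff_add)
qed

lemma lower_smul: "lower k u w x \<Longrightarrow> lower k u w (smul a x)"
  unfolding lower_def by (metis few_smul null_smul smul_diff)

lemma lower_diff: "\<lbrakk>lower k u w x; lower k u w y\<rbrakk> \<Longrightarrow> lower k u w (x - y)"
  unfolding diff_eq_smul by (intro lower_add lower_smul)

lemma lower_mono: "\<lbrakk>lower k u w x; k \<le> l\<rbrakk> \<Longrightarrow> lower l u w x"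
  unfolding lower_def using few_mono by blast

lemma lower_comp_left:
  assumes "lower k u w x" "is_valid OKLRW d" "src d = w"
  shows "lower (k + crossings d) u (target d) (dg d \<odot> x)"
proof -
  obtain y where y: "few OKLRW k u w y" "is_null OKLRW (x - y)"
    using assms unfolding lower_def by blast
  have "few OKLRW (Suc (crossings d) + k - 1) u (target d) (dg d \<odot> y)"
    using assms y by (intro few_comp) (auto simp: few_dg)
  moreover have "is_null OKLRW (dg d \<odot> (x - y))"
    using assms y by (intro null_comp_left)
  ultimately show ?thesis
    unfolding lower_def by (intro exI[of _ "dg d \<odot> y"]) (simp add: comp_diff_right add.commute)
qed

lemma lower_comp_right:
  assumes "lower k u w x" "is_valid OKLRW d" "target d = u"
  shows "lower (k + crossings d) (src d) w (x \<odot> dg d)"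
proof -
  obtain y where y: "few OKLRW k u w y" "is_null OKLRW (x - y)"
    using assms unfolding lower_def by blast
  have "few OKLRW (k + Suc (crossings d) - 1) (src d) w (y \<odot> dg d)"
    using assms y by (intro few_comp) (auto simp: few_dg)
  moreover have "is_null OKLRW ((x - y) \<odot> dg d)"
    using assms y by (intro null_comp_right)
  ultimately show ?thesis
    unfolding lower_def by (intro exI[of _ "y \<odot> dg d"]) (simp add: comp_diff_left)
qed

lemma deq_mod_deq: "deq OKLRW d e \<Longrightarrow> deq_mod k d e"
  unfolding deq_def deq_mod_def by (simp add: lower_null)

lemma deq_mod_refl: "is_valid OKLRW d \<Longrightarrow> deq_mod k d d"
  by (simp add: deq_mod_def)

lemma deq_mod_sym: "deq_mod k d e \<Longrightarrow> deq_mod k e d"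
  using lower_smul[of k "src d" "target d" "dg d - dg e" "- 1"] by (auto simp: deq_mod_def
    smul_minus_one)

lemma deq_mod_trans [trans]: "\<lbrakk>deq_mod k d e; deq_mod k e f\<rbrakk> \<Longrightarrow> deq_mod k d f"
  using lower_add[of k "src d" "target d" "dg d - dg e" "dg e - dg f"] by (auto simp: deq_mod_def)

lemma deq_mod_mono: "\<lbrakk>deq_mod k d e; k \<le> l\<rbrakk> \<Longrightarrow> deq_mod l d e"
  unfolding deq_mod_def using lower_mono by blast

lemma deq_mod_trans_deq [trans]: "\<lbrakk>deq_mod k d e; deq OKLRW e f\<rbrakk> \<Longrightarrow> deq_mod k d f"
  by (blast intro: deq_mod_trans deq_mod_deq)

lemma deq_deq_mod_trans [trans]: "\<lbrakk>deq OKLRW d e; deq_mod k e f\<rbrakk> \<Longrightarrow> deq_mod k d f"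
  by (blast intro: deq_mod_trans deq_mod_deq)

lemma deq_mod_comp_left:
  assumes "deq_mod k d e" "is_valid OKLRW f" "src f = target d"
  shows "deq_mod (k + crossings f) (Comp f d) (Comp f e)"
  using assms lower_comp_left[of k "src d" "target d" "dg d - dg e" f]
  by (auto simp: deq_mod_def comp_diff_right comp_dg)

lemma deq_mod_comp_right:
  assumes "deq_mod k d e" "is_valid OKLRW f" "src d = target f"
  shows "deq_mod (k + crossings f) (Comp d f) (Comp e f)"
  using assms lower_comp_right[of k "src d" "target d" "dg d - dg e" f]
  by (auto simp: deq_mod_def comp_diff_left comp_dg)

lemma lower_deq: "\<lbrakk>deq OKLRW d e; lower k u w (dg e)\<rbrakk> \<Longrightarrow> lower k u w (dg d)"
  using lower_add[OF lower_null[of "dg d - dg e"], of k u w "dg e"] by (auto simp: deq_def)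

lemma lower_deq_mod: "\<lbrakk>deq_mod k d e; lower k (src d) (target d) (dg e)\<rbrakk> \<Longrightarrow> lower k (src d) (target
  d) (dg d)"
  using lower_add[of k "src d" "target d" "dg d - dg e" "dg e"] by (auto simp: deq_mod_def)


section \<open>Local relations\<close>

lemma null_padded:
  assumes "is_null KLRW x" "word_ok u" "word_ok z"
  shows "is_null L ((dg (Strands u) \<boxtimes> x) \<boxtimes> dg (Strands z))"
  using assms by (intro null_tensor_right null_tensor_left) auto

lemma few_padded:
  assumes "few KLRW k v w x" "word_ok u" "word_ok z"
  shows "few L k (u @ v @ z) (u @ w @ z) ((dg (Strands u) \<boxtimes> x) \<boxtimes> dg (Strands z))"
proof -
  have "few L (1 + k - 1) (u @ v) (u @ w) (dg (Strands u) \<boxtimes> x)"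
    using assms by (intro few_tensor) (auto simp: few_dg)
  then have "few L (k + 1 - 1) ((u @ v) @ z) ((u @ w) @ z) ((dg (Strands u) \<boxtimes> x) \<boxtimes> dg (Strands z))"
    using assms by (intro few_tensor) (auto simp: few_dg)
  then show ?thesis by simp
qed

text \<open>Tensoring with vertical strands is linear, respects null elements and adds no crossing,
  so a local relation with a crossing-free correction term \<open>r\<close> becomes a congruence
  inside a larger diagram.\<close>

lemma deq_mod_padded:
  assumes "is_null KLRW (dg d - dg e - r)" "few KLRW 1 (src d) (target d) r"
    and "is_valid KLRW d" "is_valid KLRW e" "src d = src e" "target d = target e"
    and "word_ok u" "word_ok z"
  shows "deq_mod 1 (padded u d z) (padded u e z)"
proof -
  have "is_null OKLRW (dg (padded u d z) - dg (padded u e z) - (dg (Strands u) \<boxtimes> r) \<boxtimes> dg (Strands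
    z))"
    using null_padded[OF assms(1), of u z OKLRW] assms
    by (simp add: tensor_diff_left tensor_diff_right padded_def)
  moreover have "few OKLRW 1 (u @ src d @ z) (u @ target d @ z) ((dg (Strands u) \<boxtimes> r) \<boxtimes> dg (Strands
    z))"
    using assms by (intro few_padded) auto
  ultimately show ?thesis using assms unfolding deq_mod_def lower_def by auto
qed

lemma lower_padded:
  assumes "is_null KLRW (dg d - r)" "few KLRW 1 (src d) (target d) r" "word_ok u" "word_ok z"
  shows "lower 1 (u @ src d @ z) (u @ target d @ z) (dg (padded u d z))"
proof -
  have "is_null OKLRW (dg (padded u d z) - (dg (Strands u) \<boxtimes> r) \<boxtimes> dg (Strands z))"
    using null_padded[OF assms(1), of u z OKLRW] assms
    by (simp add: tensor_diff_left tensor_diff_right padded_def)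
  moreover have "few OKLRW 1 (u @ src d @ z) (u @ target d @ z) ((dg (Strands u) \<boxtimes> r) \<boxtimes> dg (Strands
    z))"
    using assms by (intro few_padded) auto
  ultimately show ?thesis unfolding lower_def by auto
qed

section \<open>Braid relations for three strands\<close>

lemma deq_triple_left:
  assumes "letter_ok Q a" "letter_ok Q b" "letter_ok Q c"
    "\<not> (is_red a \<and> is_red b)" "\<not> (is_red a \<and> is_red c)" "\<not> (is_red b \<and> is_red c)"
    "word_ok u" "word_ok z"
  shows "deq L (padded u (Comp (Tensor (Cross b c) (Strands [a]))
      (Comp (Tensor (Strands [b]) (Cross a c)) (Tensor (Cross a b) (Strands [c])))) z)
    (Comp (padded u (Cross b c) (a # z))
      (Comp (padded (u @ [b]) (Cross a c) z) (padded u (Cross a b) (c # z))))" (is "deq L ?l ?r")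
proof -
  have "deq L ?l (Comp (padded u (Tensor (Cross b c) (Strands [a])) z)
      (padded u (Comp (Tensor (Strands [b]) (Cross a c)) (Tensor (Cross a b) (Strands [c]))) z))"
    using assms by (intro deq_padded_comp) (auto simp: is_red_iff)
  also have "deq L \<dots> (Comp (padded u (Cross b c) ([a] @ z))
     (Comp (padded u (Tensor (Strands [b]) (Cross a c)) z) (padded u (Tensor (Cross a b) (Strands
       [c])) z)))"
    using assms by (intro deq_comp deq_padded_right deq_padded_comp) (auto simp: is_red_iff)
  also have "deq L \<dots> (Comp (padded u (Cross b c) ([a] @ z))
     (Comp (padded (u @ [b]) (Cross a c) z) (padded u (Cross a b) ([c] @ z))))"
    using assms by (intro deq_comp deq_padded_right deq_padded_left deq_refl) (auto simp:
      is_red_iff)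
  finally show ?thesis by simp
qed

lemma deq_triple_right:
  assumes "letter_ok Q a" "letter_ok Q b" "letter_ok Q c"
    "\<not> (is_red a \<and> is_red b)" "\<not> (is_red a \<and> is_red c)" "\<not> (is_red b \<and> is_red c)"
    "word_ok u" "word_ok z"
  shows "deq L (padded u (Comp (Tensor (Strands [c]) (Cross a b))
      (Comp (Tensor (Cross a c) (Strands [b])) (Tensor (Strands [a]) (Cross b c)))) z)
    (Comp (padded (u @ [c]) (Cross a b) z)
      (Comp (padded u (Cross a c) (b # z)) (padded (u @ [a]) (Cross b c) z)))" (is "deq L ?l ?r")
proof -
  have "deq L ?l (Comp (padded u (Tensor (Strands [c]) (Cross a b)) z)
      (padded u (Comp (Tensor (Cross a c) (Strands [b])) (Tensor (Strands [a]) (Cross b c))) z))"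
    using assms by (intro deq_padded_comp) (auto simp: is_red_iff)
  also have "deq L \<dots> (Comp (padded (u @ [c]) (Cross a b) z)
     (Comp (padded u (Tensor (Cross a c) (Strands [b])) z) (padded u (Tensor (Strands [a]) (Cross b
       c)) z)))"
    using assms by (intro deq_comp deq_padded_left deq_padded_comp) (auto simp: is_red_iff)
  also have "deq L \<dots> (Comp (padded (u @ [c]) (Cross a b) z)
     (Comp (padded u (Cross a c) ([b] @ z)) (padded (u @ [a]) (Cross b c) z)))"
    using assms by (intro deq_comp deq_padded_right deq_padded_left deq_refl) (auto simp:
      is_red_iff)
  finally show ?thesis by simp
qed

text \<open>Two red strands never cross, so at most one of the three letters is red, and the four
  cases are exactly the four triple relations. The correction \<open>r\<close> is a polynomial in
  dots for three black strands or a red strand in the middle, and zero for a red strand at an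
  end.\<close>

lemma triple_null:
  assumes ok: "letter_ok Q a" "letter_ok Q b" "letter_ok Q c"
    and red: "\<not> (is_red a \<and> is_red b)" "\<not> (is_red a \<and> is_red c)" "\<not> (is_red b \<and> is_red c)"
  obtains r where "few KLRW 1 [a, b, c] [c, b, a] r"
    "is_null KLRW (dg (Comp (Tensor (Cross b c) (Strands [a]))
      (Comp (Tensor (Strands [b]) (Cross a c)) (Tensor (Cross a b) (Strands [c]))))
     - dg (Comp (Tensor (Strands [c]) (Cross a b))
      (Comp (Tensor (Cross a c) (Strands [b])) (Tensor (Strands [a]) (Cross b c)))) - r)"
proof (cases "is_red a \<or> is_red b \<or> is_red c")
  case False
  then obtain i j k where abc: "a = Black i" "b = Black j" "c = Black k"
    by (auto simp: not_is_red)
  have v: "i \<in> verts Q" "j \<in> verts Q" "k \<in> verts Q" using ok abc by auto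
  define r where "r = (if i = k \<and> k \<noteq> j
          then eval_poly3 \<tau> [Black i, Black j, Black k]
                 (dot i \<boxtimes> idm [Black j, Black k])
                 (idm [Black i] \<boxtimes> dot j \<boxtimes> idm [Black k])
                 (idm [Black i, Black j] \<boxtimes> dot k) (f_quotient Q i j)
          else 0)"
  have "few KLRW 1 [a, b, c] [c, b, a] r"
    using v abc few_eval_poly3[of KLRW "[Black i, Black j, Black k]"]
    by (auto simp: r_def few_dg)
  moreover have "is_null KLRW (dg (Comp (Tensor (Cross b c) (Strands [a]))
      (Comp (Tensor (Strands [b]) (Cross a c)) (Tensor (Cross a b) (Strands [c]))))
     - dg (Comp (Tensor (Strands [c]) (Cross a b))
      (Comp (Tensor (Cross a c) (Strands [b])) (Tensor (Strands [a]) (Cross b c)))) - r)"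
    using null_klrw[OF triple[OF v], of \<tau> KLRW]
    by (simp add: comp_dg abc flip: r_def)
  ultimately show ?thesis using that by blast
next
  case True
  then consider \<theta> i j where "a = Black i" "b = Red \<theta>" "c = Black j"
    | \<theta> i j where "a = Black i" "b = Black j" "c = Red \<theta>"
    | \<theta> i j where "a = Red \<theta>" "b = Black j" "c = Black i"
    using red by (cases a; cases b; cases c) auto
  then show ?thesis
  proof cases
    case 1
    note abc = 1
    have v: "i \<in> verts Q" "j \<in> verts Q" "letter_ok Q (Red \<theta>)" using ok abc by auto
    define r where "r = (if i = j
          then (\<Sum>(a, b) \<in> {(a, b). a + b + 1 = \<theta> i}.
                  pow \<tau> [Black i] (dot i) a \<boxtimes> idm [Red \<theta>] \<boxtimes> pow \<tau> [Black j] (dot j) b)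
          else 0)"
    have "few KLRW 1 [Black i, Red \<theta>, Black i] [Black i, Red \<theta>, Black i]
        (pow \<tau> [Black i] (dot i) a \<boxtimes> idm [Red \<theta>] \<boxtimes> pow \<tau> [Black i] (dot i) b)" for a b
    proof -
      have p: "few KLRW 1 [Black i] [Black i] (pow \<tau> [Black i] (dot i) n)" for n
        using v by (intro few_pow) (auto simp: few_dg)
      have "few KLRW (1 + 1 - 1) ([Red \<theta>] @ [Black i]) ([Red \<theta>] @ [Black i]) (idm [Red \<theta>] \<boxtimes> pow \<tau>
        [Black i] (dot i) b)"
        using v p by (intro few_tensor) (auto simp: few_dg)
      then have "few KLRW 1 [Red \<theta>, Black i] [Red \<theta>, Black i] (idm [Red \<theta>] \<boxtimes> pow \<tau> [Black i] (dot i)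
        b)"
        by simp
      from few_tensor[OF p this] show ?thesis by simp
    qed
    then have "few KLRW 1 [a, b, c] [c, b, a] r"
      using v abc by (auto simp: r_def intro!: few_sum)
    moreover have "is_null KLRW (dg (Comp (Tensor (Cross b c) (Strands [a]))
      (Comp (Tensor (Strands [b]) (Cross a c)) (Tensor (Cross a b) (Strands [c]))))
     - dg (Comp (Tensor (Strands [c]) (Cross a b))
      (Comp (Tensor (Cross a c) (Strands [b])) (Tensor (Strands [a]) (Cross b c)))) - r)"
      using null_klrw[OF triple_black_red_black[OF v], of \<tau> KLRW]
      by (simp add: comp_dg abc flip: r_def)
    ultimately show ?thesis using that by blast
  next
    case 2
    then have v: "i \<in> verts Q" "j \<in> verts Q" "letter_ok Q (Red \<theta>)" using ok by auto
    show ?thesis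
      using that[of 0] null_klrw[OF triple_black_black_red[OF v], of \<tau> KLRW] 2
      by (simp add: comp_dg)
  next
    \<comment> \<open>The names \<open>i\<close> and \<open>j\<close> are exchanged here, to match a
      relation whose lower word is \<open>Red \<theta>\<close>, \<open>Black j\<close>,
      \<open>Black i\<close>.\<close>
    case 3
    then have v: "i \<in> verts Q" "j \<in> verts Q" "letter_ok Q (Red \<theta>)" using ok by auto
    show ?thesis
      using that[of 0] null_klrw[OF triple_red_black_black[OF v], of \<tau> KLRW] 3
      by (simp add: comp_dg)
  qed
qed

lemma deq_mod_triple:
  assumes "letter_ok Q a" "letter_ok Q b" "letter_ok Q c"
    "\<not> (is_red a \<and> is_red b)" "\<not> (is_red a \<and> is_red c)" "\<not> (is_red b \<and> is_red c)"
    "word_ok u" "word_ok z"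
  shows "deq_mod 1
    (Comp (padded u (Cross b c) (a # z))
      (Comp (padded (u @ [b]) (Cross a c) z) (padded u (Cross a b) (c # z))))
    (Comp (padded (u @ [c]) (Cross a b) z)
      (Comp (padded u (Cross a c) (b # z)) (padded (u @ [a]) (Cross b c) z)))"
proof -
  obtain r where r: "few KLRW 1 [a, b, c] [c, b, a] r"
    "is_null KLRW (dg (Comp (Tensor (Cross b c) (Strands [a]))
      (Comp (Tensor (Strands [b]) (Cross a c)) (Tensor (Cross a b) (Strands [c]))))
     - dg (Comp (Tensor (Strands [c]) (Cross a b))
      (Comp (Tensor (Cross a c) (Strands [b])) (Tensor (Strands [a]) (Cross b c)))) - r)"
    using triple_null[of a b c] assms by auto
  show ?thesis
    by (rule deq_deq_mod_trans[OF deq_sym[OF deq_triple_left[OF assms]]],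
        rule deq_mod_trans_deq[OF deq_mod_padded[OF r(2)] deq_triple_right[OF assms]])
       (use r assms in \<open>auto simp: is_red_iff\<close>)
qed

text \<open>Each of the four kinds of double crossings equals zero or a polynomial in dots, so both
  crossings disappear.\<close>

lemma lower_bigon:
  assumes "letter_ok Q a" "letter_ok Q b" "\<not> (is_red a \<and> is_red b)" "word_ok u" "word_ok z"
  shows "lower 1 (u @ [a, b] @ z) (u @ [a, b] @ z)
    (dg (Comp (padded u (Cross b a) z) (padded u (Cross a b) z)))"
proof -
  have "\<exists>r. few KLRW 1 [a, b] [a, b] r \<and> is_null KLRW (dg (Comp (Cross b a) (Cross a b)) - r)"
  proof (cases a)
    case a: (Black i)
    then have i: "i \<in> verts Q" using assms by auto
    show ?thesis
    proof (cases b)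
      case b: (Black j)
      then have j: "j \<in> verts Q" using assms by auto
      show ?thesis
      proof (cases "i = j")
        case True
        then show ?thesis using null_klrw[OF bigon_same[OF i], of \<tau> KLRW] a b
          by (intro exI[of _ 0]) (simp add: comp_dg)
      next
        case False
        show ?thesis
          using null_klrw[OF bigon[OF i j False], of \<tau> KLRW] a b i j
            few_eval_poly2[of KLRW "[Black i, Black j]" "dot i \<boxtimes> idm [Black j]" "idm [Black i] \<boxtimes> dot
              j" "f_poly Q i j"]
          by (auto simp add: comp_dg few_dg)
      qed
    next
      case b: (Red \<theta>)
      then have \<theta>: "letter_ok Q (Red \<theta>)" using assms by auto
      have "few KLRW 1 [Black i] [Black i] (pow \<tau> [Black i] (dot i) (\<theta> i))"
        using i by (intro few_pow) (auto simp: few_dg)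
      moreover have "few KLRW 1 [Red \<theta>] [Red \<theta>] (idm [Red \<theta>])" using \<theta> by (auto simp: few_dg)
      ultimately have "few KLRW 1 [Black i, Red \<theta>] [Black i, Red \<theta>] (pow \<tau> [Black i] (dot i) (\<theta> i) \<boxtimes>
        idm [Red \<theta>])"
        using few_tensor[of KLRW 1 "[Black i]" "[Black i]" _ 1 "[Red \<theta>]" "[Red \<theta>]"] by simp
      then show ?thesis
        using null_klrw[OF bigon_black_red[OF i \<theta>], of \<tau> KLRW] a b by (auto simp add: comp_dg)
    qed
  next
    case a: (Red \<theta>)
    then have \<theta>: "letter_ok Q (Red \<theta>)" using assms by auto
    obtain i where b: "b = Black i" using a assms(3) by (cases b) auto
    then have i: "i \<in> verts Q" using assms by auto
    have "few KLRW 1 [Black i] [Black i] (pow \<tau> [Black i] (dot i) (\<theta> i))"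
      using i by (intro few_pow) (auto simp: few_dg)
    moreover have "few KLRW 1 [Red \<theta>] [Red \<theta>] (idm [Red \<theta>])" using \<theta> by (auto simp: few_dg)
    ultimately have "few KLRW 1 [Red \<theta>, Black i] [Red \<theta>, Black i] (idm [Red \<theta>] \<boxtimes> pow \<tau> [Black i]
      (dot i) (\<theta> i))"
      using few_tensor[of KLRW 1 "[Red \<theta>]" "[Red \<theta>]" "idm [Red \<theta>]" 1] by simp
    then show ?thesis
      using null_klrw[OF bigon_red_black[OF i \<theta>], of \<tau> KLRW] a b by (auto simp add: comp_dg)
  qed
  then obtain r where r: "few KLRW 1 [a, b] [a, b] r"
    "is_null KLRW (dg (Comp (Cross b a) (Cross a b)) - r)" by blast
  have "lower 1 (u @ [a, b] @ z) (u @ [a, b] @ z) (dg (padded u (Comp (Cross b a) (Cross a b)) z))"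
    using lower_padded[OF r(2)] r(1) assms by simp
  moreover have "deq OKLRW (Comp (padded u (Cross b a) z) (padded u (Cross a b) z))
      (padded u (Comp (Cross b a) (Cross a b)) z)"
    using assms by (intro deq_sym[OF deq_padded_comp]) (auto simp: is_red_iff)
  ultimately show ?thesis
    by (blast intro: lower_deq)
qed

text \<open>The only correction occurs when a dot slides through a crossing of two black strands
  with equal labels. It is an identity, so it has no crossing; through a red strand the dot slides
  exactly.\<close>

lemma deq_mod_dot_left:
  assumes "letter_ok Q a" "j \<in> verts Q" "word_ok u" "word_ok z"
  shows "deq_mod 1 (Comp (padded u (Dot j) (a # z)) (padded u (Cross a (Black j)) z))
    (Comp (padded u (Cross a (Black j)) z) (padded (u @ [a]) (Dot j) z))"
proof -
  let ?l = "Comp (Tensor (Dot j) (Strands [a])) (Cross a (Black j))"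
  let ?r = "Comp (Cross a (Black j)) (Tensor (Strands [a]) (Dot j))"
  have "\<exists>r. few KLRW 1 [a, Black j] [Black j, a] r \<and> is_null KLRW (dg ?l - dg ?r - r)"
  proof (cases a)
    case a: (Black i)
    then have i: "i \<in> verts Q" using assms by auto
    show ?thesis
      using null_klrw[OF dot_slide_left[OF i assms(2)], of \<tau> KLRW] a i
      by (intro exI[of _ "if i = j then idm [Black i, Black j] else 0"])
         (auto simp: comp_dg few_dg diff_diff_eq)
  next
    case a: (Red \<theta>)
    then have \<theta>: "letter_ok Q (Red \<theta>)" using assms by auto
    show ?thesis
      using null_klrw[OF dot_slide_red_black[OF assms(2) \<theta>], of \<tau> KLRW] a
      by (intro exI[of _ 0]) (auto simp: comp_dg)
  qed
  then obtain r where r: "few KLRW 1 [a, Black j] [Black j, a] r" "is_null KLRW (dg ?l - dg ?r - r)"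
    by blast
  have "deq_mod 1 (padded u ?l z) (padded u ?r z)"
    using r assms by (intro deq_mod_padded[OF r(2)]) (auto simp: is_red_iff)
  moreover have "deq OKLRW (padded u ?l z) (Comp (padded u (Dot j) ([a] @ z)) (padded u (Cross a
    (Black j)) z))"
    using assms
    by (intro deq_trans[OF deq_padded_comp] deq_comp deq_refl deq_padded_right) auto
  moreover have "deq OKLRW (padded u ?r z) (Comp (padded u (Cross a (Black j)) z) (padded (u @ [a])
    (Dot j) z))"
    using assms
    by (intro deq_trans[OF deq_padded_comp] deq_comp deq_refl deq_padded_left) auto
  ultimately have "deq_mod 1 (Comp (padded u (Dot j) ([a] @ z)) (padded u (Cross a (Black j)) z))
    (Comp (padded u (Cross a (Black j)) z) (padded (u @ [a]) (Dot j) z))"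
    by (blast intro: deq_deq_mod_trans[OF deq_sym] deq_mod_trans_deq)
  then show ?thesis by simp
qed

lemma deq_mod_dot_right:
  assumes "letter_ok Q b" "i \<in> verts Q" "word_ok u" "word_ok z"
  shows "deq_mod 1 (Comp (padded (u @ [b]) (Dot i) z) (padded u (Cross (Black i) b) z))
    (Comp (padded u (Cross (Black i) b) z) (padded u (Dot i) (b # z)))"
proof -
  let ?l = "Comp (Cross (Black i) b) (Tensor (Dot i) (Strands [b]))"
  let ?r = "Comp (Tensor (Strands [b]) (Dot i)) (Cross (Black i) b)"
  have "\<exists>r. few KLRW 1 [Black i, b] [b, Black i] r \<and> is_null KLRW (dg ?l - dg ?r - r)"
  proof (cases b)
    case b: (Black j)
    then have j: "j \<in> verts Q" using assms by auto
    show ?thesis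
      using null_klrw[OF dot_slide_right[OF assms(2) j], of \<tau> KLRW] b j
      by (intro exI[of _ "if i = j then idm [Black i, Black j] else 0"])
         (auto simp: comp_dg few_dg diff_diff_eq)
  next
    case b: (Red \<theta>)
    then have \<theta>: "letter_ok Q (Red \<theta>)" using assms by auto
    show ?thesis
      using null_klrw[OF dot_slide_black_red[OF assms(2) \<theta>], of \<tau> KLRW] b
      by (intro exI[of _ 0]) (auto simp: comp_dg)
  qed
  then obtain r where r: "few KLRW 1 [Black i, b] [b, Black i] r" "is_null KLRW (dg ?l - dg ?r - r)"
    by blast
  have "deq_mod 1 (padded u ?l z) (padded u ?r z)"
    using r assms by (intro deq_mod_padded[OF r(2)]) (auto simp: is_red_iff)
  moreover have "deq OKLRW (padded u ?l z) (Comp (padded u (Cross (Black i) b) z) (padded u (Dot i)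
    ([b] @ z)))"
    using assms
    by (intro deq_trans[OF deq_padded_comp] deq_comp deq_refl deq_padded_right) auto
  moreover have "deq OKLRW (padded u ?r z) (Comp (padded (u @ [b]) (Dot i) z) (padded u (Cross
    (Black i) b) z))"
    using assms
    by (intro deq_trans[OF deq_padded_comp] deq_comp deq_refl deq_padded_left) auto
  ultimately have "deq_mod 1 (Comp (padded u (Cross (Black i) b) z) (padded u (Dot i) ([b] @ z)))
    (Comp (padded (u @ [b]) (Dot i) z) (padded u (Cross (Black i) b) z))"
    by (blast intro: deq_deq_mod_trans[OF deq_sym] deq_mod_trans_deq)
  then show ?thesis by (simp add: deq_mod_sym)
qed

section \<open>Relations at the mirror\<close>

abbreviation reflect :: "'q \<Rightarrow> 'q word \<Rightarrow> 'q diagram" where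
  "reflect i z \<equiv> Tensor (Mirror i) (Strands z)"

lemma deq_tensor_strands_padded:
  assumes "is_valid KLRW d" "word_ok z"
  shows "deq L (Tensor d (Strands z)) (padded [] d z)"
  unfolding padded_def using assms
  by (intro deq_tensor deq_refl deq_sym[OF deq_tensor_unit_left]) auto

text \<open>Reflecting twice gives the identity, which counts two crossings less than the left-hand
  side.\<close>

lemma lower_mirror_twice:
  assumes "i \<in> verts Q" "word_ok z"
  shows "lower 1 (Black i # z) (Black i # z) (dg (Comp (reflect (\<tau> i) z) (reflect i z)))"
proof -
  have "is_null OKLRW ((mirror (\<tau> i) \<odot> mirror i - idm [Black i]) \<boxtimes> dg (Strands z))"
    using assms by (intro null_tensor_right null_mirror mirror_twice) auto
  then have "is_null OKLRW (dg (Tensor (Comp (Mirror (\<tau> i)) (Mirror i)) (Strands z)) - dg (Tensor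
    (Strands [Black i]) (Strands z)))"
    by (simp add: comp_dg tensor_diff_left)
  then have "deq OKLRW (Tensor (Comp (Mirror (\<tau> i)) (Mirror i)) (Strands z)) (Tensor (Strands [Black
    i]) (Strands z))"
    using assms by (simp add: deq_def tau_tau)
  moreover have "deq OKLRW (Tensor (Comp (Mirror (\<tau> i)) (Mirror i)) (Strands z)) (Comp (reflect (\<tau>
    i) z) (reflect i z))"
    using assms by (intro deq_comp_tensor_strands) auto
  ultimately have "deq OKLRW (Comp (reflect (\<tau> i) z) (reflect i z)) (Tensor (Strands [Black i])
    (Strands z))"
    by (meson deq_sym deq_trans)
  moreover have "lower 1 (Black i # z) (Black i # z) (dg (Tensor (Strands [Black i]) (Strands z)))"
    using assms by (intro lower_few) (auto simp: few_dg)
  ultimately show ?thesis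
    by (blast intro: lower_deq)
qed

text \<open>The relation is exact but carries a sign, so it cannot be a congruence
  \<open>deq\<close> of two single diagrams and is kept as a vanishing sum. This sign is the source
  of the scalars in \<open>dot_elementary\<close>.\<close>

lemma null_mirror_dot:
  assumes "i \<in> verts Q" "word_ok z"
  shows "is_null OKLRW (dg (Comp (reflect i z) (padded [] (Dot i) z))
    + dg (Comp (padded [] (Dot (\<tau> i)) z) (reflect i z)))"
proof -
  have "is_null OKLRW ((mirror i \<odot> dot i + dot (\<tau> i) \<odot> mirror i) \<boxtimes> dg (Strands z))"
    using assms by (intro null_tensor_right null_mirror mirror_dot) auto
  then have "is_null OKLRW (dg (Tensor (Comp (Mirror i) (Dot i)) (Strands z)) + dg (Tensor (Comp
    (Dot (\<tau> i)) (Mirror i)) (Strands z)))"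
    by (simp add: comp_dg tensor_add_left)
  moreover have "deq OKLRW (Comp (reflect i z) (padded [] (Dot i) z)) (Tensor (Comp (Mirror i) (Dot
    i)) (Strands z))"
    using assms
    by (intro deq_sym[OF deq_trans[OF deq_comp_tensor_strands]] deq_comp deq_refl
      deq_tensor_strands_padded) auto
  moreover have "deq OKLRW (Comp (padded [] (Dot (\<tau> i)) z) (reflect i z)) (Tensor (Comp (Dot (\<tau> i))
    (Mirror i)) (Strands z))"
    using assms
    by (intro deq_sym[OF deq_trans[OF deq_comp_tensor_strands]] deq_comp deq_refl
      deq_tensor_strands_padded) auto
  ultimately have "is_null OKLRW ((dg (Tensor (Comp (Mirror i) (Dot i)) (Strands z)) + dg (Tensor
    (Comp (Dot (\<tau> i)) (Mirror i)) (Strands z)))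
    + (dg (Comp (reflect i z) (padded [] (Dot i) z)) - dg (Tensor (Comp (Mirror i) (Dot i)) (Strands
      z)))
    + (dg (Comp (padded [] (Dot (\<tau> i)) z) (reflect i z)) - dg (Tensor (Comp (Dot (\<tau> i)) (Mirror i))
      (Strands z))))"
    unfolding deq_def by (intro null_add[OF null_add]) auto
  then show ?thesis by (simp add: algebra_simps)
qed

text \<open>The braid relation of length four in type B holds without correction, so the work is
  only to distribute the padding \<open>z\<close> over the composites and to merge it with the extra
  letter beside each mirror.\<close>

lemma deq_mirror_braid:
  assumes "i \<in> verts Q" "j \<in> verts Q" "word_ok z"
  shows "deq OKLRW
    (Comp (padded [] (Cross (Black (\<tau> j)) (Black (\<tau> i))) z) (Comp (reflect j (Black (\<tau> i) # z))
      (Comp (padded [] (Cross (Black (\<tau> i)) (Black j)) z) (reflect i (Black j # z)))))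
    (Comp (reflect i (Black (\<tau> j) # z)) (Comp (padded [] (Cross (Black (\<tau> j)) (Black i)) z)
      (Comp (reflect j (Black i # z)) (padded [] (Cross (Black i) (Black j)) z))))"
proof -
  let ?l = "Comp (Cross (Black (\<tau> j)) (Black (\<tau> i))) (Comp (reflect j [Black (\<tau> i)])
      (Comp (Cross (Black (\<tau> i)) (Black j)) (reflect i [Black j])))"
  let ?r = "Comp (reflect i [Black (\<tau> j)]) (Comp (Cross (Black (\<tau> j)) (Black i))
      (Comp (reflect j [Black i]) (Cross (Black i) (Black j))))"
  have m: "deq OKLRW (Tensor (reflect i' [b]) (Strands z)) (reflect i' (b # z))"
    if "i' \<in> verts Q" "letter_ok Q b" for i' b
    using that assms deq_tensor_strands[of "[b]" z KLRW]
    by (intro deq_trans[OF deq_tensor_assoc] deq_tensor deq_refl) auto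
  have x: "deq OKLRW (Tensor (Cross a b) (Strands z)) (padded [] (Cross a b) z)"
    if "is_valid KLRW (Cross a b)" for a b
    using that assms by (intro deq_tensor_strands_padded)
  have "is_null OKLRW (dg ?l - dg ?r)"
    using null_mirror[OF mirror_braid[OF assms(1,2)]] by (simp add: comp_dg)
  then have "is_null OKLRW ((dg ?l - dg ?r) \<boxtimes> dg (Strands z))"
    using assms by (intro null_tensor_right) auto
  then have *: "deq OKLRW (Tensor ?l (Strands z)) (Tensor ?r (Strands z))"
    using assms by (simp add: deq_def tensor_diff_left)
  have l: "deq OKLRW (Tensor ?l (Strands z))
    (Comp (padded [] (Cross (Black (\<tau> j)) (Black (\<tau> i))) z) (Comp (reflect j (Black (\<tau> i) # z))
      (Comp (padded [] (Cross (Black (\<tau> i)) (Black j)) z) (reflect i (Black j # z)))))"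
    by (rule deq_trans[OF deq_comp_tensor_strands] deq_comp m x |
        (use assms in \<open>simp add: tau_tau\<close>; fail))+
  have r: "deq OKLRW (Tensor ?r (Strands z))
    (Comp (reflect i (Black (\<tau> j) # z)) (Comp (padded [] (Cross (Black (\<tau> j)) (Black i)) z)
      (Comp (reflect j (Black i # z)) (padded [] (Cross (Black i) (Black j)) z))))"
    by (rule deq_trans[OF deq_comp_tensor_strands] deq_comp m x |
        (use assms in \<open>simp add: tau_tau\<close>; fail))+
  show ?thesis using * l r by (meson deq_sym deq_trans)
qed

end


section \<open>Signed permutations\<close>

text \<open>A state lists, for each position of the upper word, the position (counted from 1) of the lower
  word at which the strand ends; the sign records whether the strand has been reflected an odd
    number
  of times.\<close>

datatype generator = Swap nat | Flip

text \<open>The parameter \<open>f\<close> is the effect of a reflection on one entry. With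
  \<open>uminus\<close> the generators act on states, with \<open>bar\<close> on words, so that
  words of states transform in parallel with states.\<close>

fun act :: "('a \<Rightarrow> 'a) \<Rightarrow> generator \<Rightarrow> 'a list \<Rightarrow> 'a list" where
  "act f (Swap k) xs = xs[k := xs ! Suc k, Suc k := xs ! k]"
| "act f Flip [] = []"
| "act f Flip (x # xs) = f x # xs"

abbreviation move :: "generator \<Rightarrow> int list \<Rightarrow> int list" where
  "move \<equiv> act uminus"

fun descent :: "generator \<Rightarrow> int list \<Rightarrow> bool" where
  "descent (Swap k) L \<longleftrightarrow> Suc k < length L \<and> L ! Suc k < L ! k"
| "descent Flip L \<longleftrightarrow> L \<noteq> [] \<and> L ! 0 < 0"

text \<open>The pairs \<open>y < x\<close> are crossings of two strands of the unfolded picture, the pairs \<open>x + y < 0\<close>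
  crossings of a strand with the mirror image of another one.\<close>

fun inversions :: "int list \<Rightarrow> nat" where
  "inversions [] = 0"
| "inversions (x # xs) = of_bool (x < 0) + (\<Sum>y\<leftarrow>xs. of_bool (y < x) + of_bool (x + y < 0)) +
  inversions xs"

text \<open>Every step lowers the length by one, so a descending list from \<open>L\<close> to the
  standard state is a reduced word of the signed permutation \<open>L\<close>.\<close>

primrec descending :: "int list \<Rightarrow> generator list \<Rightarrow> int list \<Rightarrow> bool" where
  "descending L [] K \<longleftrightarrow> L = K"
| "descending L (s # ss) K \<longleftrightarrow> descent s L \<and> descending (move s L) ss K"

definition standard :: "nat \<Rightarrow> int list" where
  "standard n = map int [1..<Suc n]"

lemma length_act [simp]: "length (act f s xs) = length xs"
  by (cases "(f, s, xs)" rule: act.cases) auto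

lemma act_Swap_split: "length A = k \<Longrightarrow> act f (Swap k) (A @ x # y # B) = A @ y # x # B"
  by (auto simp: nth_append list_update_append)

lemma act_Swap_Cons: "act f (Swap (Suc k)) (x # xs) = x # act f (Swap k) xs"
  by simp

lemma move_move: "(\<And>k. s = Swap k \<Longrightarrow> Suc k < length L) \<Longrightarrow> move s (move s L) = L"
  by (cases "(uminus :: int \<Rightarrow> int, s, L)" rule: act.cases)
     (auto simp: list_update_swap[of "Suc _"] nth_list_update intro!: nth_equalityI)

lemma mset_act_Swap: "Suc k < length xs \<Longrightarrow> mset (act f (Swap k) xs) = mset xs"
  by (simp add: mset_swap)

text \<open>For a swap, the entries to the left see the same multiset of later entries, so an
  induction on \<open>k\<close> leaves only the contribution of the two swapped entries. Replacing a
  negative first entry \<open>x\<close> by \<open>- x\<close> exchanges the two kinds of pairs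
  \<open>y < x\<close> and \<open>x + y < 0\<close>, so only the count of the sign changes.\<close>

lemma inversions_descent: "descent s L \<Longrightarrow> inversions L = Suc (inversions (move s L))"
proof (cases s)
  case (Swap k)
  assume "descent s L"
  then have "Suc k < length L" "L ! Suc k < L ! k" using Swap by auto
  then have "inversions L = Suc (inversions (move (Swap k) L))"
  proof (induction k arbitrary: L)
    case 0
    then obtain x y B where "L = x # y # B"
      by (metis length_0_conv length_Cons list.exhaust not_less_zero Suc_less_eq)
    then show ?case using 0 by (auto simp: algebra_simps)
  next
    case (Suc k)
    then obtain x xs where L: "L = x # xs" by (cases L) auto
    have "inversions xs = Suc (inversions (move (Swap k) xs))"
      using Suc.prems L by (intro Suc.IH) auto
    moreover have "(\<Sum>y\<leftarrow>act uminus (Swap k) xs. of_bool (y < x) + of_bool (x + y < 0)) =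
        (\<Sum>y\<leftarrow>xs. of_bool (y < x) + of_bool (x + y < 0 :: bool) :: nat)"
      using Suc.prems L mset_act_Swap[where k = k and xs = xs and f = uminus]
      by (simp only: flip: sum_mset_sum_list mset_map) simp
    ultimately show ?case unfolding L act_Swap_Cons inversions.simps by linarith
  qed
  then show ?thesis using Swap by simp
next
  case Flip
  assume "descent s L"
  then obtain x xs where L: "L = x # xs" and x: "x < 0" using Flip by (cases L) auto
  have eq: "map (\<lambda>y. of_bool (y < - x) + of_bool (- x + y < 0)) xs =
      map (\<lambda>y. of_bool (y < x) + of_bool (x + y < 0) :: nat) xs"
    by (intro map_cong refl) (simp add: of_bool_def)
  show ?thesis
    unfolding L Flip act.simps inversions.simps eq using x by simp
qed

lemma inversions_descending: "descending L ss K \<Longrightarrow> inversions L = length ss + inversions K"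
  by (induction ss arbitrary: L) (auto simp: inversions_descent)

lemma descending_append:
  "descending L (ss @ ts) K \<longleftrightarrow> (\<exists>L'. descending L ss L' \<and> descending L' ts K)"
  by (induction ss arbitrary: L) auto

lemma length_standard [simp]: "length (standard n) = n"
  by (simp add: standard_def)

lemma nth_standard [simp]: "k < n \<Longrightarrow> standard n ! k = int (Suc k)"
  unfolding standard_def by (simp del: upt_Suc)

lemma sorted_standard: "sorted (standard n)"
  by (auto simp: sorted_iff_nth_mono)

lemma distinct_standard: "distinct (standard n)"
  by (simp add: standard_def distinct_map)

lemma set_standard: "set (standard n) = {1..int n}"
proof -
  have "set (standard n) = int ` {1..n}" by (auto simp: standard_def)
  then show ?thesis by (simp add: image_int_atLeastAtMost)
qed

lemma inversions_sorted_pos: "\<lbrakk>sorted L; \<forall>x\<in>set L. 0 < x\<rbrakk> \<Longrightarrow> inversions L = 0"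
proof (induction L)
  case (Cons x xs)
  then have "map (\<lambda>y. of_bool (y < x) + of_bool (x + y < 0)) xs = map (\<lambda>_. 0 :: nat) xs"
    by (intro map_cong refl) (force simp: of_bool_def)
  then show ?case using Cons by simp
qed simp

lemma inversions_standard [simp]: "inversions (standard n) = 0"
  using inversions_sorted_pos[OF sorted_standard, of n] by (auto simp: set_standard)

lemma no_descent_sorted_nonneg:
  assumes "\<And>s. \<not> descent s L"
  shows "sorted L" "\<forall>x\<in>set L. 0 \<le> x"
proof -
  show s: "sorted L"
    using assms[of "Swap _"] by (force simp: sorted_iff_nth_Suc not_less)
  show "\<forall>x\<in>set L. 0 \<le> x"
    using assms[of Flip] s by (cases L) auto
qed

lemma no_descent_standard:
  assumes "\<And>s. \<not> descent s L" "mset (map abs L) = mset (standard n)"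
  shows "L = standard n"
proof -
  have "map abs L = L"
    using no_descent_sorted_nonneg(2)[OF assms(1)] by (intro map_idI) auto
  then have "mset L = mset (standard n)" using assms(2) by simp
  then show ?thesis
    using no_descent_sorted_nonneg(1)[OF assms(1)] sorted_standard
    by (metis properties_for_sort sorted_sort_id)
qed


section \<open>Reduced diagrams\<close>

context mirror_quiver
begin

primrec bar :: "'q letter \<Rightarrow> 'q letter" where
  "bar (Black i) = Black (\<tau> i)"
| "bar (Red \<theta>) = Red \<theta>"

lemma letter_ok_bar [simp]: "letter_ok Q a \<Longrightarrow> letter_ok Q (bar a)"
  by (cases a) auto

lemma bar_bar [simp]: "letter_ok Q a \<Longrightarrow> bar (bar a) = a"
  by (cases a) (auto simp: tau_tau)

lemma is_red_bar [simp]: "is_red (bar a) = is_red a"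
  by (cases a) auto

fun layer_ok :: "'q word \<Rightarrow> generator \<Rightarrow> bool" where
  "layer_ok w (Swap k) \<longleftrightarrow> Suc k < length w \<and> \<not> (is_red (w ! k) \<and> is_red (w ! Suc k))"
| "layer_ok w Flip \<longleftrightarrow> w \<noteq> [] \<and> \<not> is_red (w ! 0)"

text \<open>The generator is indexed by the word below it; the word above is
  \<open>act bar s w\<close>. Since states are read at the top, the chain for \<open>L\<close>
  therefore uses \<open>word_of u (move s L)\<close>.\<close>

fun elementary :: "'q word \<Rightarrow> generator \<Rightarrow> 'q diagram" where
  "elementary w (Swap k) = padded (take k w) (Cross (w ! k) (w ! Suc k)) (drop (Suc (Suc k)) w)"
| "elementary w Flip = reflect (vertex (w ! 0)) (tl w)"

definition dot_at :: "'q word \<Rightarrow> nat \<Rightarrow> 'q diagram" where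
  "dot_at w m = padded (take m w) (Dot (vertex (w ! m))) (drop (Suc m) w)"

lemma elementary_Swap_split:
  "length A = k \<Longrightarrow> elementary (A @ a # b # B) (Swap k) = padded A (Cross a b) B"
  by (auto simp: nth_append)

lemma dot_at_split: "length A = m \<Longrightarrow> dot_at (A @ Black i # B) m = padded A (Dot i) B"
  by (auto simp: dot_at_def)

lemma split_nth: "m < length w \<Longrightarrow> \<exists>A B. w = A @ w ! m # B \<and> length A = m"
  by (intro exI conjI, rule id_take_nth_drop) simp_all

lemma split_Suc_nth:
  assumes "Suc k < length w"
  shows "\<exists>A a b B. w = A @ a # b # B \<and> length A = k"
proof -
  obtain A C where w: "w = A @ w ! k # C" "length A = k"
    using split_nth[of k w] assms by auto
  have "length w = length (A @ w ! k # C)" using w(1) by (rule arg_cong)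
  then obtain b B where "C = b # B" using assms w(2) by (cases C) auto
  with w show ?thesis by metis
qed

lemma elementary_props:
  assumes "word_ok w" "layer_ok w s"
  shows "is_valid OKLRW (elementary w s)" "src (elementary w s) = w"
    "target (elementary w s) = act bar s w" "crossings (elementary w s) = 1"
proof -
  have "is_valid OKLRW (elementary w s) \<and> src (elementary w s) = w \<and>
    target (elementary w s) = act bar s w \<and> crossings (elementary w s) = 1"
  proof (cases s)
    case (Swap k)
    then have "Suc k < length w" using assms by simp
    from split_Suc_nth[OF this] obtain A a b B where w: "w = A @ a # b # B" "length A = k"
      by blast
    have "\<not> (is_red a \<and> is_red b)" using assms(2) w Swap by (auto simp: nth_append)
    with w show ?thesis using assms(1) Swap
      by (simp add: elementary_Swap_split act_Swap_split is_red_iff del: elementary.simps act.simps)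
  next
    case Flip
    then show ?thesis using assms by (cases w) (auto simp: not_is_red)
  qed
  then show "is_valid OKLRW (elementary w s)" "src (elementary w s) = w"
    "target (elementary w s) = act bar s w" "crossings (elementary w s) = 1" by auto
qed

lemma dot_at_props:
  assumes "word_ok w" "m < length w" "\<not> is_red (w ! m)"
  shows "is_valid OKLRW (dot_at w m)" "src (dot_at w m) = w" "target (dot_at w m) = w"
    "crossings (dot_at w m) = 0"
proof -
  obtain i where "w ! m = Black i" using assms by (auto simp: not_is_red)
  then obtain A B where w: "w = A @ Black i # B" "length A = m"
    using split_nth[OF assms(2)] by auto
  then show "is_valid OKLRW (dot_at w m)" "src (dot_at w m) = w" "target (dot_at w m) = w"
    "crossings (dot_at w m) = 0" using assms by (auto simp: dot_at_split)
qed

section \<open>Diagrams as stacks of single generators and dots\<close>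

inductive layered :: "'q word \<Rightarrow> 'q diagram \<Rightarrow> bool" for u where
  layered_strands: "layered u (Strands u)"
| layered_elementary: "\<lbrakk>layered u d; layer_ok (target d) s\<rbrakk> \<Longrightarrow> layered u (Comp (elementary (target d)
  s) d)"
| layered_dot: "\<lbrakk>layered u d; m < length (target d); \<not> is_red (target d ! m)\<rbrakk>
    \<Longrightarrow> layered u (Comp (dot_at (target d) m) d)"

lemma layered_props: "\<lbrakk>layered u d; word_ok u\<rbrakk> \<Longrightarrow> is_valid OKLRW d \<and> src d = u"
proof (induction rule: layered.induct)
  case (layered_elementary d s)
  then show ?case using word_ok_src_target[of OKLRW d] elementary_props[of "target d" s] by auto
next
  case (layered_dot d m)
  then show ?case using word_ok_src_target[of OKLRW d] dot_at_props[of "target d" m] by auto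
qed auto

text \<open>Rewriting a diagram as a stack must preserve the number of crossings, so that the stack
  lies in the same step of the filtration as the diagram.\<close>

definition flattens :: "'q diagram \<Rightarrow> bool" where
  "flattens d \<longleftrightarrow> (\<exists>d'. layered (src d) d' \<and> deq OKLRW d d' \<and> crossings d' = crossings d)"

lemma layered_comp:
  assumes "layered (target e) d" "layered u e" "word_ok u"
  shows "\<exists>f. layered u f \<and> deq OKLRW (Comp d e) f \<and> crossings f = crossings d + crossings e"
  using assms(1)
proof (induction rule: layered.induct)
  case layered_strands
  then show ?case using assms(2,3) layered_props by (auto intro!: exI[of _ e] deq_unit_left)
next
  case (layered_elementary d s)
  then obtain f where f: "layered u f" "deq OKLRW (Comp d e) f" "crossings f = crossings d +
    crossings e"
    by blast
  have e: "is_valid OKLRW e" "src e = u" using layered_props assms by auto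
  have t: "target f = target d" "is_valid OKLRW d" "src d = target e" using f(2) by (auto simp:
    deq_def)
  have el: "is_valid OKLRW (elementary (target d) s)" "src (elementary (target d) s) = target d"
    using elementary_props[of "target d" s] word_ok_src_target[OF t(2)] layered_elementary by auto
  have "deq OKLRW (Comp (Comp (elementary (target d) s) d) e) (Comp (elementary (target d) s) (Comp
    d e))"
    using e t el by (intro deq_comp_assoc)
  also have "deq OKLRW \<dots> (Comp (elementary (target d) s) f)"
    using e t el f by (intro deq_comp deq_refl) auto
  finally show ?case using layered.layered_elementary[OF f(1), of s] layered_elementary t f
    by (auto intro!: exI[of _ "Comp (elementary (target d) s) f"])
next
  case (layered_dot d m)
  then obtain f where f: "layered u f" "deq OKLRW (Comp d e) f" "crossings f = crossings d +
    crossings e"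
    by blast
  have e: "is_valid OKLRW e" "src e = u" using layered_props assms by auto
  have t: "target f = target d" "is_valid OKLRW d" "src d = target e" using f(2) by (auto simp:
    deq_def)
  have el: "is_valid OKLRW (dot_at (target d) m)" "src (dot_at (target d) m) = target d"
    using dot_at_props[of "target d" m] word_ok_src_target[OF t(2)] layered_dot by auto
  have "deq OKLRW (Comp (Comp (dot_at (target d) m) d) e) (Comp (dot_at (target d) m) (Comp d e))"
    using e t el by (intro deq_comp_assoc)
  also have "deq OKLRW \<dots> (Comp (dot_at (target d) m) f)"
    using e t el f by (intro deq_comp deq_refl) auto
  finally show ?case using layered.layered_dot[OF f(1), of m] layered_dot t f
    by (auto intro!: exI[of _ "Comp (dot_at (target d) m) f"])
qed

lemma flattens_comp:
  assumes "flattens d" "flattens e" "src d = target e"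
  shows "flattens (Comp d e)"
proof -
  obtain d' where d': "layered (src d) d'" "deq OKLRW d d'" "crossings d' = crossings d"
    using assms unfolding flattens_def by blast
  obtain e' where e': "layered (src e) e'" "deq OKLRW e e'" "crossings e' = crossings e"
    using assms unfolding flattens_def by blast
  have t: "target e' = target e" "word_ok (src e)" "is_valid OKLRW e"
    using e' word_ok_src_target by (auto simp: deq_def)
  obtain f where f: "layered (src e) f" "deq OKLRW (Comp d' e') f" "crossings f = crossings d' +
    crossings e'"
    using layered_comp[of e' d' "src e"] d' e' t assms by auto
  have "deq OKLRW (Comp d e) (Comp d' e')" using d' e' assms by (intro deq_comp)
  with f d' e' show ?thesis unfolding flattens_def by (auto intro: deq_trans)
qed

lemma flattens_deq: "\<lbrakk>deq OKLRW d e; flattens e; crossings d = crossings e\<rbrakk> \<Longrightarrow> flattens d"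
  unfolding flattens_def using deq_trans by (fastforce simp: deq_def)

lemma flattens_strands: "word_ok u \<Longrightarrow> flattens (Strands u)"
  unfolding flattens_def by (auto intro!: exI[of _ "Strands u"] layered_strands deq_refl)

lemma flattens_elementary:
  assumes "word_ok w" "layer_ok w s"
  shows "flattens (elementary w s)"
  unfolding flattens_def
  using layered_elementary[OF layered_strands, of w s] elementary_props[OF assms] assms
  by (auto intro!: exI[of _ "Comp (elementary w s) (Strands w)"] deq_sym[OF deq_unit_right])

lemma flattens_dot_at:
  assumes "word_ok w" "m < length w" "\<not> is_red (w ! m)"
  shows "flattens (dot_at w m)"
  unfolding flattens_def
  using layered_dot[OF layered_strands, of m w] dot_at_props[OF assms] assms
  by (auto intro!: exI[of _ "Comp (dot_at w m) (Strands w)"] deq_sym[OF deq_unit_right])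

lemma deq_padded_tensor:
  assumes "is_valid KLRW d" "is_valid KLRW e" "word_ok u" "word_ok z"
  shows "deq L (padded u (Tensor d e) z) (Comp (padded u d (target e @ z)) (padded (u @ src d) e
    z))"
proof -
  have ok: "word_ok (src d)" "word_ok (target e)" using assms word_ok_src_target by blast+
  have "deq L (padded u (Tensor d e) z)
      (padded u (Comp (Tensor d (Strands (target e))) (Tensor (Strands (src d)) e)) z)"
    using assms by (intro deq_padded_cong deq_split_lower_right)
  also have "deq L \<dots> (Comp (padded u (Tensor d (Strands (target e))) z) (padded u (Tensor (Strands
    (src d)) e) z))"
    using assms ok by (intro deq_padded_comp) auto
  also have "deq L \<dots> (Comp (padded u d (target e @ z)) (padded (u @ src d) e z))"
    using assms ok by (intro deq_comp deq_padded_right deq_padded_left) auto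
  finally show ?thesis .
qed

text \<open>The surrounding words are part of the induction because each factor of a tensor product
  sees the strands of the other factor as additional padding.\<close>

lemma flattens_padded: "\<lbrakk>is_valid KLRW d; word_ok u; word_ok z\<rbrakk> \<Longrightarrow> flattens (padded u d z)"
proof (induction d arbitrary: u z)
  case (Strands v)
  then show ?case by (intro flattens_deq[OF deq_padded_strands] flattens_strands) auto
next
  case (Dot i)
  then show ?case using flattens_dot_at[of "u @ Black i # z" "length u"]
    by (auto simp: dot_at_split)
next
  case (Cross a b)
  then show ?case using flattens_elementary[of "u @ a # b # z" "Swap (length u)"]
    by (auto simp: elementary_Swap_split nth_append is_red_iff simp del: elementary.simps)
next
  case (Comp d e)
  then show ?case by (intro flattens_deq[OF deq_padded_comp] flattens_comp) auto
next
  case (Tensor d e)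
  then have "word_ok (src d)" "word_ok (target e)" using word_ok_src_target[of KLRW] by auto
  with Tensor show ?case
    by (intro flattens_deq[OF deq_padded_tensor] flattens_comp) (auto simp: ball_Un)
qed simp

text \<open>A diagram with mirrors can only be extended on the right. In \<open>Tensor d e\<close>
  the left factor is extended by the upper strands of \<open>e\<close>, and \<open>e\<close>, which
  has no mirrors, is placed below with the lower strands of \<open>d\<close> on its left, where
  \<open>flattens_padded\<close> applies.\<close>

lemma flattens_tensor_strands: "\<lbrakk>is_valid OKLRW d; word_ok z\<rbrakk> \<Longrightarrow> flattens (Tensor d (Strands z))"
proof (induction d arbitrary: z)
  case (Strands v)
  then show ?case by (intro flattens_deq[OF deq_tensor_strands_padded] flattens_padded) auto
next
  case (Dot i)
  then show ?case by (intro flattens_deq[OF deq_tensor_strands_padded] flattens_padded) auto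
next
  case (Cross a b)
  then show ?case by (intro flattens_deq[OF deq_tensor_strands_padded] flattens_padded) auto
next
  case (Mirror i)
  then show ?case using flattens_elementary[of "Black i # z" Flip] by auto
next
  case (Comp d e)
  then show ?case by (intro flattens_deq[OF deq_comp_tensor_strands] flattens_comp) auto
next
  case (Tensor d e)
  then have v: "is_valid OKLRW d" "is_valid KLRW e" by auto
  have ok: "word_ok (src d)" "word_ok (target e)" using v word_ok_src_target by blast+
  have "deq OKLRW (Tensor (Tensor d e) (Strands z)) (Tensor d (Tensor e (Strands z)))"
    using v Tensor.prems by (intro deq_tensor_assoc) auto
  also have "deq OKLRW \<dots> (Comp (Tensor d (Strands (target (Tensor e (Strands z)))))
      (Tensor (Strands (src d)) (Tensor e (Strands z))))"
    using v Tensor.prems by (intro deq_split_lower_right) auto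
  also have "deq OKLRW \<dots> (Comp (Tensor d (Strands (target e @ z))) (padded (src d) e z))"
    unfolding padded_def using v ok Tensor.prems
    by (intro deq_comp deq_sym[OF deq_tensor_assoc]) (auto intro!: deq_refl)
  finally show ?case
    by (rule flattens_deq) (use Tensor v ok in \<open>auto simp: ball_Un intro!: flattens_comp
      flattens_padded\<close>)
qed

lemma flattens_valid: "is_valid OKLRW d \<Longrightarrow> flattens d"
  by (rule flattens_deq[OF deq_sym[OF deq_tensor_unit_right] flattens_tensor_strands]) auto

end


section \<open>States and the diagrams of chains of generators\<close>

lemma descent_Swap_split: "length A = k \<Longrightarrow> descent (Swap k) (A @ x # y # B) \<longleftrightarrow> y < x"
  by (auto simp: nth_append)

context mirror_quiver
begin

text \<open>The letter at the upper end of the strand whose lower end is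
  \<open>\<bar>x\<bar>\<close>: a reflected strand arrives with the label changed by
  \<open>\<tau>\<close>. Positions start at 1 because 0 has no sign, hence the subtraction in the
  list index.\<close>

definition letter_of :: "'q word \<Rightarrow> int \<Rightarrow> 'q letter" where
  "letter_of u x = (if 0 < x then u ! (nat x - 1) else bar (u ! (nat (- x) - 1)))"

definition word_of :: "'q word \<Rightarrow> int list \<Rightarrow> 'q word" where
  "word_of u L = map (letter_of u) L"

text \<open>Besides being a signed permutation, a state leaves red strands unreflected and in their
  order: they neither meet the mirror nor cross each other.\<close>

definition state :: "'q word \<Rightarrow> int list \<Rightarrow> bool" where
  "state u L \<longleftrightarrow> word_ok u \<and> mset (map abs L) = mset (standard (length u)) \<and>
     (\<forall>x\<in>set L. is_red (letter_of u x) \<longrightarrow> 0 < x) \<and> sorted (filter (\<lambda>x. is_red (letter_of u x)) L)"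

text \<open>The generators of a chain are listed from the top of the diagram to its bottom.\<close>

primrec chain_diagram :: "'q word \<Rightarrow> int list \<Rightarrow> generator list \<Rightarrow> 'q diagram" where
  "chain_diagram u L [] = Strands (word_of u L)"
| "chain_diagram u L (s # ss) =
     Comp (elementary (word_of u (move s L)) s) (chain_diagram u (move s L) ss)"

lemma length_word_of [simp]: "length (word_of u L) = length L"
  by (simp add: word_of_def)

lemma word_of_append: "word_of u (K @ L) = word_of u K @ word_of u L"
  and word_of_Cons: "word_of u (x # L) = letter_of u x # word_of u L"
  and word_of_Nil: "word_of u [] = []"
  by (simp_all add: word_of_def)

lemma nth_word_of: "k < length L \<Longrightarrow> word_of u L ! k = letter_of u (L ! k)"
  by (simp add: word_of_def)

lemma word_of_standard [simp]: "word_of u (standard (length u)) = u"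
  by (rule nth_equalityI) (auto simp: nth_word_of letter_of_def nat_add_distrib)

lemma state_word_ok: "state u L \<Longrightarrow> word_ok u"
  by (simp add: state_def)

lemma state_set:
  assumes "state u L" "x \<in> set L"
  shows "1 \<le> \<bar>x\<bar>" "\<bar>x\<bar> \<le> int (length u)"
proof -
  have "\<bar>x\<bar> \<in># mset (map abs L)" using assms by auto
  then have "\<bar>x\<bar> \<in> set (standard (length u))"
    using assms(1) unfolding state_def by (metis set_mset_mset)
  then show "1 \<le> \<bar>x\<bar>" "\<bar>x\<bar> \<le> int (length u)" by (auto simp: set_standard)
qed

lemma state_distinct: "state u L \<Longrightarrow> distinct (map abs L)"
  unfolding state_def using distinct_standard mset_eq_imp_distinct_iff by blast

lemma letter_ok_letter_of:
  assumes "state u L" "x \<in> set L"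
  shows "letter_ok Q (letter_of u x)"
proof -
  have "nat \<bar>x\<bar> - 1 < length u" using state_set[OF assms] by linarith
  then have "letter_ok Q (u ! (nat \<bar>x\<bar> - 1))" using state_word_ok[OF assms(1)] by simp
  then show ?thesis using state_set(1)[OF assms] by (auto simp: letter_of_def)
qed

lemma letter_of_uminus:
  assumes "state u L" "x \<in> set L"
  shows "letter_of u (- x) = bar (letter_of u x)"
proof -
  have "nat \<bar>x\<bar> - 1 < length u" using state_set[OF assms] by linarith
  then have "letter_ok Q (u ! (nat \<bar>x\<bar> - 1))" using state_word_ok[OF assms(1)] by simp
  then show ?thesis using state_set(1)[OF assms] by (auto simp: letter_of_def)
qed

lemma word_ok_word_of: "state u L \<Longrightarrow> word_ok (word_of u L)"
  using letter_ok_letter_of by (auto simp: word_of_def)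

lemma state_standard:
  assumes "word_ok u"
  shows "state u (standard (length u))"
proof -
  have "map abs (standard (length u)) = standard (length u)"
    by (rule map_idI) (auto simp: set_standard)
  then show ?thesis
    unfolding state_def using assms sorted_standard[of "length u"]
    by (auto simp: set_standard sorted_filter[where f = "\<lambda>x. x", simplified] simp del: mset_map)
qed

lemma state_move:
  assumes "state u L" "layer_ok (word_of u L) s"
  shows "state u (move s L)" "word_of u (move s L) = act bar s (word_of u L)"
    "layer_ok (word_of u (move s L)) s"
proof -
  have *: "state u (move s L) \<and> word_of u (move s L) = act bar s (word_of u L) \<and>
      layer_ok (word_of u (move s L)) s"
  proof (cases s)
    case (Swap k)
    then have k: "Suc k < length L" using assms(2) by simp
    then obtain A x y B where L: "L = A @ x # y # B" "length A = k"
      using split_Suc_nth by blast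
    have K: "move s L = A @ y # x # B" using L Swap by (simp only: act_Swap_split)
    have red: "\<not> (is_red (letter_of u x) \<and> is_red (letter_of u y))"
      using assms(2) L Swap by (auto simp: nth_word_of nth_append)
    have "mset (map abs (A @ y # x # B)) = mset (map abs (A @ x # y # B))" by simp
    moreover have "filter (\<lambda>x. is_red (letter_of u x)) (A @ y # x # B) =
        filter (\<lambda>x. is_red (letter_of u x)) (A @ x # y # B)" using red by auto
    ultimately have "state u (A @ y # x # B)"
      using assms(1) unfolding state_def L by (simp only: set_append list.set) auto
    moreover have "word_of u (A @ y # x # B) = act bar (Swap k) (word_of u A @ letter_of u x #
      letter_of u y # word_of u B)"
      using L(2) by (simp only: act_Swap_split length_word_of word_of_append word_of_Cons)
    moreover have "layer_ok (word_of u (A @ y # x # B)) (Swap k)"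
      using red L(2) by (auto simp: nth_word_of nth_append)
    ultimately show ?thesis
      unfolding K unfolding L Swap by (simp only: word_of_append word_of_Cons)
  next
    case Flip
    then obtain x B where L: "L = x # B" using assms(2) by (cases L) (auto simp: word_of_def)
    have red: "\<not> is_red (letter_of u x)" using assms(2) L Flip by (simp add: word_of_Cons)
    have bar: "letter_of u (- x) = bar (letter_of u x)"
      using letter_of_uminus[OF assms(1)] L by simp
    have "state u (- x # B)" using assms(1) red bar unfolding state_def L by simp
    then show ?thesis using red bar Flip L by (simp add: word_of_Cons)
  qed
  then show "state u (move s L)" "word_of u (move s L) = act bar s (word_of u L)"
    "layer_ok (word_of u (move s L)) s" by auto
qed

text \<open>Red entries are positive and increasing, so neither a reflection of a red strand nor a
  swap of two red strands can be a descent. Every reduced word thus consists of existing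
  generators.\<close>

lemma descent_layer_ok:
  assumes "state u L" "descent s L"
  shows "layer_ok (word_of u L) s"
proof (cases s)
  case (Swap k)
  then have k: "Suc k < length L" using assms(2) by simp
  then obtain A x y B where L: "L = A @ x # y # B" "length A = k"
    using split_Suc_nth by blast
  have "y < x" using assms(2) L Swap by (simp add: descent_Swap_split nth_append)
  have "\<not> (is_red (letter_of u x) \<and> is_red (letter_of u y))"
  proof
    assume "is_red (letter_of u x) \<and> is_red (letter_of u y)"
    then show False using assms(1) \<open>y < x\<close> unfolding state_def L by (auto simp: sorted_append)
  qed
  then show ?thesis using L Swap by (simp add: nth_word_of nth_append)
next
  case Flip
  then obtain x B where L: "L = x # B" "x < 0" using assms(2) by (cases L) auto
  then show ?thesis using assms(1) Flip by (auto simp: state_def word_of_Cons)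
qed

lemma state_descent:
  assumes "state u L" "descent s L"
  shows "state u (move s L)" "word_of u (move s L) = act bar s (word_of u L)"
    "layer_ok (word_of u (move s L)) s" "move s (move s L) = L"
  using state_move[OF assms(1) descent_layer_ok[OF assms]] assms(2)
  by (auto intro!: move_move)

lemma state_descending: "\<lbrakk>descending L ss K; state u L\<rbrakk> \<Longrightarrow> state u K"
  by (induction ss arbitrary: L) (auto simp: state_descent)

text \<open>Entries of a state are nonzero with distinct absolute values, so there is no equality
  between descent and ascent.\<close>

lemma ascent_descent:
  assumes "state u L" "layer_ok (word_of u L) s" "\<not> descent s L"
  shows "descent s (move s L)"
proof (cases s)
  case (Swap k)
  then have k: "Suc k < length L" using assms(2) by simp
  then have "L ! k \<noteq> L ! Suc k"
    using state_distinct[OF assms(1)] by (metis Suc_lessD distinct_map n_not_Suc_n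
      nth_eq_iff_index_eq)
  then show ?thesis using Swap k assms(3) by simp
next
  case Flip
  then obtain x B where L: "L = x # B" using assms(2) by (cases L) (auto simp: word_of_def)
  then show ?thesis using Flip assms(3) state_set[OF assms(1), of x] by auto
qed

lemma elementary_state:
  assumes "state u L" "descent s L"
  shows "is_valid OKLRW (elementary (word_of u (move s L)) s)"
    "src (elementary (word_of u (move s L)) s) = word_of u (move s L)"
    "target (elementary (word_of u (move s L)) s) = word_of u L"
    "crossings (elementary (word_of u (move s L)) s) = 1"
proof -
  note st = state_descent[OF assms]
  note el = elementary_props[OF word_ok_word_of[OF st(1)] st(3)]
  show "is_valid OKLRW (elementary (word_of u (move s L)) s)"
    "src (elementary (word_of u (move s L)) s) = word_of u (move s L)"
    "crossings (elementary (word_of u (move s L)) s) = 1"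
    by (fact el)+
  show "target (elementary (word_of u (move s L)) s) = word_of u L"
    using el(3) state_move(2)[OF st(1) st(3)] st(4) by simp
qed

lemma chain_diagram_props:
  assumes "state u L" "descending L ss K"
  shows "is_valid OKLRW (chain_diagram u L ss)" "src (chain_diagram u L ss) = word_of u K"
    "target (chain_diagram u L ss) = word_of u L" "crossings (chain_diagram u L ss) = length ss"
proof -
  have "is_valid OKLRW (chain_diagram u L ss) \<and> src (chain_diagram u L ss) = word_of u K \<and>
    target (chain_diagram u L ss) = word_of u L \<and> crossings (chain_diagram u L ss) = length ss"
    using assms
  proof (induction ss arbitrary: L)
    case Nil
    then show ?case using word_ok_word_of by auto
  next
    case (Cons s ss)
    then show ?case using elementary_state[of u L s] state_descent[of u L s] by auto
  qed
  then show "is_valid OKLRW (chain_diagram u L ss)" "src (chain_diagram u L ss) = word_of u K"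
    "target (chain_diagram u L ss) = word_of u L" "crossings (chain_diagram u L ss) = length ss" by
      auto
qed

lemma chain_diagram_Cons_cong:
  assumes "state u L" "descending L (s # ss) K" "deq OKLRW (chain_diagram u (move s L) ss) d"
  shows "deq OKLRW (chain_diagram u L (s # ss)) (Comp (elementary (word_of u (move s L)) s) d)"
  using assms elementary_state[of u L s] chain_diagram_props(3)[of u "move s L" ss K]
    state_descent(1)[of u L s]
  by (auto intro!: deq_comp deq_refl)

lemma chain_diagram_single:
  assumes "state u L" "descent s L"
  shows "deq OKLRW (chain_diagram u L [s]) (elementary (word_of u (move s L)) s)"
  using elementary_state[OF assms] by (auto intro!: deq_unit_right)

lemma chain_diagram_append:
  assumes "state u L" "descending L ss L'" "descending L' ts K"
  shows "deq OKLRW (chain_diagram u L (ss @ ts)) (Comp (chain_diagram u L ss) (chain_diagram u L'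
    ts))"
  using assms
proof (induction ss arbitrary: L)
  case Nil
  then show ?case using chain_diagram_props[of u L' ts K]
    by (auto intro!: deq_sym[OF deq_unit_left])
next
  case (Cons s ss)
  have s: "state u (move s L)" "descent s L" "descending (move s L) ss L'"
    using Cons.prems state_descent by auto
  note el = elementary_state[OF Cons.prems(1) s(2)]
  note cd = chain_diagram_props[OF s(1,3)]
  note cd' = chain_diagram_props[OF state_descending[OF s(3,1)] Cons.prems(3)]
  have "deq OKLRW (chain_diagram u L ((s # ss) @ ts))
      (Comp (elementary (word_of u (move s L)) s) (Comp (chain_diagram u (move s L) ss)
        (chain_diagram u L' ts)))"
    using Cons.IH[OF s(1,3) Cons.prems(3)] s el cd Cons.prems
    by (auto intro!: deq_comp deq_refl) (auto simp: deq_def)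
  also have "deq OKLRW \<dots> (Comp (chain_diagram u L (s # ss)) (chain_diagram u L' ts))"
    using el cd cd' by (auto intro!: deq_sym[OF deq_comp_assoc])
  finally show ?case .
qed

text \<open>Apply descents as long as there are any; the standard state is the only one without a
  descent.\<close>

lemma descending_standard_exists:
  assumes "state u L"
  shows "\<exists>ss. descending L ss (standard (length u))"
  using assms
proof (induction "inversions L" arbitrary: L rule: less_induct)
  case less
  show ?case
  proof (cases "\<exists>s. descent s L")
    case True
    then obtain s where s: "descent s L" by blast
    then have "inversions (move s L) < inversions L" using inversions_descent by simp
    from less.hyps[OF this] obtain ss where "descending (move s L) ss (standard (length u))"
      using state_descent less.prems s by blast
    then show ?thesis using s by (auto intro!: exI[of _ "s # ss"])
  next
    case False
    then have "L = standard (length u)"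
      using no_descent_standard less.prems by (auto simp: state_def)
    then show ?thesis by (auto intro!: exI[of _ "[]"])
  qed
qed

text \<open>Two descents can be continued to a common state by chains of equal length. The bound
  \<open>Suc (length ss)\<close> is the number of crossings of either chain, so the two diagrams
  differ by diagrams with strictly fewer crossings.\<close>

definition confluent :: "'q word \<Rightarrow> int list \<Rightarrow> generator \<Rightarrow> generator \<Rightarrow> bool" where
  "confluent u L s t \<longleftrightarrow> (\<exists>ss ts K. descending L (s # ss) K \<and> descending L (t # ts) K \<and>
     deq_mod (Suc (length ss)) (chain_diagram u L (s # ss)) (chain_diagram u L (t # ts)))"

lemma confluent_sym:
  assumes "confluent u L s t"
  shows "confluent u L t s"
proof -
  obtain ss ts K where *: "descending L (s # ss) K" "descending L (t # ts) K"
     "deq_mod (Suc (length ss)) (chain_diagram u L (s # ss)) (chain_diagram u L (t # ts))"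
    using assms unfolding confluent_def by blast
  then have "length ss = length ts"
    using inversions_descending[OF *(1)] inversions_descending[OF *(2)] by simp
  then show ?thesis using * deq_mod_sym unfolding confluent_def by metis
qed

text \<open>The crossings involve disjoint pairs of strands, so the interchange law makes the two
  chains equal without correction.\<close>

lemma confluent_far:
  assumes "state u L" "descent (Swap k) L" "descent (Swap l) L" "Suc k < l"
  shows "confluent u L (Swap k) (Swap l)"
proof -
  obtain D p q C where D: "L = D @ p # q # C" "length D = l"
    using assms(3) split_Suc_nth[of l L] by auto
  then obtain A x y B where "D = A @ x # y # B" "length A = k"
    using assms(4) split_Suc_nth[of k D] by auto
  with D have L: "L = A @ x # y # B @ p # q # C" and k: "length A = k"
    and l: "length (A @ x # y # B) = l" "length (A @ y # x # B) = l" by auto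
  have lt: "y < x" "q < p"
    using assms(2,3) descent_Swap_split[OF k, of x y "B @ p # q # C"]
      descent_Swap_split[OF l(1), of p q C] unfolding L by simp_all
  let ?s = "Swap k" and ?t = "Swap l"
  have m1: "move ?s L = A @ y # x # B @ p # q # C"
    unfolding L by (rule act_Swap_split[OF k])
  have m2: "move ?t L = A @ x # y # B @ q # p # C"
    using act_Swap_split[OF l(1), of uminus p q C] unfolding L by simp
  have m12: "move ?t (move ?s L) = A @ y # x # B @ q # p # C"
    using act_Swap_split[OF l(2), of uminus p q C] unfolding m1 by simp
  have m21: "move ?s (move ?t L) = A @ y # x # B @ q # p # C"
    unfolding m2 by (rule act_Swap_split[OF k])
  have d1: "descent ?t (move ?s L)"
    using descent_Swap_split[OF l(2), of p q C] lt unfolding m1 by simp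
  have d2: "descent ?s (move ?t L)"
    using descent_Swap_split[OF k, of x y "B @ q # p # C"] lt unfolding m2 by simp
  let ?A = "word_of u A" and ?B = "word_of u B" and ?C = "word_of u C"
  let ?x = "letter_of u x" and ?y = "letter_of u y" and ?p = "letter_of u p" and ?q = "letter_of u
    q"
  have e1: "elementary (word_of u (move ?s L)) ?s = padded ?A (Cross ?y ?x) (?B @ [?p, ?q] @ ?C)"
    using elementary_Swap_split[of ?A k ?y ?x] k unfolding m1 by (simp add: word_of_append
      word_of_Cons)
  have e12: "elementary (word_of u (move ?t (move ?s L))) ?t = padded (?A @ [?y, ?x] @ ?B) (Cross ?q
    ?p) ?C"
    using elementary_Swap_split[of "?A @ [?y, ?x] @ ?B" l ?q ?p ?C] l unfolding m12
    by (simp add: word_of_append word_of_Cons)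
  have e2: "elementary (word_of u (move ?t L)) ?t = padded (?A @ [?x, ?y] @ ?B) (Cross ?q ?p) ?C"
    using elementary_Swap_split[of "?A @ [?x, ?y] @ ?B" l ?q ?p ?C] l unfolding m2
    by (simp add: word_of_append word_of_Cons)
  have e21: "elementary (word_of u (move ?s (move ?t L))) ?s = padded ?A (Cross ?y ?x) (?B @ [?q,
    ?p] @ ?C)"
    using elementary_Swap_split[of ?A k ?y ?x] k unfolding m21 by (simp add: word_of_append
      word_of_Cons)
  note st = state_descent(1)[OF assms(1,2)] state_descent(1)[OF assms(1,3)]
  have v: "is_valid KLRW (Cross ?y ?x)" "is_valid KLRW (Cross ?q ?p)" "word_ok ?A" "word_ok ?B"
    "word_ok ?C"
    using elementary_state(1)[OF assms(1,2)] elementary_state(1)[OF assms(1,3)] unfolding e1 e2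
    by (auto simp: ball_Un)
  have "deq OKLRW (chain_diagram u L [?s, ?t])
      (Comp (padded ?A (Cross ?y ?x) (?B @ [?p, ?q] @ ?C)) (padded (?A @ [?y, ?x] @ ?B) (Cross ?q
        ?p) ?C))"
    unfolding e1[symmetric] e12[symmetric]
    by (rule chain_diagram_Cons_cong chain_diagram_single assms st d1 | simp only: descending.simps
      simp_thms assms d1)+
  also have "deq OKLRW \<dots>
      (Comp (padded (?A @ [?x, ?y] @ ?B) (Cross ?q ?p) ?C) (padded ?A (Cross ?y ?x) (?B @ [?q, ?p] @
        ?C)))"
    using deq_commute[OF v, of OKLRW] by simp
  also have "deq OKLRW \<dots> (chain_diagram u L [?t, ?s])"
    unfolding e2[symmetric] e21[symmetric]
    by (rule deq_sym, (rule chain_diagram_Cons_cong chain_diagram_single assms st d2 | simp only: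
      descending.simps simp_thms assms d2)+)
  finally show ?thesis
    unfolding confluent_def using assms(2,3) d1 d2 m12 m21
    by (intro exI[of _ "[?t]"] exI[of _ "[?s]"] exI[of _ "A @ y # x # B @ q # p # C"])
       (simp only: descending.simps simp_thms deq_mod_deq)
qed

lemma confluent_flip_far:
  assumes "state u L" "descent Flip L" "descent (Swap l) L" "0 < l"
  shows "confluent u L Flip (Swap l)"
proof -
  obtain D p q C where D: "L = D @ p # q # C" "length D = l"
    using assms(3) split_Suc_nth[of l L] by auto
  then obtain x B where "D = x # B" using assms(4) by (cases D) auto
  with D have L: "L = x # B @ p # q # C" and l: "length (x # B) = l" "length (- x # B) = l" by auto
  have lt: "x < 0" "q < p"
    using assms(2,3) descent_Swap_split[OF l(1), of p q C] L by auto
  let ?s = "Flip" and ?t = "Swap l"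
  have m1: "move ?s L = - x # B @ p # q # C" unfolding L by simp
  have m2: "move ?t L = x # B @ q # p # C"
    using act_Swap_split[OF l(1), of uminus p q C] unfolding L by simp
  have m12: "move ?t (move ?s L) = - x # B @ q # p # C"
    using act_Swap_split[OF l(2), of uminus p q C] unfolding m1 by simp
  have m21: "move ?s (move ?t L) = - x # B @ q # p # C" unfolding m2 by simp
  have d1: "descent ?t (move ?s L)"
    using descent_Swap_split[OF l(2), of p q C] lt unfolding m1 by simp
  have d2: "descent ?s (move ?t L)" using lt unfolding m2 by simp
  let ?B = "word_of u B" and ?C = "word_of u C"
  let ?x = "letter_of u x" and ?p = "letter_of u p" and ?q = "letter_of u q"
  have "layer_ok (word_of u L) Flip" using descent_layer_ok assms by blast
  then obtain j where j: "?x = Black j" using L by (auto simp: word_of_Cons not_is_red)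
  have j': "j \<in> verts Q" using letter_ok_letter_of[OF assms(1), of x] L j by simp
  define i where "i = \<tau> j"
  have i: "i \<in> verts Q" "\<tau> i = j" using j' by (auto simp: i_def tau_tau)
  have x': "letter_of u (- x) = Black i"
    using letter_of_uminus[OF assms(1), of x] L j by (simp add: i_def)
  have e1: "elementary (word_of u (move ?s L)) ?s = reflect i (?B @ [?p, ?q] @ ?C)"
    unfolding m1 by (simp add: word_of_append word_of_Cons x')
  have e12: "elementary (word_of u (move ?t (move ?s L))) ?t = padded ([Black i] @ ?B) (Cross ?q ?p)
    ?C"
    using elementary_Swap_split[of "Black i # ?B" l ?q ?p ?C] l unfolding m12
    by (simp add: word_of_append word_of_Cons x')
  have e2: "elementary (word_of u (move ?t L)) ?t = padded ([Black j] @ ?B) (Cross ?q ?p) ?C"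
    using elementary_Swap_split[of "Black j # ?B" l ?q ?p ?C] l unfolding m2
    by (simp add: word_of_append word_of_Cons j)
  have e21: "elementary (word_of u (move ?s (move ?t L))) ?s = reflect i (?B @ [?q, ?p] @ ?C)"
    unfolding m21 by (simp add: word_of_append word_of_Cons x')
  note st = state_descent(1)[OF assms(1,2)] state_descent(1)[OF assms(1,3)]
  have v: "is_valid OKLRW (Mirror i)" "is_valid KLRW (Cross ?q ?p)" "word_ok ?B" "word_ok ?C"
    using elementary_state(1)[OF assms(1,2)] elementary_state(1)[OF assms(1,3)] unfolding e1 e2
    by (auto simp: ball_Un)
  have "deq OKLRW (chain_diagram u L [?s, ?t])
      (Comp (reflect i (?B @ [?p, ?q] @ ?C)) (padded ([Black i] @ ?B) (Cross ?q ?p) ?C))"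
    unfolding e1[symmetric] e12[symmetric]
    by (rule chain_diagram_Cons_cong chain_diagram_single assms st d1 | simp only: descending.simps
      simp_thms assms d1)+
  also have "deq OKLRW \<dots>
      (Comp (padded ([Black j] @ ?B) (Cross ?q ?p) ?C) (reflect i (?B @ [?q, ?p] @ ?C)))"
    using deq_commute_first[OF v] i by simp
  also have "deq OKLRW \<dots> (chain_diagram u L [?t, ?s])"
    unfolding e2[symmetric] e21[symmetric]
    by (rule deq_sym, (rule chain_diagram_Cons_cong chain_diagram_single assms st d2 | simp only:
      descending.simps simp_thms assms d2)+)
  finally show ?thesis
    unfolding confluent_def using assms(2,3) d1 d2 m12 m21
    by (intro exI[of _ "[?t]"] exI[of _ "[?s]"] exI[of _ "- x # B @ q # p # C"])
       (simp only: descending.simps simp_thms deq_mod_deq)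
qed

text \<open>The entries satisfy \<open>z < y < x\<close>, and both chains are reduced words for
  their reversal. They differ by one triple relation, the only rank two case with a correction
  term.\<close>

lemma confluent_adjacent:
  assumes "state u L" "descent (Swap k) L" "descent (Swap (Suc k)) L"
  shows "confluent u L (Swap k) (Swap (Suc k))"
proof -
  obtain A x y D where D: "L = A @ x # y # D" "length A = k"
    using assms(2) split_Suc_nth[of k L] by auto
  moreover from D obtain z C where "D = z # C" using assms(3) by (cases D) auto
  ultimately have L: "L = A @ x # y # z # C" and k: "length A = k" by auto
  have k': "length (A @ [a]) = Suc k" for a using k by simp
  have lt: "y < x" "z < y"
    using assms(2,3) descent_Swap_split[OF k, of x y "z # C"] descent_Swap_split[OF k', of x y z C]
    unfolding L by simp_all
  let ?s = "Swap k" and ?t = "Swap (Suc k)"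
  have ms: "move ?s (A @ a # b # c # C) = A @ b # a # c # C" for a b c
    by (rule act_Swap_split[OF k])
  have mt: "move ?t (A @ a # b # c # C) = A @ a # c # b # C" for a b c
    using act_Swap_split[OF k', of uminus a b c C] by simp
  have ds: "descent ?s (A @ a # b # c # C) \<longleftrightarrow> b < a" for a b c
    by (rule descent_Swap_split[OF k])
  have dt: "descent ?t (A @ a # b # c # C) \<longleftrightarrow> c < b" for a b c
    using descent_Swap_split[OF k', of a b c C] by simp
  let ?A = "word_of u A" and ?C = "word_of u C"
  let ?a = "letter_of u x" and ?b = "letter_of u y" and ?c = "letter_of u z"
  have es: "elementary (word_of u (A @ a # b # c # C)) ?s =
      padded ?A (Cross (letter_of u a) (letter_of u b)) (letter_of u c # ?C)" for a b c
    using elementary_Swap_split[of ?A k] k by (simp only: word_of_append word_of_Cons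
      length_word_of)
  have et: "elementary (word_of u (A @ a # b # c # C)) ?t =
      padded (?A @ [letter_of u a]) (Cross (letter_of u b) (letter_of u c)) ?C" for a b c
    using elementary_Swap_split[of "?A @ [letter_of u a]" "Suc k" "letter_of u b" "letter_of u c"
      ?C] k
    by (simp add: word_of_append word_of_Cons del: elementary.simps)
  have c1: "descending L [?s, ?t, ?s] (A @ z # y # x # C)"
    and c2: "descending L [?t, ?s, ?t] (A @ z # y # x # C)"
    using lt unfolding L by (simp_all only: descending.simps ms mt ds dt) auto
  have st: "state u (A @ y # x # z # C)" "state u (A @ y # z # x # C)"
    "state u (A @ x # z # y # C)" "state u (A @ z # x # y # C)"
    using state_descent(1)[OF assms(1,2)] state_descent(1)[OF assms(1,3)]
      state_descending[of L "[?s, ?t]"] state_descending[of L "[?t, ?s]"] c1 c2 assms(1)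
    unfolding L by (auto simp only: ms mt descending.simps)
  have ok: "letter_ok Q ?a" "letter_ok Q ?b" "letter_ok Q ?c" "word_ok ?A" "word_ok ?C"
    using word_ok_word_of[OF assms(1)] L by (auto simp: word_of_append word_of_Cons)
  have red: "\<not> (is_red ?c \<and> is_red ?b)" "\<not> (is_red ?c \<and> is_red ?a)" "\<not> (is_red ?b \<and> is_red ?a)"
    using descent_layer_ok[OF assms(1,2)] descent_layer_ok[OF assms(1,3)]
      descent_layer_ok[OF st(1), of ?t] lt k
    by (auto simp: L dt nth_word_of nth_append simp del: descent.simps)
  have "deq OKLRW (chain_diagram u L [?s, ?t, ?s])
      (Comp (padded ?A (Cross ?b ?a) (?c # ?C))
        (Comp (padded (?A @ [?b]) (Cross ?c ?a) ?C) (padded ?A (Cross ?c ?b) (?a # ?C))))"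
    using chain_diagram_Cons_cong[OF assms(1) c1, OF chain_diagram_Cons_cong[where K = "A @ z # y #
      x # C", OF _ _ chain_diagram_single]]
      c1 st unfolding L by (simp only: descending.simps ms mt es et simp_thms)
  also have "deq_mod 1 \<dots> (Comp (padded (?A @ [?a]) (Cross ?c ?b) ?C)
        (Comp (padded ?A (Cross ?c ?a) (?b # ?C)) (padded (?A @ [?c]) (Cross ?b ?a) ?C)))"
    using ok red by (intro deq_mod_triple)
  also have "deq OKLRW \<dots> (chain_diagram u L [?t, ?s, ?t])"
    using chain_diagram_Cons_cong[OF assms(1) c2, OF chain_diagram_Cons_cong[where K = "A @ z # y #
      x # C", OF _ _ chain_diagram_single]]
      c2 st unfolding L by - (rule deq_sym, simp only: descending.simps ms mt es et simp_thms)
  finally show ?thesis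
    unfolding confluent_def using c1 c2
    by (intro exI[of _ "[?t, ?s]"] exI[of _ "[?s, ?t]"] exI[of _ "A @ z # y # x # C"])
       (auto intro: deq_mod_mono simp del: chain_diagram.simps descending.simps)
qed

text \<open>Here \<open>y < x < 0\<close>. Both chains have length four and negate the two entries
  in place, which is the longest element of type B of rank two.\<close>

lemma confluent_flip_swap:
  assumes "state u L" "descent Flip L" "descent (Swap 0) L"
  shows "confluent u L Flip (Swap 0)"
proof -
  obtain x y C where L: "L = x # y # C"
    using assms(3) split_Suc_nth[of 0 L] by auto
  have lt: "x < 0" "y < x" using assms(2,3) L by auto
  let ?s = "Flip" and ?t = "Swap 0"
  have ms: "move ?s (a # b # C) = - a # b # C" for a b by simp
  have mt: "move ?t (a # b # C) = b # a # C" for a b by simp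
  have ds: "descent ?s (a # b # C) \<longleftrightarrow> a < 0" for a b by simp
  have dt: "descent ?t (a # b # C) \<longleftrightarrow> b < a" for a b by simp
  have c1: "descending L [?s, ?t, ?s, ?t] (- x # - y # C)"
    and c2: "descending L [?t, ?s, ?t, ?s] (- x # - y # C)"
    using lt unfolding L by (simp_all only: descending.simps ms mt ds dt) auto
  have st: "state u (- x # y # C)" "state u (y # - x # C)" "state u (- y # - x # C)"
    "state u (y # x # C)" "state u (- y # x # C)" "state u (x # - y # C)"
    using state_descent(1)[OF assms(1,2)] state_descent(1)[OF assms(1,3)]
      state_descending[of L "[?s, ?t]"] state_descending[of L "[?t, ?s]"]
      state_descending[of L "[?s, ?t, ?s]"] state_descending[of L "[?t, ?s, ?t]"] c1 c2 assms(1)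
    unfolding L by (auto simp only: ms mt descending.simps)
  have "\<not> is_red (letter_of u x)" "\<not> is_red (letter_of u y)"
    using assms(1) lt unfolding state_def L by auto
  then obtain i' j' where l: "letter_of u x = Black i'" "letter_of u y = Black j'"
    by (auto simp: not_is_red)
  \<comment> \<open>The mirror relation is stated with the labels at the bottom. Both strands arrive
    reflected, so these are the images under \<open>\<tau>\<close> of the labels read at the
    top.\<close>
  define i j where ij: "i = \<tau> i'" "j = \<tau> j'"
  have "i' \<in> verts Q" "j' \<in> verts Q"
    using letter_ok_letter_of[OF assms(1), of x] letter_ok_letter_of[OF assms(1), of y] l L by auto
  then
  have ij': "i' = \<tau> i" "j' = \<tau> j" "i \<in> verts Q" "j \<in> verts Q"
    by (auto simp: ij tau_tau)
  have l': "letter_of u (- x) = Black i" "letter_of u (- y) = Black j"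
    using letter_of_uminus[OF assms(1)] l L by (auto simp: ij)
  let ?C = "word_of u C"
  have C: "word_ok ?C" using word_ok_word_of[OF assms(1)] L by (auto simp: word_of_Cons)
  have es: "elementary (word_of u (a # b # C)) ?s =
      reflect (vertex (letter_of u a)) (letter_of u b # ?C)" for a b
    by (simp add: word_of_Cons)
  have et: "elementary (word_of u (a # b # C)) ?t =
      padded [] (Cross (letter_of u a) (letter_of u b)) ?C" for a b
    by (simp add: word_of_Cons)
  have "deq OKLRW (chain_diagram u L [?t, ?s, ?t, ?s])
    (Comp (padded [] (Cross (Black (\<tau> j)) (Black (\<tau> i))) ?C) (Comp (reflect j (Black (\<tau> i) # ?C))
      (Comp (padded [] (Cross (Black (\<tau> i)) (Black j)) ?C) (reflect i (Black j # ?C)))))"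
    using chain_diagram_Cons_cong[OF assms(1) c2, OF chain_diagram_Cons_cong[where K = "- x # - y #
      C",
        OF _ _ chain_diagram_Cons_cong[where K = "- x # - y # C", OF _ _ chain_diagram_single]]]
      c2 st unfolding L
    by (simp only: descending.simps ms mt es et simp_thms l l' ij' vertex.simps minus_minus)
  also have "deq OKLRW \<dots> 
    (Comp (reflect i (Black (\<tau> j) # ?C)) (Comp (padded [] (Cross (Black (\<tau> j)) (Black i)) ?C)
      (Comp (reflect j (Black i # ?C)) (padded [] (Cross (Black i) (Black j)) ?C))))"
    using ij' C by (intro deq_mirror_braid)
  also have "deq OKLRW \<dots> (chain_diagram u L [?s, ?t, ?s, ?t])"
    using chain_diagram_Cons_cong[OF assms(1) c1, OF chain_diagram_Cons_cong[where K = "- x # - y #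
      C",
        OF _ _ chain_diagram_Cons_cong[where K = "- x # - y # C", OF _ _ chain_diagram_single]]]
      c1 st unfolding L
    by - (rule deq_sym, simp only: descending.simps ms mt es et simp_thms l l' ij' vertex.simps
      minus_minus)
  finally show ?thesis
    unfolding confluent_def using c1 c2
    by (intro exI[of _ "[?t, ?s, ?t]"] exI[of _ "[?s, ?t, ?s]"] exI[of _ "- x # - y # C"])
       (auto intro: deq_mod_deq deq_sym simp del: chain_diagram.simps descending.simps)
qed

lemma confluent_descents:
  assumes "state u L" "descent s L" "descent t L" "s \<noteq> t"
  shows "confluent u L s t"
proof -
  have flip: "confluent u L Flip (Swap l)" if "descent Flip L" "descent (Swap l) L" for l
    using confluent_flip_far[OF assms(1) that] confluent_flip_swap[OF assms(1) that(1)] that(2)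
    by (cases "l = 0") auto
  have swap: "confluent u L (Swap k) (Swap l)" if "descent (Swap k) L" "descent (Swap l) L" "k < l"
    for k l
    using confluent_far[OF assms(1) that(1,2)] confluent_adjacent[OF assms(1) that(1)] that(2,3)
    by (cases "l = Suc k") auto
  show ?thesis
  proof (cases s)
    case s: Flip
    then show ?thesis using flip assms by (cases t) auto
  next
    case s: (Swap k)
    show ?thesis
    proof (cases t)
      case Flip
      then show ?thesis using flip assms s confluent_sym by blast
    next
      case (Swap l)
      then show ?thesis using swap assms s confluent_sym by (metis linorder_neqE_nat)
    qed
  qed
qed

text \<open>Matsumoto's theorem, up to diagrams with fewer crossings.\<close>

theorem reduced_diagrams_deq_mod:
  assumes "state u L" "descending L ss (standard (length u))" "descending L ts (standard (length
    u))"
  shows "deq_mod (inversions L) (chain_diagram u L ss) (chain_diagram u L ts)"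
  using assms
proof (induction "inversions L" arbitrary: L ss ts rule: less_induct)
  case less
  show ?case
  proof (cases "ss = [] \<or> ts = []")
    case True
    then have "inversions L = 0" using less.prems(2,3) by auto
    then have "ss = []" "ts = []"
      using inversions_descending[OF less.prems(2)] inversions_descending[OF less.prems(3)] by auto
    then show ?thesis using chain_diagram_props[OF less.prems(1,2)] by (auto intro: deq_mod_refl)
  next
    case False
    then obtain s ss' t ts' where st: "ss = s # ss'" "ts = t # ts'" by (meson list.exhaust)
    \<comment> \<open>For two words with the same first generator the tails are compared by the
      induction hypothesis; the generator in front raises the bound by exactly one.\<close>
    have step: "deq_mod (inversions L) (chain_diagram u L (r # rs)) (chain_diagram u L (r # rs'))"
      if "descending L (r # rs) (standard (length u))" "descending L (r # rs') (standard (length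
        u))"
      for r rs rs'
    proof -
      have r: "descent r L" using that by simp
      have s: "state u (move r L)" using state_descent[OF less.prems(1) r] by blast
      have "deq_mod (inversions (move r L)) (chain_diagram u (move r L) rs) (chain_diagram u (move r
        L) rs')"
        using less.hyps[of "move r L"] inversions_descent[OF r] s that by simp
      then have "deq_mod (inversions (move r L) + crossings (elementary (word_of u (move r L)) r))
        (chain_diagram u L (r # rs)) (chain_diagram u L (r # rs'))"
        unfolding chain_diagram.simps
        using elementary_state[OF less.prems(1) r] chain_diagram_props[OF s] that
        by (intro deq_mod_comp_left) auto
      then show ?thesis using elementary_state[OF less.prems(1) r] inversions_descent[OF r] by simp
    qed
    show ?thesis
    proof (cases "s = t")
      case True
      then show ?thesis using step less.prems st by blast
    next
      case False
      have "confluent u L s t" using confluent_descents less.prems st False by simp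
      then obtain s1 t1 K where K: "descending L (s # s1) K" "descending L (t # t1) K"
        "deq_mod (Suc (length s1)) (chain_diagram u L (s # s1)) (chain_diagram u L (t # t1))"
        unfolding confluent_def by blast
      have sK: "state u K" using state_descending K(1) less.prems(1) by blast
      \<comment> \<open>A common completion \<open>r\<close> below the confluence point
        \<open>K\<close> links the two given words: \<open>ss\<close> is compared with
        \<open>(s # s1) @ r\<close>, this with \<open>(t # t1) @ r\<close>, and the latter with
        \<open>ts\<close>.\<close>
      obtain r where r: "descending K r (standard (length u))"
        using descending_standard_exists[OF sK] by blast
      have s1: "descending L ((s # s1) @ r) (standard (length u))"
        and t1: "descending L ((t # t1) @ r) (standard (length u))"
        using K r descending_append by blast+
      note cK = chain_diagram_props[OF sK r]
      have len: "inversions L = Suc (length s1) + length r"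
        using inversions_descending[OF s1] by simp
      have "deq_mod (inversions L) (chain_diagram u L ss) (chain_diagram u L ((s # s1) @ r))"
        using step[of s ss' "s1 @ r"] less.prems(2) s1 st by simp
      also have "deq OKLRW \<dots> (Comp (chain_diagram u L (s # s1)) (chain_diagram u K r))"
        using less.prems(1) K(1) r by (rule chain_diagram_append)
      also have "deq_mod (inversions L) \<dots> (Comp (chain_diagram u L (t # t1)) (chain_diagram u K r))"
        unfolding len using deq_mod_comp_right[OF K(3) cK(1)] cK chain_diagram_props[OF
          less.prems(1) K(1)]
        by simp
      also have "deq OKLRW \<dots> (chain_diagram u L ((t # t1) @ r))"
        using less.prems(1) K(2) r by (rule deq_sym[OF chain_diagram_append])
      also have "deq_mod (inversions L) \<dots> (chain_diagram u L ts)"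
        using step[of t "t1 @ r" ts'] less.prems(3) t1 st by simp
      finally show ?thesis .
    qed
  qed
qed

end


section \<open>Normal forms\<close>

context mirror_quiver
begin

definition spanned :: "'q diagram set \<Rightarrow> 'q lincomb \<Rightarrow> bool" where
  "spanned S x \<longleftrightarrow> (\<exists>y. Poly_Mapping.keys y \<subseteq> S \<and> is_null OKLRW (x - y))"

lemma spanned_null: "is_null OKLRW x \<Longrightarrow> spanned S x"
  unfolding spanned_def by (rule exI[of _ 0]) simp

lemma spanned_dg: "d \<in> S \<Longrightarrow> spanned S (dg d)"
  unfolding spanned_def by (rule exI[of _ "dg d"]) (simp add: null_zero)

lemma spanned_add:
  assumes "spanned S x" "spanned S y"
  shows "spanned S (x + y)"
proof -
  obtain x' y' where *: "Poly_Mapping.keys x' \<subseteq> S" "is_null OKLRW (x - x')"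
    "Poly_Mapping.keys y' \<subseteq> S" "is_null OKLRW (y - y')"
    using assms unfolding spanned_def by blast
  then have "is_null OKLRW ((x - x') + (y - y'))" by (intro null_add)
  moreover have "Poly_Mapping.keys (x' + y') \<subseteq> S" using keys_add[of x' y'] * by blast
  ultimately show ?thesis unfolding spanned_def by (metis add_diff_add)
qed

lemma spanned_smul:
  assumes "spanned S x"
  shows "spanned S (smul a x)"
proof -
  obtain y where "Poly_Mapping.keys y \<subseteq> S" "is_null OKLRW (x - y)"
    using assms unfolding spanned_def by blast
  then have "Poly_Mapping.keys (smul a y) \<subseteq> S" "is_null OKLRW (smul a x - smul a y)"
    using keys_smul null_smul[of Q \<tau> OKLRW "x - y" a] by (auto simp: smul_diff)
  then show ?thesis unfolding spanned_def by blast
qed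

lemma spanned_induct [consumes 1, case_names null add smul dg]:
  assumes "spanned S x"
    and null: "\<And>x. is_null OKLRW x \<Longrightarrow> P x"
    and add: "\<And>x y. \<lbrakk>P x; P y\<rbrakk> \<Longrightarrow> P (x + y)"
    and smul: "\<And>a x. P x \<Longrightarrow> P (smul a x)"
    and dg: "\<And>d. d \<in> S \<Longrightarrow> P (dg d)"
  shows "P x"
proof -
  obtain y where y: "Poly_Mapping.keys y \<subseteq> S" "is_null OKLRW (x - y)"
    using assms(1) unfolding spanned_def by blast
  have "P y"
    by (rule lincomb_induct[of P y]) (use y in \<open>auto intro: null null_zero add smul dg\<close>)
  with y(2) have "P ((x - y) + y)" by (intro add) (rule null)
  then show ?thesis by simp
qed

lemma spanned_trans:
  "\<lbrakk>spanned S x; \<And>d. d \<in> S \<Longrightarrow> spanned T (dg d)\<rbrakk> \<Longrightarrow> spanned T x"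
  by (induction rule: spanned_induct) (auto intro: spanned_null spanned_add spanned_smul)

lemma spanned_mono: "\<lbrakk>spanned S x; S \<subseteq> T\<rbrakk> \<Longrightarrow> spanned T x"
  by (rule spanned_trans) (auto intro: spanned_dg)

lemma spanned_comp_left:
  assumes "spanned S x" "is_valid OKLRW f" "\<And>d. d \<in> S \<Longrightarrow> spanned T (dg f \<odot> dg d)"
  shows "spanned T (dg f \<odot> x)"
  using assms(1)
proof (induction rule: spanned_induct)
  case (null x)
  then show ?case using assms(2) by (intro spanned_null null_comp_left)
next
  case (add x y)
  then show ?case by (simp add: comp_add_right spanned_add)
next
  case (smul a x)
  then show ?case by (simp add: comp_smul_right spanned_smul)
next
  case (dg d)
  then show ?case by (rule assms(3))
qed

lemma spanned_deq: "\<lbrakk>deq OKLRW d e; spanned S (dg e)\<rbrakk> \<Longrightarrow> spanned S (dg d)"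
  using spanned_add[OF spanned_null[of "dg d - dg e"], of S "dg e"] by (simp add: deq_def)

lemma lower_iff_spanned: "lower k u w x \<longleftrightarrow>
    spanned {d. is_valid OKLRW d \<and> src d = u \<and> target d = w \<and> crossings d < k} x"
  unfolding lower_def spanned_def few_def by (simp add: subset_iff Ball_def)

text \<open>The lowest factor \<open>e\<close> carries the dots. Asking only that it has no
  crossings, and not for a monomial in a fixed order, makes the set stable under adding a dot at the
  bottom.\<close>

definition normal_forms :: "nat \<Rightarrow> 'q word \<Rightarrow> 'q word \<Rightarrow> 'q diagram set" where
  "normal_forms k u w = {Comp (chain_diagram u L ss) e | L ss e.
     state u L \<and> word_of u L = w \<and> descending L ss (standard (length u)) \<and> inversions L < k \<and>
     is_valid OKLRW e \<and> src e = u \<and> target e = u \<and> crossings e = 0}"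

text \<open>The scalar \<open>a\<close> is 1, except that it is -1 when the dot sits on the strand
  being reflected. The position changes from \<open>m\<close> to \<open>m'\<close> when the dot sits
  on one of two crossing strands.\<close>

lemma dot_elementary:
  assumes "word_ok w" "layer_ok w s" "m < length w" "\<not> is_red (act bar s w ! m)"
  shows "\<exists>m' a. m' < length w \<and> \<not> is_red (w ! m') \<and> lower 1 w (act bar s w)
    (dg (Comp (dot_at (act bar s w) m) (elementary w s)) - smul a (dg (Comp (elementary w s) (dot_at
      w m'))))"
proof -
  have *: ?thesis if "deq_mod 1 (Comp (dot_at (act bar s w) m) (elementary w s)) (Comp (elementary w
    s) (dot_at w m'))"
    "m' < length w" "\<not> is_red (w ! m')" for m'
    using that elementary_props[OF assms(1,2)] dot_at_props[of "act bar s w" m] assms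
    by (intro exI[of _ m'] exI[of _ 1])
       (auto simp: deq_mod_def)
  show ?thesis
  proof (cases s)
    case (Swap k)
    then obtain A a b B where w: "w = A @ a # b # B" "length A = k"
      using assms(2) split_Suc_nth[of k w] by auto
    have t: "act bar s w = A @ b # a # B" unfolding Swap w(1) by (rule act_Swap_split[OF w(2)])
    have el: "elementary w s = padded A (Cross a b) B"
      unfolding Swap w(1) by (rule elementary_Swap_split[OF w(2)])
    have ok: "word_ok A" "word_ok B" "letter_ok Q a" "letter_ok Q b" using assms(1) w by auto
    have red: "\<not> (is_red a \<and> is_red b)" using assms(2) w Swap by (auto simp: nth_append)
    then have vx: "is_valid KLRW (Cross a b)" using ok by (auto simp: is_red_iff)
    consider "m < k" | "m = k" | "m = Suc k" | "Suc k < m" by linarith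
    then show ?thesis
    proof cases
      case 1
      obtain A1 c A2 where A: "A = A1 @ c # A2" "length A1 = m" using split_nth[of m A] 1 w(2) by
        auto
      then obtain i where i: "c = Black i" using assms(4) t by (auto simp: nth_append not_is_red)
      have "deq OKLRW (Comp (padded A1 (Dot i) (A2 @ target (Cross a b) @ B)) (padded (A1 @ src (Dot
        i) @ A2) (Cross a b) B))
        (Comp (padded (A1 @ target (Dot i) @ A2) (Cross a b) B) (padded A1 (Dot i) (A2 @ src (Cross
          a b) @ B)))"
        using ok A i vx by (intro deq_commute) auto
      then have "deq_mod 1 (Comp (dot_at (act bar s w) m) (elementary w s)) (Comp (elementary w s)
        (dot_at w m))"
        using A i w dot_at_split[OF A(2), of i] unfolding t el by (auto intro: deq_mod_deq)
      moreover have "\<not> is_red (w ! m)" using A i w by (auto simp: nth_append)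
      ultimately show ?thesis using assms(3) by (intro *)
    next
      case 2
      then obtain j where j: "b = Black j" using assms(4) t w(2) by (auto simp: nth_append
        not_is_red)
      have "deq_mod 1 (Comp (padded A (Dot j) (a # B)) (padded A (Cross a (Black j)) B))
        (Comp (padded A (Cross a (Black j)) B) (padded (A @ [a]) (Dot j) B))"
        using ok j by (intro deq_mod_dot_left) auto
      then show ?thesis
        using *[of "Suc k"] j w 2 dot_at_split[of A k j] dot_at_split[of "A @ [a]" "Suc k" j B]
          unfolding t el
        by (auto simp: nth_append)
    next
      case 3
      then obtain i where i: "a = Black i" using assms(4) t w(2) by (auto simp: nth_append
        not_is_red)
      have "deq_mod 1 (Comp (padded (A @ [b]) (Dot i) B) (padded A (Cross (Black i) b) B))
        (Comp (padded A (Cross (Black i) b) B) (padded A (Dot i) (b # B)))"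
        using ok i by (intro deq_mod_dot_right) auto
      then show ?thesis
        using *[of k] i w 3 dot_at_split[of A k i] dot_at_split[of "A @ [b]" "Suc k" i B] unfolding
          t el
        by (auto simp: nth_append)
    next
      case 4
      have "m - Suc (Suc k) < length B" using 4 assms(3) w by simp
      then obtain B1 c B2 where B: "B = B1 @ c # B2" "length B1 = m - Suc (Suc k)"
        using split_nth[of "m - Suc (Suc k)" B] by auto
      have len: "length (A @ [b, a] @ B1) = m" "length (A @ [a, b] @ B1) = m" using B w 4 by auto
      have "(A @ b # a # B) ! m = c" "w ! m = c"
        using len B nth_append_length[of "A @ [b, a] @ B1" c B2] nth_append_length[of "A @ [a, b] @
          B1" c B2] w
        by auto
      then obtain i where i: "c = Black i" "\<not> is_red (w ! m)" using assms(4) t by (auto simp: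
        not_is_red)
      have "deq OKLRW (Comp (padded A (Cross a b) (B1 @ target (Dot i) @ B2)) (padded (A @ src
        (Cross a b) @ B1) (Dot i) B2))
        (Comp (padded (A @ target (Cross a b) @ B1) (Dot i) B2) (padded A (Cross a b) (B1 @ src (Dot
          i) @ B2)))"
        using ok B i vx by (intro deq_commute) auto
      then show ?thesis
        using *[of m] B i w assms(3) dot_at_split[OF len(1), of i B2] dot_at_split[OF len(2), of i
          B2] unfolding t el
        by (auto intro: deq_mod_deq deq_sym)
    qed
  next
    case Flip
    then obtain a B where w: "w = a # B" using assms(2) by (cases w) auto
    then obtain i where i: "a = Black i" using assms(2) Flip by (auto simp: not_is_red)
    have t: "act bar s w = Black (\<tau> i) # B" and el: "elementary w s = reflect i B"
      using Flip w i by auto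
    have ok: "i \<in> verts Q" "word_ok B" using assms(1) w i by auto
    show ?thesis
    proof (cases m)
      case 0
      have d: "dot_at (Black j # B) 0 = padded [] (Dot j) B" for j
        using dot_at_split[of "[]" 0 j B] by simp
      have "is_null OKLRW (dg (Comp (dot_at (act bar s w) m) (elementary w s)) - smul (- 1) (dg
        (Comp (elementary w s) (dot_at w m))))"
        using null_mirror_dot[OF ok] unfolding t el
        by (simp add: 0 w i d smul_minus_one add.commute)
      then show ?thesis using 0 w i
        by (intro exI[of _ 0] exI[of _ "- 1"]) (auto intro: lower_null)
    next
      case (Suc n)
      then obtain B1 c B2 where B: "B = B1 @ c # B2" "length B1 = n"
        using assms(3) w split_nth[of n B] by auto
      then obtain j where j: "c = Black j" using assms(4) t Suc by (auto simp: not_is_red)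
      have len: "length (x # B1) = m" for x using B Suc by simp
      have "deq OKLRW (Comp (Tensor (Mirror i) (Strands (B1 @ target (Dot j) @ B2))) (padded (src
        (Mirror i) @ B1) (Dot j) B2))
          (Comp (padded (target (Mirror i) @ B1) (Dot j) B2) (Tensor (Mirror i) (Strands (B1 @ src
            (Dot j) @ B2))))"
        using ok B j by (intro deq_commute_first) auto
      from deq_mod_deq[OF deq_sym[OF this], of 1]
      have "deq_mod 1 (Comp (dot_at (act bar s w) m) (elementary w s)) (Comp (elementary w s)
        (dot_at w m))"
        using B i j w Suc dot_at_split[OF len, of "Black i" j B2] dot_at_split[OF len, of "Black (\<tau>
          i)" j B2]
        unfolding t el by simp
      moreover have "\<not> is_red (w ! m)" using B i j w Suc by auto
      ultimately show ?thesis using assms(3) by (intro *)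
    qed
  qed
qed

text \<open>A dot at the top of a chain slides to its bottom. Each correction replaces one generator
  by something without crossings, so it has fewer than \<open>length ss\<close> crossings; the signs
  from the mirrors multiply.\<close>

lemma dot_chain_diagram:
  assumes "state u L" "descending L ss K" "m < length L" "\<not> is_red (word_of u L ! m)"
  shows "\<exists>m' a. m' < length K \<and> \<not> is_red (word_of u K ! m') \<and>
    lower (length ss) (word_of u K) (word_of u L)
      (dg (Comp (dot_at (word_of u L) m) (chain_diagram u L ss))
       - smul a (dg (Comp (chain_diagram u L ss) (dot_at (word_of u K) m'))))"
  using assms
proof (induction ss arbitrary: L m)
  case Nil
  let ?w = "word_of u L"
  have d: "is_valid OKLRW (dot_at ?w m)" "src (dot_at ?w m) = ?w" "target (dot_at ?w m) = ?w"
    using dot_at_props[of ?w m] word_ok_word_of[OF Nil.prems(1)] Nil.prems by auto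
  have "deq OKLRW (Comp (dot_at ?w m) (Strands ?w)) (Comp (Strands ?w) (dot_at ?w m))"
    using d by (metis deq_sym deq_trans deq_unit_left deq_unit_right)
  then have "lower 0 ?w ?w (dg (Comp (dot_at ?w m) (Strands ?w)) - smul 1 (dg (Comp (Strands ?w)
    (dot_at ?w m))))"
    by (intro lower_null) (simp add: deq_def)
  moreover have "K = L" using Nil by simp
  ultimately show ?case using Nil.prems by (auto intro!: exI[of _ m] exI[of _ "1 :: complex"])
next
  case (Cons s ss)
  let ?L = "move s L"
  let ?w = "word_of u L" and ?w' = "word_of u ?L" and ?v = "word_of u K"
  let ?e = "elementary ?w' s" and ?c = "chain_diagram u ?L ss"
  have s: "descent s L" "descending ?L ss K" using Cons.prems by auto
  note st = state_descent[OF Cons.prems(1) s(1)]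
  have w: "act bar s ?w' = ?w" using state_move(2)[OF st(1,3)] st(4) by simp
  note e = elementary_state[OF Cons.prems(1) s(1)]
  note c = chain_diagram_props[OF st(1) s(2)]
  have d: "is_valid OKLRW (dot_at ?w m)" "src (dot_at ?w m) = ?w" "target (dot_at ?w m) = ?w"
    using dot_at_props[of ?w m] word_ok_word_of[OF Cons.prems(1)] Cons.prems by auto
  obtain m1 a1 where 1: "m1 < length ?w'" "\<not> is_red (?w' ! m1)"
    "lower 1 ?w' ?w (dg (Comp (dot_at ?w m) ?e) - smul a1 (dg (Comp ?e (dot_at ?w' m1))))"
    using dot_elementary[OF word_ok_word_of[OF st(1)] st(3), of m] Cons.prems unfolding w by auto
  obtain m2 a2 where 2: "m2 < length K" "\<not> is_red (?v ! m2)"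
    "lower (length ss) ?v ?w' (dg (Comp (dot_at ?w' m1) ?c) - smul a2 (dg (Comp ?c (dot_at ?v
      m2))))"
    using Cons.IH[OF st(1) s(2), of m1] 1 by auto
  have d1: "is_valid OKLRW (dot_at ?w' m1)" "src (dot_at ?w' m1) = ?w'" "target (dot_at ?w' m1) =
    ?w'"
    using dot_at_props[of ?w' m1] word_ok_word_of[OF st(1)] 1 by auto
  have d2: "is_valid OKLRW (dot_at ?v m2)" "src (dot_at ?v m2) = ?v" "target (dot_at ?v m2) = ?v"
    using dot_at_props[of ?v m2] word_ok_word_of[OF state_descending[OF s(2) st(1)]] 2 by auto
  let ?k = "length (s # ss)"
  let ?x0 = "dg (Comp (dot_at ?w m) (Comp ?e ?c))" and ?x1 = "dg (Comp (Comp (dot_at ?w m) ?e) ?c)"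
  let ?x2 = "dg (Comp (Comp ?e (dot_at ?w' m1)) ?c)" and ?x3 = "dg (Comp ?e (Comp (dot_at ?w' m1)
    ?c))"
  let ?x4 = "dg (Comp ?e (Comp ?c (dot_at ?v m2)))" and ?x5 = "dg (Comp (Comp ?e ?c) (dot_at ?v
    m2))"
  have null: "is_null OKLRW (?x1 - ?x0)" "is_null OKLRW (?x2 - ?x3)" "is_null OKLRW (?x5 - ?x4)"
    using deq_comp_assoc[of OKLRW "dot_at ?w m" ?e ?c] deq_comp_assoc[of OKLRW ?e "dot_at ?w' m1"
      ?c]
      deq_comp_assoc[of OKLRW ?e ?c "dot_at ?v m2"] d e c d1 d2
    by (auto simp: deq_def)
  have "lower (1 + crossings ?c) ?v ?w ((dg (Comp (dot_at ?w m) ?e) - smul a1 (dg (Comp ?e (dot_at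
    ?w' m1)))) \<odot> dg ?c)"
    using lower_comp_right[OF 1(3) c(1,3)] c by simp
  then have l1: "lower ?k ?v ?w (?x1 - smul a1 ?x2)"
    using d e c d1 by (simp add: comp_diff_left comp_smul_left comp_dg)
  have "lower (length ss + crossings ?e) ?v ?w (dg ?e \<odot> (dg (Comp (dot_at ?w' m1) ?c) - smul a2 (dg
    (Comp ?c (dot_at ?v m2)))))"
    using lower_comp_left[OF 2(3) e(1,2)] e by simp
  then have l2: "lower ?k ?v ?w (?x3 - smul a2 ?x4)"
    using d e c d1 d2 by (simp add: comp_diff_right comp_smul_right comp_dg)
  \<comment> \<open>The sum telescopes to \<open>?x0 - smul (a1 * a2) ?x5\<close>: the null terms
    reassociate composites, the others slide the dot through the top generator and through the
    rest.\<close>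
  have "lower ?k ?v ?w ((?x1 - smul a1 ?x2) - (?x1 - ?x0) + smul a1 (?x2 - ?x3)
      + smul a1 (?x3 - smul a2 ?x4) - smul (a1 * a2) (?x5 - ?x4))"
    by (intro lower_add lower_diff l1 l2 lower_smul lower_null null)
  then have "lower ?k ?v ?w (?x0 - smul (a1 * a2) ?x5)"
    by (simp add: smul_diff algebra_simps)
  then show ?case using 2(1,2) by auto
qed

lemma lower_elementary_twice:
  assumes "word_ok w" "layer_ok w s"
  shows "lower 1 w w (dg (Comp (elementary (act bar s w) s) (elementary w s)))"
proof (cases s)
  case (Swap k)
  then obtain A a b B where w: "w = A @ a # b # B" "length A = k"
    using assms(2) split_Suc_nth[of k w] by auto
  have t: "act bar s w = A @ b # a # B" unfolding Swap w(1) by (rule act_Swap_split[OF w(2)])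
  have el: "elementary w s = padded A (Cross a b) B" "elementary (act bar s w) s = padded A (Cross b
    a) B"
    unfolding t unfolding Swap w(1) by (rule elementary_Swap_split[OF w(2)])+
  have red: "\<not> (is_red a \<and> is_red b)" using assms(2) w Swap by (auto simp: nth_append)
  have "lower 1 (A @ [a, b] @ B) (A @ [a, b] @ B) (dg (Comp (padded A (Cross b a) B) (padded A
    (Cross a b) B)))"
    using assms(1) red w by (intro lower_bigon) auto
  then show ?thesis unfolding el unfolding w by simp
next
  case Flip
  then obtain a B where w: "w = a # B" using assms(2) by (cases w) auto
  then obtain i where i: "a = Black i" using assms(2) Flip by (auto simp: not_is_red)
  show ?thesis using lower_mirror_twice[of i B] assms(1) w i Flip by simp
qed

lemma normal_forms_mono: "k \<le> l \<Longrightarrow> normal_forms k u w \<subseteq> normal_forms l u w"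
  unfolding normal_forms_def by fastforce

text \<open>The induction on the filtration absorbs all corrections, and inside it an induction on
  layers builds a diagram from below. A generator on top either lengthens the reduced word or, after
  a change of the reduced word, produces a double generator with fewer crossings; a dot on top
  slides down to the other dots.\<close>

theorem lower_spanned_normal_forms:
  assumes "word_ok u" "lower k u w x"
  shows "spanned (normal_forms k u w) x"
  using assms(2)
proof (induction k arbitrary: w x)
  case 0
  then have "is_null OKLRW x" by (auto simp: lower_def few_def)
  then show ?case by (rule spanned_null)
next
  case (Suc k)
  let ?n = "standard (length u)"
  have lay: "spanned (normal_forms (Suc k) u (target d)) (dg d)" if "layered u d" "crossings d \<le> k"
    for d
    using that
  proof (induction rule: layered.induct)
    case layered_strands
    have st: "state u ?n" using assms(1) by (rule state_standard)
    have "Comp (chain_diagram u ?n []) (Strands u) \<in> normal_forms (Suc k) u u"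
      unfolding normal_forms_def using st assms(1)
      by - (rule CollectI, rule exI[of _ ?n], rule exI[of _ "[]"], rule exI[of _ "Strands u"], simp)
    then have mem: "Comp (Strands u) (Strands u) \<in> normal_forms (Suc k) u u" by simp
    have "deq OKLRW (Strands u) (Comp (Strands u) (Strands u))"
      by (rule deq_sym, rule deq_unit_left) (use assms(1) in simp_all)
    from spanned_deq[OF this spanned_dg[OF mem]] show ?case by simp
  next
    case (layered_elementary d s)
    have d: "is_valid OKLRW d" "src d = u" using layered_props layered_elementary assms(1) by auto
    note e = elementary_props[OF conjunct2[OF word_ok_src_target[OF d(1)]]
      layered_elementary.hyps(2)]
    have k: "0 < k" "crossings d < k" using layered_elementary.prems e by auto
    \<comment> \<open>Without its top generator the diagram has fewer than \<open>k\<close>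
      crossings, so the outer hypothesis gives normal forms with fewer than \<open>k\<close>
      inversions, which leaves room for one more.\<close>
    have "lower k u (target d) (dg d)" using d k by (intro lower_few) (simp add: few_dg)
    then have "spanned (normal_forms k u (target d)) (dg d)" by (rule Suc.IH)
    then have "spanned (normal_forms (Suc k) u (act bar s (target d))) (dg (elementary (target d) s)
      \<odot> dg d)"
    proof (rule spanned_comp_left[OF _ e(1)])
      fix f assume "f \<in> normal_forms k u (target d)"
      then obtain L ss g where f: "f = Comp (chain_diagram u L ss) g" "state u L" "word_of u L =
        target d"
         "descending L ss ?n" "inversions L < k" "is_valid OKLRW g" "src g = u" "target g = u"
           "crossings g = 0"
        unfolding normal_forms_def by blast
      let ?e = "elementary (target d) s" and ?c = "chain_diagram u L ss"
      note c = chain_diagram_props[OF f(2,4)]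
      have ok: "layer_ok (word_of u L) s" using layered_elementary.hyps(2) f(3) by simp
      have assoc: "deq OKLRW (Comp ?e (Comp ?c g)) (Comp (Comp ?e ?c) g)"
        using e c f by (intro deq_sym[OF deq_comp_assoc]) auto
      have "spanned (normal_forms (Suc k) u (act bar s (target d))) (dg (Comp ?e (Comp ?c g)))"
      proof (cases "descent s L")
        case False
        note m = state_move[OF f(2) ok]
        have s: "descent s (move s L)" using ascent_descent[OF f(2) ok False] .
        have mm: "move s (move s L) = L" using ok by (intro move_move) auto
        have "descending (move s L) (s # ss) ?n" using s mm f(4) by simp
        moreover have cd: "chain_diagram u (move s L) (s # ss) = Comp ?e ?c" using mm f(3) by simp
        moreover have "inversions (move s L) < Suc k" using inversions_descent[OF s] mm f(5) by simp
        moreover have "word_of u (move s L) = act bar s (target d)" using m(2) f(3) by simp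
        ultimately have "Comp (Comp ?e ?c) g \<in> normal_forms (Suc k) u (act bar s (target d))"
          unfolding normal_forms_def cd[symmetric] using m(1) f(6,7,8,9) by blast
        then show ?thesis by (intro spanned_deq[OF assoc] spanned_dg)
      next
        case True
        note st = state_descent[OF f(2) True]
        \<comment> \<open>As \<open>s\<close> is a descent, the reduced word can be exchanged for
          one starting with \<open>s\<close>. The two copies of \<open>s\<close> on top cancel
          modulo fewer crossings, and both errors stay below \<open>Suc (inversions L)\<close>,
          which is at most \<open>k\<close>.\<close>
        obtain ts where ts: "descending (move s L) ts ?n"
          using descending_standard_exists[OF st(1)] by blast
        let ?e' = "elementary (word_of u (move s L)) s" and ?c' = "chain_diagram u (move s L) ts"
        note c' = chain_diagram_props[OF st(1) ts]
        note e' = elementary_state[OF f(2) True]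
        have w: "word_of u (move s L) = act bar s (target d)" using st(2) f(3) by simp
        have "deq_mod (inversions L) ?c (Comp ?e' ?c')"
          using reduced_diagrams_deq_mod[OF f(2,4), of "s # ts"] True ts by simp
        then have "deq_mod (inversions L + crossings ?e) (Comp ?e ?c) (Comp ?e (Comp ?e' ?c'))"
          using e f c by (intro deq_mod_comp_left) auto
        also have "deq OKLRW (Comp ?e (Comp ?e' ?c')) (Comp (Comp ?e ?e') ?c')"
          using e e' c' f by (intro deq_sym[OF deq_comp_assoc]) auto
        finally have 1: "deq_mod (Suc (inversions L)) (Comp ?e ?c) (Comp (Comp ?e ?e') ?c')"
          using e by simp
        have bigon: "lower 1 (word_of u (move s L)) (word_of u (move s L)) (dg (Comp ?e ?e'))"
          using lower_elementary_twice[OF word_ok_word_of[OF st(1)] st(3)]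
          unfolding state_move(2)[OF st(1,3), symmetric] st(4) f(3) .
        have "lower (1 + crossings ?c') u (act bar s (target d)) (dg (Comp ?e ?e') \<odot> dg ?c')"
          using lower_comp_right[OF bigon c'(1,3)] c' w by simp
        moreover have "1 + crossings ?c' \<le> Suc (inversions L)"
          using c'(4) inversions_descending[OF ts] inversions_descent[OF True] by simp
        ultimately have "lower (Suc (inversions L)) u (act bar s (target d)) (dg (Comp (Comp ?e ?e')
          ?c'))"
          using lower_mono e e' c' by (simp add: comp_dg)
        then have "lower (Suc (inversions L)) u (act bar s (target d)) (dg (Comp ?e ?c))"
          using lower_deq_mod[OF 1] e c f by simp
        then have "lower (Suc (inversions L) + crossings g) (src g) (act bar s (target d)) (dg (Comp
          ?e ?c) \<odot> dg g)"
          using f by (intro lower_comp_right)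
        then have "lower k u (act bar s (target d)) (dg (Comp (Comp ?e ?c) g))"
          using lower_mono[of "Suc (inversions L)" _ _ _ k] f c by (simp add: comp_dg)
        then have "spanned (normal_forms k u (act bar s (target d))) (dg (Comp (Comp ?e ?c) g))"
          by (rule Suc.IH)
        then have "spanned (normal_forms (Suc k) u (act bar s (target d))) (dg (Comp (Comp ?e ?c)
          g))"
          by (rule spanned_mono) (rule normal_forms_mono, simp)
        then show ?thesis by (rule spanned_deq[OF assoc])
      qed
      then show "spanned (normal_forms (Suc k) u (act bar s (target d))) (dg ?e \<odot> dg f)"
        using e f c by (simp add: comp_dg)
    qed
    then show ?case using e by (simp add: comp_dg)
  next
    case (layered_dot d m)
    have d: "is_valid OKLRW d" "src d = u" using layered_props layered_dot assms(1) by auto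
    note e = dot_at_props[OF conjunct2[OF word_ok_src_target[OF d(1)]] layered_dot.hyps(2,3)]
    \<comment> \<open>A dot does not change the number of crossings, so here the normal forms of
      \<open>d\<close> come from the induction on layers and not from the outer one.\<close>
    have "spanned (normal_forms (Suc k) u (target d)) (dg d)"
      using layered_dot by simp
    then have "spanned (normal_forms (Suc k) u (target d)) (dg (dot_at (target d) m) \<odot> dg d)"
    proof (rule spanned_comp_left[OF _ e(1)])
      fix f assume "f \<in> normal_forms (Suc k) u (target d)"
      then obtain L ss g where f: "f = Comp (chain_diagram u L ss) g" "state u L" "word_of u L =
        target d"
         "descending L ss ?n" "inversions L < Suc k" "is_valid OKLRW g" "src g = u" "target g = u"
           "crossings g = 0"
        unfolding normal_forms_def by blast
      let ?e = "dot_at (target d) m" and ?c = "chain_diagram u L ss"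
      note c = chain_diagram_props[OF f(2,4)]
      have len: "length ss = inversions L" using inversions_descending[OF f(4)] by simp
      have "m < length L" "\<not> is_red (word_of u L ! m)"
        using layered_dot.hyps(2,3) f(3) length_word_of[of u L] by auto
      from dot_chain_diagram[OF f(2,4) this] obtain m' a where m': "m' < length u" "\<not> is_red (u !
        m')"
        "lower (inversions L) u (target d) (dg (Comp ?e ?c) - smul a (dg (Comp ?c (dot_at u m'))))"
        using len f(3) by auto
      note e' = dot_at_props[OF assms(1) m'(1,2)]
      have "lower (inversions L + crossings g) (src g) (target d)
          ((dg (Comp ?e ?c) - smul a (dg (Comp ?c (dot_at u m')))) \<odot> dg g)"
        using m'(3) f by (intro lower_comp_right) auto
      then have "lower k u (target d) (dg (Comp (Comp ?e ?c) g) - smul a (dg (Comp (Comp ?c (dot_at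
        u m')) g)))"
        using f c e e' lower_mono[of "inversions L" _ _ _ k] by (simp add: comp_diff_left
          comp_smul_left comp_dg)
      from Suc.IH[OF this] have 1: "spanned (normal_forms (Suc k) u (target d))
          (dg (Comp (Comp ?e ?c) g) - smul a (dg (Comp (Comp ?c (dot_at u m')) g)))"
        by (rule spanned_mono) (rule normal_forms_mono, simp)
      have "Comp ?c (Comp (dot_at u m') g) \<in> normal_forms (Suc k) u (target d)"
        unfolding normal_forms_def using f e'
        by - (rule CollectI, rule exI[of _ L], rule exI[of _ ss], rule exI[of _ "Comp (dot_at u m')
          g"], simp)
      moreover have "deq OKLRW (Comp (Comp ?c (dot_at u m')) g) (Comp ?c (Comp (dot_at u m') g))"
        using f c e' by (intro deq_comp_assoc) auto
      ultimately have "spanned (normal_forms (Suc k) u (target d)) (dg (Comp (Comp ?c (dot_at u m'))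
        g))"
        by (intro spanned_deq[OF _ spanned_dg])
      from spanned_add[OF 1 spanned_smul[OF this, of a]]
      have 2: "spanned (normal_forms (Suc k) u (target d)) (dg (Comp (Comp ?e ?c) g))" by simp
      have "deq OKLRW (Comp ?e (Comp ?c g)) (Comp (Comp ?e ?c) g)"
        using e c f by (intro deq_sym[OF deq_comp_assoc]) auto
      then have "spanned (normal_forms (Suc k) u (target d)) (dg (Comp ?e (Comp ?c g)))"
        using 2 by (rule spanned_deq)
      then show "spanned (normal_forms (Suc k) u (target d)) (dg ?e \<odot> dg f)"
        using e f c by (simp add: comp_dg)
    qed
    then show ?case using e by (simp add: comp_dg)
  qed
  have "spanned (normal_forms (Suc k) u w) (dg d)"
    if d: "is_valid OKLRW d" "src d = u" "target d = w" "crossings d < Suc k" for d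
  proof -
    obtain d' where d': "layered u d'" "deq OKLRW d d'" "crossings d' = crossings d"
      using flattens_valid[OF d(1)] d(2) unfolding flattens_def by blast
    then have "spanned (normal_forms (Suc k) u (target d')) (dg d')" using lay d by simp
    then show ?thesis using d' d by (auto simp: deq_def intro: spanned_deq[OF d'(2)])
  qed
  then show ?case
    by (intro spanned_trans[OF Suc.prems[unfolded lower_iff_spanned]]) simp
qed

end


section \<open>Moving one strand\<close>

text \<open>Moving one entry is described as passing from \<open>insert_at p x R\<close> to
  \<open>insert_at q x R\<close> with the same rest \<open>R\<close>, for states as well as for
  words.\<close>

definition insert_at :: "nat \<Rightarrow> 'a \<Rightarrow> 'a list \<Rightarrow> 'a list" where
  "insert_at p x xs = take p xs @ x # drop p xs"

lemma length_insert_at [simp]: "length (insert_at p x xs) = Suc (length xs)"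
  by (simp add: insert_at_def)

lemma nth_insert_at [simp]: "p \<le> length xs \<Longrightarrow> insert_at p x xs ! p = x"
  by (simp add: insert_at_def nth_append)

lemma take_insert_at: "p \<le> length xs \<Longrightarrow> take p (insert_at p x xs) = take p xs"
  by (simp add: insert_at_def)

lemma drop_insert_at: "p \<le> length xs \<Longrightarrow> drop (Suc p) (insert_at p x xs) = drop p xs"
  by (simp add: insert_at_def)

lemma nth_insert_at_less: "\<lbrakk>j < p; p \<le> length xs\<rbrakk> \<Longrightarrow> insert_at p x xs ! j = xs ! j"
  by (simp add: insert_at_def nth_append)

lemma nth_insert_at_greater: "\<lbrakk>p \<le> j; j < length xs\<rbrakk> \<Longrightarrow> insert_at p x xs ! Suc j = xs ! j"
  by (simp add: insert_at_def nth_append)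

lemma insert_at_remove: "p < length xs \<Longrightarrow> insert_at p (xs ! p) (take p xs @ drop (Suc p) xs) = xs"
  by (simp add: insert_at_def id_take_nth_drop[symmetric])

lemma map_insert_at: "map f (insert_at p x xs) = insert_at p (f x) (map f xs)"
  by (simp add: insert_at_def take_map drop_map)

lemma count_list_insert_at: "count_list (insert_at p x xs) y = count_list xs y + of_bool (x = y)"
  using count_list_append[of "take p xs" "drop p xs" y] by (simp add: insert_at_def)

lemma set_insert_at: "set (insert_at p x xs) = insert x (set xs)"
  using set_append[of "take p xs" "drop p xs"] unfolding insert_at_def by simp

lemma insert_at_split: "\<lbrakk>p \<le> q; q \<le> length xs\<rbrakk> \<Longrightarrow>
    insert_at p x xs = take p xs @ x # take (q - p) (drop p xs) @ drop q xs"
  unfolding insert_at_def using append_take_drop_id[of "q - p" "drop p xs"]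
  by (simp only: drop_drop le_add_diff_inverse2)

lemma insert_at_split': "\<lbrakk>p \<le> q; q \<le> length xs\<rbrakk> \<Longrightarrow>
    insert_at q x xs = take p xs @ take (q - p) (drop p xs) @ x # drop q xs"
  unfolding insert_at_def using take_add[of p "q - p" xs] by simp

context mirror_quiver
begin

lemma word_of_insert_at: "word_of u (insert_at p x L) = insert_at p (letter_of u x) (word_of u L)"
  by (simp add: word_of_def map_insert_at)

lemma valid_strand_left: "is_valid KLRW (strand_left B a) \<and> src (strand_left B a) = B @ [a] \<and>
    target (strand_left B a) = a # B" if "word_ok B" "letter_ok Q a" "\<forall>b\<in>set B. \<not> (is_red a \<and> is_red
      b)"
  using that by (induction B) (auto simp: is_red_iff)

lemma valid_strand_right: "is_valid KLRW (strand_right a B) \<and> src (strand_right a B) = a # B \<and>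
    target (strand_right a B) = B @ [a]" if "word_ok B" "letter_ok Q a" "\<forall>b\<in>set B. \<not> (is_red a \<and>
      is_red b)"
  using that by (induction B) (auto simp: is_red_iff)

text \<open>Generators are listed from the top. There \<open>x\<close> moves right through the
  smaller entries of \<open>B\<close>, one descent each; read upwards, the strand goes left.\<close>

lemma chain_strand_left:
  assumes "state u (A @ x # B @ C)" "\<forall>y\<in>set B. y < x" "\<not> is_red (letter_of u x)"
  shows "\<exists>ss. descending (A @ x # B @ C) ss (A @ B @ x # C) \<and>
    deq OKLRW (chain_diagram u (A @ x # B @ C) ss)
      (padded (word_of u A) (strand_left (word_of u B) (letter_of u x)) (word_of u C))"
  using assms
proof (induction B arbitrary: A)
  case Nil
  then have "word_ok (word_of u A @ [letter_of u x] @ word_of u C)"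
    using word_ok_word_of[OF Nil.prems(1)] by (auto simp: word_of_append word_of_Cons)
  then have "deq OKLRW (Strands (word_of u A @ [letter_of u x] @ word_of u C))
      (padded (word_of u A) (Strands [letter_of u x]) (word_of u C))"
    by (intro deq_sym[OF deq_padded_strands]) auto
  then show ?case
    by (intro exI[of _ "[]"]) (simp add: word_of_append word_of_Cons word_of_Nil)
next
  case (Cons b B)
  let ?L = "A @ x # b # B @ C" and ?K = "(A @ [b]) @ x # B @ C"
  let ?A = "word_of u A" and ?B = "word_of u B" and ?C = "word_of u C"
  let ?x = "letter_of u x" and ?b = "letter_of u b" and ?s = "Swap (length A)"
  have m: "move ?s ?L = ?K" using act_Swap_split[OF refl, of uminus A x b "B @ C"] by simp
  have d: "descent ?s ?L" using Cons.prems(2) by (subst descent_Swap_split) auto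
  have st: "state u ?L" using Cons.prems(1) by simp
  have ok: "word_ok ?A" "word_ok ?B" "word_ok ?C" "letter_ok Q ?x" "letter_ok Q ?b"
    using word_ok_word_of[OF st] by (auto simp: word_of_append word_of_Cons)
  have st': "state u ?K" using state_descent(1)[OF st d] m by simp
  obtain ss where ss: "descending ?K ss ((A @ [b]) @ B @ x # C)"
    "deq OKLRW (chain_diagram u ?K ss) (padded (word_of u (A @ [b])) (strand_left ?B ?x) ?C)"
    using Cons.IH[OF st'] Cons.prems by auto
  have dd: "descending ?L (?s # ss) (A @ (b # B) @ x # C)" using d m ss(1) by simp
  have el: "elementary (word_of u (move ?s ?L)) ?s = padded ?A (Cross ?b ?x) (?B @ ?C)"
    unfolding m using elementary_Swap_split[of ?A "length A" ?b ?x "?B @ ?C"] by (simp add: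
      word_of_append word_of_Cons word_of_Nil del: elementary.simps)
  have "deq OKLRW (chain_diagram u ?L (?s # ss))
      (Comp (elementary (word_of u (move ?s ?L)) ?s) (padded (word_of u (A @ [b])) (strand_left ?B
        ?x) ?C))"
    using ss(2) by (intro chain_diagram_Cons_cong[OF st dd]) (simp only: m)
  then have 1: "deq OKLRW (chain_diagram u ?L (?s # ss))
      (Comp (padded ?A (Cross ?b ?x) (?B @ ?C)) (padded (?A @ [?b]) (strand_left ?B ?x) ?C))"
    by (simp only: el word_of_append word_of_Cons word_of_Nil)
  note vl = valid_strand_left[of ?B ?x]
  have "deq OKLRW (padded ?A (strand_left (?b # ?B) ?x) ?C)
      (Comp (padded ?A (Tensor (Cross ?b ?x) (Strands ?B)) ?C) (padded ?A (Tensor (Strands [?b])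
        (strand_left ?B ?x)) ?C))"
    unfolding strand_left.simps using ok vl Cons.prems(3) by (intro deq_padded_comp) (auto simp:
      is_red_iff)
  also have "deq OKLRW \<dots> (Comp (padded ?A (Cross ?b ?x) (?B @ ?C)) (padded (?A @ [?b]) (strand_left
    ?B ?x) ?C))"
    using ok vl Cons.prems(3) by (intro deq_comp deq_padded_right deq_padded_left) (auto simp:
      is_red_iff)
  finally have "deq OKLRW (chain_diagram u ?L (?s # ss)) (padded ?A (strand_left (?b # ?B) ?x) ?C)"
    using 1 by (blast intro: deq_trans deq_sym)
  with dd show ?case by (intro exI[of _ "?s # ss"]) (simp add: word_of_Cons del: chain_diagram.simps
    descending.simps)
qed

text \<open>The mirror case of \<open>chain_strand_left\<close>. In \<open>strand_right\<close> the
  crossing with the first strand of \<open>B\<close> is the lowest one, so the induction appends a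
  generator at the bottom of the chain.\<close>

lemma chain_strand_right:
  assumes "state u (A @ B @ x # C)" "\<forall>y\<in>set B. x < y" "\<not> is_red (letter_of u x)"
  shows "\<exists>ss. descending (A @ B @ x # C) ss (A @ x # B @ C) \<and>
    deq OKLRW (chain_diagram u (A @ B @ x # C) ss)
      (padded (word_of u A) (strand_right (letter_of u x) (word_of u B)) (word_of u C))"
  using assms
proof (induction B arbitrary: A)
  case Nil
  then have "word_ok (word_of u A @ [letter_of u x] @ word_of u C)"
    using word_ok_word_of[OF Nil.prems(1)] by (auto simp: word_of_append word_of_Cons)
  then have "deq OKLRW (Strands (word_of u A @ [letter_of u x] @ word_of u C))
      (padded (word_of u A) (Strands [letter_of u x]) (word_of u C))"
    by (intro deq_sym[OF deq_padded_strands]) auto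
  then show ?case
    by (intro exI[of _ "[]"]) (simp add: word_of_append word_of_Cons word_of_Nil)
next
  case (Cons b B)
  let ?L = "(A @ [b]) @ B @ x # C" and ?K = "A @ b # x # B @ C"
  let ?A = "word_of u A" and ?B = "word_of u B" and ?C = "word_of u C"
  let ?x = "letter_of u x" and ?b = "letter_of u b" and ?s = "Swap (length A)"
  have m: "move ?s ?K = A @ x # b # B @ C" by (rule act_Swap_split[OF refl])
  have d: "descent ?s ?K" using Cons.prems(2) by (subst descent_Swap_split) auto
  have st: "state u ?L" using Cons.prems(1) by simp
  have ok: "word_ok ?A" "word_ok ?B" "word_ok ?C" "letter_ok Q ?x" "letter_ok Q ?b"
    using word_ok_word_of[OF st] by (auto simp: word_of_append word_of_Cons)
  obtain ss where ss: "descending ?L ss ((A @ [b]) @ x # B @ C)"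
    "deq OKLRW (chain_diagram u ?L ss) (padded (word_of u (A @ [b])) (strand_right ?x ?B) ?C)"
    using Cons.IH[OF st] Cons.prems by auto
  have ssK: "descending ?L ss ?K" using ss(1) by simp
  have st': "state u ?K" using state_descending[OF ssK st] .
  have dK: "descending ?K [?s] (A @ x # b # B @ C)" using d m by simp
  have dd: "descending ?L (ss @ [?s]) (A @ x # (b # B) @ C)"
    unfolding descending_append using ssK dK by (intro exI[of _ ?K]) simp
  have el: "elementary (word_of u (move ?s ?K)) ?s = padded ?A (Cross ?x ?b) (?B @ ?C)"
    unfolding m using elementary_Swap_split[of ?A "length A" ?x ?b "?B @ ?C"]
    by (simp add: word_of_append word_of_Cons del: elementary.simps)
  note c = chain_diagram_props[OF st ssK] and c' = chain_diagram_props[OF st' dK]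
  have "deq OKLRW (chain_diagram u ?L (ss @ [?s])) (Comp (chain_diagram u ?L ss) (chain_diagram u ?K
    [?s]))"
    by (rule chain_diagram_append[OF st ssK dK])
  also have "deq OKLRW \<dots> (Comp (padded (word_of u (A @ [b])) (strand_right ?x ?B) ?C) (padded ?A
    (Cross ?x ?b) (?B @ ?C)))"
    using chain_diagram_single[OF st' d] ss(2) c(2) c'(3) unfolding el by (intro deq_comp) simp_all
  finally have 1: "deq OKLRW (chain_diagram u ?L (ss @ [?s]))
      (Comp (padded (?A @ [?b]) (strand_right ?x ?B) ?C) (padded ?A (Cross ?x ?b) (?B @ ?C)))"
    by (simp only: word_of_append word_of_Cons word_of_Nil)
  note vl = valid_strand_right[of ?B ?x]
  have "deq OKLRW (padded ?A (strand_right ?x (?b # ?B)) ?C)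
      (Comp (padded ?A (Tensor (Strands [?b]) (strand_right ?x ?B)) ?C) (padded ?A (Tensor (Cross ?x
        ?b) (Strands ?B)) ?C))"
    unfolding strand_right.simps using ok vl Cons.prems(3) by (intro deq_padded_comp) (auto simp:
      is_red_iff)
  also have "deq OKLRW \<dots> (Comp (padded (?A @ [?b]) (strand_right ?x ?B) ?C) (padded ?A (Cross ?x ?b)
    (?B @ ?C)))"
    using ok vl Cons.prems(3) by (intro deq_comp deq_padded_right deq_padded_left) (auto simp:
      is_red_iff)
  finally have "deq OKLRW (chain_diagram u ?L (ss @ [?s])) (padded ?A (strand_right ?x (?b # ?B))
    ?C)"
    using 1 by (blast intro: deq_trans deq_sym)
  with dd show ?case by (intro exI[of _ "ss @ [?s]"]) (simp add: word_of_Cons del: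
    chain_diagram.simps descending.simps)
qed

lemma nth_in_take_drop:
  assumes "y \<in> set (take (q - p) (drop p xs))" "q \<le> length xs"
  shows "\<exists>j. p \<le> j \<and> j < q \<and> y = xs ! j"
proof -
  obtain i where "i < q - p" "y = xs ! (p + i)"
    using assms by (auto simp: in_set_conv_nth)
  then show ?thesis by (intro exI[of _ "p + i"]) auto
qed

lemma chain_insert_right:
  assumes "state u (insert_at p x R)" "p \<le> q" "q \<le> length R" "\<not> is_red (letter_of u x)"
    and "\<And>j. \<lbrakk>p \<le> j; j < q\<rbrakk> \<Longrightarrow> R ! j < x"
  shows "\<exists>ss. descending (insert_at p x R) ss (insert_at q x R) \<and>
    deq OKLRW (chain_diagram u (insert_at p x R) ss)
      (padded (take p (word_of u R)) (strand_left (take (q - p) (drop p (word_of u R))) (letter_of u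
        x))
        (drop q (word_of u R)))"
proof -
  have "\<forall>y\<in>set (take (q - p) (drop p R)). y < x"
    using nth_in_take_drop[OF _ assms(3)] assms(5) by blast
  then show ?thesis
    using chain_strand_left[of u "take p R" x "take (q - p) (drop p R)" "drop q R"] assms
    unfolding insert_at_split[OF assms(2,3)] insert_at_split'[OF assms(2,3)]
    by (simp add: word_of_def take_map drop_map)
qed

lemma chain_insert_left:
  assumes "state u (insert_at q x R)" "p \<le> q" "q \<le> length R" "\<not> is_red (letter_of u x)"
    and "\<And>j. \<lbrakk>p \<le> j; j < q\<rbrakk> \<Longrightarrow> x < R ! j"
  shows "\<exists>ss. descending (insert_at q x R) ss (insert_at p x R) \<and>
    deq OKLRW (chain_diagram u (insert_at q x R) ss)
      (padded (take p (word_of u R)) (strand_right (letter_of u x) (take (q - p) (drop p (word_of u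
        R))))
        (drop q (word_of u R)))"
proof -
  have "\<forall>y\<in>set (take (q - p) (drop p R)). x < y"
    using nth_in_take_drop[OF _ assms(3)] assms(5) by blast
  then show ?thesis
    using chain_strand_right[of u "take p R" "take (q - p) (drop p R)" x "drop q R"] assms
    unfolding insert_at_split[OF assms(2,3)] insert_at_split'[OF assms(2,3)]
    by (simp add: word_of_def take_map drop_map)
qed

text \<open>The inequality is strict because for equal positions \<open>long_crossing\<close> takes
  its other branch.\<close>

lemma long_crossing_insert_left:
  assumes "p < q" "q \<le> length w"
  shows "long_crossing (insert_at q a w) q p =
    padded (take p w) (strand_left (take (q - p) (drop p w)) a) (drop q w)"
proof -
  have "take p (insert_at q a w) = take p w"
    "take (q - p) (drop p (insert_at q a w)) = take (q - p) (drop p w)"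
    using assms by (simp_all add: insert_at_def min_def take_drop)
  then show ?thesis using assms unfolding long_crossing_def by (simp add: drop_insert_at)
qed

lemma long_crossing_insert_right:
  assumes "p \<le> q" "q \<le> length w"
  shows "long_crossing (insert_at p a w) p q =
    padded (take p w) (strand_right a (take (q - p) (drop p w))) (drop q w)"
proof -
  have "drop (Suc q) (insert_at p a w) = drop q w"
    using assms by (simp add: insert_at_def Suc_diff_le)
  then show ?thesis using assms unfolding long_crossing_def
    by (simp add: take_insert_at drop_insert_at)
qed

lemma chain_long_crossing_left:
  assumes "state u (insert_at p x R)" "p < q" "q \<le> length R" "\<not> is_red (letter_of u x)"
    and "\<And>j. \<lbrakk>p \<le> j; j < q\<rbrakk> \<Longrightarrow> R ! j < x"
  shows "\<exists>ss. descending (insert_at p x R) ss (insert_at q x R) \<and>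
    deq OKLRW (chain_diagram u (insert_at p x R) ss) (long_crossing (word_of u (insert_at q x R)) q
      p)"
  using chain_insert_right[OF assms(1) less_imp_le[OF assms(2)] assms(3-5)] assms(2,3)
  by (simp add: word_of_insert_at long_crossing_insert_left)

lemma chain_long_crossing_right:
  assumes "state u (insert_at q x R)" "p \<le> q" "q \<le> length R" "\<not> is_red (letter_of u x)"
    and "\<And>j. \<lbrakk>p \<le> j; j < q\<rbrakk> \<Longrightarrow> x < R ! j"
  shows "\<exists>ss. descending (insert_at q x R) ss (insert_at p x R) \<and>
    deq OKLRW (chain_diagram u (insert_at q x R) ss) (long_crossing (word_of u (insert_at p x R)) p
      q)"
  using chain_insert_left[OF assms] assms(2,3)
  by (simp add: word_of_insert_at long_crossing_insert_right)

text \<open>From the top, \<open>x\<close> moves to the left edge past larger entries, changes its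
  sign from negative to positive, and \<open>- x\<close> moves right past smaller entries. Every
  generator is a descent, so the long reflection is a piece of a reduced diagram.\<close>

lemma chain_long_reflection:
  assumes st: "state u (insert_at p x R)" and pq: "p \<le> length R" "q \<le> length R"
    and i: "letter_of u (- x) = Black i" and x: "x < 0"
    and left: "\<And>j. j < p \<Longrightarrow> x < R ! j" and right: "\<And>j. j < q \<Longrightarrow> R ! j < - x"
  shows "\<exists>ss. descending (insert_at p x R) ss (insert_at q (- x) R) \<and>
    deq OKLRW (chain_diagram u (insert_at p x R) ss) (long_reflection \<tau> (word_of u (insert_at q (-
      x) R)) q i p)"
proof -
  have x': "letter_of u x = bar (Black i)"
    using letter_of_uminus[OF st, of x] i letter_ok_letter_of[OF st, of x]
    by (simp add: set_insert_at)
  then have lx: "letter_of u x = Black (\<tau> i)" by simp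
  let ?W = "word_of u R"
  let ?L = "insert_at p x R" and ?L1 = "x # R" and ?L2 = "- x # R" and ?K = "insert_at q (- x) R"
  have i0: "insert_at 0 y R = y # R" for y by (simp add: insert_at_def)
  obtain s1 where s1: "descending ?L s1 ?L1"
    "deq OKLRW (chain_diagram u ?L s1) (padded [] (strand_right (Black (\<tau> i)) (take p ?W)) (drop p
      ?W))"
    using chain_insert_left[OF st _ pq(1), of 0] left lx by (auto simp: i0)
  have st1: "state u ?L1" using state_descending[OF s1(1) st] .
  have d: "descent Flip ?L1" using x by simp
  have st2: "state u ?L2" using state_descent(1)[OF st1 d] by simp
  obtain s3 where s3: "descending ?L2 s3 ?K"
    "deq OKLRW (chain_diagram u ?L2 s3) (padded [] (strand_left (take q ?W) (Black i)) (drop q ?W))"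
    using chain_insert_right[of u 0 "- x" R q] st2 right i pq by (auto simp: i0)
  have s2: "descending ?L1 [Flip] ?L2" using d by simp
  have c2: "deq OKLRW (chain_diagram u ?L1 [Flip]) (reflect i ?W)"
    using chain_diagram_single[OF st1 d] i by (simp add: word_of_Cons del: chain_diagram.simps)
  have s23: "descending ?L1 ([Flip] @ s3) ?K" using s2 s3 descending_append by blast
  have s123: "descending ?L (s1 @ [Flip] @ s3) ?K" using s1 s23 descending_append by blast
  note p1 = chain_diagram_props[OF st s1(1)] and p2 = chain_diagram_props[OF st1 s2]
    and p3 = chain_diagram_props[OF st2 s3(1)] and p23 = chain_diagram_props[OF st1 s23]
  have r: "deq OKLRW (chain_diagram u ?L1 ([Flip] @ s3))
      (Comp (reflect i ?W) (padded [] (strand_left (take q ?W) (Black i)) (drop q ?W)))"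
    by (rule deq_trans[OF chain_diagram_append[OF st1 s2 s3(1)]], rule deq_comp[OF c2 s3(2)])
       (simp only: p2 p3)
  have "deq OKLRW (chain_diagram u ?L (s1 @ [Flip] @ s3))
      (Comp (padded [] (strand_right (Black (\<tau> i)) (take p ?W)) (drop p ?W))
        (Comp (reflect i ?W) (padded [] (strand_left (take q ?W) (Black i)) (drop q ?W))))"
    by (rule deq_trans[OF chain_diagram_append[OF st s1(1) s23]], rule deq_comp[OF s1(2) r])
       (simp only: p1 p23)
  moreover have "long_reflection \<tau> (word_of u ?K) q i p =
      Comp (padded [] (strand_right (Black (\<tau> i)) (take p ?W)) (drop p ?W))
        (Comp (reflect i ?W) (padded [] (strand_left (take q ?W) (Black i)) (drop q ?W)))"
  proof -
    have "q \<le> length ?W" using pq by simp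
    then show ?thesis unfolding long_reflection_def word_of_insert_at Let_def
      by (simp only: take_insert_at drop_insert_at append_take_drop_id i)
  qed
  ultimately show ?thesis using s123 by metis
qed

end


section \<open>Words of interval sequences\<close>

text \<open>The letters of the \<open>r\<close>-th interval have height \<open>2 * r\<close>, and the red letter \<open>\<Lambda> r\<close> has
  height \<open>2 * r + 1\<close>.\<close>

definition reds_before :: "'q word \<Rightarrow> nat \<Rightarrow> nat" where
  "reds_before w k = length (filter is_red (take k w))"

definition height :: "'q word \<Rightarrow> nat \<Rightarrow> nat" where
  "height w k = 2 * reds_before w k + of_bool (is_red (w ! k))"

lemma reds_before_mono: "j \<le> k \<Longrightarrow> reds_before w j \<le> reds_before w k"
  unfolding reds_before_def using take_add[of j "k - j" w] by simp

lemma reds_before_Suc: "k < length w \<Longrightarrow> reds_before w (Suc k) = reds_before w k + of_bool (is_red (w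
  ! k))"
  by (simp add: reds_before_def take_Suc_conv_app_nth)

lemma height_mono:
  assumes "j \<le> k" "k < length w"
  shows "height w j \<le> height w k"
proof (cases "j = k")
  case False
  then have "reds_before w (Suc j) \<le> reds_before w k" using assms by (intro reds_before_mono) simp
  then show ?thesis using reds_before_Suc[of j w] assms by (simp add: height_def)
qed simp

lemma height_less:
  assumes "j < k" "k < length w" "is_red (w ! j) \<or> is_red (w ! k)"
  shows "height w j < height w k"
proof -
  have "reds_before w (Suc j) \<le> reds_before w k" using assms by (intro reds_before_mono) simp
  then show ?thesis using reds_before_Suc[of j w] assms by (auto simp: height_def)
qed

lemma height_insert_at:
  assumes "\<not> is_red a" "p \<le> length w"
  shows "j < p \<Longrightarrow> height (insert_at p a w) j = height w j"
    and "\<lbrakk>p \<le> j; j < length w\<rbrakk> \<Longrightarrow> height (insert_at p a w) (Suc j) = height w j"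
proof -
  assume "j < p"
  then show "height (insert_at p a w) j = height w j"
    using assms(2) nth_insert_at_less[of j p w a]
    by (simp add: height_def reds_before_def) (simp add: insert_at_def)
next
  assume j: "p \<le> j" "j < length w"
  have "take (Suc j) (insert_at p a w) = take p w @ a # take (j - p) (drop p w)"
    using assms(2) j by (simp add: insert_at_def Suc_diff_le)
  moreover have "take j w = take p w @ take (j - p) (drop p w)"
    using take_add[of p "j - p" w] j by simp
  ultimately show "height (insert_at p a w) (Suc j) = height w j"
    using assms j by (simp add: height_def reds_before_def nth_insert_at_greater)
qed

context
  fixes \<Lambda> :: "nat \<Rightarrow> 'q \<Rightarrow> nat"
begin

lemma seq_word_0: "seq_word \<Lambda> 0 \<nu> = [Red (\<Lambda> 0)]"
  by (simp add: seq_word_def)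

lemma seq_word_Suc: "seq_word \<Lambda> (Suc N) \<nu> = seq_word \<Lambda> N \<nu> @ map Black (\<nu> (Suc N)) @ [Red (\<Lambda> (Suc
  N))]"
  by (simp add: seq_word_def)

lemma seq_word_cong: "(\<And>r. \<lbrakk>1 \<le> r; r \<le> N\<rbrakk> \<Longrightarrow> \<nu> r = \<kappa> r) \<Longrightarrow> seq_word \<Lambda> N \<nu> = seq_word \<Lambda> N \<kappa>"
  unfolding seq_word_def by (intro arg_cong2[where f = Cons] arg_cong[where f = concat] map_cong)
    auto

lemma filter_black [simp]: "filter is_red (map Black xs) = []"
  by (induction xs) auto

lemma reds_seq_word: "length (filter is_red (seq_word \<Lambda> N \<nu>)) = Suc N"
  by (induction N) (auto simp: seq_word_0 seq_word_Suc)

lemma seq_word_split: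
  assumes "1 \<le> a" "a \<le> N"
  shows "\<exists>z. seq_word \<Lambda> N \<nu> = seq_word \<Lambda> (a - 1) \<nu> @ map Black (\<nu> a) @ Red (\<Lambda> a) # z"
  using assms(2)
proof (induction N rule: dec_induct)
  case base
  then show ?case using seq_word_Suc[of "a - 1" \<nu>] assms(1) by simp
next
  case (step N)
  then show ?case by (auto simp: seq_word_Suc)
qed

text \<open>The tail \<open>z\<close> is chosen before the content \<open>xs\<close> of interval
  \<open>a\<close>, so that words with different contents of this interval can be compared.\<close>

lemma seq_word_split_upd:
  assumes "1 \<le> a" "a \<le> N"
  shows "\<exists>z. \<forall>xs. seq_word \<Lambda> N (\<nu>(a := xs)) = seq_word \<Lambda> (a - 1) \<nu> @ map Black xs @ Red (\<Lambda> a) # z"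
  using assms(2)
proof (induction N rule: dec_induct)
  case base
  have "seq_word \<Lambda> (a - 1) (\<nu>(a := xs)) = seq_word \<Lambda> (a - 1) \<nu>" for xs
    using assms(1) by (intro seq_word_cong) auto
  then have "seq_word \<Lambda> a (\<nu>(a := xs)) = seq_word \<Lambda> (a - 1) \<nu> @ map Black xs @ [Red (\<Lambda> a)]" for xs
    using seq_word_Suc[of "a - 1" "\<nu>(a := xs)"] assms(1) by simp
  then show ?case by (intro exI[of _ "[]"]) blast
next
  case (step n)
  then obtain z where "\<forall>xs. seq_word \<Lambda> n (\<nu>(a := xs)) = seq_word \<Lambda> (a - 1) \<nu> @ map Black xs @ Red (\<Lambda>
    a) # z"
    by blast
  moreover have "(\<nu>(a := xs)) (Suc n) = \<nu> (Suc n)" for xs using step.hyps by simp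
  ultimately show ?case
    by (intro exI[of _ "z @ map Black (\<nu> (Suc n)) @ [Red (\<Lambda> (Suc n))]"])
       (simp add: seq_word_Suc del: fun_upd_apply)
qed

lemma length_before: "l \<le> length (\<nu> a) \<Longrightarrow> length (before \<Lambda> \<nu> a l) = length (seq_word \<Lambda> (a - 1) \<nu>) +
  l"
  by (simp add: before_def)

lemma length_before_le:
  assumes "1 \<le> a" "a \<le> N" "l \<le> length (\<nu> a)"
  shows "length (before \<Lambda> \<nu> a l) \<le> length (seq_word \<Lambda> N \<nu>)"
  using seq_word_split[OF assms(1,2), of \<nu>] assms(3) by (auto simp: length_before)

lemma before_upd:
  assumes "1 \<le> a" "take l xs = take l (\<nu> a)"
  shows "before \<Lambda> (\<nu>(a := xs)) a l = before \<Lambda> \<nu> a l"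
proof -
  have "seq_word \<Lambda> (a - 1) (\<nu>(a := xs)) = seq_word \<Lambda> (a - 1) \<nu>"
    using assms(1) by (intro seq_word_cong) auto
  then show ?thesis using assms(2) by (simp add: before_def)
qed

lemma seq_word_insert_at:
  assumes "1 \<le> a" "a \<le> N" "l \<le> length (\<nu> a)"
  shows "seq_word \<Lambda> N (\<nu>(a := insert_at l i (\<nu> a))) =
    insert_at (length (before \<Lambda> \<nu> a l)) (Black i) (seq_word \<Lambda> N \<nu>)"
proof -
  obtain z where z: "\<And>xs. seq_word \<Lambda> N (\<nu>(a := xs)) = seq_word \<Lambda> (a - 1) \<nu> @ map Black xs @ Red (\<Lambda>
    a) # z"
    using seq_word_split_upd[OF assms(1,2)] by blast
  show ?thesis
    using z[of "\<nu> a"] z[of "insert_at l i (\<nu> a)"] assms(3)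
    by (simp add: length_before insert_at_def take_map drop_map)
qed

lemma seq_word_nth_before:
  assumes "1 \<le> a" "a \<le> N" "l < length (\<nu> a)"
  shows "length (before \<Lambda> \<nu> a l) < length (seq_word \<Lambda> N \<nu>)"
    and "seq_word \<Lambda> N \<nu> ! length (before \<Lambda> \<nu> a l) = Black (\<nu> a ! l)"
    and "height (seq_word \<Lambda> N \<nu>) (length (before \<Lambda> \<nu> a l)) = 2 * a"
proof -
  obtain z where z: "seq_word \<Lambda> N \<nu> = seq_word \<Lambda> (a - 1) \<nu> @ map Black (\<nu> a) @ Red (\<Lambda> a) # z"
    using seq_word_split[OF assms(1,2)] by blast
  show "length (before \<Lambda> \<nu> a l) < length (seq_word \<Lambda> N \<nu>)"
    and 1: "seq_word \<Lambda> N \<nu> ! length (before \<Lambda> \<nu> a l) = Black (\<nu> a ! l)"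
    using z assms(3) by (auto simp: length_before nth_append)
  have "take (length (before \<Lambda> \<nu> a l)) (seq_word \<Lambda> N \<nu>) = before \<Lambda> \<nu> a l"
    using z assms(3) by (simp add: before_def take_map)
  then have "reds_before (seq_word \<Lambda> N \<nu>) (length (before \<Lambda> \<nu> a l)) = a"
    using assms(1) by (simp add: reds_before_def before_def reds_seq_word)
  then show "height (seq_word \<Lambda> N \<nu>) (length (before \<Lambda> \<nu> a l)) = 2 * a"
    using 1 by (simp add: height_def)
qed

lemma seq_word_locate:
  assumes "k < length (seq_word \<Lambda> N \<nu>)" "\<not> is_red (seq_word \<Lambda> N \<nu> ! k)"
  obtains a l where "1 \<le> a" "a \<le> N" "l < length (\<nu> a)" "k = length (before \<Lambda> \<nu> a l)"
proof -
  have "\<exists>a l. 1 \<le> a \<and> a \<le> N \<and> l < length (\<nu> a) \<and> k = length (before \<Lambda> \<nu> a l)"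
    using assms
  proof (induction N)
    case 0
    then show ?case by (simp add: seq_word_0)
  next
    case (Suc N)
    let ?n = "length (seq_word \<Lambda> N \<nu>)"
    consider "k < ?n" | "?n \<le> k" "k < ?n + length (\<nu> (Suc N))" | "k = ?n + length (\<nu> (Suc N))"
      using Suc.prems(1) by (auto simp: seq_word_Suc) linarith
    then show ?case
    proof cases
      case 1
      then have "\<exists>a l. 1 \<le> a \<and> a \<le> N \<and> l < length (\<nu> a) \<and> k = length (before \<Lambda> \<nu> a l)"
        using Suc by (auto simp: seq_word_Suc nth_append)
      then show ?thesis using le_SucI by blast
    next
      case 2
      then show ?thesis
        by (intro exI[of _ "Suc N"] exI[of _ "k - ?n"]) (auto simp: length_before)
    next
      case 3
      then show ?thesis using Suc.prems(2) by (auto simp: seq_word_Suc nth_append)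
    qed
  qed
  then show ?thesis using that by blast
qed

lemma height_before:
  assumes "1 \<le> a" "a \<le> N" "l \<le> length (\<nu> a)" "j < length (before \<Lambda> \<nu> a l)"
  shows "height (seq_word \<Lambda> N \<nu>) j < 2 * a \<or>
    height (seq_word \<Lambda> N \<nu>) j = 2 * a \<and> (\<exists>m<l. j = length (before \<Lambda> \<nu> a m))"
proof -
  let ?w = "seq_word \<Lambda> N \<nu>" and ?s = "seq_word \<Lambda> (a - 1) \<nu>"
  obtain z where z: "?w = ?s @ map Black (\<nu> a) @ Red (\<Lambda> a) # z"
    using seq_word_split[OF assms(1,2)] by blast
  show ?thesis
  proof (cases "j < length ?s")
    case True
    \<comment> \<open>The prefix ends with the red letter numbered \<open>a - 1\<close>. At most
      \<open>a - 1\<close> red letters precede position \<open>j\<close>, so its height is at most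
      \<open>2 * (a - 1) + 1\<close>, even if \<open>j\<close> is this last red letter.\<close>
    have "?s \<noteq> []" "is_red (last ?s)"
      by (cases "a - 1"; simp add: seq_word_0 seq_word_Suc)+
    then obtain s b where s: "?s = s @ [b]" "is_red b" by (cases ?s rule: rev_cases) auto
    have "length (filter is_red ?s) = a" using assms(1) by (simp add: reds_seq_word)
    then have a: "Suc (length (filter is_red s)) = a" using s by simp
    have "take j ?w = take j s" "is_red (?w ! j) \<longrightarrow> True" using True z s by auto
    then have "reds_before ?w j \<le> length (filter is_red s)"
      unfolding reds_before_def using append_take_drop_id[of j s]
      by (metis filter_append le_add1 length_append)
    then have "height ?w j < 2 * a" using a by (simp add: height_def)
    then show ?thesis by simp
  next
    case False
    define m where "m = j - length ?s"
    have m: "m < l" "j = length (before \<Lambda> \<nu> a m)"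
      using False assms(3,4) by (auto simp: m_def length_before)
    then show ?thesis using seq_word_nth_before(3)[OF assms(1,2), of m] assms(3) by auto
  qed
qed

lemma height_after:
  assumes "1 \<le> a" "a \<le> N" "l \<le> length (\<nu> a)" "length (before \<Lambda> \<nu> a l) \<le> j" "j < length (seq_word \<Lambda> N
    \<nu>)"
  shows "2 * a < height (seq_word \<Lambda> N \<nu>) j \<or>
    height (seq_word \<Lambda> N \<nu>) j = 2 * a \<and> (\<exists>m\<ge>l. m < length (\<nu> a) \<and> j = length (before \<Lambda> \<nu> a m))"
proof -
  let ?w = "seq_word \<Lambda> N \<nu>" and ?s = "seq_word \<Lambda> (a - 1) \<nu>"
  obtain z where z: "?w = ?s @ map Black (\<nu> a) @ Red (\<Lambda> a) # z"
    using seq_word_split[OF assms(1,2)] by blast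
  \<comment> \<open>This is the position of the red letter that closes interval \<open>a\<close>;
    its height is \<open>2 * a + 1\<close>, and heights increase weakly from there on.\<close>
  let ?n = "length ?s + length (\<nu> a)"
  have n: "?n < length ?w" "is_red (?w ! ?n)" using z by (simp_all add: nth_append)
  have "reds_before ?w ?n = a"
    using z assms(1) by (simp add: reds_before_def reds_seq_word)
  then have h: "height ?w ?n = 2 * a + 1" using n by (simp add: height_def)
  show ?thesis
  proof (cases "j < ?n")
    case True
    define m where "m = j - length ?s"
    have m: "l \<le> m" "m < length (\<nu> a)" "j = length (before \<Lambda> \<nu> a m)"
      using True assms(3,4) by (auto simp: m_def length_before)
    then show ?thesis using seq_word_nth_before(3)[OF assms(1,2), of m] by auto
  next
    case False
    then show ?thesis using height_mono[of ?n j ?w] assms(5) h by simp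
  qed
qed

lemma length_before_mono:
  assumes "1 \<le> a" "a < b" "l \<le> length (\<nu> a)" "m \<le> length (\<nu> b)"
  shows "length (before \<Lambda> \<nu> a l) < length (before \<Lambda> \<nu> b m)"
proof -
  have "a \<le> b - 1" using assms(2) by simp
  from seq_word_split[OF assms(1) this] obtain z
    where "seq_word \<Lambda> (b - 1) \<nu> = seq_word \<Lambda> (a - 1) \<nu> @ map Black (\<nu> a) @ Red (\<Lambda> a) # z" by blast
  then show ?thesis using assms by (simp add: length_before)
qed

end


section \<open>Peeling off a generator\<close>

text \<open>A predicate that is closed downwards cuts a sorted list in two, and \<open>i\<close> may
  be inserted at the cut. Taking for \<open>p\<close> the letters not above \<open>i\<close>, or
  those below or equal to \<open>i\<close>, gives the places before and after all letters equal to
  \<open>i\<close>.\<close>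

lemma sorted_insert_takeWhile:
  assumes sorted: "sorted_wrt r xs" and sub: "set xs \<subseteq> A"
    and p: "\<And>j. \<lbrakk>j \<in> A; p j\<rbrakk> \<Longrightarrow> r j i" "\<And>j. \<lbrakk>j \<in> A; \<not> p j\<rbrakk> \<Longrightarrow> r i j"
      "\<And>j k. \<lbrakk>j \<in> A; k \<in> A; r j k; p k\<rbrakk> \<Longrightarrow> p j"
  shows "sorted_wrt r (insert_at (length (takeWhile p xs)) i xs)"
    and "\<And>m. m < length (takeWhile p xs) \<Longrightarrow> p (xs ! m)"
    and "\<And>m. \<lbrakk>length (takeWhile p xs) \<le> m; m < length xs\<rbrakk> \<Longrightarrow> \<not> p (xs ! m)"
proof -
  let ?l = "length (takeWhile p xs)"
  have td: "take ?l xs = takeWhile p xs" "drop ?l xs = dropWhile p xs"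
    by (rule takeWhile_eq_take[symmetric], rule dropWhile_eq_drop[symmetric])
  show 1: "p (xs ! m)" if "m < ?l" for m
  proof -
    have "takeWhile p xs ! m \<in> set (takeWhile p xs)" using that by simp
    then show ?thesis using that set_takeWhileD takeWhile_nth by metis
  qed
  show 2: "\<not> p (xs ! m)" if "?l \<le> m" "m < length xs" for m
  proof
    assume "p (xs ! m)"
    have l: "\<not> p (xs ! ?l)" using that by (intro nth_length_takeWhile) simp
    then have "?l \<noteq> m" using \<open>p (xs ! m)\<close> by auto
    then have "r (xs ! ?l) (xs ! m)" using sorted_wrt_nth_less[OF sorted, of ?l m] that by simp
    then show False using p(3)[of "xs ! ?l" "xs ! m"] \<open>p (xs ! m)\<close> l sub that by (auto simp:
      subset_iff)
  qed
  have d: "\<not> p j" if "j \<in> set (dropWhile p xs)" for j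
  proof -
    have "j \<in> set (drop ?l xs)" using that by (simp only: td(2))
    then obtain m where m: "m < length (drop ?l xs)" "drop ?l xs ! m = j"
      unfolding in_set_conv_nth by blast
    have "?l + m < length xs" "xs ! (?l + m) = j" using m by simp_all
    then show ?thesis using 2[OF le_add1, of m] by simp
  qed
  have "sorted_wrt r (takeWhile p xs @ dropWhile p xs)" using sorted by simp
  then have s: "sorted_wrt r (takeWhile p xs)" "sorted_wrt r (dropWhile p xs)"
    "\<And>x y. \<lbrakk>x \<in> set (takeWhile p xs); y \<in> set (dropWhile p xs)\<rbrakk> \<Longrightarrow> r x y"
    unfolding sorted_wrt_append by blast+
  have sub': "set (takeWhile p xs) \<subseteq> A" "set (dropWhile p xs) \<subseteq> A"
    using sub by (auto dest: set_takeWhileD set_dropWhileD)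
  show "sorted_wrt r (insert_at ?l i xs)"
    unfolding insert_at_def td sorted_wrt_append sorted_wrt.simps
  proof (intro conjI ballI)
    fix x y assume x: "x \<in> set (takeWhile p xs)" and y: "y \<in> set (i # dropWhile p xs)"
    have "r x i" using p(1) set_takeWhileD[OF x] sub by blast
    then show "r x y" using s(3)[OF x] y by auto
  next
    fix y assume "y \<in> set (dropWhile p xs)"
    then show "r i y" using p(2) d sub'(2) by blast
  qed (rule s)+
qed

locale interval_setting = mirror_quiver Q \<tau>
  for Q :: "('q, 'e) pre_digraph" and \<tau> :: "'q \<Rightarrow> 'q" +
  fixes P :: "'q set" and le :: "'q rel" and v :: "'q \<Rightarrow> nat" and \<Lambda> :: "nat \<Rightarrow> 'q \<Rightarrow> nat"
  assumes P_verts: "P \<subseteq> verts Q"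
    and tau_P: "i \<in> P \<Longrightarrow> \<tau> i \<in> verts Q - P"
    and tau_not_P: "i \<in> verts Q - P \<Longrightarrow> \<tau> i \<in> P"
    and order: "linear_order_on P le"
    and red_ok: "letter_ok Q (Red (\<Lambda> n))"
begin

section \<open>Orders on the intervals and moving a letter within an interval sequence\<close>

abbreviation "seqs \<equiv> interval_seqs Q \<tau> P le v"
abbreviation "sword \<equiv> seq_word \<Lambda>"
abbreviation "pos \<nu> a l \<equiv> length (before \<Lambda> \<nu> a l)"

definition alphabet :: "nat \<Rightarrow> 'q set" where
  "alphabet r = (if odd r then P else verts Q - P)"

definition interval_le :: "nat \<Rightarrow> 'q \<Rightarrow> 'q \<Rightarrow> bool" where
  "interval_le r i j \<longleftrightarrow> (if odd r then (i, j) \<in> le else (\<tau> j, \<tau> i) \<in> le)"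

lemma alphabet_verts: "i \<in> alphabet r \<Longrightarrow> i \<in> verts Q"
  using P_verts by (auto simp: alphabet_def split: if_splits)

lemma le_facts: "refl_on P le" "trans le" "antisym le" "total_on P le"
  using order by (simp_all add: order_on_defs)

lemma interval_le_refl: "i \<in> alphabet r \<Longrightarrow> interval_le r i i"
  using refl_onD[OF le_facts(1), of i] refl_onD[OF le_facts(1), of "\<tau> i"] tau_not_P[of i]
  by (auto simp: alphabet_def interval_le_def)

lemma interval_le_trans: "\<lbrakk>interval_le r i j; interval_le r j k\<rbrakk> \<Longrightarrow> interval_le r i k"
  using transD[OF le_facts(2), of i j k] transD[OF le_facts(2), of "\<tau> k" "\<tau> j" "\<tau> i"]
  by (auto simp: interval_le_def)

lemma interval_le_antisym:
  assumes "i \<in> alphabet r" "j \<in> alphabet r" "interval_le r i j" "interval_le r j i"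
  shows "i = j"
proof (cases "odd r")
  case True
  then show ?thesis using antisymD[OF le_facts(3), of i j] assms by (simp add: interval_le_def)
next
  case False
  then have "\<tau> i = \<tau> j" "i \<in> verts Q" "j \<in> verts Q"
    using antisymD[OF le_facts(3), of "\<tau> i" "\<tau> j"] assms by (simp_all add: interval_le_def
      alphabet_def)
  then show ?thesis using tau_tau by metis
qed

lemma interval_le_total:
  assumes "i \<in> alphabet r" "j \<in> alphabet r"
  shows "interval_le r i j \<or> interval_le r j i"
proof (cases "i = j \<or> \<tau> i = \<tau> j")
  case True
  then have "i = j" using assms alphabet_verts tau_tau by metis
  then show ?thesis using interval_le_refl assms by simp
next
  case False
  have "total_on P le" by (rule le_facts)
  then show ?thesis
    using False assms tau_not_P[of i] tau_not_P[of j] unfolding total_on_def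
    by (cases "odd r") (simp_all add: alphabet_def interval_le_def, blast)
qed

text \<open>A vertex determines the parity of the intervals in which it can occur. This and the next
  lemma supply the parity conditions in the definitions of long crossings and long
  reflections.\<close>

lemma alphabet_parity: "\<lbrakk>i \<in> alphabet a; i \<in> alphabet b\<rbrakk> \<Longrightarrow> a mod 2 = b mod 2"
  by (auto simp: alphabet_def mod2_eq_if split: if_splits)

lemma alphabet_parity_tau: "\<lbrakk>i \<in> alphabet a; \<tau> i \<in> alphabet b\<rbrakk> \<Longrightarrow> a mod 2 \<noteq> b mod 2"
  using tau_P[of i] tau_not_P[of i] by (auto simp: alphabet_def mod2_eq_if split: if_splits)

lemma seqs_iff: "\<nu> \<in> seqs \<longleftrightarrow> \<nu> 0 = [] \<and> finite {r. \<nu> r \<noteq> []} \<and>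
    (\<forall>r\<ge>1. set (\<nu> r) \<subseteq> alphabet r \<and> sorted_wrt (interval_le r) (\<nu> r)) \<and>
    (\<forall>i \<in> P. (\<Sum>r \<in> {r. \<nu> r \<noteq> []}. count_list (\<nu> r) i + count_list (\<nu> r) (\<tau> i)) = v i)"
proof -
  have *: "(\<forall>r\<ge>1. R r) \<longleftrightarrow> (\<forall>n. R (2 * n + 1)) \<and> (\<forall>n. R (2 * n + 2))" for R :: "nat \<Rightarrow> bool"
  proof
    assume r: "(\<forall>n. R (2 * n + 1)) \<and> (\<forall>n. R (2 * n + 2))"
    show "\<forall>r\<ge>1. R r"
    proof (intro allI impI)
      fix r :: nat assume "1 \<le> r"
      then have "r = 2 * ((r - 1) div 2) + 1 \<or> r = 2 * ((r - 1) div 2) + 2" by presburger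
      then show "R r" using r by metis
    qed
  qed auto
  show ?thesis
    unfolding interval_seqs_def mem_Collect_eq *
    by (simp add: alphabet_def interval_le_def[abs_def])
qed

lemma seqs_alphabet: "\<lbrakk>\<nu> \<in> seqs; 1 \<le> r; m < length (\<nu> r)\<rbrakk> \<Longrightarrow> \<nu> r ! m \<in> alphabet r"
  unfolding seqs_iff by (meson nth_mem subsetD)

lemma seqs_sorted: "\<lbrakk>\<nu> \<in> seqs; 1 \<le> r\<rbrakk> \<Longrightarrow> sorted_wrt (interval_le r) (\<nu> r)"
  by (simp add: seqs_iff)

lemma seqs_sorted_nth:
  assumes "\<nu> \<in> seqs" "1 \<le> r" "m \<le> k" "k < length (\<nu> r)"
  shows "interval_le r (\<nu> r ! m) (\<nu> r ! k)"
proof (cases "m = k")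
  case True
  then show ?thesis using seqs_alphabet[OF assms(1,2,4)] by (simp add: interval_le_refl)
next
  case False
  then show ?thesis using sorted_wrt_nth_less[OF seqs_sorted[OF assms(1,2)], of m k] assms by simp
qed

lemma word_ok_sword: "\<nu> \<in> seqs \<Longrightarrow> word_ok (sword N \<nu>)"
proof (induction N)
  case 0
  then show ?case using red_ok[of 0] by (simp add: seq_word_0)
next
  case (Suc N)
  moreover have "\<forall>i\<in>set (\<nu> (Suc N)). i \<in> verts Q"
    using Suc.prems alphabet_verts unfolding seqs_iff by (metis One_nat_def le_add1 plus_1_eq_Suc
      subsetD)
  ultimately show ?case using red_ok[of "Suc N"] by (auto simp: seq_word_Suc)
qed

lemma sum_fits:
  assumes "fits \<Lambda> N \<nu>" "\<And>r. \<nu> r = [] \<Longrightarrow> f r = 0"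
  shows "(\<Sum>r \<in> {r. \<nu> r \<noteq> []}. f r) = (\<Sum>r\<le>N. f r :: nat)"
proof -
  have "{r. \<nu> r \<noteq> []} \<subseteq> {..N}"
    using assms(1) unfolding fits_def by (auto simp: not_le[symmetric])
  then show ?thesis using assms(2) by (intro sum.mono_neutral_left) auto
qed

text \<open>The sum runs over a fixed range and not over the nonempty intervals, so that changing
  one interval does not change the index set.\<close>

definition occurrences :: "nat \<Rightarrow> (nat \<Rightarrow> 'q list) \<Rightarrow> 'q \<Rightarrow> nat" where
  "occurrences N \<nu> i = (\<Sum>r\<le>N. count_list (\<nu> r) i + count_list (\<nu> r) (\<tau> i))"

lemma occurrences_insert_at:
  assumes "a \<le> N"
  shows "occurrences N (\<nu>(a := insert_at l i (\<nu> a))) j = occurrences N \<nu> j + (of_bool (i = j) +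
    of_bool (i = \<tau> j))"
proof -
  have "(\<Sum>r\<in>{..N} - {a}. count_list ((\<nu>(a := xs)) r) j + count_list ((\<nu>(a := xs)) r) (\<tau> j)) =
      (\<Sum>r\<in>{..N} - {a}. count_list (\<nu> r) j + count_list (\<nu> r) (\<tau> j))" for xs
    by (intro sum.cong) auto
  then show ?thesis
    using assms unfolding occurrences_def
    by (simp add: sum.remove[of "{..N}" a] count_list_insert_at del: fun_upd_apply)
       (simp add: count_list_insert_at)
qed

lemma remove_at_insert_at:
  "l < length (\<nu> a) \<Longrightarrow> (remove_at \<nu> a l)(a := insert_at l (\<nu> a ! l) (remove_at \<nu> a l a)) = \<nu>"
  by (simp add: remove_at_def insert_at_remove)

lemma insert_at_remove_at:
  "l \<le> length (\<rho> a) \<Longrightarrow> remove_at (\<rho>(a := insert_at l i (\<rho> a))) a l = \<rho>"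
  by (simp add: remove_at_def take_insert_at drop_insert_at)

text \<open>Here \<open>\<nu>\<close> is the upper sequence and \<open>\<kappa>\<close> the lower
  one. The inserted letter \<open>s\<close> is the deleted letter or its partner under
  \<open>\<tau>\<close>, so the total count of each pair is unchanged; sorting matters only in
  interval \<open>b\<close>, since deleting a letter keeps a list sorted.\<close>

lemma seqs_moved:
  assumes \<nu>: "\<nu> \<in> seqs" "fits \<Lambda> N \<nu>" and a: "1 \<le> a" "a \<le> N" "l < length (\<nu> a)"
    and b: "1 \<le> b" "b \<le> N" and s: "s \<in> alphabet b" "s = \<nu> a ! l \<or> \<tau> s = \<nu> a ! l"
    and \<rho>: "\<rho> = remove_at \<nu> a l" and m: "m \<le> length (\<rho> b)"
    and sorted: "sorted_wrt (interval_le b) (insert_at m s (\<rho> b))"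
    and \<kappa>: "\<kappa> = \<rho>(b := insert_at m s (\<rho> b))"
  shows "\<kappa> \<in> seqs" "fits \<Lambda> N \<kappa>" "moved \<kappa> b m s \<nu> a l (\<nu> a ! l)"
proof -
  let ?i = "\<nu> a ! l"
  have sv: "s \<in> verts Q" using alphabet_verts[OF s(1)] .
  have \<nu>': "\<nu> = \<rho>(a := insert_at l ?i (\<rho> a))" unfolding \<rho> using remove_at_insert_at[where \<nu> = \<nu> and
    a = a and l = l, OF a(3)] by simp
  have sub: "set (\<rho> r) \<subseteq> set (\<nu> r)" for r
    unfolding \<rho> remove_at_def by (auto dest: in_set_takeD in_set_dropD)
  have zero: "\<kappa> r = []" if "\<nu> r = []" "r \<noteq> b" for r
    using sub[of r] that unfolding \<kappa> by simp
  show fits: "fits \<Lambda> N \<kappa>" using \<nu>(2) zero b unfolding fits_def by auto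
  have "{r. \<kappa> r \<noteq> []} \<subseteq> {..N}"
    using fits unfolding fits_def by (auto simp: not_le[symmetric])
  then have fin: "finite {r. \<kappa> r \<noteq> []}" by (rule finite_subset) simp
  have occ: "occurrences N \<kappa> j = occurrences N \<nu> j" if "j \<in> P" for j
  proof -
    have j: "j \<in> verts Q" "\<tau> j \<in> verts Q" using that P_verts tau_closed by auto
    have "of_bool (s = j) + of_bool (s = \<tau> j) = (of_bool (?i = j) + of_bool (?i = \<tau> j) :: nat)"
      using s(2)
    proof
      assume "\<tau> s = ?i"
      then have "?i = j \<longleftrightarrow> s = \<tau> j" "?i = \<tau> j \<longleftrightarrow> s = j" using sv j tau_tau by metis+
      then show ?thesis by simp
    qed simp
    moreover have "occurrences N \<nu> j = occurrences N (\<rho>(a := insert_at l ?i (\<rho> a))) j"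
      by (simp only: \<nu>'[symmetric])
    ultimately show ?thesis
      unfolding \<kappa> by (simp only: occurrences_insert_at[OF b(2)] occurrences_insert_at[OF a(2)])
  qed
  have set: "set (\<kappa> r) \<subseteq> alphabet r \<and> sorted_wrt (interval_le r) (\<kappa> r)" if "1 \<le> r" for r
  proof (cases "r = b")
    case True
    then show ?thesis using sorted s(1) sub[of b] \<nu>(1) b(1) unfolding \<kappa> seqs_iff
      by (auto simp: set_insert_at)
  next
    case False
    have "sorted_wrt (interval_le r) (\<rho> r)"
    proof (cases "r = a")
      case True
      have "sorted_wrt (interval_le a) (take l (\<nu> a) @ ?i # drop (Suc l) (\<nu> a))"
        using seqs_sorted[OF \<nu>(1) a(1)] a(3) by (simp add: id_take_nth_drop[symmetric])
      then show ?thesis using True unfolding \<rho> remove_at_def by (simp add: sorted_wrt_append)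
    next
      case False
      then show ?thesis using seqs_sorted[OF \<nu>(1) that] unfolding \<rho> remove_at_def by simp
    qed
    then show ?thesis using False sub[of r] \<nu>(1) that unfolding \<kappa> seqs_iff by auto
  qed
  have "\<kappa> 0 = []" using zero[of 0] \<nu>(1) b(1) by (simp add: seqs_iff)
  moreover have "(\<Sum>r \<in> {r. \<kappa> r \<noteq> []}. count_list (\<kappa> r) i + count_list (\<kappa> r) (\<tau> i)) = v i"
    if i: "i \<in> P" for i
  proof -
    have "(\<Sum>r \<in> {r. \<kappa> r \<noteq> []}. count_list (\<kappa> r) i + count_list (\<kappa> r) (\<tau> i)) = occurrences N \<kappa> i"
      unfolding occurrences_def by (rule sum_fits[OF fits]) simp
    also have "\<dots> = occurrences N \<nu> i" using occ i .
    also have "\<dots> = (\<Sum>r \<in> {r. \<nu> r \<noteq> []}. count_list (\<nu> r) i + count_list (\<nu> r) (\<tau> i))"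
      unfolding occurrences_def by (rule sum_fits[OF \<nu>(2), symmetric]) simp
    finally show ?thesis using \<nu>(1) i by (simp add: seqs_iff)
  qed
  ultimately show "\<kappa> \<in> seqs" using fin set unfolding seqs_iff by blast
  have "remove_at \<kappa> b m = \<rho>" unfolding \<kappa> using m by (rule insert_at_remove_at)
  then show "moved \<kappa> b m s \<nu> a l ?i"
    unfolding moved_def using a b m \<rho> by (simp add: \<kappa>)
qed

text \<open>The four kinds of nontrivial generators at a fixed number of red strands, from
  \<open>\<nu>\<close> at the bottom to \<open>\<nu>'\<close> at the top. The idempotents reappear
  as empty products.\<close>

definition generator_diagram :: "nat \<Rightarrow> (nat \<Rightarrow> 'q list) \<Rightarrow> (nat \<Rightarrow> 'q list) \<Rightarrow> 'q diagram \<Rightarrow> bool" where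
  "generator_diagram N \<nu> \<nu>' d \<longleftrightarrow>
     (\<exists>a l b l' i. a mod 2 = b mod 2 \<and> moved \<nu> a l i \<nu>' b l' i \<and>
        d = long_crossing (sword N \<nu>) (pos \<nu> a l) (pos \<nu>' b l')) \<or>
     (\<exists>a l b l' i. a mod 2 \<noteq> b mod 2 \<and> moved \<nu> a l i \<nu>' b l' (\<tau> i) \<and>
        d = long_reflection \<tau> (sword N \<nu>) (pos \<nu> a l) i (pos \<nu>' b l')) \<or>
     \<nu>' = \<nu> \<and> (\<exists>j k. 1 \<le> j \<and> Suc k < length (\<nu> j) \<and> \<nu> j ! k = \<nu> j ! Suc k \<and>
        d = elementary (sword N \<nu>) (Swap (pos \<nu> j k))) \<or>
     \<nu>' = \<nu> \<and> (\<exists>j k. 1 \<le> j \<and> k < length (\<nu> j) \<and> d = dot_at (sword N \<nu>) (pos \<nu> j k))"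

text \<open>The height of the lower end of a strand in the unfolded picture, extended as an odd
  function: the image of a strand under the mirror has the negative height.\<close>

definition source_height :: "'q word \<Rightarrow> int \<Rightarrow> int" where
  "source_height u x = (if 0 < x then int (height u (nat x - 1)) else - int (height u (nat (- x) -
    1)))"

lemma source_height_mono:
  assumes "1 \<le> \<bar>x\<bar>" "\<bar>x\<bar> \<le> int (length u)" "1 \<le> \<bar>y\<bar>" "\<bar>y\<bar> \<le> int (length u)" "x \<le> y"
  shows "source_height u x \<le> source_height u y"
proof -
  consider "0 < x" | "x < 0" "0 < y" | "y < 0" using assms by linarith
  then show ?thesis
  proof cases
    case 1
    then have "height u (nat x - 1) \<le> height u (nat y - 1)" using assms by (intro height_mono)
      linarith+
    then show ?thesis using 1 assms by (simp add: source_height_def)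
  next
    case 2
    then show ?thesis by (simp add: source_height_def)
  next
    case 3
    then have "height u (nat (- y) - 1) \<le> height u (nat (- x) - 1)" using assms by (intro
      height_mono) linarith+
    then show ?thesis using 3 assms by (simp add: source_height_def)
  qed
qed

lemma source_height_uminus: "x \<noteq> 0 \<Longrightarrow> source_height u (- x) = - source_height u x"
  by (auto simp: source_height_def)

lemma height_sword_pos: "k < length (sword N \<nu>) \<Longrightarrow> 0 < height (sword N \<nu>) k"
proof -
  assume k: "k < length (sword N \<nu>)"
  have "sword N \<nu> ! 0 = Red (\<Lambda> 0)" by (simp add: seq_word_def)
  then have "height (sword N \<nu>) 0 = 1" by (simp add: height_def reds_before_def)
  then show ?thesis using height_mono[of 0 k "sword N \<nu>"] k by simp
qed

lemma source_locate:
  assumes "1 \<le> x" "x \<le> int (length (sword N \<nu>))" "sword N \<nu> ! (nat x - 1) = Black i"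
  obtains b m where "1 \<le> b" "b \<le> N" "m < length (\<nu> b)" "nat x - 1 = pos \<nu> b m" "\<nu> b ! m = i"
    "source_height (sword N \<nu>) x = 2 * int b"
proof -
  have "nat x - 1 < length (sword N \<nu>)" using assms(1,2) by linarith
  then obtain b m where b: "1 \<le> b" "b \<le> N" "m < length (\<nu> b)" "nat x - 1 = pos \<nu> b m"
    using seq_word_locate[of "nat x - 1" \<Lambda> N \<nu>] assms(3) by auto
  note n = seq_word_nth_before[where \<Lambda> = \<Lambda> and \<nu> = \<nu> and a = b and l = m and N = N, OF b(1-3)]
  have "\<nu> b ! m = i" using n(2) assms(3) b(4) by simp
  moreover have "source_height (sword N \<nu>) x = 2 * int b"
    using n(3) b(4) assms(1) by (simp add: source_height_def)
  ultimately show ?thesis using that b by blast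
qed

lemma same_height_le:
  assumes \<nu>: "\<nu> \<in> seqs" and st: "state (sword N \<nu>) L" "x \<in> set L \<or> - x \<in> set L" "y \<in> set L \<or> - y \<in>
    set L"
    and h: "source_height (sword N \<nu>) x = 2 * int b" "source_height (sword N \<nu>) y = 2 * int b" "1 \<le>
      b"
    and l: "letter_of (sword N \<nu>) x = Black i" "letter_of (sword N \<nu>) y = Black j" and xy: "x \<le> y"
  shows "interval_le b i j"
proof -
  let ?u = "sword N \<nu>"
  have pos: "0 < z" if "source_height ?u z = 2 * int b" for z
    using that h(3) by (auto simp: source_height_def split: if_splits)
  have "\<bar>x\<bar> \<le> int (length ?u)" "\<bar>y\<bar> \<le> int (length ?u)" using state_set(2)[OF st(1)] st(2,3) by
    force+
  then have b: "x \<le> int (length ?u)" "y \<le> int (length ?u)" "1 \<le> x" "1 \<le> y"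
    using pos[OF h(1)] pos[OF h(2)] by auto
  have lx: "?u ! (nat x - 1) = Black i" "?u ! (nat y - 1) = Black j"
    using l b(3,4) by (auto simp: letter_of_def)
  obtain b1 m1 where 1: "1 \<le> b1" "m1 < length (\<nu> b1)" "nat x - 1 = pos \<nu> b1 m1" "\<nu> b1 ! m1 = i"
    "source_height ?u x = 2 * int b1"
    using source_locate[OF b(3,1) lx(1)] by metis
  obtain b2 m2 where 2: "1 \<le> b2" "m2 < length (\<nu> b2)" "nat y - 1 = pos \<nu> b2 m2" "\<nu> b2 ! m2 = j"
    "source_height ?u y = 2 * int b2"
    using source_locate[OF b(4,2) lx(2)] by metis
  have "b1 = b" "b2 = b" using 1 2 h by auto
  moreover have "pos \<nu> b1 m1 \<le> pos \<nu> b2 m2" using 1(3) 2(3) xy by linarith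
  ultimately have "m1 \<le> m2" using 1 2 by (simp add: length_before)
  then show ?thesis using seqs_sorted_nth[OF \<nu>, of b m1 m2] 1 2 \<open>b1 = b\<close> \<open>b2 = b\<close> h(3) by auto
qed

lemma filter_nth_length:
  assumes "k < length xs" "p (xs ! k)"
  shows "length (filter p (take k xs)) < length (filter p xs)"
    and "filter p xs ! length (filter p (take k xs)) = xs ! k"
proof -
  have "filter p xs = filter p (take k xs @ xs ! k # drop (Suc k) xs)"
    using assms(1) by (simp only: id_take_nth_drop[symmetric])
  then have "filter p xs = filter p (take k xs) @ xs ! k # filter p (drop (Suc k) xs)"
    using assms(2) by simp
  then show "length (filter p (take k xs)) < length (filter p xs)"
    and "filter p xs ! length (filter p (take k xs)) = xs ! k" by simp_all
qed

lemma reds_before_word_of: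
  "reds_before (word_of u L) k = length (filter (\<lambda>x. is_red (letter_of u x)) (take k L))"
  by (simp add: reds_before_def word_of_def take_map filter_map o_def)

text \<open>Red strands keep their order, so the red letter with a given number at the top comes
  from the one with the same number at the bottom, and this number determines the height. Hence a
  strand whose two heights differ is black.\<close>

lemma red_source_height:
  assumes st: "state u L" and k: "k < length L" and red: "is_red (letter_of u (L ! k))"
  shows "source_height u (L ! k) = int (height (word_of u L) k)"
proof -
  let ?p = "\<lambda>x. is_red (letter_of u x)" and ?n = "standard (length u)"
  have Lk: "L ! k \<in> set L" using k by simp
  have pos: "0 < L ! k" using st red Lk by (auto simp: state_def)
  define m where "m = nat (L ! k) - 1"
  have m: "m < length u" "?n ! m = L ! k"
    using pos state_set[OF st Lk] by (auto simp: m_def)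
  have "set (filter ?p L) = set (filter ?p ?n)"
  proof (intro set_eqI iffI)
    fix x assume "x \<in> set (filter ?p L)"
    then have "x \<in> set L" "?p x" "0 < x" using st by (auto simp: state_def)
    then show "x \<in> set (filter ?p ?n)" using state_set[OF st, of x] by (auto simp: set_standard)
  next
    fix x assume x: "x \<in> set (filter ?p ?n)"
    then have "x \<in># mset (map abs L)" using st by (auto simp: state_def)
    then obtain y where y: "y \<in> set L" "x = \<bar>y\<bar>" by auto
    show "x \<in> set (filter ?p L)"
    proof (cases "0 < y")
      case True
      then show ?thesis using x y by auto
    next
      case False
      then have "letter_of u x = bar (letter_of u y)" using letter_of_uminus[OF st y(1)] y(2) by
        simp
      then have "?p y" using x by simp
      then show ?thesis using False st y(1) by (auto simp: state_def)
    qed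
  qed
  moreover have "distinct (filter ?p L)" using state_distinct[OF st] by (simp add: distinct_map)
  moreover have "sorted (filter ?p L)" using st by (simp add: state_def)
  moreover have "distinct (filter ?p ?n)" using distinct_standard by simp
  moreover have "sorted (filter ?p ?n)"
    using sorted_standard[of "length u"] by (simp add: sorted_filter[where f = "\<lambda>x. x", simplified])
  ultimately have eq: "filter ?p L = filter ?p ?n" by (intro sorted_distinct_set_unique)
  have 1: "length (filter ?p (take k L)) < length (filter ?p L)"
      "filter ?p L ! length (filter ?p (take k L)) = L ! k"
    using filter_nth_length[of k L ?p] k red by auto
  have 2: "length (filter ?p (take m ?n)) < length (filter ?p ?n)"
      "filter ?p ?n ! length (filter ?p (take m ?n)) = L ! k"
    using filter_nth_length[of m ?n ?p] m red by auto
  have "length (filter ?p (take k L)) = length (filter ?p (take m ?n))"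
    using 1 2 eq \<open>distinct (filter ?p ?n)\<close> by (metis nth_eq_iff_index_eq)
  then have r: "reds_before (word_of u L) k = reds_before u m"
    using reds_before_word_of[of u L k] reds_before_word_of[of u ?n m] by simp
  have "is_red (u ! m)" using red pos by (simp add: letter_of_def m_def)
  moreover have "is_red (word_of u L ! k)" using red k by (simp add: nth_word_of)
  ultimately show ?thesis using pos r by (simp add: source_height_def height_def m_def)
qed

end


lemma insert_at_inject:
  assumes "k \<le> length xs" "k \<le> length ys" "insert_at k a xs = insert_at k b ys"
  shows "a = b" "xs = ys"
proof -
  show "a = b" using assms nth_insert_at by metis
  have "take k xs = take k ys" "drop k xs = drop k ys"
    using assms take_insert_at drop_insert_at by metis+
  then show "xs = ys" by (metis append_take_drop_id)
qed

context interval_setting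
begin

section \<open>Strands met by the moving strand\<close>

lemma source_less:
  assumes "state u L" "x \<in> set L \<or> - x \<in> set L" "y \<in> set L \<or> - y \<in> set L"
    "source_height u x < source_height u y"
  shows "x < y"
proof (rule ccontr)
  assume "\<not> x < y"
  moreover have "1 \<le> \<bar>x\<bar>" "\<bar>x\<bar> \<le> int (length u)" "1 \<le> \<bar>y\<bar>" "\<bar>y\<bar> \<le> int (length u)"
    using assms(2,3) state_set[OF assms(1)] by force+
  ultimately show False using source_height_mono[of y u x] assms(4) by simp
qed

text \<open>A passed strand ends at the bottom in an interval not after the one it has at the top,
  hence at height at most \<open>2 * b\<close>. If it is lower, it ends to the left of
  \<open>z\<close>. If it equals \<open>2 * b\<close>, its upper end is one of the first
  \<open>l\<close> letters of interval \<open>b\<close>, so its label is strictly smaller, and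
  sorting at the bottom puts it to the left of \<open>z\<close>.\<close>

lemma passed_right:
  assumes \<nu>: "\<nu> \<in> seqs" and st: "state (sword N \<nu>) L"
    and z: "z \<in> set L \<or> - z \<in> set L" "source_height (sword N \<nu>) z = 2 * int b"
      "letter_of (sword N \<nu>) z = Black i"
    and b: "1 \<le> b" "b \<le> N" "l \<le> length (\<rho> b)" "\<And>m. m < l \<Longrightarrow> \<not> interval_le b i (\<rho> b ! m)"
    and R: "word_of (sword N \<nu>) R = sword N \<rho>"
    and j: "j < pos \<rho> b l" "j < length R" "R ! j \<in> set L"
      "source_height (sword N \<nu>) (R ! j) \<le> int (height (sword N \<rho>) j)"
  shows "R ! j < z"
proof (cases "source_height (sword N \<nu>) (R ! j) < 2 * int b")
  case True
  then show ?thesis using source_less[OF st _ z(1), of "R ! j"] j(3) z(2) by simp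
next
  case False
  from height_before[where \<Lambda> = \<Lambda> and \<nu> = \<rho> and a = b and N = N and l = l, OF b(1-3) j(1)]
  obtain m where m: "height (sword N \<rho>) j = 2 * b" "m < l" "j = pos \<rho> b m"
    using False j(4) by auto
  have "sword N \<rho> ! j = Black (\<rho> b ! m)"
    using seq_word_nth_before(2)[where \<Lambda> = \<Lambda> and \<nu> = \<rho> and a = b and N = N and l = m] b m by simp
  then have "letter_of (sword N \<nu>) (R ! j) = Black (\<rho> b ! m)"
    using nth_word_of[OF j(2), of "sword N \<nu>"] R by simp
  moreover have "source_height (sword N \<nu>) (R ! j) = 2 * int b" using False j(4) m(1) by simp
  ultimately have "z \<le> R ! j \<Longrightarrow> interval_le b i (\<rho> b ! m)"
    using same_height_le[OF \<nu> st z(1) _ z(2) _ b(1) z(3)] j(3) by blast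
  then show ?thesis using b(4)[OF m(2)] by force
qed

text \<open>The counterpart for a strand moving left. The passed strands stay in their heights, and
  those in interval \<open>b\<close> have strictly larger labels.\<close>

lemma passed_left:
  assumes \<nu>: "\<nu> \<in> seqs" and st: "state (sword N \<nu>) L"
    and z: "z \<in> set L \<or> - z \<in> set L" "source_height (sword N \<nu>) z = 2 * int b"
      "letter_of (sword N \<nu>) z = Black i"
    and b: "1 \<le> b" "b \<le> N" "l \<le> length (\<rho> b)"
      "\<And>m. \<lbrakk>l \<le> m; m < length (\<rho> b)\<rbrakk> \<Longrightarrow> \<not> interval_le b (\<rho> b ! m) i"
    and R: "word_of (sword N \<nu>) R = sword N \<rho>"
    and j: "pos \<rho> b l \<le> j" "j < length R" "R ! j \<in> set L"
      "source_height (sword N \<nu>) (R ! j) = int (height (sword N \<rho>) j)"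
  shows "z < R ! j"
proof (cases "2 * int b < source_height (sword N \<nu>) (R ! j)")
  case True
  then show ?thesis using source_less[OF st z(1), of "R ! j"] j(3) z(2) by simp
next
  case False
  have len: "j < length (sword N \<rho>)" using j(2) length_word_of[of "sword N \<nu>" R] R by simp
  from height_after[where \<Lambda> = \<Lambda> and \<nu> = \<rho> and a = b and N = N and l = l, OF b(1-3) j(1) len]
  obtain m where m: "height (sword N \<rho>) j = 2 * b" "l \<le> m" "m < length (\<rho> b)" "j = pos \<rho> b m"
    using False j(4) by auto
  have "sword N \<rho> ! j = Black (\<rho> b ! m)"
    using seq_word_nth_before(2)[where \<Lambda> = \<Lambda> and \<nu> = \<rho> and a = b and N = N and l = m] b m by simp
  then have "letter_of (sword N \<nu>) (R ! j) = Black (\<rho> b ! m)"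
    using nth_word_of[OF j(2), of "sword N \<nu>"] R by simp
  moreover have "source_height (sword N \<nu>) (R ! j) = 2 * int b" using j(4) m(1) by simp
  ultimately have "R ! j \<le> z \<Longrightarrow> interval_le b (\<rho> b ! m) i"
    using same_height_le[OF \<nu> st _ z(1) _ z(2) b(1) _ z(3)] j(3) by blast
  then show ?thesis using b(4)[OF m(2,3)] by force
qed

text \<open>The uppermost part of some reduced diagram of \<open>L\<close> is a generator starting
  from an interval sequence \<open>\<kappa>\<close>. Since \<open>ss\<close> is nonempty, the
  remaining state \<open>K\<close> has fewer inversions.\<close>

definition peels :: "nat \<Rightarrow> (nat \<Rightarrow> 'q list) \<Rightarrow> (nat \<Rightarrow> 'q list) \<Rightarrow> int list \<Rightarrow> bool" where
  "peels N \<nu> \<nu>' L \<longleftrightarrow> (\<exists>\<kappa> K ss g. \<kappa> \<in> seqs \<and> fits \<Lambda> N \<kappa> \<and> descending L ss K \<and> ss \<noteq> [] \<and>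
     word_of (sword N \<nu>) K = sword N \<kappa> \<and> generator_diagram N \<kappa> \<nu>' g \<and>
     deq OKLRW (chain_diagram (sword N \<nu>) L ss) g)"

lemma peelsI: "\<lbrakk>\<kappa> \<in> seqs; fits \<Lambda> N \<kappa>; descending L ss K; K \<noteq> L;
     word_of (sword N \<nu>) K = sword N \<kappa>; generator_diagram N \<kappa> \<nu>' g;
     deq OKLRW (chain_diagram (sword N \<nu>) L ss) g\<rbrakk> \<Longrightarrow> peels N \<nu> \<nu>' L"
  unfolding peels_def by (metis descending.simps(1))

text \<open>The strand \<open>x\<close> at position \<open>k\<close> of the upper word has to be moved: \<open>a\<close> and \<open>b\<close> are its upper
  and lower intervals, and \<open>R\<close> and \<open>\<rho>\<close> arise by deleting it.\<close>

definition strand_data :: "nat \<Rightarrow> (nat \<Rightarrow> 'q list) \<Rightarrow> (nat \<Rightarrow> 'q list) \<Rightarrow> int list \<Rightarrow> nat \<Rightarrow>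
    int \<Rightarrow> nat \<Rightarrow> nat \<Rightarrow> nat \<Rightarrow> (nat \<Rightarrow> 'q list) \<Rightarrow> int list \<Rightarrow> 'q \<Rightarrow> bool" where
  "strand_data N \<nu> \<nu>' L k x a l b \<rho> R s \<longleftrightarrow>
     1 \<le> a \<and> a \<le> N \<and> l < length (\<nu>' a) \<and> k = pos \<nu>' a l \<and> \<rho> = remove_at \<nu>' a l \<and>
     k = pos \<rho> a l \<and> k \<le> length R \<and> L = insert_at k x R \<and> word_of (sword N \<nu>) R = sword N \<rho> \<and>
     letter_of (sword N \<nu>) x = Black (\<nu>' a ! l) \<and>
     height (sword N \<nu>') k = 2 * a \<and>
     (\<forall>j<k. R ! j = L ! j \<and> height (sword N \<rho>) j = height (sword N \<nu>') j) \<and>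
     (\<forall>j\<ge>k. j < length R \<longrightarrow> R ! j = L ! Suc j \<and> height (sword N \<rho>) j = height (sword N \<nu>') (Suc j)) \<and>
     1 \<le> b \<and> b \<le> N \<and> s \<in> alphabet b \<and> letter_of (sword N \<nu>) \<bar>x\<bar> = Black s \<and>
     source_height (sword N \<nu>) \<bar>x\<bar> = 2 * int b"

lemma strand_data_exists:
  assumes \<nu>: "\<nu> \<in> seqs" and \<nu>': "\<nu>' \<in> seqs" and st: "state (sword N \<nu>) L"
    and w: "word_of (sword N \<nu>) L = sword N \<nu>'"
    and k: "k < length L" "\<not> is_red (letter_of (sword N \<nu>) (L ! k))"
  shows "\<exists>a l b \<rho> R s. strand_data N \<nu> \<nu>' L k (L ! k) a l b \<rho> R s"
proof -
  let ?u = "sword N \<nu>" and ?w = "sword N \<nu>'" and ?x = "L ! k"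
  have len: "length ?w = length L" using w length_word_of by metis
  have wk: "?w ! k = letter_of ?u ?x" using nth_word_of[OF k(1), of ?u] w by simp
  obtain a l where a: "1 \<le> a" "a \<le> N" "l < length (\<nu>' a)" "k = pos \<nu>' a l"
    using seq_word_locate[of k \<Lambda> N \<nu>'] k len wk by metis
  note n = seq_word_nth_before[where \<Lambda> = \<Lambda> and \<nu> = \<nu>' and a = a and l = l and N = N, OF a(1-3)]
  define \<rho> where "\<rho> = remove_at \<nu>' a l"
  define R where "R = take k L @ drop (Suc k) L"
  have kR: "k \<le> length R" using k(1) by (simp add: R_def)
  have L: "L = insert_at k ?x R" unfolding R_def using insert_at_remove[OF k(1)] by simp
  have la: "l \<le> length (\<rho> a)" using a(3) by (simp add: \<rho>_def remove_at_def)
  have \<nu>'\<rho>: "\<nu>' = \<rho>(a := insert_at l (\<nu>' a ! l) (\<rho> a))"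
    unfolding \<rho>_def using remove_at_insert_at[where \<nu> = \<nu>' and a = a and l = l, OF a(3)] by simp
  have "pos (\<rho>(a := insert_at l (\<nu>' a ! l) (\<rho> a))) a l = pos \<rho> a l"
    by (subst before_upd[OF a(1)]) (use la in \<open>simp_all add: take_insert_at\<close>)
  then have k\<rho>: "k = pos \<rho> a l" using a(4) \<nu>'\<rho> by simp
  have ins: "?w = insert_at k (Black (\<nu>' a ! l)) (sword N \<rho>)"
    using seq_word_insert_at[where \<Lambda> = \<Lambda> and \<nu> = \<rho> and a = a and l = l and N = N, OF a(1,2) la, of
      "\<nu>' a ! l"]
      \<nu>'\<rho> k\<rho> by simp
  have "length (sword N \<rho>) = length R"
    using arg_cong[OF ins, of length] len arg_cong[OF L, of length] by simp
  then have kW: "k \<le> length (sword N \<rho>)" using kR by simp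
  have "insert_at k (letter_of ?u ?x) (word_of ?u R) = insert_at k (Black (\<nu>' a ! l)) (sword N \<rho>)"
    using w ins L word_of_insert_at by metis
  then have i: "letter_of ?u ?x = Black (\<nu>' a ! l)" and R: "word_of ?u R = sword N \<rho>"
    using insert_at_inject[of k "word_of ?u R" "sword N \<rho>"] kR kW by auto
  have h: "height (sword N \<rho>) j = height ?w j" if "j < k" for j
    unfolding ins using height_insert_at(1)[OF _ kW that, of "Black (\<nu>' a ! l)"] by simp
  have h': "height (sword N \<rho>) j = height ?w (Suc j)" if "k \<le> j" "j < length R" for j
    unfolding ins using height_insert_at(2)[OF _ kW that(1), of "Black (\<nu>' a ! l)"] that R
      length_word_of[of ?u R]
    by simp
  have xL: "?x \<in> set L" using k(1) by simp
  have bx: "1 \<le> \<bar>?x\<bar>" "\<bar>?x\<bar> \<le> int (length ?u)" using state_set[OF st xL] by auto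
  have "\<not> is_red (letter_of ?u \<bar>?x\<bar>)"
    using k(2) letter_of_uminus[OF st xL] by (cases "0 \<le> ?x") auto
  then obtain s where s: "letter_of ?u \<bar>?x\<bar> = Black s" by (auto simp: not_is_red)
  then have "?u ! (nat \<bar>?x\<bar> - 1) = Black s" using bx by (simp add: letter_of_def split: if_splits)
  from source_locate[OF bx this] obtain b m where b: "1 \<le> b" "b \<le> N" "m < length (\<nu> b)"
    "\<nu> b ! m = s" "source_height ?u \<bar>?x\<bar> = 2 * int b" by metis
  have "s \<in> alphabet b" using seqs_alphabet[OF \<nu> b(1,3)] b(4) by simp
  moreover have "\<forall>j<k. R ! j = L ! j" using k(1) by (simp add: R_def nth_append)
  moreover have "\<forall>j\<ge>k. j < length R \<longrightarrow> R ! j = L ! Suc j"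
    using k(1) by (auto simp: R_def nth_append)
  ultimately have "strand_data N \<nu> \<nu>' L k ?x a l b \<rho> R s"
    unfolding strand_data_def using a \<rho>_def k\<rho> kR L R i n(3) h h' b s by auto
  then show ?thesis by blast
qed

lemma strand_data_moved:
  assumes d: "strand_data N \<nu> \<nu>' L k x a l b \<rho> R s" and \<nu>': "\<nu>' \<in> seqs" "fits \<Lambda> N \<nu>'"
    and s: "s = \<nu>' a ! l \<or> \<tau> s = \<nu>' a ! l"
    and m: "m \<le> length (\<rho> b)" "sorted_wrt (interval_le b) (insert_at m s (\<rho> b))"
  obtains \<kappa> where "\<kappa> \<in> seqs" "fits \<Lambda> N \<kappa>" "moved \<kappa> b m s \<nu>' a l (\<nu>' a ! l)"
    "sword N \<kappa> = insert_at (pos \<rho> b m) (Black s) (sword N \<rho>)" "pos \<kappa> b m = pos \<rho> b m"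
    "pos \<rho> b m \<le> length R"
proof -
  have a: "1 \<le> a" "a \<le> N" "l < length (\<nu>' a)" and b: "1 \<le> b" "b \<le> N" and sb: "s \<in> alphabet b"
    and \<rho>: "\<rho> = remove_at \<nu>' a l" and R: "word_of (sword N \<nu>) R = sword N \<rho>"
    using d unfolding strand_data_def by blast+
  let ?k = "\<rho>(b := insert_at m s (\<rho> b))"
  note mv = seqs_moved[OF \<nu>' a b sb s \<rho> m refl]
  have "pos ?k b m = pos \<rho> b m"
    by (subst before_upd[OF b(1)]) (use m in \<open>simp_all add: take_insert_at\<close>)
  moreover have "sword N ?k = insert_at (pos \<rho> b m) (Black s) (sword N \<rho>)"
    by (rule seq_word_insert_at[where \<nu> = \<rho> and a = b and l = m and N = N, OF b m(1)])
  moreover have "pos \<rho> b m \<le> length R"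
    using length_before_le[where \<Lambda> = \<Lambda> and \<nu> = \<rho> and a = b and l = m and N = N, OF b m(1)] R
      length_word_of[of "sword N \<nu>" R] by simp
  ultimately show ?thesis using that mv by blast
qed

lemma remove_sorted:
  assumes "\<nu>' \<in> seqs" "1 \<le> b"
  shows "sorted_wrt (interval_le b) (remove_at \<nu>' a l b)" "set (remove_at \<nu>' a l b) \<subseteq> alphabet b"
proof -
  have s: "sorted_wrt (interval_le b) (\<nu>' b)" "set (\<nu>' b) \<subseteq> alphabet b" using assms by (auto simp:
    seqs_iff)
  have "sorted_wrt (interval_le b) (take l (\<nu>' b) @ drop (Suc l) (\<nu>' b))"
  proof (cases "l < length (\<nu>' b)")
    case True
    then have "sorted_wrt (interval_le b) (take l (\<nu>' b) @ \<nu>' b ! l # drop (Suc l) (\<nu>' b))"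
      using s(1) by (simp add: id_take_nth_drop[symmetric])
    then show ?thesis by (simp add: sorted_wrt_append)
  next
    case False
    then show ?thesis using s(1) by simp
  qed
  then show "sorted_wrt (interval_le b) (remove_at \<nu>' a l b)"
    using s(1) by (cases "b = a") (simp_all add: remove_at_def)
  show "set (remove_at \<nu>' a l b) \<subseteq> alphabet b"
    using s(2) by (auto simp: remove_at_def dest: in_set_takeD in_set_dropD)
qed

text \<open>For a strand that comes from the left: inside the interval it passes only strictly
  smaller letters.\<close>

lemma insert_before_equal:
  assumes \<nu>': "\<nu>' \<in> seqs" "1 \<le> b" and s: "s \<in> alphabet b" and \<rho>: "\<rho> = remove_at \<nu>' a l"
  obtains m where "m \<le> length (\<rho> b)" "sorted_wrt (interval_le b) (insert_at m s (\<rho> b))"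
    "\<And>n. n < m \<Longrightarrow> \<not> interval_le b s (\<rho> b ! n)"
proof -
  let ?p = "\<lambda>j. \<not> interval_le b s j"
  have p: "\<And>j. \<lbrakk>j \<in> alphabet b; ?p j\<rbrakk> \<Longrightarrow> interval_le b j s"
    "\<And>j. \<lbrakk>j \<in> alphabet b; \<not> ?p j\<rbrakk> \<Longrightarrow> interval_le b s j"
    "\<And>j k. \<lbrakk>j \<in> alphabet b; k \<in> alphabet b; interval_le b j k; ?p k\<rbrakk> \<Longrightarrow> ?p j"
    using interval_le_total s interval_le_trans by blast+
  note r = remove_sorted[OF \<nu>', of a l, folded \<rho>]
  let ?m = "length (takeWhile ?p (\<rho> b))"
  have "sorted_wrt (interval_le b) (insert_at ?m s (\<rho> b))"
    by (rule sorted_insert_takeWhile(1)[where p = ?p, OF r]) (fact p)+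
  moreover have "?p (\<rho> b ! n)" if "n < ?m" for n
    by (rule sorted_insert_takeWhile(2)[where p = ?p and i = s, OF r]) (fact p that)+
  ultimately show ?thesis using that[of ?m] length_takeWhile_le by blast
qed

text \<open>For a strand that comes from the right: inside the interval it passes only strictly
  larger letters.\<close>

lemma insert_after_equal:
  assumes \<nu>': "\<nu>' \<in> seqs" "1 \<le> b" and s: "s \<in> alphabet b" and \<rho>: "\<rho> = remove_at \<nu>' a l"
  obtains m where "m \<le> length (\<rho> b)" "sorted_wrt (interval_le b) (insert_at m s (\<rho> b))"
    "\<And>n. \<lbrakk>m \<le> n; n < length (\<rho> b)\<rbrakk> \<Longrightarrow> \<not> interval_le b (\<rho> b ! n) s"
proof -
  let ?p = "\<lambda>j. interval_le b j s"
  have p: "\<And>j. \<lbrakk>j \<in> alphabet b; ?p j\<rbrakk> \<Longrightarrow> interval_le b j s"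
    "\<And>j. \<lbrakk>j \<in> alphabet b; \<not> ?p j\<rbrakk> \<Longrightarrow> interval_le b s j"
    "\<And>j k. \<lbrakk>j \<in> alphabet b; k \<in> alphabet b; interval_le b j k; ?p k\<rbrakk> \<Longrightarrow> ?p j"
    using interval_le_total s interval_le_trans by blast+
  note r = remove_sorted[OF \<nu>', of a l, folded \<rho>]
  let ?m = "length (takeWhile ?p (\<rho> b))"
  have "sorted_wrt (interval_le b) (insert_at ?m s (\<rho> b))"
    by (rule sorted_insert_takeWhile(1)[where p = ?p, OF r]) (fact p)+
  moreover have "\<not> ?p (\<rho> b ! n)" if "?m \<le> n" "n < length (\<rho> b)" for n
    by (rule sorted_insert_takeWhile(3)[where p = ?p and i = s, OF r]) (fact p that)+
  ultimately show ?thesis using that[of ?m] length_takeWhile_le by blast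
qed

text \<open>The last strand whose lower interval is to the right of its upper one. No strand further
  to the right at the top has this property, so every strand passed on the way right fulfils the
  height condition of \<open>passed_right\<close>.\<close>

lemma peels_leftward:
  assumes \<nu>: "\<nu> \<in> seqs" and \<nu>': "\<nu>' \<in> seqs" "fits \<Lambda> N \<nu>'" and st: "state (sword N \<nu>) L"
    and w: "word_of (sword N \<nu>) L = sword N \<nu>'"
    and k: "k < length L" "int (height (sword N \<nu>') k) < source_height (sword N \<nu>) (L ! k)"
    and max: "\<And>j. \<lbrakk>k < j; j < length L\<rbrakk> \<Longrightarrow> source_height (sword N \<nu>) (L ! j) \<le> int (height (sword N
      \<nu>') j)"
  shows "peels N \<nu> \<nu>' L"
proof -
  let ?u = "sword N \<nu>" and ?x = "L ! k"
  have black: "\<not> is_red (letter_of ?u ?x)" using red_source_height[OF st k(1)] k(2) w by auto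
  obtain a l b \<rho> R s where d: "strand_data N \<nu> \<nu>' L k ?x a l b \<rho> R s"
    using strand_data_exists[OF \<nu> \<nu>'(1) st w k(1) black] by blast
  \<comment> \<open>Reflected strands have nonpositive source height, so a strand that has to move
    right is unreflected and the generator is a long crossing.\<close>
  have x: "0 < ?x" using k(2) by (auto simp: source_height_def split: if_splits)
  have D: "1 \<le> a" "a \<le> N" "l < length (\<nu>' a)" "k = pos \<nu>' a l" "\<rho> = remove_at \<nu>' a l" "k = pos \<rho> a
    l"
    "k \<le> length R" "L = insert_at k ?x R" "word_of ?u R = sword N \<rho>"
    "letter_of ?u ?x = Black (\<nu>' a ! l)" "height (sword N \<nu>') k = 2 * a"
    "1 \<le> b" "b \<le> N" "s \<in> alphabet b" "letter_of ?u ?x = Black s" "source_height ?u ?x = 2 * int b"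
    and R: "\<And>j. \<lbrakk>k \<le> j; j < length R\<rbrakk> \<Longrightarrow> R ! j = L ! Suc j \<and> height (sword N \<rho>) j = height (sword N
      \<nu>') (Suc j)"
    using d x unfolding strand_data_def by auto
  have s: "s = \<nu>' a ! l" using D(10,15) by simp
  have ab: "a < b" using k(2) D(11,16) by simp
  obtain m where m: "m \<le> length (\<rho> b)" "sorted_wrt (interval_le b) (insert_at m s (\<rho> b))"
    "\<And>n. n < m \<Longrightarrow> \<not> interval_le b s (\<rho> b ! n)"
    using insert_before_equal[OF \<nu>'(1) D(12,14,5)] by blast
  obtain \<kappa> where \<kappa>: "\<kappa> \<in> seqs" "fits \<Lambda> N \<kappa>" "moved \<kappa> b m s \<nu>' a l (\<nu>' a ! l)"
    "sword N \<kappa> = insert_at (pos \<rho> b m) (Black s) (sword N \<rho>)" "pos \<kappa> b m = pos \<rho> b m" "pos \<rho> b m \<le>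
      length R"
    using strand_data_moved[OF d \<nu>' _ m(1,2)] s by metis
  let ?q = "pos \<rho> b m"
  have lR: "length L = Suc (length R)" using arg_cong[OF D(8), of length] by simp
  have la: "l \<le> length (\<rho> a)" using D(3) by (simp add: D(5) remove_at_def)
  have kq: "k < ?q" unfolding D(6) using D(1) ab la m(1) by (rule length_before_mono)
  have less: "R ! j < ?x" if j: "k \<le> j" "j < ?q" for j
  proof (rule passed_right[OF \<nu> st _ D(16,15,12,13) m(1,3) D(9) j(2)])
    have jR: "j < length R" using j \<kappa>(6) by simp
    show "j < length R" by (rule jR)
    show "?x \<in> set L \<or> - ?x \<in> set L" using k(1) by simp
    show "R ! j \<in> set L" using R[OF j(1) jR] jR lR by simp
    show "source_height ?u (R ! j) \<le> int (height (sword N \<rho>) j)"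
      using R[OF j(1) jR] max[of "Suc j"] j(1) jR lR by simp
  qed
  have "state ?u (insert_at k ?x R)" using st D(8) by simp
  from chain_long_crossing_left[OF this kq \<kappa>(6) black less]
  obtain ss where ss: "descending L ss (insert_at ?q ?x R)"
    "deq OKLRW (chain_diagram ?u L ss) (long_crossing (word_of ?u (insert_at ?q ?x R)) ?q k)"
    unfolding D(8)[symmetric] by blast
  have wK: "word_of ?u (insert_at ?q ?x R) = sword N \<kappa>"
    unfolding word_of_insert_at D(9,15) \<kappa>(4) ..
  have "insert_at ?q ?x R ! k = R ! k" using kq \<kappa>(6) by (rule nth_insert_at_less)
  then have "insert_at ?q ?x R \<noteq> L" using less[of k] kq by auto
  moreover have "generator_diagram N \<kappa> \<nu>' (long_crossing (sword N \<kappa>) ?q k)"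
    unfolding generator_diagram_def
  proof (rule disjI1, intro exI conjI)
    show "moved \<kappa> b m s \<nu>' a l s" using \<kappa>(3) s by simp
    show "b mod 2 = a mod 2"
      using alphabet_parity[OF D(14)] seqs_alphabet[OF \<nu>'(1) D(1,3)] s by simp
    show "long_crossing (sword N \<kappa>) ?q k = long_crossing (sword N \<kappa>) (pos \<kappa> b m) (pos \<nu>' a l)"
      using \<kappa>(5) D(4) by simp
  qed
  ultimately show ?thesis
    using peelsI[OF \<kappa>(1,2) ss(1) _ wK, of \<nu>'] ss(2) unfolding wK by blast
qed

text \<open>Once no lower interval lies to the right of its upper one, the first strand with
  different intervals moves left. All strands before it have equal heights. If it is unreflected, it
  stops in its lower interval; otherwise it passes all strands before it, meets the mirror, and
  continues to the right as in the previous case.\<close>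

lemma peels_rightward:
  assumes \<nu>: "\<nu> \<in> seqs" and \<nu>': "\<nu>' \<in> seqs" "fits \<Lambda> N \<nu>'" and st: "state (sword N \<nu>) L"
    and w: "word_of (sword N \<nu>) L = sword N \<nu>'"
    and k: "k < length L" "source_height (sword N \<nu>) (L ! k) < int (height (sword N \<nu>') k)"
    and le: "\<And>j. j < length L \<Longrightarrow> source_height (sword N \<nu>) (L ! j) \<le> int (height (sword N \<nu>') j)"
    and min: "\<And>j. j < k \<Longrightarrow> source_height (sword N \<nu>) (L ! j) = int (height (sword N \<nu>') j)"
  shows "peels N \<nu> \<nu>' L"
proof -
  let ?u = "sword N \<nu>" and ?x = "L ! k"
  have black: "\<not> is_red (letter_of ?u ?x)" using red_source_height[OF st k(1)] k(2) w by auto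
  obtain a l b \<rho> R s where d: "strand_data N \<nu> \<nu>' L k ?x a l b \<rho> R s"
    using strand_data_exists[OF \<nu> \<nu>'(1) st w k(1) black] by blast
  have D: "1 \<le> a" "a \<le> N" "l < length (\<nu>' a)" "k = pos \<nu>' a l" "\<rho> = remove_at \<nu>' a l" "k = pos \<rho> a
    l"
    "k \<le> length R" "L = insert_at k ?x R" "word_of ?u R = sword N \<rho>"
    "letter_of ?u ?x = Black (\<nu>' a ! l)" "height (sword N \<nu>') k = 2 * a"
    "1 \<le> b" "b \<le> N" "s \<in> alphabet b" "letter_of ?u \<bar>?x\<bar> = Black s" "source_height ?u \<bar>?x\<bar> = 2 * int
      b"
    and R: "\<And>j. j < k \<Longrightarrow> R ! j = L ! j \<and> height (sword N \<rho>) j = height (sword N \<nu>') j"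
    "\<And>j. \<lbrakk>k \<le> j; j < length R\<rbrakk> \<Longrightarrow> R ! j = L ! Suc j \<and> height (sword N \<rho>) j = height (sword N \<nu>') (Suc
      j)"
    using d unfolding strand_data_def by auto
  have lR: "length L = Suc (length R)" using arg_cong[OF D(8), of length] by simp
  have la: "l \<le> length (\<rho> a)" using D(3) by (simp add: D(5) remove_at_def)
  have xL: "?x \<in> set L" using k(1) by simp
  have x0: "?x \<noteq> 0" using state_set(1)[OF st xL] by auto
  have stR: "state ?u (insert_at k ?x R)" using st D(8) by simp
  show ?thesis
  proof (cases "0 < ?x")
    case True
    then have x: "letter_of ?u ?x = Black s" "source_height ?u ?x = 2 * int b" using D(15,16) by
      auto
    have s: "s = \<nu>' a ! l" using D(10) x(1) by simp
    have ba: "b < a" using k(2) D(11) x(2) by simp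
    obtain m where m: "m \<le> length (\<rho> b)" "sorted_wrt (interval_le b) (insert_at m s (\<rho> b))"
      "\<And>n. \<lbrakk>m \<le> n; n < length (\<rho> b)\<rbrakk> \<Longrightarrow> \<not> interval_le b (\<rho> b ! n) s"
      using insert_after_equal[OF \<nu>'(1) D(12,14,5)] by blast
    obtain \<kappa> where \<kappa>: "\<kappa> \<in> seqs" "fits \<Lambda> N \<kappa>" "moved \<kappa> b m s \<nu>' a l (\<nu>' a ! l)"
      "sword N \<kappa> = insert_at (pos \<rho> b m) (Black s) (sword N \<rho>)" "pos \<kappa> b m = pos \<rho> b m" "pos \<rho> b m \<le>
        length R"
      using strand_data_moved[OF d \<nu>' _ m(1,2)] s by metis
    let ?q = "pos \<rho> b m"
    have qk: "?q < k" unfolding D(6) using D(12) ba m(1) la by (rule length_before_mono)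
    have less: "?x < R ! j" if j: "?q \<le> j" "j < k" for j
    proof (rule passed_left[OF \<nu> st _ x(2,1) D(12,13) m(1,3) D(9) j(1)])
      show "j < length R" using j D(7) by simp
      show "?x \<in> set L \<or> - ?x \<in> set L" using xL by simp
      show "R ! j \<in> set L" using R(1)[OF j(2)] j(2) k(1) by simp
      show "source_height ?u (R ! j) = int (height (sword N \<rho>) j)"
        using R(1)[OF j(2)] min[OF j(2)] by simp
    qed
    from chain_long_crossing_right[OF stR less_imp_le[OF qk] D(7) black less]
    obtain ss where ss: "descending L ss (insert_at ?q ?x R)"
      "deq OKLRW (chain_diagram ?u L ss) (long_crossing (word_of ?u (insert_at ?q ?x R)) ?q k)"
      unfolding D(8)[symmetric] by blast
    have wK: "word_of ?u (insert_at ?q ?x R) = sword N \<kappa>"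
      unfolding word_of_insert_at D(9) x(1) \<kappa>(4) ..
    have "insert_at ?q ?x R ! ?q = ?x" using \<kappa>(6) by simp
    moreover have "L ! ?q = R ! ?q" using R(1)[OF qk] by simp
    ultimately have "insert_at ?q ?x R \<noteq> L" using less[of ?q] qk by auto
    moreover have "generator_diagram N \<kappa> \<nu>' (long_crossing (sword N \<kappa>) ?q k)"
      unfolding generator_diagram_def
    proof (rule disjI1, intro exI conjI)
      show "moved \<kappa> b m s \<nu>' a l s" using \<kappa>(3) s by simp
      show "b mod 2 = a mod 2"
        using alphabet_parity[OF D(14)] seqs_alphabet[OF \<nu>'(1) D(1,3)] s by simp
      show "long_crossing (sword N \<kappa>) ?q k = long_crossing (sword N \<kappa>) (pos \<kappa> b m) (pos \<nu>' a l)"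
        using \<kappa>(5) D(4) by simp
    qed
    ultimately show ?thesis
      using peelsI[OF \<kappa>(1,2) ss(1) _ wK, of \<nu>'] ss(2) unfolding wK by blast
  next
    case False
    then have neg: "?x < 0" using x0 by simp
    let ?y = "- ?x"
    have y: "letter_of ?u ?y = Black s" "source_height ?u ?y = 2 * int b" using D(15,16) neg by
      simp_all
    have "letter_of ?u ?y = Black (\<tau> (\<nu>' a ! l))" using letter_of_uminus[OF st xL] D(10) by simp
    then have "s = \<tau> (\<nu>' a ! l)" using y(1) by simp
    then have s: "\<tau> s = \<nu>' a ! l"
      using tau_tau alphabet_verts[OF seqs_alphabet[OF \<nu>'(1) D(1,3)]] by simp
    obtain m where m: "m \<le> length (\<rho> b)" "sorted_wrt (interval_le b) (insert_at m s (\<rho> b))"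
      "\<And>n. n < m \<Longrightarrow> \<not> interval_le b s (\<rho> b ! n)"
      using insert_before_equal[OF \<nu>'(1) D(12,14,5)] by blast
    obtain \<kappa> where \<kappa>: "\<kappa> \<in> seqs" "fits \<Lambda> N \<kappa>" "moved \<kappa> b m s \<nu>' a l (\<nu>' a ! l)"
      "sword N \<kappa> = insert_at (pos \<rho> b m) (Black s) (sword N \<rho>)" "pos \<kappa> b m = pos \<rho> b m" "pos \<rho> b m \<le>
        length R"
      using strand_data_moved[OF d \<nu>' _ m(1,2)] s by metis
    let ?q = "pos \<rho> b m"
    \<comment> \<open>Up to the mirror the strand meets only strands with nonnegative source height,
      while its own is \<open>- 2 * b\<close>.\<close>
    have left: "?x < R ! j" if j: "j < k" for j
    proof -
      have "0 \<le> source_height ?u (R ! j)" using R(1)[OF j] min[OF j] by simp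
      moreover have "source_height ?u ?x < 0"
        using source_height_uminus[OF x0, of ?u] y(2) D(12) by simp
      moreover have "R ! j \<in> set L" using R(1)[OF j] j k(1) by simp
      ultimately show ?thesis using source_less[OF st, of ?x "R ! j"] xL by simp
    qed
    have right: "R ! j < ?y" if j: "j < ?q" for j
    proof (rule passed_right[OF \<nu> st _ y(2,1) D(12,13) m(1,3) D(9) j])
      have jR: "j < length R" using j \<kappa>(6) by simp
      show "j < length R" by (rule jR)
      show "?y \<in> set L \<or> - ?y \<in> set L" using xL by simp
      show "R ! j \<in> set L" using R(1)[of j] R(2)[of j] jR lR by (cases "j < k") auto
      show "source_height ?u (R ! j) \<le> int (height (sword N \<rho>) j)"
        using R(1)[of j] R(2)[of j] le[of j] le[of "Suc j"] jR lR by (cases "j < k") auto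
    qed
    from chain_long_reflection[OF stR D(7) \<kappa>(6) y(1) neg left right]
    obtain ss where ss: "descending L ss (insert_at ?q ?y R)"
      "deq OKLRW (chain_diagram ?u L ss) (long_reflection \<tau> (word_of ?u (insert_at ?q ?y R)) ?q s
        k)"
      unfolding D(8)[symmetric] by blast
    have wK: "word_of ?u (insert_at ?q ?y R) = sword N \<kappa>"
      unfolding word_of_insert_at D(9) y(1) \<kappa>(4) ..
    \<comment> \<open>Absolute values in a state are distinct, so \<open>L\<close> cannot contain
      both entries. Hence the state really changes, even if the position does not.\<close>
    have "?y \<notin> set L"
    proof
      assume "?y \<in> set L"
      moreover have "inj_on abs (set L)" using state_distinct[OF st] by (simp add: distinct_map)
      ultimately have "?y = ?x" using xL by (metis abs_minus_cancel inj_onD)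
      then show False using neg by simp
    qed
    then have "insert_at ?q ?y R \<noteq> L" using set_insert_at[of ?q ?y R] by auto
    moreover have "generator_diagram N \<kappa> \<nu>' (long_reflection \<tau> (sword N \<kappa>) ?q s k)"
      unfolding generator_diagram_def
    proof (rule disjI2, rule disjI1, intro exI conjI)
      show "moved \<kappa> b m s \<nu>' a l (\<tau> s)" using \<kappa>(3) s by simp
      show "b mod 2 \<noteq> a mod 2"
        using alphabet_parity_tau[OF D(14)] seqs_alphabet[OF \<nu>'(1) D(1,3)] s by simp
      show "long_reflection \<tau> (sword N \<kappa>) ?q s k = long_reflection \<tau> (sword N \<kappa>) (pos \<kappa> b m) s (pos
        \<nu>' a l)"
        using \<kappa>(5) D(4) by simp
    qed
    ultimately show ?thesis
      using peelsI[OF \<kappa>(1,2) ss(1) _ wK, of \<nu>'] ss(2) unfolding wK by blast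
  qed
qed

text \<open>All heights agree, so no strand is reflected and a descent swaps two strands of one
  interval. This interval is sorted at the top and at the bottom, in opposite orders of the two
  strands, so antisymmetry makes the labels equal and the crossing admissible.\<close>

lemma peels_crossing:
  assumes \<nu>: "\<nu> \<in> seqs" and \<nu>': "\<nu>' \<in> seqs" "fits \<Lambda> N \<nu>'" and st: "state (sword N \<nu>) L"
    and w: "word_of (sword N \<nu>) L = sword N \<nu>'" and inv: "0 < inversions L"
    and eq: "\<And>j. j < length L \<Longrightarrow> source_height (sword N \<nu>) (L ! j) = int (height (sword N \<nu>') j)"
  shows "peels N \<nu> \<nu>' L"
proof -
  let ?u = "sword N \<nu>" and ?w = "sword N \<nu>'"
  have len: "length ?w = length L" using w length_word_of by metis
  have pos: "0 < L ! j" if "j < length L" for j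
    using eq[OF that] height_sword_pos[of j N \<nu>'] that len by (auto simp: source_height_def split:
      if_splits)
  have "\<exists>s. descent s L"
  proof (rule ccontr)
    assume "\<nexists>s. descent s L"
    then have "L = standard (length ?u)" using st by (intro no_descent_standard) (auto simp:
      state_def)
    then show False using inv by simp
  qed
  then obtain s where s: "descent s L" by blast
  then obtain k where sk: "s = Swap k" using pos[of 0] by (cases s) auto
  then have k: "Suc k < length L" "L ! Suc k < L ! k" using s by auto
  let ?x = "L ! k" and ?y = "L ! Suc k"
  have xy: "?x \<in> set L" "?y \<in> set L" using k by simp_all
  have "source_height ?u ?y \<le> source_height ?u ?x"
    using source_less[OF st, of ?x ?y] k(2) xy by fastforce
  then have h: "height ?w k = height ?w (Suc k)"
    using eq[of k] eq[of "Suc k"] height_mono[of k "Suc k" ?w] k(1) len by simp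
  then have black: "\<not> is_red (?w ! k)" "\<not> is_red (?w ! Suc k)"
    using height_less[of k "Suc k" ?w] k(1) len by auto
  obtain a l where a: "1 \<le> a" "a \<le> N" "l < length (\<nu>' a)" "k = pos \<nu>' a l"
    using seq_word_locate[of k \<Lambda> N \<nu>'] black(1) k(1) len by (metis Suc_lessD)
  obtain a2 l2 where a2: "1 \<le> a2" "a2 \<le> N" "l2 < length (\<nu>' a2)" "Suc k = pos \<nu>' a2 l2"
    using seq_word_locate[of "Suc k" \<Lambda> N \<nu>'] black(2) k(1) len by metis
  note n = seq_word_nth_before[where \<Lambda> = \<Lambda> and \<nu> = \<nu>' and a = a and l = l and N = N, OF a(1-3)]
  note n2 = seq_word_nth_before[where \<Lambda> = \<Lambda> and \<nu> = \<nu>' and a = a2 and l = l2 and N = N, OF a2(1-3)]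
  have "a2 = a" using h n(3) n2(3) a(4) a2(4) by simp
  then have l2: "l2 = Suc l" using a(3,4) a2(3,4) by (simp add: length_before)
  let ?i = "\<nu>' a ! l" and ?j = "\<nu>' a ! Suc l"
  have l: "letter_of ?u ?x = Black ?i" "letter_of ?u ?y = Black ?j"
    using n(2) n2(2) a(4) a2(4) \<open>a2 = a\<close> l2 w k(1) nth_word_of[of _ L ?u] by simp_all
  have hx: "source_height ?u ?x = 2 * int a" "source_height ?u ?y = 2 * int a"
    using eq[of k] eq[of "Suc k"] n(3) n2(3) a(4) a2(4) \<open>a2 = a\<close> k(1) by simp_all
  have "interval_le a ?j ?i"
    using same_height_le[OF \<nu> st _ _ hx(2,1) a(1) l(2,1)] xy k(2) by simp
  moreover have ij: "?i \<in> alphabet a" "?j \<in> alphabet a"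
    using seqs_alphabet[OF \<nu>'(1) a(1)] a(3) a2(3) \<open>a2 = a\<close> l2 by auto
  moreover have "interval_le a ?i ?j"
    using seqs_sorted_nth[OF \<nu>'(1) a(1), of l "Suc l"] a2(3) \<open>a2 = a\<close> l2 by simp
  ultimately have e: "?i = ?j" by (intro interval_le_antisym)
  have mv: "word_of ?u (move s L) = act bar s ?w" using state_descent(2)[OF st s] w by simp
  have "?w ! k = ?w ! Suc k" using n(2) n2(2) a(4) a2(4) \<open>a2 = a\<close> l2 e by simp
  then have "act bar s ?w = ?w" unfolding sk act.simps by (metis list_update_id)
  then have wK: "word_of ?u (move s L) = ?w" using mv by simp
  have "descending L [s] (move s L)" using s by simp
  moreover have "move s L \<noteq> L" using inversions_descent[OF s] by auto
  moreover have "deq OKLRW (chain_diagram ?u L [s]) (elementary ?w s)"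
    using chain_diagram_single[OF st s] wK by simp
  moreover have "generator_diagram N \<nu>' \<nu>' (elementary ?w s)"
    unfolding generator_diagram_def sk using a a2 \<open>a2 = a\<close> l2 e by blast
  ultimately show ?thesis using peelsI[OF \<nu>'] wK by blast
qed

text \<open>\<open>A\<close> contains the strands that have to move right and \<open>B\<close> those
  that have to move left. The choice of \<open>Max A\<close>, and of \<open>Min B\<close> if
  \<open>A\<close> is empty, is the choice of the rightmost upper end in the unfolded
  picture.\<close>

lemma peels_inversions:
  assumes \<nu>: "\<nu> \<in> seqs" and \<nu>': "\<nu>' \<in> seqs" "fits \<Lambda> N \<nu>'" and st: "state (sword N \<nu>) L"
    and w: "word_of (sword N \<nu>) L = sword N \<nu>'" and inv: "0 < inversions L"
  shows "peels N \<nu> \<nu>' L"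
proof -
  define h where "h j = source_height (sword N \<nu>) (L ! j)" for j
  define t where "t j = int (height (sword N \<nu>') j)" for j
  define A where "A = {j. j < length L \<and> t j < h j}"
  define B where "B = {j. j < length L \<and> h j < t j}"
  have fin: "finite A" "finite B" by (simp_all add: A_def B_def)
  have A: "j \<in> A \<longleftrightarrow> j < length L \<and> t j < h j" and B: "j \<in> B \<longleftrightarrow> j < length L \<and> h j < t j" for j
    by (simp_all add: A_def B_def)
  show ?thesis
  proof (cases "A = {}")
    case False
    then have max: "Max A \<in> A" using fin by simp
    have "h j \<le> t j" if "Max A < j" "j < length L" for j
    proof (rule ccontr)
      assume "\<not> h j \<le> t j"
      then have "j \<in> A" using that(2) by (simp add: A)
      from Max_ge[OF fin(1) this] show False using that(1) by simp
    qed
    then show ?thesis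
      using max unfolding A h_def t_def by (intro peels_leftward[OF \<nu> \<nu>' st w, of "Max A"]) simp_all
  next
    case True
    then have le: "h j \<le> t j" if "j < length L" for j using that A[of j] by fastforce
    show ?thesis
    proof (cases "B = {}")
      case False
      then have min: "Min B \<in> B" using fin by simp
      have "h j = t j" if "j < Min B" for j
      proof (rule ccontr)
        assume "h j \<noteq> t j"
        moreover have "j < length L" using that min by (simp add: B)
        ultimately have "j \<in> B" using le[of j] by (simp add: B)
        from Min_le[OF fin(2) this] show False using that by simp
      qed
      then show ?thesis
        using min le unfolding B h_def t_def by (intro peels_rightward[OF \<nu> \<nu>' st w, of "Min B"])
          simp_all
    next
      case empty: True
      have "h j = t j" if "j < length L" for j
        using le[OF that] empty that B[of j] by fastforce
      then show ?thesis
        by (intro peels_crossing[OF \<nu> \<nu>' st w inv]) (simp add: h_def t_def)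
    qed
  qed
qed

end


section \<open>Products of generators\<close>

context interval_setting
begin

lemma last_sword: "\<exists>w. sword N \<nu> = w @ [Red (\<Lambda> N)]"
  by (cases N) (simp_all add: seq_word_0 seq_word_Suc)

lemma append_black_inject:
  assumes "w @ [Red \<theta>] @ map Black xs = w' @ [Red \<theta>'] @ map Black ys"
  shows "w @ [Red \<theta>] = w' @ [Red \<theta>'] \<and> xs = ys"
  using assms
proof (induction xs arbitrary: ys rule: rev_induct)
  case Nil
  then show ?case by (cases ys rule: rev_cases) (simp_all flip: append_assoc)
next
  case (snoc x xs)
  note IH = snoc.IH
  show ?case
  proof (cases ys rule: rev_cases)
    case Nil
    then show ?thesis using snoc.prems by (simp flip: append_assoc)
  next
    case (snoc zs z)
    then have "(w @ [Red \<theta>] @ map Black xs) @ [Black x] = (w' @ [Red \<theta>'] @ map Black zs) @ [Black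
      z]"
      using \<open>w @ [Red \<theta>] @ map Black (xs @ [x]) = w' @ [Red \<theta>'] @ map Black ys\<close> by simp
    then have "w @ [Red \<theta>] @ map Black xs = w' @ [Red \<theta>'] @ map Black zs" "x = z"
      unfolding append1_eq_conv by simp_all
    then show ?thesis using IH snoc by blast
  qed
qed

text \<open>Red labels may coincide, for instance when they are zero, so intervals are recovered by
  position: the black letters after the last red letter are determined by the word, and the
  induction continues to the left.\<close>

lemma sword_inject:
  assumes "sword N \<nu> = sword N \<kappa>" "1 \<le> r" "r \<le> N"
  shows "\<nu> r = \<kappa> r"
  using assms
proof (induction N)
  case (Suc N)
  obtain w w' where w: "sword N \<nu> = w @ [Red (\<Lambda> N)]" "sword N \<kappa> = w' @ [Red (\<Lambda> N)]"
    using last_sword by meson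
  have "sword N \<nu> @ map Black (\<nu> (Suc N)) = sword N \<kappa> @ map Black (\<kappa> (Suc N))"
    using Suc.prems(1) by (simp add: seq_word_Suc)
  then have "w @ [Red (\<Lambda> N)] @ map Black (\<nu> (Suc N)) = w' @ [Red (\<Lambda> N)] @ map Black (\<kappa> (Suc N))"
    by (simp add: w)
  from append_black_inject[OF this]
  have e: "sword N \<nu> = sword N \<kappa>" "\<nu> (Suc N) = \<kappa> (Suc N)" using w by simp_all
  show ?case using e Suc.IH Suc.prems(2,3) by (cases "r = Suc N") auto
qed simp

lemma seqs_sword_inject:
  assumes "\<nu> \<in> seqs" "\<kappa> \<in> seqs" "fits \<Lambda> N \<nu>" "fits \<Lambda> N \<kappa>" "sword N \<nu> = sword N \<kappa>"
  shows "\<nu> = \<kappa>"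
proof
  fix r
  consider "r = 0" | "1 \<le> r" "r \<le> N" | "N < r" by linarith
  then show "\<nu> r = \<kappa> r"
    using assms sword_inject[OF assms(5)] by cases (auto simp: seqs_iff fits_def)
qed

lemma fits_le: "\<lbrakk>fits \<Lambda> N \<nu>; l < length (\<nu> a)\<rbrakk> \<Longrightarrow> a \<le> N"
  unfolding fits_def by (metis leI list.size(3) not_less_zero)

text \<open>The word \<open>W\<close> has the moving letter deleted, so it is common to both
  sequences. It shows that the diagrams of long crossings and long reflections have the intended
  endpoints.\<close>

lemma moved_words:
  assumes "moved \<nu> a l i \<nu>' b m j" "fits \<Lambda> N \<nu>" "fits \<Lambda> N \<nu>'"
  obtains W where "sword N \<nu> = insert_at (pos \<nu> a l) (Black i) W" "pos \<nu> a l \<le> length W"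
    "sword N \<nu>' = insert_at (pos \<nu>' b m) (Black j) W" "pos \<nu>' b m \<le> length W"
proof -
  have *: "sword N \<kappa> = insert_at (pos \<kappa> c n) (Black (\<kappa> c ! n)) (sword N (remove_at \<kappa> c n)) \<and>
      pos \<kappa> c n \<le> length (sword N (remove_at \<kappa> c n))"
    if c: "1 \<le> c" "c \<le> N" "n < length (\<kappa> c)" for \<kappa> c n
  proof -
    let ?r = "remove_at \<kappa> c n"
    have len: "n \<le> length (?r c)" using c(3) by (simp add: remove_at_def)
    have k: "\<kappa> = ?r(c := insert_at n (\<kappa> c ! n) (?r c))"
      using remove_at_insert_at[where \<nu> = \<kappa> and a = c and l = n, OF c(3)] by simp
    have "pos (?r(c := insert_at n (\<kappa> c ! n) (?r c))) c n = pos ?r c n"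
      by (subst before_upd[OF c(1)]) (use len in \<open>simp_all add: take_insert_at\<close>)
    then have p: "pos \<kappa> c n = pos ?r c n" using k by simp
    have "sword N (?r(c := insert_at n (\<kappa> c ! n) (?r c))) = insert_at (pos ?r c n) (Black (\<kappa> c ! n))
      (sword N ?r)"
      by (rule seq_word_insert_at[where \<nu> = ?r and a = c and l = n and N = N, OF c(1,2) len])
    moreover have "pos ?r c n \<le> length (sword N ?r)"
      by (rule length_before_le[where \<nu> = ?r and a = c and l = n and N = N, OF c(1,2) len])
    ultimately show ?thesis using k p by simp
  qed
  have m: "1 \<le> a" "l < length (\<nu> a)" "\<nu> a ! l = i" "1 \<le> b" "m < length (\<nu>' b)" "\<nu>' b ! m = j"
    "remove_at \<nu> a l = remove_at \<nu>' b m"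
    using assms(1) unfolding moved_def by auto
  show ?thesis
    using that[of "sword N (remove_at \<nu> a l)"] *[of a l \<nu>] *[of b m \<nu>'] m fits_le assms(2,3) by
      metis
qed

lemma generator_diagram_props:
  assumes \<nu>: "\<nu> \<in> seqs" "fits \<Lambda> N \<nu>" and \<nu>': "\<nu>' \<in> seqs" "fits \<Lambda> N \<nu>'" and g: "generator_diagram N \<nu>
    \<nu>' d"
  shows "is_valid OKLRW d \<and> src d = sword N \<nu> \<and> target d = sword N \<nu>'"
proof -
  have ok: "word_ok (sword N \<nu>)" using word_ok_sword \<nu>(1) .
  from g consider
    (crossing) a l b l' i where "moved \<nu> a l i \<nu>' b l' i" "d = long_crossing (sword N \<nu>) (pos \<nu> a l)
      (pos \<nu>' b l')"
  | (reflection) a l b l' i where "moved \<nu> a l i \<nu>' b l' (\<tau> i)"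
      "d = long_reflection \<tau> (sword N \<nu>) (pos \<nu> a l) i (pos \<nu>' b l')"
  | (swap) j k where "\<nu>' = \<nu>" "1 \<le> j" "Suc k < length (\<nu> j)" "\<nu> j ! k = \<nu> j ! Suc k"
        "d = elementary (sword N \<nu>) (Swap (pos \<nu> j k))"
  | (dot) j k where "\<nu>' = \<nu>" "1 \<le> j" "k < length (\<nu> j)" "d = dot_at (sword N \<nu>) (pos \<nu> j k)"
    unfolding generator_diagram_def by blast
  then show ?thesis
  proof cases
    case crossing
    from moved_words[OF crossing(1) \<nu>(2) \<nu>'(2)] obtain W
      where W: "sword N \<nu> = insert_at (pos \<nu> a l) (Black i) W" "pos \<nu> a l \<le> length W"
        "sword N \<nu>' = insert_at (pos \<nu>' b l') (Black i) W" "pos \<nu>' b l' \<le> length W" .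
    let ?p = "pos \<nu> a l" and ?q = "pos \<nu>' b l'"
    have okW: "word_ok W" "i \<in> verts Q" using ok by (auto simp: W(1) set_insert_at)
    have sub: "word_ok (take n W)" "word_ok (drop n W)" "word_ok (take n (drop n' W))" for n n'
      using okW(1) by (auto dest: in_set_takeD in_set_dropD)
    show ?thesis
    proof (cases "?p \<le> ?q")
      case True
      have "d = padded (take ?p W) (strand_right (Black i) (take (?q - ?p) (drop ?p W))) (drop ?q
        W)"
        unfolding crossing(2) W(1) using long_crossing_insert_right[OF True W(4)] .
      then show ?thesis
        using valid_strand_right[of "take (?q - ?p) (drop ?p W)" "Black i"] sub okW(2)
        unfolding W(1,3) insert_at_split[OF True W(4)] insert_at_split'[OF True W(4)] by simp
    next
      case False
      then have lt: "?q < ?p" by simp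
      have "d = padded (take ?q W) (strand_left (take (?p - ?q) (drop ?q W)) (Black i)) (drop ?p W)"
        unfolding crossing(2) W(1) using long_crossing_insert_left[OF lt W(2)] .
      then show ?thesis
        using valid_strand_left[of "take (?p - ?q) (drop ?q W)" "Black i"] sub okW(2)
        unfolding W(1,3) insert_at_split[OF less_imp_le[OF lt] W(2)] insert_at_split'[OF
          less_imp_le[OF lt] W(2)] by simp
    qed
  next
    case reflection
    from moved_words[OF reflection(1) \<nu>(2) \<nu>'(2)] obtain W
      where W: "sword N \<nu> = insert_at (pos \<nu> a l) (Black i) W" "pos \<nu> a l \<le> length W"
        "sword N \<nu>' = insert_at (pos \<nu>' b l') (Black (\<tau> i)) W" "pos \<nu>' b l' \<le> length W" .
    let ?p = "pos \<nu> a l" and ?q = "pos \<nu>' b l'"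
    have okW: "word_ok W" "i \<in> verts Q" using ok by (auto simp: W(1) set_insert_at)
    have sub: "word_ok (take n W)" "word_ok (drop n W)" for n
      using okW(1) by (auto dest: in_set_takeD in_set_dropD)
    have "d = Comp (padded [] (strand_right (Black (\<tau> i)) (take ?q W)) (drop ?q W))
        (Comp (reflect i W) (padded [] (strand_left (take ?p W) (Black i)) (drop ?p W)))"
      unfolding reflection(2) W(1) long_reflection_def Let_def
      using W(2) by (simp only: take_insert_at drop_insert_at append_take_drop_id)
    then show ?thesis
      using valid_strand_left[of "take ?p W" "Black i"] valid_strand_right[of "take ?q W" "Black (\<tau>
        i)"]
        sub okW by (simp add: W(1,3)) (simp add: insert_at_def)
  next
    case swap
    let ?w = "sword N \<nu>" and ?p = "pos \<nu> j k"
    have jN: "j \<le> N" using fits_le \<nu>(2) swap(3) by blast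
    note n = seq_word_nth_before[where \<Lambda> = \<Lambda> and \<nu> = \<nu> and a = j and l = k and N = N, OF swap(2) jN
      Suc_lessD[OF swap(3)]]
    note n' = seq_word_nth_before[where \<Lambda> = \<Lambda> and \<nu> = \<nu> and a = j and l = "Suc k" and N = N, OF
      swap(2) jN swap(3)]
    have p: "pos \<nu> j (Suc k) = Suc ?p" using swap(3) by (simp add: length_before)
    have eq: "?w ! ?p = ?w ! Suc ?p" using n(2) n'(2) p swap(4) by simp
    have lay: "layer_ok ?w (Swap ?p)" using n n' p by simp
    have "act bar (Swap ?p) ?w = ?w" unfolding act.simps using eq by (metis list_update_id)
    then show ?thesis using elementary_props[OF ok lay] swap by simp
  next
    case dot
    have jN: "j \<le> N" using fits_le \<nu>(2) dot(3) by blast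
    note n = seq_word_nth_before[where \<Lambda> = \<Lambda> and \<nu> = \<nu> and a = j and l = k and N = N, OF dot(2) jN
      dot(3)]
    show ?thesis using dot_at_props[OF ok n(1)] n(2) dot by simp
  qed
qed

inductive product :: "nat \<Rightarrow> (nat \<Rightarrow> 'q list) \<Rightarrow> (nat \<Rightarrow> 'q list) \<Rightarrow> 'q diagram \<Rightarrow> bool" for N \<nu> where
  product_id: "product N \<nu> \<nu> (Strands (sword N \<nu>))"
| product_step: "\<lbrakk>product N \<nu> \<kappa> d; \<nu>' \<in> seqs; fits \<Lambda> N \<nu>'; generator_diagram N \<kappa> \<nu>' g\<rbrakk>
    \<Longrightarrow> product N \<nu> \<nu>' (Comp g d)"

lemma product_props:
  assumes "product N \<nu> \<nu>' d" "\<nu> \<in> seqs" "fits \<Lambda> N \<nu>"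
  shows "\<nu>' \<in> seqs \<and> fits \<Lambda> N \<nu>' \<and> is_valid OKLRW d \<and> src d = sword N \<nu> \<and> target d = sword N \<nu>'"
  using assms
proof (induction rule: product.induct)
  case product_id
  then show ?case using word_ok_sword by simp
next
  case (product_step \<kappa> d \<nu>' g)
  then show ?case using generator_diagram_props[of \<kappa> N \<nu>' g] by simp
qed

text \<open>A diagram without crossings is a stack of dots only, as every generator layer would
  count a crossing. Each dot sits on a black letter, hence on a letter of some interval.\<close>

lemma spanned_dots:
  assumes \<nu>: "\<nu> \<in> seqs" "fits \<Lambda> N \<nu>"
    and e: "is_valid OKLRW e" "src e = sword N \<nu>" "crossings e = 0"
  shows "spanned {d. product N \<nu> \<nu> d \<and> crossings d = 0} (dg e)"
proof -
  let ?u = "sword N \<nu>"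
  have ok: "word_ok ?u" using word_ok_sword \<nu>(1) .
  obtain d where d: "layered ?u d" "deq OKLRW e d" "crossings d = 0"
    using flattens_valid[OF e(1)] e unfolding flattens_def by auto
  have "target d = ?u \<and> product N \<nu> \<nu> d" using d(1,3)
  proof (induction rule: layered.induct)
    case layered_strands
    then show ?case by (simp add: product_id)
  next
    case (layered_elementary d s)
    then have "target d = ?u" by simp
    then show ?case using layered_elementary elementary_props(4)[OF ok, of s] by simp
  next
    case (layered_dot d m)
    then have t: "target d = ?u" and p: "product N \<nu> \<nu> d" by simp_all
    have m: "m < length ?u" "\<not> is_red (?u ! m)" using layered_dot.hyps(2,3) t by auto
    obtain a l where a: "1 \<le> a" "a \<le> N" "l < length (\<nu> a)" "m = pos \<nu> a l"
      by (rule seq_word_locate[OF m])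
    have "generator_diagram N \<nu> \<nu> (dot_at ?u m)" unfolding generator_diagram_def using a by blast
    then show ?case using product_step[OF p \<nu>] dot_at_props[OF ok m] t by simp
  qed
  then show ?thesis using d(3) by (intro spanned_deq[OF d(2) spanned_dg]) simp
qed

text \<open>A double induction: the number of inversions decreases when a generator is peeled off,
  and the filtration decreases in the error made by changing the reduced word. The dots at the
  bottom are products of generators by \<open>spanned_dots\<close> and are carried along as
  \<open>e\<close>.\<close>

theorem lower_spanned_products:
  assumes \<nu>: "\<nu> \<in> seqs" "fits \<Lambda> N \<nu>" and \<nu>': "\<nu>' \<in> seqs" "fits \<Lambda> N \<nu>'"
    and x: "lower k (sword N \<nu>) (sword N \<nu>') x"
  shows "spanned {d. product N \<nu> \<nu>' d} x"
  using \<nu>' x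
proof (induction k arbitrary: \<nu>' x)
  case 0
  then have "is_null OKLRW x" by (auto simp: lower_def few_def)
  then show ?case by (rule spanned_null)
next
  case (Suc k)
  let ?u = "sword N \<nu>"
  have ok: "word_ok ?u" using word_ok_sword \<nu>(1) .
  have main: "spanned {d. product N \<nu> \<nu>' d} (dg (Comp (chain_diagram ?u L ss) e))"
    if "state ?u L" "word_of ?u L = sword N \<nu>'" "descending L ss (standard (length ?u))" "inversions
      L \<le> k"
      "product N \<nu> \<nu> e" "\<nu>' \<in> seqs" "fits \<Lambda> N \<nu>'" "crossings e = 0" for L ss e \<nu>'
    using that
  proof (induction "inversions L" arbitrary: L ss \<nu>' rule: less_induct)
    case less
    note e = product_props[OF less.prems(5) \<nu>]
    note c = chain_diagram_props[OF less.prems(1,3)]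
    show ?case
    proof (cases "inversions L = 0")
      case True
      then have ss: "ss = []" using inversions_descending[OF less.prems(3)] by simp
      then have "L = standard (length ?u)" using less.prems(3) by simp
      then have w: "sword N \<nu>' = ?u" using less.prems(2) by simp
      then have "\<nu>' = \<nu>" using seqs_sword_inject[OF less.prems(6) \<nu>(1) less.prems(7) \<nu>(2)] by simp
      moreover have "deq OKLRW (Comp (chain_diagram ?u L ss) e) e"
        unfolding ss chain_diagram.simps less.prems(2) w using e by (intro deq_unit_left) auto
      ultimately show ?thesis
        using spanned_deq spanned_dg[of e "{d. product N \<nu> \<nu>' d}"] less.prems(5) by blast
    next
      case False
      then obtain \<kappa> K s1 g where p: "\<kappa> \<in> seqs" "fits \<Lambda> N \<kappa>" "descending L s1 K" "s1 \<noteq> []"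
        "word_of ?u K = sword N \<kappa>" "generator_diagram N \<kappa> \<nu>' g" "deq OKLRW (chain_diagram ?u L s1)
          g"
        using peels_inversions[OF \<nu>(1) less.prems(6,7,1,2)] unfolding peels_def by blast
      note g = generator_diagram_props[OF p(1,2) less.prems(6,7) p(6)]
      have sK: "state ?u K" using state_descending[OF p(3) less.prems(1)] .
      obtain s2 where s2: "descending K s2 (standard (length ?u))"
        using descending_standard_exists[OF sK] by blast
      have s12: "descending L (s1 @ s2) (standard (length ?u))" using p(3) s2 descending_append by
        blast
      have inv: "inversions K < inversions L"
        using inversions_descending[OF p(3)] p(4) by (cases s1) auto
      \<comment> \<open>The part below the peeled generator has fewer inversions and ends at an
        interval sequence, so the inner induction applies with \<open>\<kappa>\<close> in place of
        \<open>\<nu>'\<close>.\<close>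
      have "spanned {d. product N \<nu> \<kappa> d} (dg (Comp (chain_diagram ?u K s2) e))"
        using less.hyps[OF inv sK p(5) s2 _ less.prems(5) p(1,2) less.prems(8)] inv less.prems(4) by
          simp
      then have "spanned {d. product N \<nu> \<nu>' d} (dg g \<odot> dg (Comp (chain_diagram ?u K s2) e))"
      proof (rule spanned_comp_left)
        show "is_valid OKLRW g" using g by blast
        fix d assume "d \<in> {d. product N \<nu> \<kappa> d}"
        then have d: "product N \<nu> \<kappa> d" by simp
        show "spanned {d. product N \<nu> \<nu>' d} (dg g \<odot> dg d)"
          using product_step[OF d less.prems(6,7) p(6)] product_props[OF d \<nu>] g
          by (simp add: comp_dg spanned_dg)
      qed
      moreover note c2 = chain_diagram_props[OF sK s2]
      ultimately have 1: "spanned {d. product N \<nu> \<nu>' d} (dg (Comp g (Comp (chain_diagram ?u K s2)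
        e)))"
        using g p(5) by (simp add: comp_dg)
      have "deq_mod (inversions L) (chain_diagram ?u L ss) (chain_diagram ?u L (s1 @ s2))"
        by (rule reduced_diagrams_deq_mod[OF less.prems(1,3) s12])
      also have "deq OKLRW \<dots> (Comp (chain_diagram ?u L s1) (chain_diagram ?u K s2))"
        by (rule chain_diagram_append[OF less.prems(1) p(3) s2])
      also have "deq OKLRW \<dots> (Comp g (chain_diagram ?u K s2))"
        using p(7) c2 chain_diagram_props[OF less.prems(1) p(3)] by (intro deq_comp deq_refl) auto
      finally have "deq_mod (inversions L) (chain_diagram ?u L ss) (Comp g (chain_diagram ?u K s2))"
        .
      then have "deq_mod (inversions L + crossings e) (Comp (chain_diagram ?u L ss) e) (Comp (Comp g
        (chain_diagram ?u K s2)) e)"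
        using e c by (intro deq_mod_comp_right) auto
      then have "lower (inversions L + crossings e) ?u (sword N \<nu>')
          (dg (Comp (chain_diagram ?u L ss) e) - dg (Comp (Comp g (chain_diagram ?u K s2)) e))"
        using e c less.prems(2) by (auto simp: deq_mod_def)
      \<comment> \<open>As \<open>inversions L \<le> k\<close> and \<open>e\<close> has no
        crossings, the error of changing the reduced word lies in the previous step of the
        filtration, where the outer induction applies.\<close>
      then have "lower k ?u (sword N \<nu>')
          (dg (Comp (chain_diagram ?u L ss) e) - dg (Comp (Comp g (chain_diagram ?u K s2)) e))"
        by (rule lower_mono) (use less.prems(4,8) in simp)
      from Suc.IH[OF less.prems(6,7) this] have 2: "spanned {d. product N \<nu> \<nu>' d}
          (dg (Comp (chain_diagram ?u L ss) e) - dg (Comp (Comp g (chain_diagram ?u K s2)) e))" .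
      have "deq OKLRW (Comp (Comp g (chain_diagram ?u K s2)) e) (Comp g (Comp (chain_diagram ?u K
        s2) e))"
        using g c2 e p(5) by (intro deq_comp_assoc) auto
      then have "spanned {d. product N \<nu> \<nu>' d} (dg (Comp (Comp g (chain_diagram ?u K s2)) e))"
        using 1 by (rule spanned_deq)
      from spanned_add[OF 2 this] show ?thesis by simp
    qed
  qed
  have "spanned {d. product N \<nu> \<nu>' d} (dg f)" if f: "f \<in> normal_forms (Suc k) ?u (sword N \<nu>')" for f
  proof -
    obtain L ss e where f: "f = Comp (chain_diagram ?u L ss) e" "state ?u L" "word_of ?u L = sword N
      \<nu>'"
       "descending L ss (standard (length ?u))" "inversions L < Suc k"
       "is_valid OKLRW e" "src e = ?u" "target e = ?u" "crossings e = 0"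
      using f unfolding normal_forms_def by blast
    note c = chain_diagram_props[OF f(2,4)]
    have "spanned {d. product N \<nu> \<nu> d \<and> crossings d = 0} (dg e)"
      using spanned_dots[OF \<nu> f(6,7,9)] .
    then have "spanned {d. product N \<nu> \<nu>' d} (dg (chain_diagram ?u L ss) \<odot> dg e)"
    proof (rule spanned_comp_left[OF _ c(1)])
      fix d assume "d \<in> {d. product N \<nu> \<nu> d \<and> crossings d = 0}"
      then have d: "product N \<nu> \<nu> d" "crossings d = 0" by simp_all
      have "inversions L \<le> k" using f(5) by simp
      from main[OF f(2,3,4) this d(1) Suc.prems(1,2) d(2)]
      show "spanned {d. product N \<nu> \<nu>' d} (dg (chain_diagram ?u L ss) \<odot> dg d)"
        using c product_props[OF d(1) \<nu>] by (simp add: comp_dg)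
    qed
    then show ?thesis using f c by (simp add: comp_dg)
  qed
  then show ?case by (rule spanned_trans[OF lower_spanned_normal_forms[OF ok Suc.prems(3)]])
qed

end


section \<open>The direct limit\<close>

lemma reds_append [simp]: "reds (u @ w) = reds u @ reds w"
  by (induction u rule: reds.induct) auto

lemma reds_map_Black [simp]: "reds (map Black xs) = []"
  by (induction xs) auto

lemma reds_map_Red [simp]: "reds (map (\<lambda>n. Red (f n)) ns) = map f ns"
  by (induction ns) auto

context interval_setting
begin

abbreviation "at_stage \<equiv> stage \<Lambda>"
abbreviation "space \<equiv> stage_space Q \<tau> \<Lambda>"
abbreviation "limit \<equiv> lim_class Q \<tau> \<Lambda>"
abbreviation "raise \<equiv> transition \<Lambda>"

definition new_reds :: "nat \<Rightarrow> nat \<Rightarrow> 'q word" where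
  "new_reds N M = map (\<lambda>n. Red (\<Lambda> n)) [Suc N..<Suc M]"

lemma word_ok_new_reds: "word_ok (new_reds N M)"
  using red_ok by (auto simp: new_reds_def)

lemma new_reds_append: "\<lbrakk>N \<le> M; M \<le> K\<rbrakk> \<Longrightarrow> new_reds N M @ new_reds M K = new_reds N K"
  unfolding new_reds_def
  by (metis Suc_le_mono le_SucI le_add_diff_inverse map_append upt_add_eq_append)

lemma new_reds_refl: "new_reds N N = []"
  by (simp add: new_reds_def)

lemma raise_def: "raise N M x = x \<boxtimes> idm (new_reds N M)"
  by (simp add: transition_def new_reds_def)

lemma raise_dg: "raise N M (dg d) = dg (Tensor d (Strands (new_reds N M)))"
  by (simp add: raise_def)

lemma raise_linear:
  "raise N M 0 = 0" "raise N M (x + y) = raise N M x + raise N M y"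
  "raise N M (x - y) = raise N M x - raise N M y" "raise N M (smul a x) = smul a (raise N M x)"
  by (simp_all add: raise_def tensor_add_left tensor_diff_left tensor_smul_left)

lemma null_raise: "is_null OKLRW x \<Longrightarrow> is_null OKLRW (raise N M x)"
  unfolding raise_def using word_ok_new_reds by (intro null_tensor_right) auto

lemma null_linear_extension:
  assumes "\<And>d. d \<in> Poly_Mapping.keys x \<Longrightarrow> is_null OKLRW (f (dg d))"
    and f: "f 0 = 0" "\<And>x y. f (x + y) = f x + f y" "\<And>a x. f (smul a x) = smul a (f x)"
  shows "is_null OKLRW (f x)"
  by (rule lincomb_induct[of "\<lambda>x. is_null OKLRW (f x)"])
     (simp_all add: f null_zero null_add null_smul assms(1))

definition all_valid :: "'q lincomb \<Rightarrow> bool" where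
  "all_valid x \<longleftrightarrow> (\<forall>d\<in>Poly_Mapping.keys x. is_valid OKLRW d)"

text \<open>Tensor products are formal, so raising in two steps and in one step gives different
  diagrams; they agree by associativity and by merging the two blocks of identity strands.\<close>

lemma null_raise_raise:
  assumes "all_valid x" "N \<le> M" "M \<le> K"
  shows "is_null OKLRW (raise M K (raise N M x) - raise N K x)"
proof (rule null_linear_extension[of x "\<lambda>x. raise M K (raise N M x) - raise N K x"])
  fix d assume "d \<in> Poly_Mapping.keys x"
  then have d: "is_valid OKLRW d" using assms(1) by (simp add: all_valid_def)
  have "deq OKLRW (Tensor (Tensor d (Strands (new_reds N M))) (Strands (new_reds M K)))
      (Tensor d (Tensor (Strands (new_reds N M)) (Strands (new_reds M K))))"
    using d word_ok_new_reds by (intro deq_tensor_assoc) auto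
  also have "deq OKLRW \<dots> (Tensor d (Strands (new_reds N M @ new_reds M K)))"
    using d word_ok_new_reds by (intro deq_tensor deq_refl deq_tensor_strands) auto
  finally show "is_null OKLRW (raise M K (raise N M (dg d)) - raise N K (dg d))"
    by (simp add: raise_dg new_reds_append[OF assms(2,3)] deq_def)
qed (simp_all add: raise_linear smul_diff)

lemma null_raise_comp:
  assumes "all_valid x" "all_valid y"
  shows "is_null OKLRW (raise N M (x \<odot> y) - raise N M x \<odot> raise N M y)"
proof (rule null_linear_extension[of x "\<lambda>x. raise N M (x \<odot> y) - raise N M x \<odot> raise N M y"])
  fix d assume "d \<in> Poly_Mapping.keys x"
  then have d: "is_valid OKLRW d" using assms(1) by (simp add: all_valid_def)
  show "is_null OKLRW (raise N M (dg d \<odot> y) - raise N M (dg d) \<odot> raise N M y)"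
  proof (rule null_linear_extension[of y "\<lambda>y. raise N M (dg d \<odot> y) - raise N M (dg d) \<odot> raise N M
    y"])
    fix e assume "e \<in> Poly_Mapping.keys y"
    then have e: "is_valid OKLRW e" using assms(2) by (simp add: all_valid_def)
    show "is_null OKLRW (raise N M (dg d \<odot> dg e) - raise N M (dg d) \<odot> raise N M (dg e))"
    proof (cases "src d = target e")
      case True
      then show ?thesis using deq_comp_tensor_strands[OF d e True word_ok_new_reds[of N M]]
        by (simp add: raise_dg comp_dg deq_def)
    next
      case False
      then show ?thesis by (simp add: raise_dg comp_dg raise_linear null_zero)
    qed
  qed (simp_all add: raise_linear smul_diff comp_add_right comp_smul_right)
qed (simp_all add: raise_linear smul_diff comp_add_left comp_smul_left)

lemma all_valid_raise: "all_valid x \<Longrightarrow> all_valid (raise N M x)"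
  using keys_tensor[of x "idm (new_reds N M)"] word_ok_new_reds[of N M]
  unfolding all_valid_def raise_def by fastforce

definition equivalent :: "nat \<Rightarrow> 'q lincomb \<Rightarrow> nat \<Rightarrow> 'q lincomb \<Rightarrow> bool" where
  "equivalent N x M y \<longleftrightarrow> (\<exists>K. N \<le> K \<and> M \<le> K \<and> is_null OKLRW (raise N K x - raise M K y))"

lemma mem_lim: "(M, y) \<in> limit N x \<longleftrightarrow> at_stage M \<and> y \<in> space M \<and> equivalent N x M y"
  by (simp add: lim_class_def equivalent_def)

text \<open>An equality at one stage persists at all later stages. This allows two equalities, valid
  at different stages, to be used at a common one, in transitivity and in the algebra
  operations.\<close>

lemma equivalent_at:
  assumes "all_valid x" "all_valid y" "equivalent N x M y"
  shows "\<exists>K0. \<forall>K\<ge>K0. N \<le> K \<and> M \<le> K \<and> is_null OKLRW (raise N K x - raise M K y)"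
proof -
  obtain K where K: "N \<le> K" "M \<le> K" "is_null OKLRW (raise N K x - raise M K y)"
    using assms(3) unfolding equivalent_def by blast
  have "is_null OKLRW (raise N L x - raise M L y)" if L: "K \<le> L" for L
  proof -
    have "is_null OKLRW (raise K L (raise N K x) - raise K L (raise M K y))"
      using null_raise[OF K(3), of K L] by (simp add: raise_linear)
    moreover have "is_null OKLRW (raise N L x - raise K L (raise N K x))"
      by (rule null_diff_sym[OF null_raise_raise[OF assms(1) K(1) L]])
    moreover have "is_null OKLRW (raise K L (raise M K y) - raise M L y)"
      by (rule null_raise_raise[OF assms(2) K(2) L])
    ultimately show ?thesis using null_diff_trans by blast
  qed
  then show ?thesis using K by (intro exI[of _ K]) simp
qed

lemma equivalent_sym: "equivalent N x M y \<Longrightarrow> equivalent M y N x"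
  unfolding equivalent_def using null_diff_sym by blast

lemma equivalent_trans:
  assumes "all_valid x" "all_valid y" "all_valid z" "equivalent N x M y" "equivalent M y K z"
  shows "equivalent N x K z"
proof -
  obtain A where A: "\<forall>L\<ge>A. N \<le> L \<and> M \<le> L \<and> is_null OKLRW (raise N L x - raise M L y)"
    using equivalent_at[OF assms(1,2,4)] by blast
  obtain B where B: "\<forall>L\<ge>B. M \<le> L \<and> K \<le> L \<and> is_null OKLRW (raise M L y - raise K L z)"
    using equivalent_at[OF assms(2,3,5)] by blast
  let ?L = "max A B"
  have "N \<le> ?L" "K \<le> ?L" "is_null OKLRW (raise N ?L x - raise M ?L y)" "is_null OKLRW (raise M ?L y
    - raise K ?L z)"
    using A B by simp_all
  then show ?thesis unfolding equivalent_def using null_diff_trans by blast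
qed

lemma equivalent_null: "is_null OKLRW (x - y) \<Longrightarrow> equivalent N x N y"
  unfolding equivalent_def by (rule exI[of _ N]) (simp add: null_raise flip: raise_linear)

lemma space_all_valid: "x \<in> space N \<Longrightarrow> all_valid x"
  by (simp add: stage_space_def all_valid_def)

lemma equivalent_raise:
  assumes "all_valid x" "N \<le> M"
  shows "equivalent N x M (raise N M x)"
  unfolding equivalent_def using assms(2) null_raise_raise[OF assms order_refl]
  by (intro exI[of _ M]) (simp add: null_diff_sym)

lemma lim_eqI:
  assumes "x \<in> space N" "y \<in> space M" "equivalent N x M y"
  shows "limit N x = limit M y"
proof (rule set_eqI)
  fix p :: "nat \<times> 'q lincomb"
  obtain K z where p: "p = (K, z)" by (cases p)
  note v = space_all_valid[OF assms(1)] space_all_valid[OF assms(2)]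
  show "p \<in> limit N x \<longleftrightarrow> p \<in> limit M y"
    unfolding p mem_lim
    using equivalent_trans[OF v(1,2) space_all_valid[of z K] assms(3)]
      equivalent_trans[OF v(2,1) space_all_valid[of z K] equivalent_sym[OF assms(3)]] by blast
qed

lemma lim_self: "\<lbrakk>at_stage N; x \<in> space N\<rbrakk> \<Longrightarrow> (N, x) \<in> limit N x"
  unfolding mem_lim by (simp add: equivalent_null null_zero)

lemma lim_null: "\<lbrakk>x \<in> space N; y \<in> space N; is_null OKLRW (x - y)\<rbrakk> \<Longrightarrow> limit N x = limit N y"
  by (intro lim_eqI equivalent_null)

lemma space_zero: "0 \<in> space N"
  by (simp add: stage_space_def)

lemma space_add: "\<lbrakk>x \<in> space N; y \<in> space N\<rbrakk> \<Longrightarrow> x + y \<in> space N"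
  using keys_add[of x y] unfolding stage_space_def by blast

lemma space_smul: "x \<in> space N \<Longrightarrow> smul a x \<in> space N"
  using keys_smul[of a x] unfolding stage_space_def by blast

lemma space_comp: "\<lbrakk>x \<in> space N; y \<in> space N\<rbrakk> \<Longrightarrow> x \<odot> y \<in> space N"
  using keys_comp[of \<tau> x y] unfolding stage_space_def by fastforce

lemma space_dg: "dg d \<in> space N \<longleftrightarrow> is_valid OKLRW d \<and> reds (src d) = reds_upto \<Lambda> N \<and> reds (target d)
  = reds_upto \<Lambda> N"
  by (simp add: stage_space_def)

lemma reds_new_reds: "N \<le> M \<Longrightarrow> reds_upto \<Lambda> N @ reds (new_reds N M) = reds_upto \<Lambda> M"
proof -
  assume "N \<le> M"
  then have "[0..<Suc N] @ [Suc N..<Suc M] = [0..<Suc M]"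
    using upt_add_eq_append[of 0 "Suc N" "M - N"] by simp
  then show ?thesis unfolding reds_upto_def new_reds_def
    by (metis map_append reds_map_Red)
qed

lemma space_raise:
  assumes "x \<in> space N" "N \<le> M"
  shows "raise N M x \<in> space M"
  using keys_tensor[of x "idm (new_reds N M)"] assms(1) word_ok_new_reds[of N M] reds_new_reds[OF
    assms(2)]
  unfolding stage_space_def raise_def by fastforce

lemma lim_raise: "\<lbrakk>x \<in> space N; N \<le> M\<rbrakk> \<Longrightarrow> limit M (raise N M x) = limit N x"
  by (rule lim_eqI[symmetric]) (simp_all add: space_raise equivalent_raise space_all_valid)

lemma at_stage_mono: "\<lbrakk>at_stage N; N \<le> M\<rbrakk> \<Longrightarrow> at_stage M"
  by (simp add: stage_def)

text \<open>The classes of zero at all stages coincide, so the union defining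
  \<open>lim_zero\<close> is one class. A stage has to exist, since otherwise the union is
  empty.\<close>

lemma lim_zero: "at_stage N \<Longrightarrow> lim_zero Q \<tau> \<Lambda> = limit N 0"
proof -
  assume N: "at_stage N"
  have "limit M 0 = limit N 0" for M
    by (rule lim_eqI[OF space_zero space_zero])
       (auto simp: equivalent_def raise_linear null_zero intro: exI[of _ "max M N"])
  then have "{limit M 0 | M. at_stage M} = {limit N 0}" using N by blast
  then show ?thesis unfolding lim_zero_def by simp
qed

text \<open>The sum is a union over all pairs of representatives at a common stage. Each pair gives
  the same class, and at least one pair exists.\<close>

lemma lim_add_lim:
  assumes N: "at_stage N" and x: "x \<in> space N" and y: "y \<in> space N"
  shows "lim_add Q \<tau> \<Lambda> (limit N x) (limit N y) = limit N (x + y)"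
proof -
  have "limit M (x' + y') = limit N (x + y)" if m: "(M, x') \<in> limit N x" "(M, y') \<in> limit N y" for M
    x' y'
  proof -
    have s: "x' \<in> space M" "y' \<in> space M" and e: "equivalent N x M x'" "equivalent N y M y'"
      using m unfolding mem_lim by auto
    obtain A where A: "\<forall>K\<ge>A. N \<le> K \<and> M \<le> K \<and> is_null OKLRW (raise N K x - raise M K x')"
      using equivalent_at[OF space_all_valid[OF x] space_all_valid[OF s(1)] e(1)] by blast
    obtain B where B: "\<forall>K\<ge>B. N \<le> K \<and> M \<le> K \<and> is_null OKLRW (raise N K y - raise M K y')"
      using equivalent_at[OF space_all_valid[OF y] space_all_valid[OF s(2)] e(2)] by blast
    let ?K = "max A B"
    have K: "N \<le> ?K" "M \<le> ?K" "is_null OKLRW (raise N ?K x - raise M ?K x')" "is_null OKLRW (raise N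
      ?K y - raise M ?K y')"
      using A B by simp_all
    have "is_null OKLRW (raise N ?K (x + y) - raise M ?K (x' + y'))"
      using null_add[OF K(3,4)] by (simp add: raise_linear algebra_simps)
    then have "equivalent N (x + y) M (x' + y')" unfolding equivalent_def using K by blast
    then show ?thesis using lim_eqI[OF space_add[OF x y] space_add[OF s]] by simp
  qed
  then have "{limit M (x' + y') | M x' y'. (M, x') \<in> limit N x \<and> (M, y') \<in> limit N y} = {limit N (x
    + y)}"
    using lim_self[OF N x] lim_self[OF N y] by blast
  then show ?thesis unfolding lim_add_def by simp
qed

lemma lim_smul_lim:
  assumes N: "at_stage N" and x: "x \<in> space N"
  shows "lim_smul Q \<tau> \<Lambda> a (limit N x) = limit N (smul a x)"
proof -
  have "limit M (smul a x') = limit N (smul a x)" if m: "(M, x') \<in> limit N x" for M x'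
  proof -
    have s: "x' \<in> space M" using m unfolding mem_lim by auto
    obtain K where K: "N \<le> K" "M \<le> K" "is_null OKLRW (raise N K x - raise M K x')"
      using m unfolding mem_lim equivalent_def by blast
    have "is_null OKLRW (raise N K (smul a x) - raise M K (smul a x'))"
      using null_smul[OF K(3), of a] by (simp add: raise_linear smul_diff)
    then have "equivalent N (smul a x) M (smul a x')" unfolding equivalent_def using K by blast
    then show ?thesis using lim_eqI[OF space_smul[OF x] space_smul[OF s]] by simp
  qed
  then have "{limit M (smul a x') | M x'. (M, x') \<in> limit N x} = {limit N (smul a x)}"
    using lim_self[OF N x] by blast
  then show ?thesis unfolding lim_smul_def by simp
qed

lemma null_comp_diff:
  assumes "all_valid x" "all_valid y'" "is_null OKLRW (x - x')" "is_null OKLRW (y - y')"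
  shows "is_null OKLRW (x \<odot> y - x' \<odot> y')"
proof -
  have "is_null OKLRW (x \<odot> (y - y'))" "is_null OKLRW ((x - x') \<odot> y')"
    using assms by (auto simp: all_valid_def intro: null_comp_left_lin null_comp_right_lin)
  from null_add[OF this] show ?thesis by (simp add: comp_diff_left comp_diff_right)
qed

lemma lim_mult_lim:
  assumes N: "at_stage N" and x: "x \<in> space N" and y: "y \<in> space N"
  shows "lim_mult Q \<tau> \<Lambda> (limit N x) (limit N y) = limit N (x \<odot> y)"
proof -
  have "limit M (x' \<odot> y') = limit N (x \<odot> y)" if m: "(M, x') \<in> limit N x" "(M, y') \<in> limit N y" for M
    x' y'
  proof -
    have s: "x' \<in> space M" "y' \<in> space M" and e: "equivalent N x M x'" "equivalent N y M y'"
      using m unfolding mem_lim by auto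
    note v = space_all_valid[OF x] space_all_valid[OF y] space_all_valid[OF s(1)] space_all_valid[OF
      s(2)]
    obtain A where A: "\<forall>K\<ge>A. N \<le> K \<and> M \<le> K \<and> is_null OKLRW (raise N K x - raise M K x')"
      using equivalent_at[OF v(1,3) e(1)] by blast
    obtain B where B: "\<forall>K\<ge>B. N \<le> K \<and> M \<le> K \<and> is_null OKLRW (raise N K y - raise M K y')"
      using equivalent_at[OF v(2,4) e(2)] by blast
    let ?K = "max A B"
    have K: "N \<le> ?K" "M \<le> ?K" "is_null OKLRW (raise N ?K x - raise M ?K x')" "is_null OKLRW (raise N
      ?K y - raise M ?K y')"
      using A B by simp_all
    have "is_null OKLRW (raise N ?K x \<odot> raise N ?K y - raise M ?K x' \<odot> raise M ?K y')"
      by (rule null_comp_diff[OF all_valid_raise[OF v(1)] all_valid_raise[OF v(4)] K(3,4)])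
    then have "is_null OKLRW (raise N ?K (x \<odot> y) - raise M ?K x' \<odot> raise M ?K y')"
      by (rule null_diff_trans[OF null_raise_comp[OF v(1,2)]])
    then have "is_null OKLRW (raise N ?K (x \<odot> y) - raise M ?K (x' \<odot> y'))"
      by (rule null_diff_trans[OF _ null_diff_sym[OF null_raise_comp[OF v(3,4)]]])
    then have "equivalent N (x \<odot> y) M (x' \<odot> y')" unfolding equivalent_def using K by blast
    then show ?thesis using lim_eqI[OF space_comp[OF x y] space_comp[OF s]] by simp
  qed
  then have "{limit M (x' \<odot> y') | M x' y'. (M, x') \<in> limit N x \<and> (M, y') \<in> limit N y} = {limit N (x
    \<odot> y)}"
    using lim_self[OF N x] lim_self[OF N y] by blast
  then show ?thesis unfolding lim_mult_def by simp
qed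


section \<open>The interval algebra\<close>

lemma reds_sword: "reds (sword N \<nu>) = reds_upto \<Lambda> N"
  by (induction N) (simp_all add: seq_word_0 seq_word_Suc reds_upto_def)

lemma fits_at_stage: "fits \<Lambda> N \<nu> \<Longrightarrow> at_stage N"
  by (simp add: fits_def)

lemma fits_mono: "\<lbrakk>fits \<Lambda> N \<nu>; N \<le> M\<rbrakk> \<Longrightarrow> fits \<Lambda> M \<nu>"
  by (auto simp: fits_def intro: at_stage_mono)

lemma sword_new_reds:
  assumes "fits \<Lambda> N \<nu>" "N \<le> M"
  shows "sword N \<nu> @ new_reds N M = sword M \<nu>"
  using assms(2)
proof (induction M rule: dec_induct)
  case base
  then show ?case by (simp add: new_reds_refl)
next
  case (step n)
  have "\<nu> (Suc n) = []" using assms(1) step.hyps by (auto simp: fits_def)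
  then have "sword (Suc n) \<nu> = (sword N \<nu> @ new_reds N n) @ [Red (\<Lambda> (Suc n))]"
    using step.IH by (simp add: seq_word_Suc)
  also have "\<dots> = sword N \<nu> @ new_reds N (Suc n)"
    using step.hyps by (simp add: new_reds_def)
  finally show ?case ..
qed

lemma fits_exists:
  assumes "at_stage N" "\<nu> \<in> seqs"
  shows "\<exists>M. fits \<Lambda> M \<nu>"
proof -
  have "finite {r. \<nu> r \<noteq> []}" using assms(2) by (simp add: seqs_iff)
  then obtain M where M: "\<forall>r\<in>{r. \<nu> r \<noteq> []}. r \<le> M"
    using finite_nat_set_iff_bounded_le by blast
  have "\<nu> r = []" if "max M N < r" for r
  proof (rule ccontr)
    assume "\<nu> r \<noteq> []"
    then have "r \<le> M" using M by simp
    then show False using that by simp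
  qed
  then have "fits \<Lambda> (max M N) \<nu>"
    unfolding fits_def using at_stage_mono[OF assms(1), of "max M N"] by simp
  then show ?thesis by blast
qed

lemma space_idm: "\<nu> \<in> seqs \<Longrightarrow> idm (sword N \<nu>) \<in> space N"
  using word_ok_sword by (simp add: space_dg reds_sword)

text \<open>The definition of \<open>idem\<close> uses the least suitable stage; here it is moved to
  an arbitrary one, so that it can be combined with elements given there.\<close>

lemma idem_lim:
  assumes "\<nu> \<in> seqs" "fits \<Lambda> N \<nu>"
  shows "idem Q \<tau> \<Lambda> \<nu> = limit N (idm (sword N \<nu>))"
proof -
  define M where "M = (LEAST N. fits \<Lambda> N \<nu>)"
  have M: "fits \<Lambda> M \<nu>" "M \<le> N"
    unfolding M_def using assms(2) by (auto intro: LeastI Least_le)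
  have "deq OKLRW (Tensor (Strands (sword M \<nu>)) (Strands (new_reds M N))) (Strands (sword M \<nu> @
    new_reds M N))"
    using word_ok_sword[OF assms(1)] word_ok_new_reds by (intro deq_tensor_strands) auto
  then have "is_null OKLRW (raise M N (idm (sword M \<nu>)) - idm (sword N \<nu>))"
    unfolding sword_new_reds[OF M] by (simp add: raise_dg deq_def)
  then have "limit N (raise M N (idm (sword M \<nu>))) = limit N (idm (sword N \<nu>))"
    using space_raise[OF space_idm[OF assms(1)] M(2)] space_idm[OF assms(1)] by (intro lim_null)
  then show ?thesis
    unfolding idem_def Let_def M_def[symmetric]
    using lim_raise[OF space_idm[OF assms(1), of M] M(2)] by simp
qed

definition interval_diagram :: "nat \<Rightarrow> 'q diagram \<Rightarrow> bool" where
  "interval_diagram N d \<longleftrightarrow> is_valid OKLRW d \<and> (\<exists>\<nu> \<nu>'. \<nu> \<in> seqs \<and> fits \<Lambda> N \<nu> \<and> \<nu>' \<in> seqs \<and> fits \<Lambda> N \<nu>'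
    \<and>
     src d = sword N \<nu> \<and> target d = sword N \<nu>')"

definition interval_element :: "nat \<Rightarrow> 'q lincomb \<Rightarrow> bool" where
  "interval_element N x \<longleftrightarrow> at_stage N \<and> (\<forall>d\<in>Poly_Mapping.keys x. interval_diagram N d)"

text \<open>A description of the interval algebra by representatives: combinations of diagrams whose
  ends are words of interval sequences, all at one stage.\<close>

definition interval_elements :: "(nat \<times> 'q lincomb) set set" where
  "interval_elements = {limit N x | N x. interval_element N x}"

lemma interval_element_space: "interval_element N x \<Longrightarrow> x \<in> space N"
  unfolding interval_element_def interval_diagram_def stage_space_def using reds_sword by auto

lemma interval_element_add: "\<lbrakk>interval_element N x; interval_element N y\<rbrakk> \<Longrightarrow> interval_element N (x +
  y)"
  using keys_add[of x y] unfolding interval_element_def by blast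

lemma interval_element_smul: "interval_element N x \<Longrightarrow> interval_element N (smul a x)"
  using keys_smul[of a x] unfolding interval_element_def by blast

lemma interval_element_comp:
  assumes "interval_element N x" "interval_element N y"
  shows "interval_element N (x \<odot> y)"
  unfolding interval_element_def
proof (intro conjI ballI)
  show "at_stage N" using assms(1) by (simp add: interval_element_def)
  fix f assume "f \<in> Poly_Mapping.keys (x \<odot> y)"
  then obtain d e where f: "f = Comp d e" "d \<in> Poly_Mapping.keys x" "e \<in> Poly_Mapping.keys y" "src d
    = target e"
    using keys_comp[of \<tau> x y] by blast
  then have "interval_diagram N d" "interval_diagram N e" using assms by (auto simp:
    interval_element_def)
  then show "interval_diagram N f" using f(1,4) unfolding interval_diagram_def by auto
qed

lemma interval_element_raise:
  assumes "interval_element N x" "N \<le> M"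
  shows "interval_element M (raise N M x)"
  unfolding interval_element_def
proof (intro conjI ballI)
  show "at_stage M" using assms at_stage_mono by (auto simp: interval_element_def)
  fix f assume "f \<in> Poly_Mapping.keys (raise N M x)"
  then obtain d where f: "f = Tensor d (Strands (new_reds N M))" "d \<in> Poly_Mapping.keys x"
    using keys_tensor[of x "idm (new_reds N M)"] unfolding raise_def by auto
  then obtain \<nu> \<nu>' where d: "is_valid OKLRW d" "\<nu> \<in> seqs" "fits \<Lambda> N \<nu>" "\<nu>' \<in> seqs" "fits \<Lambda> N \<nu>'"
      "src d = sword N \<nu>" "target d = sword N \<nu>'"
    using assms(1) unfolding interval_element_def interval_diagram_def by blast
  have "src f = sword M \<nu>" "target f = sword M \<nu>'"
    using f(1) d(6,7) sword_new_reds[OF d(3) assms(2)] sword_new_reds[OF d(5) assms(2)] by simp_all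
  then show "interval_diagram M f"
    unfolding interval_diagram_def using f(1) d(1,2,4) fits_mono[OF d(3) assms(2)] fits_mono[OF d(5)
      assms(2)]
      word_ok_new_reds by auto
qed

lemma interval_elements_common:
  assumes "A \<in> interval_elements" "B \<in> interval_elements"
  obtains N x y where "interval_element N x" "interval_element N y" "A = limit N x" "B = limit N y"
proof -
  obtain N x where x: "A = limit N x" "interval_element N x" using assms(1) unfolding
    interval_elements_def by blast
  obtain M y where y: "B = limit M y" "interval_element M y" using assms(2) unfolding
    interval_elements_def by blast
  let ?K = "max N M"
  show ?thesis
    using that[of ?K "raise N ?K x" "raise M ?K y"] x y interval_element_raise
      lim_raise[OF interval_element_space, of N x ?K] lim_raise[OF interval_element_space, of M y
        ?K] by simp
qed

lemma interval_elements_add: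
  "\<lbrakk>A \<in> interval_elements; B \<in> interval_elements\<rbrakk> \<Longrightarrow> lim_add Q \<tau> \<Lambda> A B \<in> interval_elements"
proof (erule (1) interval_elements_common)
  fix N x y assume *: "interval_element N x" "interval_element N y" "A = limit N x" "B = limit N y"
  then have "lim_add Q \<tau> \<Lambda> A B = limit N (x + y)"
    using interval_element_space by (simp add: lim_add_lim interval_element_def)
  then show ?thesis using interval_element_add * unfolding interval_elements_def by blast
qed

lemma interval_elements_mult:
  "\<lbrakk>A \<in> interval_elements; B \<in> interval_elements\<rbrakk> \<Longrightarrow> lim_mult Q \<tau> \<Lambda> A B \<in> interval_elements"
proof (erule (1) interval_elements_common)
  fix N x y assume *: "interval_element N x" "interval_element N y" "A = limit N x" "B = limit N y"
  then have "lim_mult Q \<tau> \<Lambda> A B = limit N (x \<odot> y)"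
    using interval_element_space by (simp add: lim_mult_lim interval_element_def)
  then show ?thesis using interval_element_comp * unfolding interval_elements_def by blast
qed

lemma interval_elements_smul:
  assumes "A \<in> interval_elements"
  shows "lim_smul Q \<tau> \<Lambda> a A \<in> interval_elements"
proof -
  obtain N x where x: "A = limit N x" "interval_element N x" using assms unfolding
    interval_elements_def by blast
  then have "lim_smul Q \<tau> \<Lambda> a A = limit N (smul a x)"
    using interval_element_space by (simp add: lim_smul_lim interval_element_def)
  then show ?thesis using interval_element_smul x unfolding interval_elements_def by blast
qed

lemma interval_elements_zero:
  assumes "at_stage N"
  shows "lim_zero Q \<tau> \<Lambda> \<in> interval_elements"
proof -
  have "interval_element N 0" using assms by (simp add: interval_element_def)
  then show ?thesis unfolding interval_elements_def lim_zero[OF assms] by blast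
qed

lemma interval_elements_dg:
  assumes "at_stage N" "interval_diagram N d"
  shows "limit N (dg d) \<in> interval_elements"
proof -
  have "interval_element N (dg d)" using assms by (simp add: interval_element_def)
  then show ?thesis unfolding interval_elements_def by blast
qed

text \<open>Reduces membership in a set closed under the linear operations to classes of single
  diagrams. It serves both for \<open>lin_span\<close> and for
  \<open>subalgebra_generated\<close>.\<close>

lemma interval_elements_induct:
  assumes "interval_element N x"
    and "C (lim_zero Q \<tau> \<Lambda>)" "\<And>A B. \<lbrakk>C A; C B\<rbrakk> \<Longrightarrow> C (lim_add Q \<tau> \<Lambda> A B)" "\<And>a A. C A \<Longrightarrow> C (lim_smul Q \<tau>
      \<Lambda> a A)"
    and dg: "\<And>d. interval_diagram N d \<Longrightarrow> C (limit N (dg d))"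
  shows "C (limit N x)"
proof -
  have N: "at_stage N" using assms(1) by (simp add: interval_element_def)
  have "C (limit N x) \<and> x \<in> space N"
  proof (rule lincomb_induct[of _ x])
    show "C (limit N 0) \<and> 0 \<in> space N" using assms(2) lim_zero[OF N] space_zero by simp
  next
    fix d a y assume d: "d \<in> Poly_Mapping.keys x" and y: "C (limit N y) \<and> y \<in> space N"
    have i: "interval_diagram N d" using d assms(1) by (simp add: interval_element_def)
    have "interval_element N (dg d)" using i N by (simp add: interval_element_def)
    then have s: "dg d \<in> space N" by (rule interval_element_space)
    have "C (lim_add Q \<tau> \<Lambda> (lim_smul Q \<tau> \<Lambda> a (limit N (dg d))) (limit N y))"
      using assms(3,4) dg[OF i] y by blast
    then show "C (limit N (smul a (dg d) + y)) \<and> smul a (dg d) + y \<in> space N"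
      using y s by (simp add: lim_smul_lim[OF N] lim_add_lim[OF N] space_smul space_add)
  qed
  then show ?thesis by blast
qed

lemma interval_algebra_eq:
  assumes "at_stage N0"
  shows "interval_algebra Q \<tau> P le v \<Lambda> = interval_elements"
proof
  show "interval_algebra Q \<tau> P le v \<Lambda> \<subseteq> interval_elements"
  proof
    fix A assume "A \<in> interval_algebra Q \<tau> P le v \<Lambda>"
    then show "A \<in> interval_elements"
      unfolding interval_algebra_def
    proof (induction rule: lin_span.induct)
      case 1
      then show ?case using interval_elements_zero[OF assms] .
    next
      case (2 A)
      then obtain \<nu> \<nu>' B where A: "A = lim_mult Q \<tau> \<Lambda> (idem Q \<tau> \<Lambda> \<nu>') (lim_mult Q \<tau> \<Lambda> B (idem Q \<tau> \<Lambda>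
        \<nu>))"
        "\<nu> \<in> seqs" "\<nu>' \<in> seqs" "B \<in> oklrw_algebra Q \<tau> \<Lambda>" by blast
      obtain N x where x: "B = limit N x" "at_stage N" "x \<in> space N"
        using A(4) unfolding oklrw_algebra_def by blast
      obtain M1 M2 where "fits \<Lambda> M1 \<nu>" "fits \<Lambda> M2 \<nu>'" using A(2,3) fits_exists[OF x(2)] by metis
      define K where "K = max N (max M1 M2)"
      have K: "N \<le> K" "fits \<Lambda> K \<nu>" "fits \<Lambda> K \<nu>'"
        using fits_mono[OF \<open>fits \<Lambda> M1 \<nu>\<close>, of K] fits_mono[OF \<open>fits \<Lambda> M2 \<nu>'\<close>, of K] by (auto simp:
          K_def)
      have sK: "at_stage K" using fits_at_stage K(2) .
      let ?y = "raise N K x" and ?w = "idm (sword K \<nu>)" and ?w' = "idm (sword K \<nu>')"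
      have y: "?y \<in> space K" using space_raise x(3) K(1) .
      have "B = limit K ?y" using lim_raise[OF x(3) K(1)] x(1) by simp
      then have A': "A = limit K (?w' \<odot> ?y \<odot> ?w)"
        using A idem_lim[OF A(2) K(2)] idem_lim[OF A(3) K(3)] y
        by (simp add: lim_mult_lim[OF sK] space_comp space_idm)
      \<comment> \<open>Composition with the two idempotents discards all diagrams of
        \<open>?y\<close> with other endpoints, since non-composable products are zero.\<close>
      have "interval_diagram K f" if f: "f \<in> Poly_Mapping.keys (?w' \<odot> ?y \<odot> ?w)" for f
      proof -
        obtain g where g: "f = Comp (Strands (sword K \<nu>')) g" "g \<in> Poly_Mapping.keys (?y \<odot> ?w)"
          "sword K \<nu>' = target g"
          using subsetD[OF keys_comp[of \<tau> ?w' "?y \<odot> ?w"] f] by auto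
        then obtain h where h: "g = Comp h (Strands (sword K \<nu>))" "h \<in> Poly_Mapping.keys ?y"
          "src h = sword K \<nu>"
          using subsetD[OF keys_comp[of \<tau> ?y ?w] g(2)] by auto
        have "is_valid OKLRW h" using h(2) y by (simp add: stage_space_def)
        then have "is_valid OKLRW f \<and> src f = sword K \<nu> \<and> target f = sword K \<nu>'"
          using g(1,3) h(1,3) word_ok_sword[OF A(2), of K] word_ok_sword[OF A(3), of K] by simp
        then show ?thesis unfolding interval_diagram_def using A(2,3) K by blast
      qed
      then show ?case unfolding interval_elements_def interval_element_def using A' sK by blast
    next
      case (3 A B)
      then show ?case by (simp add: interval_elements_add)
    next
      case (4 A a)
      then show ?case by (simp add: interval_elements_smul)
    qed
  qed
next
  show "interval_elements \<subseteq> interval_algebra Q \<tau> P le v \<Lambda>"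
  proof
    fix A assume "A \<in> interval_elements"
    then obtain N x where A: "A = limit N x" and x: "interval_element N x"
      unfolding interval_elements_def by blast
    have N: "at_stage N" using x by (simp add: interval_element_def)
    from x have "limit N x \<in> interval_algebra Q \<tau> P le v \<Lambda>"
    proof (rule interval_elements_induct)
      fix d assume "interval_diagram N d"
      then obtain \<nu> \<nu>' where d: "is_valid OKLRW d" "\<nu> \<in> seqs" "fits \<Lambda> N \<nu>" "\<nu>' \<in> seqs" "fits \<Lambda> N \<nu>'"
          "src d = sword N \<nu>" "target d = sword N \<nu>'"
        unfolding interval_diagram_def by blast
      have s: "dg d \<in> space N" using d reds_sword by (simp add: space_dg)
      let ?w = "idm (sword N \<nu>)" and ?w' = "idm (sword N \<nu>')"
      have "deq OKLRW (Comp (Strands (sword N \<nu>')) (Comp d (Strands (sword N \<nu>)))) (Comp d (Strands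
        (sword N \<nu>)))"
        using d word_ok_sword by (intro deq_unit_left) auto
      also have "deq OKLRW \<dots> d" using d by (intro deq_unit_right) auto
      finally have "is_null OKLRW (?w' \<odot> dg d \<odot> ?w - dg d)"
        using d by (simp add: deq_def comp_dg)
      then have "limit N (dg d) = limit N (?w' \<odot> dg d \<odot> ?w)"
        using s d by (intro lim_null[symmetric] space_comp space_idm)
      also have "\<dots> = lim_mult Q \<tau> \<Lambda> (idem Q \<tau> \<Lambda> \<nu>') (lim_mult Q \<tau> \<Lambda> (limit N (dg d)) (idem Q \<tau> \<Lambda>
        \<nu>))"
        using idem_lim[OF d(2,3)] idem_lim[OF d(4,5)] s d
        by (simp add: lim_mult_lim[OF N] space_comp space_idm)
      finally have e: "limit N (dg d) = lim_mult Q \<tau> \<Lambda> (idem Q \<tau> \<Lambda> \<nu>') (lim_mult Q \<tau> \<Lambda> (limit N (dg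
        d)) (idem Q \<tau> \<Lambda> \<nu>))" .
      have "limit N (dg d) \<in> oklrw_algebra Q \<tau> \<Lambda>" unfolding oklrw_algebra_def using N s by blast
      then show "limit N (dg d) \<in> interval_algebra Q \<tau> P le v \<Lambda>"
        unfolding interval_algebra_def using e d(2,4) by (intro lin_span.intros(2)) blast
    qed (auto simp: interval_algebra_def intro: lin_span.intros)
    then show "A \<in> interval_algebra Q \<tau> P le v \<Lambda>" using A by simp
  qed
qed

abbreviation generators :: "(nat \<times> 'q lincomb) set set" where
  "generators \<equiv> idempotents Q \<tau> P le v \<Lambda> \<union> long_reflections Q \<tau> P le v \<Lambda> \<union> long_crossings Q \<tau> P le v
    \<Lambda> \<union>
     admissible_crossings Q \<tau> P le v \<Lambda> \<union> interval_dots Q \<tau> P le v \<Lambda>"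

lemma generator_diagram_generators:
  assumes \<nu>: "\<nu> \<in> seqs" "fits \<Lambda> N \<nu>" and \<nu>': "\<nu>' \<in> seqs" "fits \<Lambda> N \<nu>'" and g: "generator_diagram N \<nu>
    \<nu>' d"
  shows "limit N (dg d) \<in> generators"
proof -
  from g consider
    (crossing) a l b l' i where "a mod 2 = b mod 2" "moved \<nu> a l i \<nu>' b l' i" "d = long_crossing
      (sword N \<nu>) (pos \<nu> a l) (pos \<nu>' b l')"
  | (reflection) a l b l' i where "a mod 2 \<noteq> b mod 2" "moved \<nu> a l i \<nu>' b l' (\<tau> i)"
      "d = long_reflection \<tau> (sword N \<nu>) (pos \<nu> a l) i (pos \<nu>' b l')"
  | (swap) j k where "1 \<le> j" "Suc k < length (\<nu> j)" "\<nu> j ! k = \<nu> j ! Suc k"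
        "d = elementary (sword N \<nu>) (Swap (pos \<nu> j k))"
  | (dot) j k where "1 \<le> j" "k < length (\<nu> j)" "d = dot_at (sword N \<nu>) (pos \<nu> j k)"
    unfolding generator_diagram_def by blast
  then show ?thesis
  proof cases
    case crossing
    then have "limit N (dg d) \<in> long_crossings Q \<tau> P le v \<Lambda>"
      unfolding long_crossings_def using \<nu> \<nu>' by blast
    then show ?thesis by blast
  next
    case reflection
    then have "limit N (dg d) \<in> long_reflections Q \<tau> P le v \<Lambda>"
      unfolding long_reflections_def using \<nu> \<nu>' by blast
    then show ?thesis by blast
  next
    case swap
    then have "limit N (dg d) \<in> admissible_crossings Q \<tau> P le v \<Lambda>"
      unfolding admissible_crossings_def elementary.simps using \<nu> by blast
    then show ?thesis by blast
  next
    case dot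
    have "vertex (sword N \<nu> ! pos \<nu> j k) = \<nu> j ! k"
      using seq_word_nth_before(2)[where \<Lambda> = \<Lambda> and \<nu> = \<nu> and a = j and l = k and N = N]
        dot(1,2) fits_le[OF \<nu>(2) dot(2)] by simp
    then have "limit N (dg d) \<in> interval_dots Q \<tau> P le v \<Lambda>"
      unfolding interval_dots_def dot(3) dot_at_def using \<nu> dot by auto
    then show ?thesis by blast
  qed
qed

lemma generators_cases:
  assumes "at_stage N0" "A \<in> generators"
  shows "\<exists>N d. A = limit N (dg d) \<and> at_stage N \<and> interval_diagram N d"
proof -
  have *: "at_stage N \<and> interval_diagram N d"
    if "\<nu> \<in> seqs" "fits \<Lambda> N \<nu>" "\<nu>' \<in> seqs" "fits \<Lambda> N \<nu>'" "generator_diagram N \<nu> \<nu>' d" for N \<nu> \<nu>' d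
    using generator_diagram_props[OF that] that fits_at_stage unfolding interval_diagram_def by
      blast
  from assms(2) consider "A \<in> idempotents Q \<tau> P le v \<Lambda>" | "A \<in> long_reflections Q \<tau> P le v \<Lambda>"
    | "A \<in> long_crossings Q \<tau> P le v \<Lambda>" | "A \<in> admissible_crossings Q \<tau> P le v \<Lambda>" | "A \<in>
      interval_dots Q \<tau> P le v \<Lambda>"
    by blast
  then show ?thesis
  proof cases
    case 1
    then obtain \<nu> where \<nu>: "A = idem Q \<tau> \<Lambda> \<nu>" "\<nu> \<in> seqs" unfolding idempotents_def by blast
    obtain N where N: "fits \<Lambda> N \<nu>" using fits_exists[OF assms(1) \<nu>(2)] by blast
    have "interval_diagram N (Strands (sword N \<nu>))"
      unfolding interval_diagram_def using word_ok_sword[OF \<nu>(2)] \<nu>(2) N by auto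
    then show ?thesis using idem_lim[OF \<nu>(2) N] \<nu>(1) fits_at_stage[OF N] by blast
  next
    case 2
    then obtain N \<nu> \<nu>' a l b l' i where "A = limit N (dg (long_reflection \<tau> (sword N \<nu>) (pos \<nu> a l)
      i (pos \<nu>' b l')))"
      "\<nu> \<in> seqs" "\<nu>' \<in> seqs" "fits \<Lambda> N \<nu>" "fits \<Lambda> N \<nu>'" "a mod 2 \<noteq> b mod 2" "moved \<nu> a l i \<nu>' b l'
        (\<tau> i)"
      unfolding long_reflections_def by blast
    moreover from this have "generator_diagram N \<nu> \<nu>' (long_reflection \<tau> (sword N \<nu>) (pos \<nu> a l) i
      (pos \<nu>' b l'))"
      unfolding generator_diagram_def by blast
    ultimately show ?thesis using * by blast
  next
    case 3
    then obtain N \<nu> \<nu>' a l b l' i where "A = limit N (dg (long_crossing (sword N \<nu>) (pos \<nu> a l) (pos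
      \<nu>' b l')))"
      "\<nu> \<in> seqs" "\<nu>' \<in> seqs" "fits \<Lambda> N \<nu>" "fits \<Lambda> N \<nu>'" "a mod 2 = b mod 2" "moved \<nu> a l i \<nu>' b l'
        i"
      unfolding long_crossings_def by blast
    moreover from this have "generator_diagram N \<nu> \<nu>' (long_crossing (sword N \<nu>) (pos \<nu> a l) (pos \<nu>'
      b l'))"
      unfolding generator_diagram_def by blast
    ultimately show ?thesis using * by blast
  next
    case 4
    then obtain N \<nu> j k where "A = limit N (dg (elementary (sword N \<nu>) (Swap (pos \<nu> j k))))"
      "\<nu> \<in> seqs" "fits \<Lambda> N \<nu>" "1 \<le> j" "Suc k < length (\<nu> j)" "\<nu> j ! k = \<nu> j ! Suc k"
      unfolding admissible_crossings_def elementary.simps by blast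
    moreover from this have "generator_diagram N \<nu> \<nu> (elementary (sword N \<nu>) (Swap (pos \<nu> j k)))"
      unfolding generator_diagram_def by blast
    ultimately show ?thesis using * by blast
  next
    case 5
    then obtain N \<nu> j k where d: "A = limit N (dg (padded (take (pos \<nu> j k) (sword N \<nu>)) (Dot (\<nu> j !
      k)) (drop (Suc (pos \<nu> j k)) (sword N \<nu>))))"
      "\<nu> \<in> seqs" "fits \<Lambda> N \<nu>" "1 \<le> j" "k < length (\<nu> j)"
      unfolding interval_dots_def by blast
    have "vertex (sword N \<nu> ! pos \<nu> j k) = \<nu> j ! k"
      using seq_word_nth_before(2)[where \<Lambda> = \<Lambda> and \<nu> = \<nu> and a = j and l = k and N = N]
        d(4,5) fits_le[OF d(3,5)] by simp
    then have "A = limit N (dg (dot_at (sword N \<nu>) (pos \<nu> j k)))" using d(1) by (simp add: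
      dot_at_def)
    moreover have "generator_diagram N \<nu> \<nu> (dot_at (sword N \<nu>) (pos \<nu> j k))"
      unfolding generator_diagram_def using d(4,5) by blast
    ultimately show ?thesis using * d(2,3) by blast
  qed
qed

lemma product_subalgebra:
  assumes "product N \<nu> \<nu>' d" "\<nu> \<in> seqs" "fits \<Lambda> N \<nu>"
  shows "limit N (dg d) \<in> subalgebra_generated Q \<tau> \<Lambda> generators"
  using assms
proof (induction rule: product.induct)
  case product_id
  then have "limit N (idm (sword N \<nu>)) \<in> idempotents Q \<tau> P le v \<Lambda>"
    using idem_lim unfolding idempotents_def by blast
  then show ?case by (intro subalgebra_generated.intros(2)) blast
next
  case (product_step \<kappa> d \<nu>' g)
  have N: "at_stage N" using fits_at_stage product_step.prems(2) .
  note d = product_props[OF product_step.hyps(1) product_step.prems]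
  note g = generator_diagram_props[of \<kappa> N \<nu>' g]
  have gp: "is_valid OKLRW g" "src g = sword N \<kappa>" "target g = sword N \<nu>'"
    using g d product_step.hyps by auto
  have s: "dg g \<in> space N" "dg d \<in> space N" using gp d by (simp_all add: space_dg reds_sword)
  have "limit N (dg (Comp g d)) = limit N (dg g \<odot> dg d)" using gp d by (simp add: comp_dg)
  also have "\<dots> = lim_mult Q \<tau> \<Lambda> (limit N (dg g)) (limit N (dg d))" by (rule lim_mult_lim[OF N s,
    symmetric])
  finally have e: "limit N (dg (Comp g d)) = lim_mult Q \<tau> \<Lambda> (limit N (dg g)) (limit N (dg d))" .
  have "limit N (dg g) \<in> generators"
    using generator_diagram_generators[of \<kappa> N \<nu>' g] d product_step.hyps by blast
  then have "limit N (dg g) \<in> subalgebra_generated Q \<tau> \<Lambda> generators" by (rule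
    subalgebra_generated.intros(2))
  then show ?case unfolding e
    using product_step.IH[OF product_step.prems] by (rule subalgebra_generated.intros(5))
qed

lemma interval_diagram_subalgebra:
  assumes N: "at_stage N" and d: "interval_diagram N d"
  shows "limit N (dg d) \<in> subalgebra_generated Q \<tau> \<Lambda> generators"
proof -
  obtain \<nu> \<nu>' where d: "is_valid OKLRW d" "\<nu> \<in> seqs" "fits \<Lambda> N \<nu>" "\<nu>' \<in> seqs" "fits \<Lambda> N \<nu>'"
      "src d = sword N \<nu>" "target d = sword N \<nu>'"
    using d unfolding interval_diagram_def by blast
  \<comment> \<open>The filtration is exhaustive: \<open>d\<close> itself lies in the step bounded
    by its own number of crossings plus one.\<close>
  have "lower (Suc (crossings d)) (sword N \<nu>) (sword N \<nu>') (dg d)"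
    using d by (intro lower_few) (simp add: few_dg)
  then have "spanned {d. product N \<nu> \<nu>' d} (dg d)" by (rule lower_spanned_products[OF d(2-5)])
  then obtain y where y: "Poly_Mapping.keys y \<subseteq> {d. product N \<nu> \<nu>' d}" "is_null OKLRW (dg d - y)"
    unfolding spanned_def by blast
  have "limit N y \<in> subalgebra_generated Q \<tau> \<Lambda> generators \<and> y \<in> space N"
  proof (rule lincomb_induct[of _ y])
    show "limit N 0 \<in> subalgebra_generated Q \<tau> \<Lambda> generators \<and> 0 \<in> space N"
      using subalgebra_generated.intros(1) lim_zero[OF N] space_zero by metis
  next
    fix p a z assume p: "p \<in> Poly_Mapping.keys y"
      and z: "limit N z \<in> subalgebra_generated Q \<tau> \<Lambda> generators \<and> z \<in> space N"
    have p: "product N \<nu> \<nu>' p" using p y(1) by blast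
    have s: "dg p \<in> space N" using product_props[OF p d(2,3)] by (simp add: space_dg reds_sword)
    have "lim_add Q \<tau> \<Lambda> (lim_smul Q \<tau> \<Lambda> a (limit N (dg p))) (limit N z) \<in> subalgebra_generated Q \<tau> \<Lambda>
      generators"
      using product_subalgebra[OF p d(2,3)] z by (intro subalgebra_generated.intros(3,4)) blast+
    then show "limit N (smul a (dg p) + z) \<in> subalgebra_generated Q \<tau> \<Lambda> generators \<and> smul a (dg p) +
      z \<in> space N"
      using z s by (simp add: lim_smul_lim[OF N] lim_add_lim[OF N] space_smul space_add)
  qed
  moreover have "limit N (dg d) = limit N y" if "y \<in> space N"
    using that y(2) d reds_sword by (intro lim_null) (simp_all add: space_dg)
  ultimately show ?thesis by simp
qed

theorem interval_algebra_generated: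
  assumes "at_stage N0"
  shows "interval_algebra Q \<tau> P le v \<Lambda> = subalgebra_generated Q \<tau> \<Lambda> generators"
  unfolding interval_algebra_eq[OF assms]
proof
  show "interval_elements \<subseteq> subalgebra_generated Q \<tau> \<Lambda> generators"
  proof
    fix A assume "A \<in> interval_elements"
    then obtain N x where A: "A = limit N x" and x: "interval_element N x"
      unfolding interval_elements_def by blast
    have N: "at_stage N" using x by (simp add: interval_element_def)
    from x have "limit N x \<in> subalgebra_generated Q \<tau> \<Lambda> generators"
      by (rule interval_elements_induct) (auto intro: subalgebra_generated.intros(1,3,4)
        interval_diagram_subalgebra[OF N])
    then show "A \<in> subalgebra_generated Q \<tau> \<Lambda> generators" using A by simp
  qed
next
  show "subalgebra_generated Q \<tau> \<Lambda> generators \<subseteq> interval_elements"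
  proof
    fix A assume "A \<in> subalgebra_generated Q \<tau> \<Lambda> generators"
    then show "A \<in> interval_elements"
    proof (induction rule: subalgebra_generated.induct)
      case 1
      then show ?case using interval_elements_zero[OF assms] .
    next
      case (2 A)
      then show ?case using generators_cases[OF assms] interval_elements_dg by metis
    qed (simp_all add: interval_elements_add interval_elements_smul interval_elements_mult)
  qed
qed

end


section \<open>The red sequence\<close>

text \<open>Among indices of one parity, \<open>r div 2\<close> determines \<open>r\<close>. A
  finite multiset is therefore met by only finitely many red indices of each parity.\<close>

lemma inj_on_half_shift:
  "inj_on (\<lambda>r. (c :: complex) - of_int (a * int (r div 2) + b)) {r. even r \<longleftrightarrow> e}" if "a \<noteq> 0" for e ::
    bool
proof (rule inj_onI)
  fix x y assume xy: "x \<in> {r. even r \<longleftrightarrow> e}" "y \<in> {r. even r \<longleftrightarrow> e}"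
    and "c - of_int (a * int (x div 2) + b) = c - of_int (a * int (y div 2) + b)"
  then have "of_int (a * int (x div 2) + b) = (of_int (a * int (y div 2) + b) :: complex)" by simp
  then have "a * int (x div 2) + b = a * int (y div 2) + b" by (simp only: of_int_eq_iff)
  then have "x div 2 = y div 2" using that by simp
  moreover have "even x \<longleftrightarrow> even y" using xy by simp
  ultimately show "x = y" by presburger
qed

lemma finite_half_shift:
  assumes "a \<noteq> 0"
  shows "finite {r. (even r \<longleftrightarrow> e) \<and> (c :: complex) - of_int (a * int (r div 2) + b) \<in># M}"
proof -
  have "finite ((\<lambda>r. c - of_int (a * int (r div 2) + b)) -` set_mset M \<inter> {r. even r \<longleftrightarrow> e})"
    by (rule finite_vimage_IntI[OF finite_set_mset inj_on_half_shift[OF assms]])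
  then show ?thesis by (rule finite_subset[rotated]) auto
qed

locale red_data =
  fixes Q :: "('q, 'e) pre_digraph" and \<tau> :: "'q \<Rightarrow> 'q" and P :: "'q set"
    and lam :: "'q \<Rightarrow> nat" and R :: "'q \<Rightarrow> complex multiset"
  assumes tau_closed: "i \<in> verts Q \<Longrightarrow> \<tau> i \<in> verts Q"
    and tau_tau: "i \<in> verts Q \<Longrightarrow> \<tau> (\<tau> i) = i"
    and lambda_finite: "finite {i \<in> verts Q. lam i \<noteq> 0}"
    and R_size: "i \<in> verts Q \<Longrightarrow> size (R i) = lam i"
begin

text \<open>The coefficient of a red label at \<open>i\<close> is a multiplicity in the multiset of
  \<open>i\<close> or of \<open>\<tau> i\<close>, so both have to be taken into account.\<close>

definition support :: "'q set" where
  "support = {i \<in> verts Q. lam i \<noteq> 0 \<or> lam (\<tau> i) \<noteq> 0}"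

lemma finite_support: "finite support"
proof -
  have "{i \<in> verts Q. lam (\<tau> i) \<noteq> 0} \<subseteq> \<tau> ` {i \<in> verts Q. lam i \<noteq> 0}"
    using tau_closed tau_tau by (force simp: image_iff)
  then have "finite {i \<in> verts Q. lam (\<tau> i) \<noteq> 0}"
    using lambda_finite finite_surj by blast
  then have "finite ({i \<in> verts Q. lam i \<noteq> 0} \<union> {i \<in> verts Q. lam (\<tau> i) \<noteq> 0})"
    using lambda_finite by simp
  then show ?thesis by (rule finite_subset[rotated]) (auto simp: support_def)
qed

lemma red_sequence_support:
  assumes "red_sequence Q \<tau> P R r i \<noteq> 0"
  shows "i \<in> support"
proof -
  have i: "i \<in> verts Q" using assms by (auto simp: red_sequence_def split: if_splits)
  have "R i \<noteq> {#} \<or> R (\<tau> i) \<noteq> {#}"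
    using assms i tau_tau[OF i] by (auto simp: red_sequence_def z_mult_def split: if_splits)
  then have "lam i \<noteq> 0 \<or> lam (\<tau> i) \<noteq> 0"
    unfolding R_size[OF i, symmetric] R_size[OF tau_closed[OF i], symmetric] by simp
  then show ?thesis using i by (simp add: support_def)
qed

lemma letter_ok_red_sequence: "letter_ok Q (Red (red_sequence Q \<tau> P R r))"
proof -
  have sub: "{i. red_sequence Q \<tau> P R r i \<noteq> 0} \<subseteq> support" using red_sequence_support by blast
  then have "finite {i. red_sequence Q \<tau> P R r i \<noteq> 0}" using finite_support finite_subset by blast
  then show ?thesis using sub by (auto simp: support_def)
qed

lemma finite_red_sequence: "finite {r. red_sequence Q \<tau> P R r i \<noteq> 0}"
proof -
  define c where "c i = (if i \<in> P then 3 / 4 else 1 / 4 :: complex)" for i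
  \<comment> \<open>The three sets correspond to the branches of \<open>red_sequence\<close>: even
    indices, odd indices at a vertex in \<open>P\<close>, and odd indices at a vertex outside
    \<open>P\<close>.\<close>
  let ?A = "{r. (even r \<longleftrightarrow> True) \<and> c i - of_int (1 * int (r div 2) + 0) \<in># R (\<tau> i)}"
  let ?B = "{r. (even r \<longleftrightarrow> False) \<and> c (\<tau> i) - of_int (- 1 * int (r div 2) + - 1) \<in># R (\<tau> (\<tau> i))}"
  let ?C = "{r. (even r \<longleftrightarrow> False) \<and> c (\<tau> i) - of_int (- 1 * int (r div 2) + 0) \<in># R (\<tau> (\<tau> i))}"
  have "r \<in> ?A \<union> ?B \<union> ?C" if "red_sequence Q \<tau> P R r i \<noteq> 0" for r
    using that unfolding red_sequence_def z_mult_def c_def[symmetric] count_eq_zero_iff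
    by (auto split: if_splits)
  then have "{r. red_sequence Q \<tau> P R r i \<noteq> 0} \<subseteq> ?A \<union> ?B \<union> ?C" by blast
  moreover have "finite ?A" "finite ?B" "finite ?C" by (rule finite_half_shift; simp)+
  ultimately show ?thesis by (meson finite_Un finite_subset)
qed

text \<open>Each vertex occurs in finitely many red labels and only the finitely many vertices of
  \<open>support\<close> occur at all, so one bound works for all vertices, even if the quiver is
  infinite.\<close>

lemma stage_red_sequence: "\<exists>N. stage (red_sequence Q \<tau> P R) N"
proof -
  have "finite (\<Union>i\<in>support. {r. red_sequence Q \<tau> P R r i \<noteq> 0})"
    using finite_support finite_red_sequence by blast
  then obtain N where N: "\<forall>r\<in>(\<Union>i\<in>support. {r. red_sequence Q \<tau> P R r i \<noteq> 0}). r \<le> N"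
    using finite_nat_set_iff_bounded_le by blast
  have "red_sequence Q \<tau> P R r i = 0" if "N < r" for r i
  proof (rule ccontr)
    assume ne: "red_sequence Q \<tau> P R r i \<noteq> 0"
    then have "r \<le> N" using N red_sequence_support[OF ne] by blast
    then show False using that by simp
  qed
  then show ?thesis unfolding stage_def by (intro exI[of _ N]) auto
qed

end

theorem proposition4p4:
  fixes Q :: "('q, 'e) pre_digraph" and \<tau> :: "'q \<Rightarrow> 'q" and \<tau>\<^sub>1 :: "'e \<Rightarrow> 'e"
    and P :: "'q set" and le :: "'q rel"
    and lam :: "'q \<Rightarrow> nat" and \<mu> :: "'q \<Rightarrow> int" and v :: "'q \<Rightarrow> nat"
    and R :: "'q \<Rightarrow> complex multiset" and \<Lambda> :: "nat \<Rightarrow> 'q \<Rightarrow> nat"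
  assumes quiver: "involutive_quiver Q \<tau> \<tau>\<^sub>1"
    and polarization: "polarization Q \<tau> P"
    and order: "linear_order_on P le"
    and lambda_finite: "finite {i \<in> verts Q. lam i \<noteq> 0}"
    and v_finite: "finite {i \<in> verts Q. v i \<noteq> 0}"
    and v_invariant: "\<And>i. i \<in> verts Q \<Longrightarrow> v (\<tau> i) = v i"
    and mu_invariant: "\<And>i. i \<in> verts Q \<Longrightarrow> \<mu> (\<tau> i) = \<mu> i"
    and weights: "\<And>i. i \<in> verts Q \<Longrightarrow>
      int (lam i) + int (lam (\<tau> i)) - \<mu> i = (\<Sum>j \<in> {j \<in> verts Q. v j \<noteq> 0}. int (v j) * cartan Q i j)"
    and R_size: "\<And>i. i \<in> verts Q \<Longrightarrow> size (R i) = lam i"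
    and R_plus: "\<And>i c. i \<in> P \<Longrightarrow> c \<in># R i \<Longrightarrow> \<exists>n :: int. c = 1/4 + of_int n"
    and R_minus: "\<And>i c. i \<in> P \<Longrightarrow> c \<in># R (\<tau> i) \<Longrightarrow> \<exists>n :: int. c = 3/4 + of_int n"
    and Lambda: "\<Lambda> = red_sequence Q \<tau> P R"
  shows "interval_algebra Q \<tau> P le v \<Lambda> =
    subalgebra_generated Q \<tau> \<Lambda>
      (idempotents Q \<tau> P le v \<Lambda> \<union> long_reflections Q \<tau> P le v \<Lambda> \<union> long_crossings Q \<tau> P le v \<Lambda> \<union>
       admissible_crossings Q \<tau> P le v \<Lambda> \<union> interval_dots Q \<tau> P le v \<Lambda>)"
proof -
  interpret involutive_quiver Q \<tau> \<tau>\<^sub>1 by (rule quiver)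
  interpret red: red_data Q \<tau> P lam R
    using tau_verts tau_involution lambda_finite R_size by unfold_locales auto
  have P: "P \<subseteq> verts Q" "\<tau> ` P = verts Q - P" "\<tau> ` (verts Q - P) = P"
    using polarization by (auto simp: polarization_def)
  interpret interval_setting Q \<tau> P le v \<Lambda>
  proof unfold_locales
    show "\<tau> i \<in> verts Q" "\<tau> (\<tau> i) = i" if "i \<in> verts Q" for i
      using that tau_verts tau_involution by auto
    show "P \<subseteq> verts Q" by (rule P)
    show "\<tau> i \<in> verts Q - P" if "i \<in> P" for i using P(2) that by blast
    show "\<tau> i \<in> P" if "i \<in> verts Q - P" for i using P(3) that by blast
    show "linear_order_on P le" by (rule order)
    show "letter_ok Q (Red (\<Lambda> n))" for n unfolding Lambda by (rule red.letter_ok_red_sequence)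
  qed
  obtain N where "stage \<Lambda> N" using red.stage_red_sequence Lambda by blast
  then show ?thesis by (rule interval_algebra_generated)
qed

end
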